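(* Let $L>0$, $\mu>0$, $\alpha>1/2$ and $f\in V^{\alpha}$. There exists $\nu_1>0$ such that for every viscosity $\nu\ge\nu_1$ there are $R,\rho>0$ for which the local attractor $\mathcal A$ of the discrete dynamical system $U$ relative to the ball $B_{\mathcal X^\mu_\alpha}(R;\rho)$ exists and consists of a single point.
   Context: Spaces. $\mathbb T^3_L$ is the 3-dimensional torus of side length $L$. For $s\in\mathbb R$, $V^s$ is the closed subspace of the periodic Sobolev space $H^s(\mathbb T^3_L)^3$ of real, zero-mean, divergence-free vector fields. $A=-\Delta$ is the Stokes operator (positive, selfadjoint on $V^0$), with norms $\|u\|_s=\|A^{s/2}u\|_0$, where $\|\cdot\|_0$ is the $L^2$ norm on $V^0$. $V^{-s}$ is the dual of $V^s$, with duality pairing $\langle\cdot,\cdot\rangle$ extending the $L^2$ inner product. The bilinear operator $B$ is defined by $\langle B(u,v),w\rangle=b(u,v,w)=\sum_{i,j=1}^3\int_{\mathbb T^3_L}u_j\,\partial_{x_j}v_i\,w_i\,dx$, extended by continuity. Phase space. $\mathcal X^\mu_\alpha=L_2(0,\mu,V^{1+\alpha})\times V^\alpha$, and for $R,\rho>0$, $B_{\mathcal X^\mu_\alpha}(R;\rho)=B_{L_2(0,\mu,V^{1+\alpha})}(0,R)\times B_{V^\alpha}(0,\rho)$ (product of closed balls centered at $0$). Linearized system. For $(\psi,u_0)\in\mathcal X^\mu_\alpha$, let $u\in C([0,\mu],V^\alpha)\cap L_2(0,\mu,V^{1+\alpha})$ be the unique weak solution (known to exist) of $$\frac{du}{dt}(t)+\nu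 Au(t)+B(\psi(t),u(t))=f\ (t\in[0,\mu]),\qquad u(0)=u_0,$$ the equation being understood weakly in time and tested against $v\in V^{1+\alpha}$. Define $U(1,(\psi,u_0))=(u,u(\mu))$, a continuous map of $\mathcal X^\mu_\alpha$ into itself, and let $U(n,\cdot)$ be its $n$-fold composition, $n\in\mathbb N$. Local attractor. A local attractor of $U$ relative to a ball $B=B_{\mathcal X^\mu_\alpha}(R;\rho)$ is a nonempty compact set $\mathcal A\subset B$ with $U(1,\mathcal A)=\mathcal A$ and $\lim_{n\to\infty}\sup_{x\in B}\mathrm{dist}_{\mathcal X^\mu_\alpha}(U(n,x),\mathcal A)=0$. For a given ball such a set is unique if it exists. *)

theory Defs
  imports "HOL-Analysis.Analysis"
begin

section \<open>Periodic Sobolev spaces of vector fields\<close>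

text \<open>
  A periodic vector-valued distribution on the torus of side length L is represented by its
  family of Fourier coefficients: the family u stands for the formal series
  \<open>\<Sum>k. exp (i (wave L k \<bullet> x)) u k\<close>, with k ranging over the lattice of integer triples.
  In this way the spaces of every real order s consist of objects of one type, as is usual for
  periodic Sobolev spaces, and equality of families is equality of distributions.
\<close>

type_synonym coeffs = "int ^ 3 \<Rightarrow> complex ^ 3"

definition wave :: "real \<Rightarrow> int ^ 3 \<Rightarrow> real ^ 3" where
  "wave L k = (\<chi> j. 2 * pi * of_int (k $ j) / L)"

definition sobolev :: "real \<Rightarrow> real \<Rightarrow> coeffs set" where
  "sobolev L s =
     {u. (\<lambda>k. (1 + (norm (wave L k))\<^sup>2) powr s * (norm (u k))\<^sup>2) summable_on UNIV}"

definition real_valued :: "coeffs \<Rightarrow> bool" where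
  "real_valued u \<longleftrightarrow> (\<forall>k i. u (- k) $ i = cnj (u k $ i))"

definition zero_mean :: "coeffs \<Rightarrow> bool" where
  "zero_mean u \<longleftrightarrow> u 0 = 0"

definition div_free :: "real \<Rightarrow> coeffs \<Rightarrow> bool" where
  "div_free L u \<longleftrightarrow> (\<forall>k. (\<Sum>j\<in>UNIV. \<i> * of_real (wave L k $ j) * u k $ j) = 0)"

definition V :: "real \<Rightarrow> real \<Rightarrow> coeffs set" where
  "V L s = {u \<in> sobolev L s. real_valued u \<and> zero_mean u \<and> div_free L u}"

text \<open>
  The duality pairing extends the inner product of the space of square integrable fields, which
  by Parseval is \<open>L^3\<close> times the inner product of the coefficient families. The pairing is
  real on real-valued fields.
\<close>

definition pairing :: "real \<Rightarrow> coeffs \<Rightarrow> coeffs \<Rightarrow> real" where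
  "pairing L u v = L ^ 3 * (\<Sum>\<^sub>\<infinity>k. Re (\<Sum>i\<in>UNIV. u k $ i * cnj (v k $ i)))"

definition norm0 :: "real \<Rightarrow> coeffs \<Rightarrow> real" where
  "norm0 L u = sqrt (L ^ 3 * (\<Sum>\<^sub>\<infinity>k. (norm (u k))\<^sup>2))"

text \<open>
  The powers of \<open>A = - \<Delta>\<close> are Fourier multipliers. At \<open>k = 0\<close> the multiplier is 0 by the
  convention \<open>0 powr s = 0\<close>, which is harmless on zero-mean fields.
\<close>

definition stokes :: "real \<Rightarrow> coeffs \<Rightarrow> coeffs" where
  "stokes L u = (\<lambda>k. (norm (wave L k))\<^sup>2 *\<^sub>R u k)"

definition stokes_pow :: "real \<Rightarrow> real \<Rightarrow> coeffs \<Rightarrow> coeffs" where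
  "stokes_pow L s u = (\<lambda>k. ((norm (wave L k))\<^sup>2 powr s) *\<^sub>R u k)"

definition V_norm :: "real \<Rightarrow> real \<Rightarrow> coeffs \<Rightarrow> real" where
  "V_norm L s u = norm0 L (stokes_pow L (s / 2) u)"

definition V_dist :: "real \<Rightarrow> real \<Rightarrow> coeffs \<Rightarrow> coeffs \<Rightarrow> real" where
  "V_dist L s u v = V_norm L s (u - v)"


section \<open>The trilinear form\<close>

definition partial_deriv :: "3 \<Rightarrow> (real ^ 3 \<Rightarrow> real) \<Rightarrow> real ^ 3 \<Rightarrow> real" where
  "partial_deriv j g x = deriv (\<lambda>h. g (x + h *\<^sub>R axis j 1)) 0"

definition smooth_trilinear ::
  "real \<Rightarrow> (real ^ 3 \<Rightarrow> real ^ 3) \<Rightarrow> (real ^ 3 \<Rightarrow> real ^ 3) \<Rightarrow> (real ^ 3 \<Rightarrow> real ^ 3) \<Rightarrow> real" where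
  "smooth_trilinear L u v w =
     (\<Sum>i\<in>UNIV. \<Sum>j\<in>UNIV.
        integral (cbox 0 (\<chi> l. L))
          (\<lambda>x. u x $ j * partial_deriv j (\<lambda>y. v y $ i) x * w x $ i))"

text \<open>
  The trigonometric polynomial obtained by Fourier truncation, as an actual function. Its values
  are real for real-valued fields, so that taking real parts only changes the type.
\<close>

definition trig_poly :: "real \<Rightarrow> nat \<Rightarrow> coeffs \<Rightarrow> real ^ 3 \<Rightarrow> real ^ 3" where
  "trig_poly L N u x =
     (\<chi> i. Re (\<Sum>k | \<forall>j. \<bar>k $ j\<bar> \<le> int N. exp (\<i> * of_real (wave L k \<bullet> x)) * u k $ i))"

text \<open>
  Extension by continuity: the Fourier truncations are smooth and converge to the field in every
  Sobolev space which contains it, so wherever the integral form extends continuously the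
  extension is the following limit.
\<close>

definition trilinear :: "real \<Rightarrow> coeffs \<Rightarrow> coeffs \<Rightarrow> coeffs \<Rightarrow> real" where
  "trilinear L u v w =
     lim (\<lambda>N. smooth_trilinear L (trig_poly L N u) (trig_poly L N v) (trig_poly L N w))"


section \<open>Spaces of time-dependent fields\<close>

text \<open>Strong (Bochner) measurability of a map from the time interval to \<open>V L s\<close>.\<close>

definition strongly_measurable :: "real \<Rightarrow> real \<Rightarrow> real \<Rightarrow> (real \<Rightarrow> coeffs) \<Rightarrow> bool" where
  "strongly_measurable L \<mu> s u \<longleftrightarrow>
     (AE t in lebesgue_on {0..\<mu>}. u t \<in> V L s) \<and>
     (\<exists>S. (\<forall>n. simple_function (lebesgue_on {0..\<mu>}) (S n) \<and> (\<forall>t\<in>{0..\<mu>}. S n t \<in> V L s)) \<and>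
          (AE t in lebesgue_on {0..\<mu>}. (\<lambda>n. V_dist L s (S n t) (u t)) \<longlonglongrightarrow> 0))"

definition L2_fun :: "real \<Rightarrow> real \<Rightarrow> real \<Rightarrow> (real \<Rightarrow> coeffs) set" where
  "L2_fun L \<mu> s =
     {u. strongly_measurable L \<mu> s u \<and> integrable (lebesgue_on {0..\<mu>}) (\<lambda>t. (V_norm L s (u t))\<^sup>2)}"

definition L2_eq :: "real \<Rightarrow> real \<Rightarrow> real \<Rightarrow> ((real \<Rightarrow> coeffs) \<times> (real \<Rightarrow> coeffs)) set" where
  "L2_eq L \<mu> s =
     {(u, v). u \<in> L2_fun L \<mu> s \<and> v \<in> L2_fun L \<mu> s \<and> (AE t in lebesgue_on {0..\<mu>}. u t = v t)}"

type_synonym L2_class = "(real \<Rightarrow> coeffs) set"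

definition L2 :: "real \<Rightarrow> real \<Rightarrow> real \<Rightarrow> L2_class set" where
  "L2 L \<mu> s = L2_fun L \<mu> s // L2_eq L \<mu> s"

definition L2_class_of :: "real \<Rightarrow> real \<Rightarrow> real \<Rightarrow> (real \<Rightarrow> coeffs) \<Rightarrow> L2_class" where
  "L2_class_of L \<mu> s u = L2_eq L \<mu> s `` {u}"

definition rep :: "L2_class \<Rightarrow> real \<Rightarrow> coeffs" where
  "rep \<Psi> = (SOME \<psi>. \<psi> \<in> \<Psi>)"

definition L2_norm :: "real \<Rightarrow> real \<Rightarrow> real \<Rightarrow> L2_class \<Rightarrow> real" where
  "L2_norm L \<mu> s \<Psi> = sqrt (LINT t|lebesgue_on {0..\<mu>}. (V_norm L s (rep \<Psi> t))\<^sup>2)"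

definition L2_dist :: "real \<Rightarrow> real \<Rightarrow> real \<Rightarrow> L2_class \<Rightarrow> L2_class \<Rightarrow> real" where
  "L2_dist L \<mu> s \<Psi> \<Phi> =
     sqrt (LINT t|lebesgue_on {0..\<mu>}. (V_dist L s (rep \<Psi> t) (rep \<Phi> t))\<^sup>2)"

definition C_fun :: "real \<Rightarrow> real \<Rightarrow> real \<Rightarrow> (real \<Rightarrow> coeffs) set" where
  "C_fun L \<mu> s =
     {u. \<forall>t\<in>{0..\<mu>}. u t \<in> V L s \<and> ((\<lambda>\<tau>. V_dist L s (u \<tau>) (u t)) \<longlongrightarrow> 0) (at t within {0..\<mu>})}"


section \<open>Phase space\<close>

type_synonym phase = "L2_class \<times> coeffs"

definition phase_space :: "real \<Rightarrow> real \<Rightarrow> real \<Rightarrow> phase set" where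
  "phase_space L \<mu> \<alpha> = L2 L \<mu> (1 + \<alpha>) \<times> V L \<alpha>"

definition phase_dist :: "real \<Rightarrow> real \<Rightarrow> real \<Rightarrow> phase \<Rightarrow> phase \<Rightarrow> real" where
  "phase_dist L \<mu> \<alpha> = prod_dist (L2_dist L \<mu> (1 + \<alpha>)) (V_dist L \<alpha>)"

definition phase_ball :: "real \<Rightarrow> real \<Rightarrow> real \<Rightarrow> real \<Rightarrow> real \<Rightarrow> phase set" where
  "phase_ball L \<mu> \<alpha> R \<rho> =
     {\<Psi> \<in> L2 L \<mu> (1 + \<alpha>). L2_norm L \<mu> (1 + \<alpha>) \<Psi> \<le> R} \<times> {v \<in> V L \<alpha>. V_norm L \<alpha> v \<le> \<rho>}"


section \<open>The linearized system\<close>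

definition test_function :: "real \<Rightarrow> (real \<Rightarrow> real) \<Rightarrow> bool" where
  "test_function \<mu> \<phi> \<longleftrightarrow>
     (\<forall>n t. (deriv ^^ n) \<phi> differentiable (at t)) \<and>
     (\<exists>a b. 0 < a \<and> b < \<mu> \<and> (\<forall>t. t \<notin> {a..b} \<longrightarrow> \<phi> t = 0))"

text \<open>
  The time derivative is taken in the sense of scalar distributions on the open time interval,
  after pairing the equation with a fixed v; it is moved to the test function.
\<close>

definition weak_solution ::
  "real \<Rightarrow> real \<Rightarrow> real \<Rightarrow> real \<Rightarrow> coeffs \<Rightarrow> (real \<Rightarrow> coeffs) \<Rightarrow> coeffs \<Rightarrow> (real \<Rightarrow> coeffs) \<Rightarrow> bool"
where
  "weak_solution L \<mu> \<alpha> \<nu> f \<psi> u0 u \<longleftrightarrow>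
     u \<in> C_fun L \<mu> \<alpha> \<inter> L2_fun L \<mu> (1 + \<alpha>) \<and> u 0 = u0 \<and>
     (\<forall>v \<in> V L (1 + \<alpha>). \<forall>\<phi>. test_function \<mu> \<phi> \<longrightarrow>
        (LINT t|lebesgue_on {0..\<mu>}.
            - pairing L (u t) v * deriv \<phi> t
            + (\<nu> * pairing L (stokes L (u t)) v + trilinear L (\<psi> t) (u t) v) * \<phi> t)
        = (LINT t|lebesgue_on {0..\<mu>}. pairing L f v * \<phi> t))"

text \<open>
  Functions of time are total in HOL; a solution is determined only on \<open>{0..\<mu>}\<close>, hence the
  restriction to extensional functions in the definite description.
\<close>

definition solution ::
  "real \<Rightarrow> real \<Rightarrow> real \<Rightarrow> real \<Rightarrow> coeffs \<Rightarrow> phase \<Rightarrow> real \<Rightarrow> coeffs" where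
  "solution L \<mu> \<alpha> \<nu> f X =
     (THE u. u \<in> extensional {0..\<mu>} \<and> weak_solution L \<mu> \<alpha> \<nu> f (rep (fst X)) (snd X) u)"

definition U1 :: "real \<Rightarrow> real \<Rightarrow> real \<Rightarrow> real \<Rightarrow> coeffs \<Rightarrow> phase \<Rightarrow> phase" where
  "U1 L \<mu> \<alpha> \<nu> f X =
     (let u = solution L \<mu> \<alpha> \<nu> f X in (L2_class_of L \<mu> (1 + \<alpha>) u, u \<mu>))"

definition U :: "real \<Rightarrow> real \<Rightarrow> real \<Rightarrow> real \<Rightarrow> coeffs \<Rightarrow> nat \<Rightarrow> phase \<Rightarrow> phase" where
  "U L \<mu> \<alpha> \<nu> f n = U1 L \<mu> \<alpha> \<nu> f ^^ n"

text \<open>Suprema and infima of distances are formed in the extended nonnegative reals.\<close>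

definition local_attractor ::
  "real \<Rightarrow> real \<Rightarrow> real \<Rightarrow> real \<Rightarrow> coeffs \<Rightarrow> real \<Rightarrow> real \<Rightarrow> phase set \<Rightarrow> bool" where
  "local_attractor L \<mu> \<alpha> \<nu> f R \<rho> \<A> \<longleftrightarrow>
     \<A> \<noteq> {} \<and>
     compactin (Metric_space.mtopology (phase_space L \<mu> \<alpha>) (phase_dist L \<mu> \<alpha>)) \<A> \<and>
     \<A> \<subseteq> phase_ball L \<mu> \<alpha> R \<rho> \<and>
     U L \<mu> \<alpha> \<nu> f 1 ` \<A> = \<A> \<and>
     (\<lambda>n. SUP x\<in>phase_ball L \<mu> \<alpha> R \<rho>. INF a\<in>\<A>. ennreal (phase_dist L \<mu> \<alpha> (U L \<mu> \<alpha> \<nu> f n x) a))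
       \<longlonglongrightarrow> 0"

end

theory Submission
  imports Defs
begin

text \<open>
  For large viscosity the map \<open>U1\<close> halves the distance to the phase formed by the constant curve
  \<open>w\<close> and its value \<open>w\<close>, where \<open>w\<close> is the small solution of the stationary equation
  \<open>\<nu> A w + B(w, w) = f\<close>. It does so on the ball of radius 4 around that phase, which contains the
  ball with \<open>R = \<rho> = 1\<close>; so the attractor relative to the latter is the fixed point alone
  (\<open>U1_contracts\<close>, \<open>local_attractor_fixpoint\<close>). All drifts that occur are small relative to \<open>\<nu>\<close>
  (predicate \<open>small\<close>), and for those both existence and uniqueness of the solution follow from
  one contraction estimate.

  Everything is computed on Fourier coefficients. The trilinear form, a limit of integrals of
  trigonometric polynomials, is the pairing with the Leray projection of a convolution
  (\<open>trilinear_eq_pairing_nl\<close>). One application of the Cauchy-Schwarz inequality bounds this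
  convolution: with a drift of order \<open>1 + \<alpha>\<close> and a field of order \<open>\<alpha>\<close> the nonlinear term has
  order \<open>\<alpha> - 1\<close> (\<open>conv_estimate\<close>, \<open>nl_estimate\<close>). Convergence of the lattice sum that appears
  requires \<open>2 + 2 \<alpha> > 3\<close>, which is the hypothesis on \<open>\<alpha>\<close>.

  Tested with a single pair of modes, the weak formulation becomes a scalar linear differential
  equation in the sense of distributions, and that is equivalent to Duhamel's formula
  (\<open>weak_imp_duhamel\<close>, \<open>duhamel_imp_weak\<close>). Hence weak solutions are the curves that satisfy
  Duhamel's formula mode by mode (\<open>weak_solution_imp_mild\<close>, \<open>mild_imp_weak_solution\<close>). There the
  heat kernel gains two derivatives and a factor \<open>1 / \<nu>\<close> in the square integral norm, and one
  derivative and a factor \<open>1 / sqrt \<nu>\<close> in the supremum norm (\<open>energy_L2\<close>, \<open>smoothing_sup\<close>). The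
  supremum over time can even be taken in every mode separately, before summation. Solutions are
  therefore fixed points in a weighted space of square summable families of bounded continuous
  functions of time, to which the contraction principle applies directly (\<open>mild_exists\<close>); the
  same principle, with constant modes, provides the stationary solution (\<open>stationary_exists\<close>).

  The difference \<open>u - w\<close> satisfies Duhamel's formula with the right-hand side
  \<open>- B(\<psi>, u - w) - B(\<psi> - w, w)\<close>. The first part is absorbed, the second is controlled by the
  distance of \<open>\<psi>\<close> from \<open>w\<close>, and the energy estimates supply factors that tend to 0 with \<open>1 / \<nu>\<close>
  (\<open>difference_estimate\<close>). At the final time the initial difference is damped by the decay of the
  lowest mode, whose rate is proportional to \<open>\<nu>\<close>.
\<close>
section \<open>Weighted square-summable families\<close>

text \<open>
  The values lie in an arbitrary normed space, because two instances are needed: coefficient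
  vectors, and whole bounded continuous functions of time in every mode.
\<close>

definition wl2 :: "('a \<Rightarrow> real) \<Rightarrow> ('a \<Rightarrow> 'b::real_normed_vector) set" where
  "wl2 \<omega> = {x. (\<lambda>k. (\<omega> k * norm (x k))\<^sup>2) summable_on UNIV}"

definition wnorm :: "('a \<Rightarrow> real) \<Rightarrow> ('a \<Rightarrow> 'b::real_normed_vector) \<Rightarrow> real" where
  "wnorm \<omega> x = sqrt (\<Sum>\<^sub>\<infinity>k. (\<omega> k * norm (x k))\<^sup>2)"

lemma square_sum_le:
  fixes a b c :: real
  assumes "a \<le> b + c" "0 \<le> a"
  shows "a\<^sup>2 \<le> 2 * b\<^sup>2 + 2 * c\<^sup>2"
proof -
  have "a\<^sup>2 \<le> (b + c)\<^sup>2" using assms by (intro power_mono) auto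
  also have "\<dots> \<le> 2 * b\<^sup>2 + 2 * c\<^sup>2" using sum_squares_bound[of b c] by (simp add: power2_sum)
  finally show ?thesis .
qed

lemma wnorm_nonneg [simp]: "0 \<le> wnorm \<omega> x"
  by (simp add: wnorm_def infsum_nonneg)

lemma wnorm_power2: "(wnorm \<omega> x)\<^sup>2 = (\<Sum>\<^sub>\<infinity>k. (\<omega> k * norm (x k))\<^sup>2)"
  by (simp add: wnorm_def infsum_nonneg)

text \<open>
  Terms are nonnegative, so one bound on all finite partial sums proves membership and the norm
  bound at the same time.
\<close>

lemma
  assumes "\<And>F. finite F \<Longrightarrow> (\<Sum>k\<in>F. (\<omega> k * norm (x k))\<^sup>2) \<le> C"
  shows wl2_if_finite_sums: "x \<in> wl2 \<omega>"
    and wnorm_le_if_finite_sums: "(wnorm \<omega> x)\<^sup>2 \<le> C"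
proof -
  have s: "(\<lambda>k. (\<omega> k * norm (x k))\<^sup>2) summable_on UNIV"
    by (rule nonneg_bdd_above_summable_on) (auto intro!: bdd_aboveI2[where M=C] assms)
  then show "x \<in> wl2 \<omega>" by (simp add: wl2_def)
  show "(wnorm \<omega> x)\<^sup>2 \<le> C"
    unfolding wnorm_power2 by (rule infsum_le_finite_sums[OF s]) (rule assms)
qed

lemma finite_sum_le_wnorm:
  assumes "x \<in> wl2 \<omega>" "finite F"
  shows "(\<Sum>k\<in>F. (\<omega> k * norm (x k))\<^sup>2) \<le> (wnorm \<omega> x)\<^sup>2"
  unfolding wnorm_power2 using assms(1)
  by (intro finite_sum_le_infsum assms(2)) (simp_all add: wl2_def)

lemma mode_le_wnorm:
  assumes "x \<in> wl2 \<omega>"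
  shows "\<omega> k * norm (x k) \<le> wnorm \<omega> x"
proof (rule power2_le_imp_le)
  show "(\<omega> k * norm (x k))\<^sup>2 \<le> (wnorm \<omega> x)\<^sup>2"
    using finite_sum_le_wnorm[OF assms, of "{k}"] by simp
qed simp

lemma
  fixes x :: "'a \<Rightarrow> 'b::real_normed_vector" and y :: "'a \<Rightarrow> 'c::real_normed_vector"
  assumes y: "y \<in> wl2 \<omega>'" and le: "\<And>k. \<bar>\<omega> k * norm (x k)\<bar> \<le> c * \<bar>\<omega>' k * norm (y k)\<bar>" and c: "0 \<le> c"
  shows wl2_mono: "x \<in> wl2 \<omega>" and wnorm_mono: "wnorm \<omega> x \<le> c * wnorm \<omega>' y"
proof -
  have *: "(\<Sum>k\<in>F. (\<omega> k * norm (x k))\<^sup>2) \<le> (c * wnorm \<omega>' y)\<^sup>2" if "finite F" for F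
  proof -
    have "(\<Sum>k\<in>F. (\<omega> k * norm (x k))\<^sup>2) \<le> (\<Sum>k\<in>F. c\<^sup>2 * (\<omega>' k * norm (y k))\<^sup>2)"
    proof (rule sum_mono)
      fix k
      have "\<bar>\<omega> k * norm (x k)\<bar>\<^sup>2 \<le> (c * \<bar>\<omega>' k * norm (y k)\<bar>)\<^sup>2"
        by (rule power_mono[OF le]) simp
      then show "(\<omega> k * norm (x k))\<^sup>2 \<le> c\<^sup>2 * (\<omega>' k * norm (y k))\<^sup>2"
        unfolding power2_abs power_mult_distrib[of c] .
    qed
    also have "\<dots> \<le> c\<^sup>2 * (wnorm \<omega>' y)\<^sup>2"
      using finite_sum_le_wnorm[OF y that] by (simp add: sum_distrib_left[symmetric] mult_left_mono)
    finally show ?thesis by (simp add: power_mult_distrib)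
  qed
  show "x \<in> wl2 \<omega>" by (rule wl2_if_finite_sums[OF *])
  show "wnorm \<omega> x \<le> c * wnorm \<omega>' y"
    by (rule power2_le_imp_le[OF wnorm_le_if_finite_sums[OF *]]) (use c in auto)
qed

lemma
  fixes x y z :: "'a \<Rightarrow> 'b::real_normed_vector"
  assumes x: "x \<in> wl2 \<omega>" and y: "y \<in> wl2 \<omega>" and le: "\<And>k. norm (z k) \<le> norm (x k) + norm (y k)"
  shows wl2_triangle: "z \<in> wl2 \<omega>" and wnorm_triangle: "wnorm \<omega> z \<le> wnorm \<omega> x + wnorm \<omega> y"
proof -
  have *: "(\<Sum>k\<in>F. (\<omega> k * norm (z k))\<^sup>2) \<le> (wnorm \<omega> x + wnorm \<omega> y)\<^sup>2" if "finite F" for F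
  proof -
    have "L2_set (\<lambda>k. \<bar>\<omega> k\<bar> * norm (z k)) F
        \<le> L2_set (\<lambda>k. \<bar>\<omega> k\<bar> * norm (x k) + \<bar>\<omega> k\<bar> * norm (y k)) F"
      by (rule L2_set_mono) (auto simp: le mult_left_mono distrib_left[symmetric])
    also have "\<dots> \<le> L2_set (\<lambda>k. \<bar>\<omega> k\<bar> * norm (x k)) F + L2_set (\<lambda>k. \<bar>\<omega> k\<bar> * norm (y k)) F"
      by (rule L2_set_triangle_ineq)
    also have "\<dots> \<le> wnorm \<omega> x + wnorm \<omega> y"
      using finite_sum_le_wnorm[OF x that] finite_sum_le_wnorm[OF y that]
      by (intro add_mono) (auto simp: L2_set_def power_mult_distrib intro!: real_le_lsqrt sum_nonneg)
    finally have "(L2_set (\<lambda>k. \<bar>\<omega> k\<bar> * norm (z k)) F)\<^sup>2 \<le> (wnorm \<omega> x + wnorm \<omega> y)\<^sup>2"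
      by (intro power_mono) auto
    then show ?thesis by (simp add: L2_set_def sum_nonneg power_mult_distrib)
  qed
  show "z \<in> wl2 \<omega>" by (rule wl2_if_finite_sums[OF *])
  show "wnorm \<omega> z \<le> wnorm \<omega> x + wnorm \<omega> y"
    by (rule power2_le_imp_le[OF wnorm_le_if_finite_sums[OF *]]) auto
qed

lemma wl2_diff: "x \<in> wl2 \<omega> \<Longrightarrow> y \<in> wl2 \<omega> \<Longrightarrow> x - y \<in> wl2 \<omega>"
  by (rule wl2_triangle[of x \<omega> y]) (auto simp: norm_triangle_ineq4)

lemma wnorm_minus_commute: "wnorm \<omega> (x - y) = wnorm \<omega> (y - x)"
  by (simp add: wnorm_def norm_minus_commute)

lemma wl2_zero [simp]: "(\<lambda>k. 0) \<in> wl2 \<omega>"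
  by (simp_all add: wl2_def)

lemma wnorm_zero [simp]: "wnorm \<omega> (\<lambda>k. 0) = 0"
  by (simp_all add: wnorm_def)

text \<open>Fatou's lemma: membership and norm bounds survive limits taken mode by mode.\<close>

lemma
  fixes x :: "'a \<Rightarrow> 'b::real_normed_vector"
  assumes X: "\<And>n. X n \<in> wl2 \<omega>" and le: "eventually (\<lambda>n. wnorm \<omega> (X n) \<le> C) sequentially"
    and lim: "\<And>k. \<omega> k \<noteq> 0 \<Longrightarrow> (\<lambda>n. X n k) \<longlonglongrightarrow> x k"
  shows wl2_Fatou: "x \<in> wl2 \<omega>" and wnorm_Fatou: "wnorm \<omega> x \<le> C"
proof -
  have *: "(\<Sum>k\<in>F. (\<omega> k * norm (x k))\<^sup>2) \<le> C\<^sup>2" if "finite F" for F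
  proof (rule tendsto_upperbound)
    have "(\<lambda>n. \<omega> k * norm (X n k)) \<longlonglongrightarrow> \<omega> k * norm (x k)" for k
      using lim[of k] by (cases "\<omega> k = 0") (auto intro!: tendsto_intros)
    from tendsto_power[OF this, of _ 2] show "(\<lambda>n. \<Sum>k\<in>F. (\<omega> k * norm (X n k))\<^sup>2) \<longlonglongrightarrow> (\<Sum>k\<in>F. (\<omega> k * norm (x k))\<^sup>2)"
      by (intro tendsto_sum) 
    show "eventually (\<lambda>n. (\<Sum>k\<in>F. (\<omega> k * norm (X n k))\<^sup>2) \<le> C\<^sup>2) sequentially"
      using le
    proof eventually_elim
      case (elim n)
      then show ?case
        using finite_sum_le_wnorm[OF X that, of n] power_mono[OF elim, of 2] by simp
    qed
  qed simp
  show "x \<in> wl2 \<omega>" by (rule wl2_if_finite_sums[OF *])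
  obtain n where "wnorm \<omega> (X n) \<le> C" using le by (auto simp: eventually_sequentially)
  then have "0 \<le> C" by (rule order_trans[OF wnorm_nonneg])
  then show "wnorm \<omega> x \<le> C"
    using wnorm_le_if_finite_sums[OF *] by (auto intro: power2_le_imp_le)
qed

text \<open>
  The contraction principle. Completeness of the values and Fatou's lemma make every set that is
  closed under modewise limits complete. Modes of weight zero are invisible to the norm, so the
  members of the set have to vanish there.
\<close>

theorem wl2_contraction_fixpoint:
  fixes T :: "('a \<Rightarrow> 'b::banach) \<Rightarrow> 'a \<Rightarrow> 'b"
  assumes \<omega>: "\<And>k. 0 \<le> \<omega> k"
    and sub: "S \<subseteq> wl2 \<omega>" and ne: "S \<noteq> {}"
    and vanish: "\<And>x k. x \<in> S \<Longrightarrow> \<omega> k = 0 \<Longrightarrow> x k = 0"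
    and closed: "\<And>X x. (\<And>n. X n \<in> S) \<Longrightarrow> x \<in> wl2 \<omega> \<Longrightarrow> (\<And>k. (\<lambda>n. X n k) \<longlonglongrightarrow> x k) \<Longrightarrow> x \<in> S"
    and maps: "\<And>x. x \<in> S \<Longrightarrow> T x \<in> S"
    and q: "q < 1" and contr: "\<And>x y. x \<in> S \<Longrightarrow> y \<in> S \<Longrightarrow> wnorm \<omega> (T x - T y) \<le> q * wnorm \<omega> (x - y)"
  obtains x where "x \<in> S" "T x = x"
proof -
  define d where "d = (\<lambda>x y :: 'a \<Rightarrow> 'b. wnorm \<omega> (x - y))"
  have mode: "\<omega> k * norm (x k - y k) \<le> d x y" if "x \<in> S" "y \<in> S" for x y k
    using mode_le_wnorm[of "x - y" \<omega> k] wl2_diff[of x \<omega> y] that sub by (auto simp: d_def)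
  interpret Metric_space S d
  proof
    fix x y z
    show "0 \<le> d x y" "d x y = d y x" by (simp_all add: d_def wnorm_minus_commute)
    { assume xy: "x \<in> S" "y \<in> S"
      show "d x y = 0 \<longleftrightarrow> x = y"
      proof
        assume 0: "d x y = 0"
        have "x k = y k" for k
          using mode[OF xy, of k] vanish[OF xy(1), of k] vanish[OF xy(2), of k] \<omega>[of k]
          unfolding 0 by (cases "\<omega> k = 0") (auto simp: mult_le_0_iff)
        then show "x = y" by auto
      qed (auto simp: d_def wnorm_def)
      assume z: "z \<in> S"
      have n: "norm ((x - z) k) \<le> norm ((x - y) k) + norm ((y - z) k)" for k
        using norm_triangle_ineq[of "x k - y k" "y k - z k"] by simp
      show "d x z \<le> d x y + d y z"
        unfolding d_def using xy z sub by (intro wnorm_triangle[OF wl2_diff wl2_diff n]) auto }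
  qed
  have mcomplete
    unfolding mcomplete_def
  proof (intro allI impI)
    fix X assume "MCauchy X"
    then have XS: "\<And>n. X n \<in> S"
      and C: "\<And>e. 0 < e \<Longrightarrow> \<exists>N. \<forall>n n'. N \<le> n \<longrightarrow> N \<le> n' \<longrightarrow> d (X n) (X n') < e"
      unfolding MCauchy_def by auto
    have "\<exists>a. (\<lambda>n. X n k) \<longlonglongrightarrow> a" for k
    proof (cases "\<omega> k = 0")
      case True
      have "X n k = 0" for n using vanish[OF XS True] .
      then show ?thesis by (intro exI[of _ 0]) (simp del: LIMSEQ_const_iff)
    next
      case False
      then have pos: "0 < \<omega> k" using \<omega>[of k] by simp
      have "Cauchy (\<lambda>n. X n k)"
      proof (rule CauchyI)
        fix e :: real assume "0 < e"
        then obtain N where N: "\<And>n n'. N \<le> n \<Longrightarrow> N \<le> n' \<Longrightarrow> d (X n) (X n') < e * \<omega> k"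
          using C[of "e * \<omega> k"] pos by auto
        have "norm (X m k - X n k) < e" if "N \<le> m" "N \<le> n" for m n
          using mode[OF XS XS, of k m n] N[OF that] pos
          by (smt (verit) mult.commute mult_less_cancel_left_pos)
        then show "\<exists>M. \<forall>m\<ge>M. \<forall>n\<ge>M. norm (X m k - X n k) < e" by blast
      qed
      then show ?thesis by (simp add: Cauchy_convergent_iff convergent_def)
    qed
    then obtain x where x: "\<And>k. (\<lambda>n. X n k) \<longlonglongrightarrow> x k" by metis
    \<comment> \<open>The Cauchy property passes to the modewise limit by Fatou's lemma; this gives convergence in norm.\<close>
    have tail: "X n - x \<in> wl2 \<omega> \<and> wnorm \<omega> (X n - x) \<le> e"
      if N: "\<And>m. N \<le> m \<Longrightarrow> d (X n) (X m) < e" for n N e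
    proof -
      have *: "X n - X m \<in> wl2 \<omega>" for m using XS sub by (auto intro!: wl2_diff)
      have **: "eventually (\<lambda>m. wnorm \<omega> (X n - X m) \<le> e) sequentially"
        using N unfolding d_def by (auto simp: eventually_sequentially less_imp_le intro!: exI[of _ N])
      have ***: "(\<lambda>m. (X n - X m) k) \<longlonglongrightarrow> (X n - x) k" for k
        using x[of k] by (auto intro!: tendsto_intros)
      show ?thesis using wl2_Fatou[OF * ** ***] wnorm_Fatou[OF * ** ***] by (simp add: fun_diff_def)
    qed
    obtain N where N: "\<And>m. N \<le> m \<Longrightarrow> d (X N) (X m) < 1" using C[of 1] by auto
    have "X N - x \<in> wl2 \<omega>" using tail[of N N 1] N by blast
    then have "X N - (X N - x) \<in> wl2 \<omega>" using XS[of N] sub by (blast intro: wl2_diff)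
    moreover have "X N - (X N - x) = x" by auto
    ultimately have xS: "x \<in> S" using closed[of X x, OF XS _ x] by simp
    have "eventually (\<lambda>n. X n \<in> S \<and> d (X n) x < e) sequentially" if "0 < e" for e
    proof -
      obtain N where N: "\<And>n n'. N \<le> n \<Longrightarrow> N \<le> n' \<Longrightarrow> d (X n) (X n') < e / 2"
        using C[of "e / 2"] \<open>0 < e\<close> by auto
      have "d (X n) x < e" if "N \<le> n" for n
        using tail[of N n "e / 2"] N[OF that] \<open>0 < e\<close> by (auto simp: d_def)
      then show ?thesis using XS by (auto simp: eventually_sequentially)
    qed
    then show "\<exists>x. limitin mtopology X x sequentially"
      using xS by (auto simp: limitin_metric)
  qed
  then show ?thesis
    using Banach_fixedpoint_thm[OF _ ne, of T q] maps q contr that by (auto simp: d_def)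
qed

section \<open>Sums over the lattice\<close>

abbreviation kap :: "real \<Rightarrow> int ^ 3 \<Rightarrow> real" where
  "kap L k \<equiv> norm (wave L k)"

lemma wave_simps [simp]:
  "wave L 0 = 0" "wave L (- k) = - wave L k"
  "wave L (k + m) = wave L k + wave L m" "wave L (k - m) = wave L k - wave L m"
  by (simp_all add: wave_def vec_eq_iff add_divide_distrib diff_divide_distrib ring_distribs)

lemma component_le_kap: "0 < L \<Longrightarrow> 2 * pi / L * \<bar>of_int (k $ j)\<bar> \<le> kap L k"
  using component_le_norm_cart[of "wave L k" j] by (simp add: wave_def abs_mult)

lemma kap_ge: 
  assumes "0 < L" "k \<noteq> 0"
  shows "2 * pi / L \<le> kap L k"
proof -
  obtain j where "k $ j \<noteq> 0" using assms by (auto simp: vec_eq_iff)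
  then have "1 \<le> \<bar>k $ j\<bar>" by linarith
  then have "1 \<le> \<bar>real_of_int (k $ j)\<bar>" by linarith
  then have "2 * pi / L * 1 \<le> 2 * pi / L * \<bar>real_of_int (k $ j)\<bar>"
    using assms by (intro mult_left_mono) auto
  then show ?thesis using component_le_kap[OF assms(1), of k j] by simp
qed

lemma kap_pos: "0 < L \<Longrightarrow> k \<noteq> 0 \<Longrightarrow> 0 < kap L k"
  using kap_ge[of L k] by (meson divide_pos_pos less_le_trans mult_pos_pos pi_gt_zero zero_less_numeral)

lemma kap_eq_0_iff [simp]: "0 < L \<Longrightarrow> kap L k = 0 \<longleftrightarrow> k = 0"
  using kap_pos[of L k] by auto

lemma wave_eq_0_iff [simp]: "0 < L \<Longrightarrow> wave L k = 0 \<longleftrightarrow> k = 0"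
  using kap_eq_0_iff[of L k] by (simp del: kap_eq_0_iff)

lemma summable_on_int_powr:
  assumes "1 < p"
  shows "(\<lambda>j::int. (1 + \<bar>of_int j\<bar> :: real) powr - p) summable_on UNIV"
proof -
  have "summable (\<lambda>n. of_nat (Suc n) powr - p :: real)"
    using assms summable_real_powr_iff[of "- p"] by (subst summable_Suc_iff) auto
  then have n: "(\<lambda>n::nat. (1 + real n) powr - p) summable_on UNIV"
    by (simp add: summable_on_UNIV_nonneg_real_iff add.commute)
  have "(\<lambda>j::int. (1 + \<bar>of_int j\<bar> :: real) powr - p) summable_on range int"
    by (subst summable_on_reindex) (use n in \<open>auto simp: o_def\<close>)
  moreover have "(\<lambda>j::int. (1 + \<bar>of_int j\<bar> :: real) powr - p) summable_on range (\<lambda>n. - int n)"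
    by (subst summable_on_reindex) (use n in \<open>auto simp: o_def inj_on_def\<close>)
  ultimately have "(\<lambda>j::int. (1 + \<bar>of_int j\<bar> :: real) powr - p)
      summable_on (range int \<union> range (\<lambda>n. - int n))"
    by (rule summable_on_union)
  moreover have "range int \<union> range (\<lambda>n. - int n) = UNIV"
    by (auto simp: image_def) (metis int_cases2)
  ultimately show ?thesis by simp
qed

text \<open>
  Away from the origin every \<open>1 + \<bar>k $ j\<bar>\<close> is at most a multiple of \<open>kap L k\<close>, so that the
  lattice sum is dominated by a product of three convergent sums over the integers.
\<close>

lemma summable_on_kap_powr:
  assumes L: "0 < L" and s: "3 < s"
  shows "(\<lambda>k. kap L k powr - s) summable_on UNIV"
proof -
  define c where "c = 2 * pi / L"
  have c: "0 < c" using L by (simp add: c_def)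
  define g where "g = (\<lambda>j::int. (1 + \<bar>of_int j\<bar> :: real) powr - (s / 3))"
  define G where "G = infsum g UNIV"
  have g: "g summable_on UNIV" unfolding g_def by (rule summable_on_int_powr) (use s in auto)
  have g0: "0 \<le> g j" for j by (simp add: g_def)
  have bound: "kap L k powr - s \<le> (c / 2) powr - s * (\<Prod>j\<in>UNIV. g (k $ j))" for k
  proof (cases "k = 0")
    case False
    define y where "y = 2 * kap L k / c"
    have y0: "0 < y" using kap_pos[OF L False] c by (simp add: y_def)
    have "c \<le> kap L k" "c * \<bar>of_int (k $ j)\<bar> \<le> kap L k" for j
      unfolding c_def by (rule kap_ge[OF L False], rule component_le_kap[OF L])
    from add_mono[OF this] have "1 + \<bar>of_int (k $ j)\<bar> \<le> y" for j
      using c by (simp add: y_def field_simps)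
    then have "y powr - (s / 3) \<le> g (k $ j)" for j
      unfolding g_def using s y0 by (intro powr_mono2') auto
    then have "(\<Prod>j\<in>(UNIV::3 set). y powr - (s / 3)) \<le> (\<Prod>j\<in>UNIV. g (k $ j))"
      by (intro prod_mono) auto
    also have "(\<Prod>j\<in>(UNIV::3 set). y powr - (s / 3)) = y powr - s"
      using y0 by (simp add: powr_realpow[symmetric] powr_powr)
    finally have "(c / 2) powr - s * y powr - s \<le> (c / 2) powr - s * (\<Prod>j\<in>UNIV. g (k $ j))"
      by (intro mult_left_mono) auto
    also have "(c / 2) powr - s * y powr - s = kap L k powr - s"
      using c y0 by (simp add: powr_mult[symmetric] y_def)
    finally show ?thesis .
  qed (simp add: g_def prod_nonneg)
  have "(\<Sum>k\<in>F. kap L k powr - s) \<le> (c / 2) powr - s * G ^ 3" if F: "finite F" for F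
  proof -
    define J where "J = (\<Union>k\<in>F. range (vec_nth k))"
    have J: "finite J" using F by (simp add: J_def)
    have "(\<Sum>k\<in>F. \<Prod>j\<in>UNIV. g (k $ j)) = (\<Sum>h\<in>vec_nth ` F. \<Prod>j\<in>UNIV. g (h j))"
      by (subst sum.reindex) (auto simp: inj_on_def vec_nth_inject)
    also have "\<dots> \<le> (\<Sum>h\<in>PiE (UNIV::3 set) (\<lambda>_. J). \<Prod>j\<in>UNIV. g (h j))"
      by (rule sum_mono2) (use J in \<open>auto simp: J_def intro!: finite_PiE prod_nonneg g0\<close>)
    also have "\<dots> = (\<Prod>j\<in>(UNIV::3 set). \<Sum>x\<in>J. g x)"
      using J by (subst prod_sum_PiE) auto
    also have "\<dots> \<le> (\<Prod>j\<in>(UNIV::3 set). G)"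
      unfolding G_def using J g g0 by (intro prod_mono conjI sum_nonneg finite_sum_le_infsum) auto
    finally have "(\<Sum>k\<in>F. \<Prod>j\<in>UNIV. g (k $ j)) \<le> G ^ 3" by simp
    moreover have "(\<Sum>k\<in>F. kap L k powr - s) \<le> (\<Sum>k\<in>F. (c / 2) powr - s * (\<Prod>j\<in>UNIV. g (k $ j)))"
      by (intro sum_mono bound)
    ultimately show ?thesis
      by (simp add: sum_distrib_left[symmetric]) (meson mult_left_mono order_trans powr_ge_zero)
  qed
  then show ?thesis
    by (intro nonneg_bdd_above_summable_on bdd_aboveI2[where M = "(c / 2) powr - s * G ^ 3"]) auto
qed

section \<open>The convolution estimate\<close>

lemma
  fixes x y :: "'a \<Rightarrow> real"
  assumes "(\<lambda>m. (x m)\<^sup>2) summable_on UNIV" "(\<lambda>m. (y m)\<^sup>2) summable_on UNIV"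
  shows summable_on_mult_if_square_summable: "(\<lambda>m. \<bar>x m * y m\<bar>) summable_on UNIV"
    and Cauchy_Schwarz_infsum:
      "(\<Sum>\<^sub>\<infinity>m. \<bar>x m * y m\<bar>)\<^sup>2 \<le> (\<Sum>\<^sub>\<infinity>m. (x m)\<^sup>2) * (\<Sum>\<^sub>\<infinity>m. (y m)\<^sup>2)"
proof -
  define X where "X = (\<Sum>\<^sub>\<infinity>m. (x m)\<^sup>2)"
  define Y where "Y = (\<Sum>\<^sub>\<infinity>m. (y m)\<^sup>2)"
  have *: "(\<Sum>m\<in>F. \<bar>x m * y m\<bar>) \<le> sqrt X * sqrt Y" if F: "finite F" for F
  proof -
    have "(\<Sum>m\<in>F. \<bar>x m * y m\<bar>) \<le> L2_set x F * L2_set y F"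
      using L2_set_mult_ineq[of x y F] by (simp add: abs_mult)
    also have "\<dots> \<le> sqrt X * sqrt Y"
      unfolding L2_set_def X_def Y_def using assms F
      by (intro mult_mono real_sqrt_le_mono finite_sum_le_infsum) (auto intro: sum_nonneg infsum_nonneg)
    finally show ?thesis .
  qed
  show s: "(\<lambda>m. \<bar>x m * y m\<bar>) summable_on UNIV"
    by (rule nonneg_bdd_above_summable_on) (auto intro!: bdd_aboveI2[where M="sqrt X * sqrt Y"] *)
  have "(\<Sum>\<^sub>\<infinity>m. \<bar>x m * y m\<bar>) \<le> sqrt X * sqrt Y"
    by (rule infsum_le_finite_sums[OF s]) (rule *)
  then have "(\<Sum>\<^sub>\<infinity>m. \<bar>x m * y m\<bar>)\<^sup>2 \<le> (sqrt X * sqrt Y)\<^sup>2"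
    by (intro power_mono infsum_nonneg) auto
  then show "(\<Sum>\<^sub>\<infinity>m. \<bar>x m * y m\<bar>)\<^sup>2 \<le> X * Y"
    by (simp add: power_mult_distrib X_def Y_def infsum_nonneg)
qed

text \<open>
  The weight of order \<open>s\<close>. It vanishes at the origin for every \<open>s\<close>, since \<open>0 powr s = 0\<close>. The
  norm therefore ignores the zero mode, and laws such as \<open>sob_cancel\<close> hold off the origin only.
\<close>

definition sob :: "real \<Rightarrow> real \<Rightarrow> int ^ 3 \<Rightarrow> real" where
  "sob L s k = kap L k powr s"

lemma sob_nonneg [simp]: "0 \<le> sob L s k" "\<bar>sob L s k\<bar> = sob L s k"
  by (simp_all add: sob_def)

lemma sob_zero [simp]: "sob L s 0 = 0"
  by (simp add: sob_def)

lemma sob_pos: "0 < L \<Longrightarrow> k \<noteq> 0 \<Longrightarrow> 0 < sob L s k"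
  by (simp add: sob_def)

lemma sob_add: "sob L (s + t) k = sob L s k * sob L t k"
  by (simp add: sob_def powr_add)

lemma sob_power2: "(sob L s k)\<^sup>2 = sob L (2 * s) k"
  by (cases "wave L k = 0") (simp_all add: sob_def powr_power mult.commute)

lemma sob_cancel: "0 < L \<Longrightarrow> sob L (- s) k * sob L s k = (if k = 0 then 0 else 1)"
  by (simp add: sob_def powr_minus)

lemma sob_shift:
  assumes "0 < L"
  shows "sob L \<alpha> k = sob L (\<alpha> - 1) k * kap L k" "sob L (1 + \<alpha>) k = sob L (\<alpha> - 1) k * (kap L k)\<^sup>2"
proof -
  have "kap L k powr (1 + \<alpha>) = kap L k powr (\<alpha> - 1) * kap L k powr 2"
    unfolding powr_add[symmetric] by simp
  then show "sob L (1 + \<alpha>) k = sob L (\<alpha> - 1) k * (kap L k)\<^sup>2" by (simp add: sob_def)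
  show "sob L \<alpha> k = sob L (\<alpha> - 1) k * kap L k"
    using assms by (cases "k = 0") (simp_all add: sob_def powr_diff)
qed

lemma sob_weaken:
  assumes "0 < L" "s \<le> t"
  shows "sob L s k \<le> (2 * pi / L) powr (s - t) * sob L t k"
proof (cases "k = 0")
  case False
  have "kap L k powr (s - t) \<le> (2 * pi / L) powr (s - t)"
    using assms kap_ge[OF assms(1) False] by (intro powr_mono2') auto
  then have "kap L k powr (s - t) * kap L k powr t \<le> (2 * pi / L) powr (s - t) * kap L k powr t"
    by (intro mult_right_mono) auto
  then show ?thesis by (simp add: sob_def powr_add[symmetric])
qed simp

text \<open>
  The weight \<open>kap\<close> of \<open>k\<close> is at most the sum of those of \<open>m\<close> and \<open>k - m\<close>; after this splitting
  both resulting sums are dominated by lattice sums with exponent \<open>2 + 2 \<alpha> > 3\<close>.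
\<close>

lemma conv_weight_bound:
  assumes L: "0 < L" and a: "1 / 2 < \<alpha>"
  obtains K where "0 < K"
    "\<And>k. (\<lambda>m. sob L (- 2 - 2 * \<alpha>) m * sob L (- 2 * \<alpha>) (k - m)) summable_on UNIV"
    "\<And>k. sob L (2 * \<alpha>) k * (\<Sum>\<^sub>\<infinity>m. sob L (- 2 - 2 * \<alpha>) m * sob L (- 2 * \<alpha>) (k - m)) \<le> K"
proof -
  define g where "g = sob L (- 2 - 2 * \<alpha>)"
  have g: "g summable_on UNIV"
    using summable_on_kap_powr[OF L, of "2 + 2 * \<alpha>"] a
    unfolding g_def sob_def by (simp add: algebra_simps)
  have gs: "(\<lambda>m. g (k - m)) summable_on UNIV" "(\<Sum>\<^sub>\<infinity>m. g (k - m)) = infsum g UNIV" for k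
  proof -
    have b: "bij_betw (\<lambda>m. k - m) UNIV UNIV"
      by (rule bij_betw_byWitness[where f' = "\<lambda>m. k - m"]) auto
    show "(\<lambda>m. g (k - m)) summable_on UNIV"
      using g summable_on_reindex_bij_betw[OF b, of g] by simp
    show "(\<Sum>\<^sub>\<infinity>m. g (k - m)) = infsum g UNIV"
      by (rule infsum_reindex_bij_betw[OF b])
  qed
  have g0: "0 \<le> g m" for m by (simp add: g_def)
  \<comment> \<open>Replacing the larger of the two wave numbers by the smaller merges both negative powers into one.\<close>
  have mix: "sob L (- 2) m * sob L (- 2 * \<alpha>) n \<le> g m + g n" for m n
  proof (cases "m = 0 \<or> n = 0")
    case False
    then have p: "0 < kap L m" "0 < kap L n" using kap_pos[OF L] by auto
    show ?thesis
    proof (cases "kap L m \<le> kap L n")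
      case True
      have "kap L m powr - 2 * kap L n powr (- 2 * \<alpha>) \<le> kap L m powr - 2 * kap L m powr (- 2 * \<alpha>)"
        using True a p by (intro mult_left_mono powr_mono2') auto
      also have "\<dots> = g m" by (simp add: g_def sob_def powr_add[symmetric])
      finally show ?thesis using g0[of n] by (simp add: sob_def)
    next
      case False
      have "kap L m powr - 2 * kap L n powr (- 2 * \<alpha>) \<le> kap L n powr - 2 * kap L n powr (- 2 * \<alpha>)"
        using False a p by (intro mult_right_mono powr_mono2') auto
      also have "\<dots> = g n" by (simp add: g_def sob_def powr_add[symmetric])
      finally show ?thesis using g0[of m] by (simp add: sob_def)
    qed
  qed (use g0 in \<open>auto\<close>)
  define h where "h = (\<lambda>k m. sob L (- 2 - 2 * \<alpha>) m * sob L (- 2 * \<alpha>) (k - m))"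
  define C where "C = (2::real) powr (2 * \<alpha>)"
  have C0: "0 < C" by (simp add: C_def)
  have sh: "h k summable_on UNIV" for k
  proof (rule summable_on_comparison_test)
    show "(\<lambda>m. (2 * pi / L) powr (- 2 * \<alpha>) * g m) summable_on UNIV"
      by (rule summable_on_cmult_right[OF g])
    show "h k m \<le> (2 * pi / L) powr (- 2 * \<alpha>) * g m" for m
    proof (cases "k - m = 0")
      case False
      have "sob L (- 2 * \<alpha>) (k - m) \<le> (2 * pi / L) powr (- 2 * \<alpha>)"
        unfolding sob_def using kap_ge[OF L False] L a by (intro powr_mono2') auto
      then show ?thesis unfolding h_def g_def by (metis mult.commute mult_left_mono sob_nonneg(1))
    qed (simp add: h_def g0)
  qed (auto simp: h_def)
  have pt: "sob L (2 * \<alpha>) k * h k m \<le> C * (2 * g m + g (k - m))" for k m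
  proof (cases "m = 0 \<or> k - m = 0")
    case False
    define M where "M = max (kap L m) (kap L (k - m))"
    have p: "0 < kap L m" "0 < kap L (k - m)" using False kap_pos[OF L] by blast+
    have "kap L k \<le> kap L m + kap L (k - m)"
      using norm_triangle_ineq[of "wave L m" "wave L (k - m)"] by (simp del: wave_simps(4) add: wave_simps(3)[symmetric])
    then have "kap L k \<le> 2 * M" by (simp add: M_def)
    then have "kap L k powr (2 * \<alpha>) \<le> (2 * M) powr (2 * \<alpha>)"
      using a by (intro powr_mono2) auto
    also have "\<dots> = C * M powr (2 * \<alpha>)"
      using p by (simp add: C_def powr_mult M_def)
    also have "M powr (2 * \<alpha>) \<le> kap L m powr (2 * \<alpha>) + kap L (k - m) powr (2 * \<alpha>)"
      by (auto simp: M_def max_def)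
    finally have "sob L (2 * \<alpha>) k \<le> C * (sob L (2 * \<alpha>) m + sob L (2 * \<alpha>) (k - m))"
      using C0 by (simp add: sob_def)
    then have "sob L (2 * \<alpha>) k * h k m \<le> C * (sob L (2 * \<alpha>) m + sob L (2 * \<alpha>) (k - m)) * h k m"
      by (intro mult_right_mono) (auto simp: h_def)
    also have "\<dots> = C * (sob L (- 2) m * sob L (- 2 * \<alpha>) (k - m) + g m)"
    proof -
      have "sob L (2 * \<alpha>) m * sob L (- 2 - 2 * \<alpha>) m = sob L (- 2) m"
        by (simp add: sob_add[symmetric])
      moreover have "sob L (2 * \<alpha>) (k - m) * sob L (- 2 * \<alpha>) (k - m) = 1"
        using sob_cancel[OF L, of "2 * \<alpha>" "k - m"] False by (simp add: mult.commute)
      ultimately show ?thesis unfolding h_def g_def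
        by (simp only: distrib_left distrib_right mult.assoc[symmetric]) (simp add: mult.assoc mult.left_commute)
    qed
    also have "\<dots> \<le> C * (2 * g m + g (k - m))"
      using mix[of m "k - m"] C0 by (intro mult_left_mono) auto
    finally show ?thesis .
  qed (use g0 C0 in \<open>auto simp: h_def\<close>)
  have "sob L (2 * \<alpha>) k * infsum (h k) UNIV \<le> C * (3 * infsum g UNIV) + 1" for k
  proof -
    have "sob L (2 * \<alpha>) k * infsum (h k) UNIV = (\<Sum>\<^sub>\<infinity>m. sob L (2 * \<alpha>) k * h k m)"
      by (rule infsum_cmult_right[symmetric]) (rule sh)
    also have "\<dots> \<le> (\<Sum>\<^sub>\<infinity>m. C * (2 * g m + g (k - m)))"
      by (intro infsum_mono pt summable_on_cmult_right summable_on_add g gs sh)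
    also have "\<dots> = C * (3 * infsum g UNIV)"
      using g gs[of k] by (simp add: infsum_cmult_right' infsum_add summable_on_cmult_right)
    finally show ?thesis by simp
  qed
  moreover have "0 < C * (3 * infsum g UNIV) + 1"
    using C0 g0 by (simp add: infsum_nonneg add_nonneg_pos)
  ultimately show ?thesis using that[of "C * (3 * infsum g UNIV) + 1"] sh unfolding h_def by blast
qed

lemma
  fixes f :: "'a \<Rightarrow> 'b \<Rightarrow> real"
  assumes "\<And>k. k \<in> F \<Longrightarrow> f k summable_on A"
  shows summable_on_finite_sum: "(\<lambda>m. \<Sum>k\<in>F. f k m) summable_on A"
    and infsum_finite_sum: "(\<Sum>\<^sub>\<infinity>m\<in>A. \<Sum>k\<in>F. f k m) = (\<Sum>k\<in>F. infsum (f k) A)"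
  using assms by (induction F rule: infinite_finite_induct) (auto simp: infsum_add summable_on_add)

text \<open>
  One application of the Cauchy-Schwarz inequality, with the weights placed on the factors,
  reduces the estimate to the preceding lemma.
\<close>

lemma conv_estimate:
  assumes L: "0 < L" and \<alpha>: "1 / 2 < \<alpha>"
  shows "\<exists>K>0. \<forall>a b. a \<in> wl2 (sob L (1 + \<alpha>)) \<and> b \<in> wl2 (sob L \<alpha>) \<and> a 0 = 0 \<and> b 0 = 0 \<and>
        (\<forall>m. (0::real) \<le> a m \<and> (0::real) \<le> b m) \<longrightarrow>
      (\<forall>k. (\<lambda>m. a m * b (k - m)) summable_on UNIV) \<and>
      (\<lambda>k. \<Sum>\<^sub>\<infinity>m. a m * b (k - m)) \<in> wl2 (sob L \<alpha>) \<and>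
      wnorm (sob L \<alpha>) (\<lambda>k. \<Sum>\<^sub>\<infinity>m. a m * b (k - m)) \<le> K * wnorm (sob L (1 + \<alpha>)) a * wnorm (sob L \<alpha>) b"
proof -
  obtain K where K: "0 < K"
    and sK: "\<And>k. (\<lambda>m. sob L (- 2 - 2 * \<alpha>) m * sob L (- 2 * \<alpha>) (k - m)) summable_on UNIV"
    and bK: "\<And>k. sob L (2 * \<alpha>) k * (\<Sum>\<^sub>\<infinity>m. sob L (- 2 - 2 * \<alpha>) m * sob L (- 2 * \<alpha>) (k - m)) \<le> K"
    by (rule conv_weight_bound[OF L \<alpha>]) (rule that)
  { fix a b :: "int ^ 3 \<Rightarrow> real"
    assume a: "a \<in> wl2 (sob L (1 + \<alpha>))" and b: "b \<in> wl2 (sob L \<alpha>)"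
      and z: "a 0 = 0" "b 0 = 0" and nn: "\<And>m. 0 \<le> a m" "\<And>m. 0 \<le> b m"
    \<comment> \<open>\<open>A\<close> and \<open>B\<close> carry the weights of the two norms, \<open>x\<close> their reciprocals; the sum over \<open>m\<close> of
      \<open>(x k m)\<^sup>2\<close> is the one of \<open>conv_weight_bound\<close>.\<close>
    define A where "A = (\<lambda>m. sob L (1 + \<alpha>) m * a m)"
    define B where "B = (\<lambda>m. sob L \<alpha> m * b m)"
    define x where "x = (\<lambda>k m. sob L (- 1 - \<alpha>) m * sob L (- \<alpha>) (k - m))"
    define Na where "Na = wnorm (sob L (1 + \<alpha>)) a"
    define Nb where "Nb = wnorm (sob L \<alpha>) b"
    have A2: "(\<lambda>m. (A m)\<^sup>2) summable_on UNIV" "(\<Sum>\<^sub>\<infinity>m. (A m)\<^sup>2) = Na\<^sup>2"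
      using a nn by (simp_all add: A_def wl2_def Na_def wnorm_power2)
    have B2: "(\<Sum>n\<in>F. (B n)\<^sup>2) \<le> Nb\<^sup>2" if "finite F" for F
      using finite_sum_le_wnorm[OF b that] nn by (simp add: B_def Nb_def)
    have B2': "(B n)\<^sup>2 \<le> Nb\<^sup>2" for n using B2[of "{n}"] by simp
    have AB: "(\<lambda>m. (A m * B (k - m))\<^sup>2) summable_on UNIV" for k
    proof (rule summable_on_comparison_test)
      show "(\<lambda>m. (A m)\<^sup>2 * Nb\<^sup>2) summable_on UNIV" by (intro summable_on_cmult_left A2)
      show "(A m * B (k - m))\<^sup>2 \<le> (A m)\<^sup>2 * Nb\<^sup>2" for m
        using B2'[of "k - m"] by (simp add: power_mult_distrib mult_left_mono)
    qed simp
    have x2: "(x k m)\<^sup>2 = sob L (- 2 - 2 * \<alpha>) m * sob L (- 2 * \<alpha>) (k - m)" for k m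
    proof -
      have "2 * (- 1 - \<alpha>) = - 2 - 2 * \<alpha>" "2 * - \<alpha> = - 2 * \<alpha>" by simp_all
      then show ?thesis by (simp only: x_def power_mult_distrib sob_power2)
    qed
    have fact: "\<bar>x k m * (A m * B (k - m))\<bar> = a m * b (k - m)" for k m
    proof (cases "m = 0 \<or> k - m = 0")
      case False
      have "x k m * (A m * B (k - m))
          = (sob L (- (1 + \<alpha>)) m * sob L (1 + \<alpha>) m) * (sob L (- \<alpha>) (k - m) * sob L \<alpha> (k - m)) * (a m * b (k - m))"
        by (simp add: x_def A_def B_def)
      also have "\<dots> = a m * b (k - m)"
        using False by (simp only: sob_cancel[OF L]) simp
      finally show ?thesis using nn by simp
    qed (use z in \<open>auto simp: x_def\<close>)
    have sx: "(\<lambda>m. (x k m)\<^sup>2) summable_on UNIV" for k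
      unfolding x2 by (rule sK)
    have s: "(\<lambda>m. a m * b (k - m)) summable_on UNIV" for k
      using summable_on_mult_if_square_summable[OF sx[of k] AB[of k]] unfolding fact .
    define c where "c = (\<lambda>k. \<Sum>\<^sub>\<infinity>m. a m * b (k - m))"
    have c2: "(sob L \<alpha> k * norm (c k))\<^sup>2 \<le> K * (\<Sum>\<^sub>\<infinity>m. (A m * B (k - m))\<^sup>2)" for k
    proof -
      have "(c k)\<^sup>2 \<le> (\<Sum>\<^sub>\<infinity>m. (x k m)\<^sup>2) * (\<Sum>\<^sub>\<infinity>m. (A m * B (k - m))\<^sup>2)"
        using Cauchy_Schwarz_infsum[OF sx[of k] AB[of k]] unfolding fact c_def .
      then have "sob L (2 * \<alpha>) k * (c k)\<^sup>2
          \<le> (sob L (2 * \<alpha>) k * (\<Sum>\<^sub>\<infinity>m. (x k m)\<^sup>2)) * (\<Sum>\<^sub>\<infinity>m. (A m * B (k - m))\<^sup>2)"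
        by (simp add: mult_left_mono mult.assoc)
      also have "\<dots> \<le> K * (\<Sum>\<^sub>\<infinity>m. (A m * B (k - m))\<^sup>2)"
        using bK[of k] unfolding x2 by (intro mult_right_mono infsum_nonneg) auto
      finally show ?thesis by (simp add: power_mult_distrib sob_power2)
    qed
    have fin: "(\<Sum>k\<in>F. (sob L \<alpha> k * norm (c k))\<^sup>2) \<le> (sqrt K * Na * Nb)\<^sup>2" if F: "finite F" for F
    proof -
      have "(\<Sum>k\<in>F. (sob L \<alpha> k * norm (c k))\<^sup>2) \<le> (\<Sum>k\<in>F. K * (\<Sum>\<^sub>\<infinity>m. (A m * B (k - m))\<^sup>2))"
        by (intro sum_mono c2)
      also have "\<dots> = K * (\<Sum>\<^sub>\<infinity>m. \<Sum>k\<in>F. (A m * B (k - m))\<^sup>2)"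
        by (subst infsum_finite_sum[OF AB]) (simp add: sum_distrib_left)
      also have "(\<Sum>\<^sub>\<infinity>m. \<Sum>k\<in>F. (A m * B (k - m))\<^sup>2) \<le> (\<Sum>\<^sub>\<infinity>m. (A m)\<^sup>2 * Nb\<^sup>2)"
      proof (rule infsum_mono)
        show "(\<lambda>m. \<Sum>k\<in>F. (A m * B (k - m))\<^sup>2) summable_on UNIV"
          by (intro summable_on_finite_sum AB)
        show "(\<lambda>m. (A m)\<^sup>2 * Nb\<^sup>2) summable_on UNIV" by (intro summable_on_cmult_left A2)
        fix m
        have "(\<Sum>k\<in>F. (B (k - m))\<^sup>2) = (\<Sum>n\<in>(\<lambda>k. k - m) ` F. (B n)\<^sup>2)"
          by (subst sum.reindex) (auto simp: inj_on_def)
        also have "\<dots> \<le> Nb\<^sup>2" using F by (intro B2) auto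
        finally show "(\<Sum>k\<in>F. (A m * B (k - m))\<^sup>2) \<le> (A m)\<^sup>2 * Nb\<^sup>2"
          by (simp add: power_mult_distrib sum_distrib_left[symmetric] mult_left_mono)
      qed
      also have "(\<Sum>\<^sub>\<infinity>m. (A m)\<^sup>2 * Nb\<^sup>2) = Na\<^sup>2 * Nb\<^sup>2"
        by (simp add: infsum_cmult_left' A2)
      finally show ?thesis using K by (simp add: power_mult_distrib mult.assoc)
    qed
    have "c \<in> wl2 (sob L \<alpha>)" by (rule wl2_if_finite_sums[OF fin])
    moreover have "wnorm (sob L \<alpha>) c \<le> sqrt K * Na * Nb"
      using wnorm_le_if_finite_sums[OF fin] K by (auto intro: power2_le_imp_le simp: Na_def Nb_def)
    ultimately have "\<And>k. (\<lambda>m. a m * b (k - m)) summable_on UNIV" "c \<in> wl2 (sob L \<alpha>)"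
      "wnorm (sob L \<alpha>) c \<le> sqrt K * Na * Nb" using s by auto
    note this[unfolded c_def Na_def Nb_def] }
  with K show ?thesis by (intro exI[of _ "sqrt K"]) simp
qed

section \<open>Fourier coefficients of divergence-free fields\<close>

text \<open>
  The algebraic constraints that define the spaces of every order, separated from summability.
\<close>

definition adm :: "real \<Rightarrow> coeffs set" where
  "adm L = {u. real_valued u \<and> zero_mean u \<and> div_free L u}"

definition cdot :: "real ^ 3 \<Rightarrow> complex ^ 3 \<Rightarrow> complex" where
  "cdot w z = (\<Sum>j\<in>UNIV. of_real (w $ j) * z $ j)"

definition vcnj :: "complex ^ 3 \<Rightarrow> complex ^ 3" where
  "vcnj z = (\<chi> i. cnj (z $ i))"

definition cscale :: "complex \<Rightarrow> complex ^ 3 \<Rightarrow> complex ^ 3" where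
  "cscale c z = (\<chi> i. c * z $ i)"

lemma linear_cdot: "linear (cdot w)"
  by (auto simp: cdot_def linear_iff sum.distrib ring_distribs scaleR_sum_right)

lemma linear_vcnj: "linear vcnj"
  by (auto simp: vcnj_def linear_iff vec_eq_iff)

lemma bounded_linear_cdot: "bounded_linear (cdot w)"
  using linear_cdot linear_conv_bounded_linear by blast

lemma bounded_linear_vcnj: "bounded_linear vcnj"
  using linear_vcnj linear_conv_bounded_linear by blast

lemma vcnj_simps [simp]: "vcnj (vcnj z) = z" "vcnj 0 = 0" "norm (vcnj z) = norm z"
  "inner (vcnj y) (vcnj z) = inner y z"
  by (simp_all add: vcnj_def vec_eq_iff norm_vec_def inner_vec_def inner_complex_def)

lemma cdot_simps [simp]: "cdot 0 z = 0" "cdot w 0 = 0" "cdot (- w) z = - cdot w z"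
  "cdot (w + w') z = cdot w z + cdot w' z" "cdot (w - w') z = cdot w z - cdot w' z"
  "cdot w (vcnj z) = cnj (cdot w z)"
  by (simp_all add: cdot_def vcnj_def sum_negf sum.distrib sum_subtractf ring_distribs)

lemma cdot_add: "cdot w (y + z) = cdot w y + cdot w z"
  and cdot_diff: "cdot w (y - z) = cdot w y - cdot w z"
  and cdot_scaleR: "cdot w (r *\<^sub>R z) = r *\<^sub>R cdot w z"
  by (simp_all add: cdot_def sum.distrib sum_subtractf ring_distribs scaleR_sum_right)

lemma norm_cscale [simp]: "norm (cscale c z) = cmod c * norm z"
  by (simp add: cscale_def norm_vec_def norm_mult L2_set_right_distrib)

lemma norm_cdot_le: "cmod (cdot w z) \<le> norm w * norm z"
proof -
  have "cmod (cdot w z) \<le> (\<Sum>j\<in>UNIV. \<bar>w $ j\<bar> * \<bar>cmod (z $ j)\<bar>)"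
    unfolding cdot_def by (rule sum_norm_le) (simp add: norm_mult)
  also have "\<dots> \<le> norm w * norm z"
    using L2_set_mult_ineq[of "vec_nth w" "\<lambda>j. cmod (z $ j)" UNIV] by (simp add: norm_vec_def L2_set_def)
  finally show ?thesis .
qed

lemma real_valued_iff: "real_valued u \<longleftrightarrow> (\<forall>k. u (- k) = vcnj (u k))"
  by (simp add: real_valued_def vcnj_def vec_eq_iff)

lemma div_free_iff: "div_free L u \<longleftrightarrow> (\<forall>k. cdot (wave L k) (u k) = 0)"
proof -
  have "(\<Sum>j\<in>UNIV. \<i> * of_real (wave L k $ j) * u k $ j) = \<i> * cdot (wave L k) (u k)" for k
    by (simp add: cdot_def sum_distrib_left mult.assoc)
  then show ?thesis by (simp add: div_free_def)
qed

lemma adm_iff: "u \<in> adm L \<longleftrightarrow>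
    (\<forall>k. u (- k) = vcnj (u k)) \<and> u 0 = 0 \<and> (\<forall>k. cdot (wave L k) (u k) = 0)"
  by (simp add: adm_def real_valued_iff zero_mean_def div_free_iff)

lemma adm_0 [simp]: "u \<in> adm L \<Longrightarrow> u 0 = 0"
  by (simp add: adm_iff)

lemma adm_diff: "u \<in> adm L \<Longrightarrow> v \<in> adm L \<Longrightarrow> u - v \<in> adm L"
  using linear_diff[OF linear_vcnj] by (simp add: adm_iff cdot_diff)

lemma adm_limit:
  assumes X: "\<And>n. X n \<in> adm L" and lim: "\<And>k. (\<lambda>n. X n k) \<longlonglongrightarrow> x k"
  shows "x \<in> adm L"
  unfolding adm_iff
proof (intro conjI allI)
  have a: "X n (- k) = vcnj (X n k)" "X n 0 = 0" "cdot (wave L k) (X n k) = 0" for n k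
    using X[of n] by (auto simp: adm_iff)
  show "x 0 = 0" using lim[of 0] by (simp add: a(2) LIMSEQ_const_iff)
  show "x (- k) = vcnj (x k)" for k
    using LIMSEQ_unique[OF lim[of "- k", unfolded a(1)] bounded_linear.tendsto[OF bounded_linear_vcnj lim[of k]]] .
  show "cdot (wave L k) (x k) = 0" for k
    using bounded_linear.tendsto[OF bounded_linear_cdot lim[of k], of "wave L k"] by (simp add: a(3) LIMSEQ_const_iff)
qed

lemma inner_eq_Re: "inner (y::complex ^ 3) z = Re (\<Sum>i\<in>UNIV. y $ i * cnj (z $ i))"
  by (simp add: inner_vec_def inner_complex_def)

lemma pairing_eq: "pairing L u v = L ^ 3 * (\<Sum>\<^sub>\<infinity>k. inner (u k) (v k))"
  by (simp only: pairing_def inner_eq_Re)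

lemma power2_powr: "0 \<le> x \<Longrightarrow> (x\<^sup>2 :: real) powr s = x powr (2 * s)"
  by (cases "x = 0") (auto simp: powr_powr simp flip: powr_numeral)

lemma V_norm_eq: "V_norm L s u = sqrt (L ^ 3) * wnorm (sob L s) u"
proof -
  have "((kap L k)\<^sup>2 powr (s / 2)) = sob L s k" for k
    using power2_powr[of "kap L k" "s / 2"] by (simp add: sob_def)
  then show ?thesis
    by (simp add: V_norm_def norm0_def stokes_pow_def wnorm_def real_sqrt_mult)
qed

lemma V_norm_nonneg [simp]: "0 < L \<Longrightarrow> 0 \<le> V_norm L s u"
  by (simp add: V_norm_eq)

text \<open>
  On zero-mean families the inhomogeneous weight of the Sobolev space and the homogeneous weight
  \<open>sob\<close> are comparable, because nonzero wave numbers are bounded below.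
\<close>

lemma V_eq:
  assumes L: "0 < L" and s: "0 \<le> s"
  shows "V L s = wl2 (sob L s) \<inter> adm L"
proof -
  define c where "c = 1 + 1 / (2 * pi / L)\<^sup>2"
  have c: "0 \<le> c" by (simp add: c_def)
  have le1: "(sob L s k * norm (u k))\<^sup>2 \<le> (1 + (kap L k)\<^sup>2) powr s * (norm (u k))\<^sup>2"
    for u :: coeffs and k
  proof -
    have "kap L k powr (2 * s) = (kap L k)\<^sup>2 powr s"
      by (rule power2_powr[symmetric]) simp
    also have "\<dots> \<le> (1 + (kap L k)\<^sup>2) powr s" using s by (intro powr_mono2) auto
    finally show ?thesis
      unfolding power_mult_distrib sob_power2 by (simp add: sob_def mult_right_mono)
  qed
  have le2: "(1 + (kap L k)\<^sup>2) powr s * (norm (u k))\<^sup>2 \<le> c powr s * (sob L s k * norm (u k))\<^sup>2"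
    if "u 0 = 0" for u :: coeffs and k
  proof (cases "k = 0")
    case False
    have "2 * pi / L \<le> kap L k" by (rule kap_ge[OF L False])
    then have "(2 * pi / L)\<^sup>2 \<le> (kap L k)\<^sup>2" using L by (intro power_mono) auto
    then have "1 + (kap L k)\<^sup>2 \<le> c * (kap L k)\<^sup>2" using L by (simp add: c_def field_simps)
    then have "(1 + (kap L k)\<^sup>2) powr s \<le> (c * (kap L k)\<^sup>2) powr s" using s by (intro powr_mono2) auto
    also have "\<dots> = c powr s * (kap L k)\<^sup>2 powr s" using c by (simp add: powr_mult)
    also have "(kap L k)\<^sup>2 powr s = kap L k powr (2 * s)"
      by (rule power2_powr) simp
    finally show ?thesis
      unfolding power_mult_distrib sob_power2 by (simp add: sob_def mult_right_mono flip: mult.assoc)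
  qed (simp add: that)
  have "u \<in> sobolev L s \<longleftrightarrow> u \<in> wl2 (sob L s)" if z: "u 0 = 0" for u
  proof
    assume "u \<in> sobolev L s"
    then show "u \<in> wl2 (sob L s)"
      unfolding sobolev_def wl2_def mem_Collect_eq
      by (rule summable_on_comparison_test) (use le1 in auto)
  next
    assume "u \<in> wl2 (sob L s)"
    then have "(\<lambda>k. c powr s * (sob L s k * norm (u k))\<^sup>2) summable_on UNIV"
      unfolding wl2_def mem_Collect_eq by (rule summable_on_cmult_right)
    then show "u \<in> sobolev L s"
      unfolding sobolev_def mem_Collect_eq
      by (rule summable_on_comparison_test) (use le2[of u, OF z] in auto)
  qed
  then show ?thesis unfolding V_def adm_def zero_mean_def by blast
qed

text \<open>The Leray projection of a single mode: the component orthogonal to the wave vector.\<close>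

definition leray :: "real \<Rightarrow> int ^ 3 \<Rightarrow> complex ^ 3 \<Rightarrow> complex ^ 3" where
  "leray L k z = z - cscale (cdot (wave L k) z / of_real ((kap L k)\<^sup>2)) (\<chi> i. of_real (wave L k $ i))"

lemma linear_leray: "linear (leray L k)"
  by (rule linearI) (simp_all add: leray_def cdot_add cdot_scaleR cscale_def vec_eq_iff
      add_divide_distrib ring_distribs scaleR_diff_right scaleR_conv_of_real[where 'a = complex])

lemma bounded_linear_leray: "bounded_linear (leray L k)"
  using linear_leray linear_conv_bounded_linear by blast

lemma cdot_leray [simp]: "cdot (wave L k) (leray L k z) = 0"
proof (cases "wave L k = 0")
  case False
  have "cdot w (cscale c (\<chi> i. of_real (w $ i))) = c * of_real ((norm w)\<^sup>2)" for c w
    by (simp add: cdot_def cscale_def norm_vec_def L2_set_def sum_nonneg power2_eq_square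
        sum_distrib_left mult_ac)
  with False show ?thesis by (simp add: leray_def cdot_diff)
qed simp

lemma leray_id: "cdot (wave L k) z = 0 \<Longrightarrow> leray L k z = z"
  by (simp add: leray_def cscale_def vec_eq_iff)

lemma leray_0 [simp]: "leray L k 0 = 0"
  by (simp add: leray_id)

lemma inner_leray:
  assumes "cdot (wave L k) y = 0"
  shows "inner (leray L k z) y = inner z y"
proof -
  have "inner (cscale c (\<chi> i. of_real (w $ i))) y = Re (c * cnj (cdot w y))" for c w
    by (simp add: inner_eq_Re cscale_def cdot_def sum_distrib_left mult_ac)
  then show ?thesis using assms by (simp add: leray_def inner_diff_left)
qed

lemma norm_leray_le: "norm (leray L k z) \<le> norm z"
proof -
  have "norm (leray L k z) * norm (leray L k z) = inner z (leray L k z)"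
    using inner_leray[of L k "leray L k z" z] by (simp add: dot_square_norm power2_eq_square)
  also have "\<dots> \<le> norm z * norm (leray L k z)" by (rule norm_cauchy_schwarz)
  finally show ?thesis
    by (cases "norm (leray L k z) = 0") auto
qed

lemma leray_vcnj: "leray L (- k) (vcnj z) = vcnj (leray L k z)"
  by (simp add: leray_def vcnj_def[of "_ - _"] vec_eq_iff cscale_def) (simp add: vcnj_def)

section \<open>The nonlinear term\<close>

text \<open>
  The contribution of the modes \<open>m\<close> and \<open>k - m\<close> to the mode \<open>k\<close> of the advection term. The
  derivative falls on the mode \<open>k - m\<close>, but the drift is orthogonal to the wave vector of \<open>m\<close>, so
  that the wave vector of \<open>k\<close> may stand in its place. This divergence form keeps the derivative
  outside the convolution.
\<close>

definition adv :: "real \<Rightarrow> int ^ 3 \<Rightarrow> complex ^ 3 \<Rightarrow> complex ^ 3 \<Rightarrow> complex ^ 3" where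
  "adv L k a b = cscale (\<i> * cdot (wave L k) a) b"

definition nl :: "real \<Rightarrow> coeffs \<Rightarrow> coeffs \<Rightarrow> coeffs" where
  "nl L \<psi> u k = leray L k (\<Sum>\<^sub>\<infinity>m. adv L k (\<psi> m) (u (k - m)))"

lemma norm_adv_le: "norm (adv L k a b) \<le> kap L k * (norm a * norm b)"
  using mult_right_mono[OF norm_cdot_le, of "norm b" "wave L k" a]
  by (simp add: adv_def norm_mult mult.assoc)

lemma adv_diff_left: "adv L k (a - a') b = adv L k a b - adv L k a' b"
  and adv_diff_right: "adv L k a (b - b') = adv L k a b - adv L k a b'"
  and adv_vcnj: "adv L (- k) (vcnj a) (vcnj b) = vcnj (adv L k a b)"
  by (simp_all add: adv_def cscale_def cdot_diff vec_eq_iff algebra_simps) (simp add: vcnj_def)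

text \<open>
  Absolute convergence of the convolution, under which the nonlinear term is bilinear.
\<close>

definition conv_summable :: "coeffs \<Rightarrow> coeffs \<Rightarrow> bool" where
  "conv_summable \<psi> u \<longleftrightarrow> (\<forall>k. (\<lambda>m. norm (\<psi> m) * norm (u (k - m))) summable_on UNIV)"

lemma infsum_diff:
  fixes f g :: "'a \<Rightarrow> 'b::real_normed_vector"
  assumes "f summable_on A" "g summable_on A"
  shows "(\<Sum>\<^sub>\<infinity>m\<in>A. f m - g m) = infsum f A - infsum g A"
  using infsum_add[OF assms(1), of "\<lambda>m. - g m"] assms(2) by (simp add: infsum_uminus summable_on_uminus)

lemma summable_on_adv:
  assumes "conv_summable \<psi> u"
  shows "(\<lambda>m. adv L k (\<psi> m) (u (k - m))) summable_on UNIV"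
proof (rule abs_summable_summable, rule Infinite_Sum.abs_summable_on_comparison_test')
  show "(\<lambda>m. kap L k * (norm (\<psi> m) * norm (u (k - m)))) summable_on UNIV"
    using assms by (intro summable_on_cmult_right) (simp add: conv_summable_def)
qed (rule norm_adv_le)

lemma nl_diff_left:
  assumes "conv_summable \<psi> u" "conv_summable \<psi>' u"
  shows "nl L (\<psi> - \<psi>') u = nl L \<psi> u - nl L \<psi>' u"
  using assms by (auto simp: nl_def fun_eq_iff adv_diff_left linear_diff[OF linear_leray]
      infsum_diff[OF summable_on_adv summable_on_adv])

lemma nl_diff_right:
  assumes "conv_summable \<psi> u" "conv_summable \<psi> u'"
  shows "nl L \<psi> (u - u') = nl L \<psi> u - nl L \<psi> u'"
  using assms by (auto simp: nl_def fun_eq_iff adv_diff_right linear_diff[OF linear_leray]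
      infsum_diff[OF summable_on_adv summable_on_adv])

lemma nl_adm:
  assumes s: "conv_summable \<psi> u" and \<psi>: "\<psi> \<in> adm L" and u: "u \<in> adm L"
  shows "nl L \<psi> u \<in> adm L"
  unfolding adm_iff
proof (intro conjI allI)
  fix k
  have b: "bij_betw uminus (UNIV :: (int ^ 3) set) UNIV"
    by (rule bij_betw_byWitness[where f' = uminus]) auto
  have "(\<Sum>\<^sub>\<infinity>m. adv L (- k) (\<psi> m) (u (- k - m))) = (\<Sum>\<^sub>\<infinity>m. adv L (- k) (\<psi> (- m)) (u (- k - (- m))))"
    by (rule infsum_reindex_bij_betw[OF b, symmetric])
  also have "\<dots> = (\<Sum>\<^sub>\<infinity>m. vcnj (adv L k (\<psi> m) (u (k - m))))"
  proof (rule infsum_cong)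
    fix m
    have "\<psi> (- m) = vcnj (\<psi> m)" "u (- (k - m)) = vcnj (u (k - m))"
      using \<psi> u unfolding adm_iff by blast+
    then show "adv L (- k) (\<psi> (- m)) (u (- k - - m)) = vcnj (adv L k (\<psi> m) (u (k - m)))"
      by (simp add: adv_vcnj)
  qed
  also have "\<dots> = vcnj (\<Sum>\<^sub>\<infinity>m. adv L k (\<psi> m) (u (k - m)))"
    by (rule infsumI, rule has_sum_bounded_linear[OF bounded_linear_vcnj has_sum_infsum[OF summable_on_adv[OF s]]])
  finally show "nl L \<psi> u (- k) = vcnj (nl L \<psi> u k)"
    by (simp add: nl_def leray_vcnj)
qed (simp_all add: nl_def adv_def cscale_def zero_vec_def[symmetric])

lemma wl2_norm_iff: "(\<lambda>k. norm (x k)) \<in> wl2 \<omega> \<longleftrightarrow> x \<in> wl2 \<omega>" "wnorm \<omega> (\<lambda>k. norm (x k)) = wnorm \<omega> x"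
  by (simp_all add: wl2_def wnorm_def)

text \<open>
  The projection does not increase norms and the derivative costs one factor \<open>kap L k\<close>, which is
  the loss of one order; the rest is the convolution estimate.
\<close>

lemma nl_estimate:
  assumes L: "0 < L" and \<alpha>: "1 / 2 < \<alpha>"
  shows "\<exists>K>0. \<forall>\<psi>\<in>V L (1 + \<alpha>). \<forall>u\<in>V L \<alpha>. conv_summable \<psi> u \<and>
      (\<lambda>k. \<Sum>\<^sub>\<infinity>m. norm (\<psi> m) * norm (u (k - m))) \<in> wl2 (sob L \<alpha>) \<and>
      nl L \<psi> u \<in> wl2 (sob L (\<alpha> - 1)) \<and>
      V_norm L (\<alpha> - 1) (nl L \<psi> u) \<le> K * (V_norm L (1 + \<alpha>) \<psi> * V_norm L \<alpha> u)"
proof -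
  obtain K where K: "0 < K" and conv: "\<And>a b. a \<in> wl2 (sob L (1 + \<alpha>)) \<and> b \<in> wl2 (sob L \<alpha>) \<and> a 0 = 0 \<and> b 0 = 0 \<and>
        (\<forall>m. (0::real) \<le> a m \<and> (0::real) \<le> b m) \<Longrightarrow>
      (\<forall>k. (\<lambda>m. a m * b (k - m)) summable_on UNIV) \<and>
      (\<lambda>k. \<Sum>\<^sub>\<infinity>m. a m * b (k - m)) \<in> wl2 (sob L \<alpha>) \<and>
      wnorm (sob L \<alpha>) (\<lambda>k. \<Sum>\<^sub>\<infinity>m. a m * b (k - m)) \<le> K * wnorm (sob L (1 + \<alpha>)) a * wnorm (sob L \<alpha>) b"
    using conv_estimate[OF L \<alpha>] by blast
  { fix \<psi> u assume "\<psi> \<in> V L (1 + \<alpha>)" "u \<in> V L \<alpha>"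
    then have \<psi>: "\<psi> \<in> wl2 (sob L (1 + \<alpha>))" "\<psi> 0 = 0" and u: "u \<in> wl2 (sob L \<alpha>)" "u 0 = 0"
      using L \<alpha> by (auto simp: V_eq)
    define a where "a = (\<lambda>m. norm (\<psi> m))"
    define b where "b = (\<lambda>m. norm (u m))"
    have ab: "a 0 = 0" "b 0 = 0" "\<And>m. 0 \<le> a m" "\<And>m. 0 \<le> b m"
      using \<psi> u by (auto simp: a_def b_def)
    have K1: "(\<lambda>m. a m * b (k - m)) summable_on UNIV"
      and K2: "(\<lambda>k. \<Sum>\<^sub>\<infinity>m. a m * b (k - m)) \<in> wl2 (sob L \<alpha>)"
      and K3: "wnorm (sob L \<alpha>) (\<lambda>k. \<Sum>\<^sub>\<infinity>m. a m * b (k - m)) \<le> K * wnorm (sob L (1 + \<alpha>)) a * wnorm (sob L \<alpha>) b"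
      for k
      using conv[of a b] ab \<psi> u by (auto simp: a_def b_def wl2_norm_iff)
    have s: "conv_summable \<psi> u"
      using K1 by (simp add: conv_summable_def a_def b_def)
    define c where "c = (\<lambda>k. \<Sum>\<^sub>\<infinity>m. a m * b (k - m))"
    have le: "\<bar>sob L (\<alpha> - 1) k * norm (nl L \<psi> u k)\<bar> \<le> 1 * \<bar>sob L \<alpha> k * norm (c k)\<bar>" for k
    proof -
      have "norm (nl L \<psi> u k) \<le> norm (\<Sum>\<^sub>\<infinity>m. adv L k (\<psi> m) (u (k - m)))"
        unfolding nl_def by (rule norm_leray_le)
      also have "\<dots> \<le> (\<Sum>\<^sub>\<infinity>m. kap L k * (a m * b (k - m)))"
      proof (rule norm_infsum_le)
        show "((\<lambda>m. adv L k (\<psi> m) (u (k - m))) has_sum (\<Sum>\<^sub>\<infinity>m. adv L k (\<psi> m) (u (k - m)))) UNIV"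
          by (rule has_sum_infsum[OF summable_on_adv[OF s]])
        show "((\<lambda>m. kap L k * (a m * b (k - m))) has_sum (\<Sum>\<^sub>\<infinity>m. kap L k * (a m * b (k - m)))) UNIV"
          by (rule has_sum_infsum[OF summable_on_cmult_right[OF K1]])
      qed (simp add: a_def b_def norm_adv_le)
      also have "\<dots> = kap L k * c k"
        unfolding c_def by (rule infsum_cmult_right[OF K1])
      finally have "sob L (\<alpha> - 1) k * norm (nl L \<psi> u k) \<le> sob L (\<alpha> - 1) k * (kap L k * c k)"
        by (rule mult_left_mono) simp
      also have "\<dots> = sob L \<alpha> k * c k"
        by (simp add: sob_shift(1)[OF L, of \<alpha>])
      finally show ?thesis by (simp add: abs_mult c_def infsum_nonneg ab)
    qed
    have cw: "c \<in> wl2 (sob L \<alpha>)" unfolding c_def by (rule K2)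
    have n: "nl L \<psi> u \<in> wl2 (sob L (\<alpha> - 1))" by (rule wl2_mono[OF cw le]) simp
    have "wnorm (sob L (\<alpha> - 1)) (nl L \<psi> u) \<le> 1 * wnorm (sob L \<alpha>) c"
      by (rule wnorm_mono[OF cw le]) simp
    also have "\<dots> \<le> K * wnorm (sob L (1 + \<alpha>)) \<psi> * wnorm (sob L \<alpha>) u"
      using K3 by (simp add: c_def a_def b_def wl2_norm_iff)
    finally have "sqrt (L ^ 3) * wnorm (sob L (\<alpha> - 1)) (nl L \<psi> u)
        \<le> sqrt (L ^ 3) * (K * wnorm (sob L (1 + \<alpha>)) \<psi> * wnorm (sob L \<alpha>) u)"
      using L by (intro mult_left_mono) auto
    then have "V_norm L (\<alpha> - 1) (nl L \<psi> u) \<le> K / sqrt (L ^ 3) * (V_norm L (1 + \<alpha>) \<psi> * V_norm L \<alpha> u)"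
      using L by (simp add: V_norm_eq)
    note s cw[unfolded c_def a_def b_def] n this }
  moreover have "0 < K / sqrt (L ^ 3)" using K L by simp
  ultimately show ?thesis by (intro exI[of _ "K / sqrt (L ^ 3)"]) blast
qed

section \<open>The trilinear form in Fourier coefficients\<close>

definition wexp :: "real \<Rightarrow> int ^ 3 \<Rightarrow> real ^ 3 \<Rightarrow> complex" where
  "wexp L k x = exp (\<i> * of_real (wave L k \<bullet> x))"

lemma wexp_add: "wexp L (k + m) x = wexp L k x * wexp L m x"
  by (simp add: wexp_def exp_add[symmetric] inner_add_left ring_distribs)

lemma wexp_minus: "wexp L (- k) x = cnj (wexp L k x)"
  by (simp add: wexp_def exp_cnj)

lemma integral_period:
  fixes n :: int
  assumes L: "0 < L"
  shows "has_bochner_integral lborel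
    (\<lambda>y. indicator {0..L} y *\<^sub>R exp (\<i> * of_real (2 * pi * n / L * y))) (if n = 0 then of_real L else 0)"
proof (cases "n = 0")
  case True
  have "has_bochner_integral lborel (\<lambda>y. indicator {0..L} y *\<^sub>R (1::complex)) (of_real L - of_real 0)"
    by (rule has_bochner_integral_FTC_Icc) (use L in \<open>auto intro!: derivative_eq_intros simp: has_vector_derivative_def scaleR_conv_of_real fun_eq_iff\<close>)
  with True show ?thesis by simp
next
  case False
  define a where "a = 2 * pi * n / L"
  have a: "a \<noteq> 0" using False L by (simp add: a_def)
  define F where "F = (\<lambda>y::real. exp (\<i> * of_real (a * y)) / (\<i> * of_real a))"
  have "has_bochner_integral lborel (\<lambda>y. indicator {0..L} y *\<^sub>R exp (\<i> * of_real (a * y))) (F L - F 0)"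
  proof (rule has_bochner_integral_FTC_Icc)
    show "continuous_on {0..L} (\<lambda>y. exp (\<i> * complex_of_real (a * y)))"
      by (intro continuous_intros)
    fix y :: real
    have "((\<lambda>z. exp (\<i> * (of_real a * z)) / (\<i> * of_real a)) has_field_derivative exp (\<i> * (of_real a * of_real y)))
        (at (of_real y))"
      using a by (auto intro!: derivative_eq_intros simp: mult_ac)
    then have "((\<lambda>z. exp (\<i> * (of_real a * of_real z)) / (\<i> * of_real a)) has_vector_derivative
        exp (\<i> * (of_real a * of_real y))) (at y within {0..L})"
      by (rule has_vector_derivative_real_field)
    then show "(F has_vector_derivative exp (\<i> * complex_of_real (a * y))) (at y within {0..L})"
      by (simp add: F_def)
  qed (use L in auto)
  moreover have "F L - F 0 = 0"
  proof -
    have "\<i> * complex_of_real (a * L) = \<i> * (of_int n * (of_real pi * 2))"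
      using L by (simp add: a_def)
    then have "exp (\<i> * complex_of_real (a * L)) = 1"
      using exp_integer_2pi[of "of_int n"] by (simp add: mult_ac)
    then show ?thesis by (simp add: F_def)
  qed
  ultimately show ?thesis using False by (simp add: a_def)
qed

text \<open>Orthogonality of the exponentials, reduced to one dimension by the product structure.\<close>

lemma has_integral_wexp:
  assumes L: "0 < L"
  shows "(wexp L p has_integral (if p = 0 then of_real (L ^ 3) else 0)) (cbox 0 (\<chi> l. L))"
proof -
  define g where "g = (\<lambda>b::real ^ 3. \<lambda>y. indicator {0..L} y *\<^sub>R exp (\<i> * of_real ((wave L p \<bullet> b) * y)))"
  have B: "b \<in> Basis \<longleftrightarrow> (\<exists>j. b = axis j (1::real))" for b :: "real ^ 3"
    by (auto simp: Basis_vec_def)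
  have gi: "has_bochner_integral lborel (g (axis j 1)) (if p $ j = 0 then of_real L else 0)" for j
    using integral_period[OF L, of "p $ j"] by (simp add: g_def inner_axis wave_def)
  have cb: "x \<in> cbox 0 (\<chi> l. L) \<longleftrightarrow> (\<forall>b\<in>Basis. x \<bullet> b \<in> {0..L})" for x :: "real ^ 3"
  proof -
    have "(\<forall>b\<in>Basis. Q b) \<longleftrightarrow> (\<forall>j. Q (axis j (1::real)))" for Q :: "real ^ 3 \<Rightarrow> bool"
      unfolding Ball_def B by blast
    then show ?thesis by (simp add: mem_box_cart inner_axis)
  qed
  have pt: "indicator (cbox 0 (\<chi> l. L)) x *\<^sub>R wexp L p x = (\<Prod>b\<in>Basis. g b (x \<bullet> b))" for x
  proof -
    have "wave L p \<bullet> x = (\<Sum>b\<in>Basis. (wave L p \<bullet> b) * (x \<bullet> b))"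
      by (rule euclidean_inner)
    then have e: "wexp L p x = (\<Prod>b\<in>Basis. exp (\<i> * of_real ((wave L p \<bullet> b) * (x \<bullet> b))))"
      by (simp add: wexp_def exp_sum sum_distrib_left)
    show ?thesis
    proof (cases "x \<in> cbox 0 (\<chi> l. L)")
      case True
      then have "\<And>b. b \<in> Basis \<Longrightarrow> x \<bullet> b \<in> {0..L}" by (simp add: cb)
      with True show ?thesis by (simp add: g_def e)
    next
      case False
      then obtain b where "b \<in> Basis" "x \<bullet> b \<notin> {0..L}" by (auto simp: cb)
      then have "(\<Prod>b\<in>Basis. g b (x \<bullet> b)) = 0"
        by (intro prod_zero) (auto simp: g_def intro!: bexI[of _ b])
      with False show ?thesis by simp
    qed
  qed
  interpret product_sigma_finite "\<lambda>b::real ^ 3. lborel :: real measure" ..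
  have mg: "(\<lambda>x. \<Prod>b\<in>(Basis :: (real ^ 3) set). g b (x \<bullet> b)) \<in> borel_measurable borel"
    unfolding g_def by measurable
  have "(LINT x|lborel. indicator (cbox 0 (\<chi> l. L)) x *\<^sub>R wexp L p x) = (LINT x|lborel. (\<Prod>b\<in>Basis. g b (x \<bullet> b)))"
    by (simp add: pt)
  also have "\<dots> = (LINT f|(\<Pi>\<^sub>M b\<in>Basis. lborel). (\<Prod>b\<in>Basis. g b ((\<Sum>b\<in>Basis. f b *\<^sub>R b) \<bullet> b)))"
    by (subst lborel_eq, subst integral_distr) (use mg in \<open>auto\<close>)
  also have "\<dots> = (LINT f|(\<Pi>\<^sub>M b\<in>Basis. lborel). (\<Prod>b\<in>(Basis :: (real ^ 3) set). g b (f b)))"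
    by (intro Bochner_Integration.integral_cong refl prod.cong) simp
  also have "\<dots> = (\<Prod>b\<in>(Basis :: (real ^ 3) set). integral\<^sup>L lborel (g b))"
    by (rule product_integral_prod) (use gi in \<open>auto simp: B has_bochner_integral_iff\<close>)
  also have "\<dots> = (\<Prod>j\<in>UNIV. integral\<^sup>L lborel (g (axis j 1)))"
    by (rule prod.reindex_bij_betw[symmetric])
      (auto simp: bij_betw_def inj_on_def axis_eq_axis B image_def)
  also have "\<dots> = (\<Prod>j\<in>UNIV. if p $ j = 0 then of_real L else 0)"
    by (rule prod.cong[OF refl]) (rule has_bochner_integral_integral_eq[OF gi])
  also have "\<dots> = (if p = 0 then of_real (L ^ 3) else 0)"
    by (auto simp: vec_eq_iff intro!: prod_zero)
  finally have I: "(LINT x|lborel. indicator (cbox 0 (\<chi> l. L)) x *\<^sub>R wexp L p x) = (if p = 0 then of_real (L ^ 3) else 0)" .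
  have c: "continuous_on (cbox 0 (\<chi> l. L)) (wexp L p)"
    unfolding wexp_def by (intro continuous_intros)
  have i: "integrable lborel (\<lambda>x. indicator (cbox 0 (\<chi> l. L)) x *\<^sub>R wexp L p x)"
    by (rule borel_integrable_compact[OF compact_cbox c])
  have "((\<lambda>x. indicator (cbox 0 (\<chi> l. L)) x *\<^sub>R wexp L p x) has_integral (if p = 0 then of_real (L ^ 3) else 0)) UNIV"
    using has_integral_integral_lborel[OF i] unfolding I .
  moreover have "(\<lambda>x. indicator (cbox 0 (\<chi> l. L)) x *\<^sub>R wexp L p x)
      = (\<lambda>x. if x \<in> cbox 0 (\<chi> l. L) then wexp L p x else 0)"
    by (auto simp: fun_eq_iff)
  ultimately show ?thesis by (simp only: has_integral_restrict_UNIV)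
qed

definition kbox :: "nat \<Rightarrow> (int ^ 3) set" where
  "kbox N = {k. \<forall>j. \<bar>k $ j\<bar> \<le> int N}"

lemma finite_kbox [simp]: "finite (kbox N)"
proof -
  have "kbox N \<subseteq> vec_lambda ` (PiE UNIV (\<lambda>_. {- int N..int N}))"
  proof
    fix k assume "k \<in> kbox N"
    then have "\<bar>k $ j\<bar> \<le> int N" for j by (simp add: kbox_def)
    then have "k $ j \<in> {- int N..int N}" for j using abs_le_iff by (metis atLeastAtMost_iff minus_le_iff)
    then have "vec_nth k \<in> PiE UNIV (\<lambda>_. {- int N..int N})" by auto
    then show "k \<in> vec_lambda ` (PiE UNIV (\<lambda>_. {- int N..int N}))" by (metis image_eqI vec_nth_inverse)
  qed
  then show ?thesis by (rule finite_subset) (intro finite_imageI finite_PiE, auto)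
qed

lemma uminus_kbox: "bij_betw uminus (kbox N) (kbox N)"
  by (rule bij_betw_byWitness[where f' = uminus]) (auto simp: kbox_def)

lemma eventually_in_kbox: "eventually (\<lambda>N. k \<in> kbox N) sequentially"
proof -
  define M where "M = nat (Max (range (\<lambda>j. \<bar>k $ j\<bar>)))"
  have "\<bar>k $ j\<bar> \<le> int N" if "M \<le> N" for j N
  proof -
    have "\<bar>k $ j\<bar> \<le> Max (range (\<lambda>j. \<bar>k $ j\<bar>))" by (rule Max_ge) auto
    then show ?thesis using that unfolding M_def by linarith
  qed
  then show ?thesis unfolding eventually_sequentially kbox_def by blast
qed

lemma filterlim_kbox: "filterlim kbox (finite_subsets_at_top UNIV) sequentially"
  unfolding filterlim_finite_subsets_at_top
proof (intro allI impI)
  fix X :: "(int ^ 3) set" assume X: "finite X \<and> X \<subseteq> UNIV"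
  then have "eventually (\<lambda>N. \<forall>k\<in>X. k \<in> kbox N) sequentially"
    using eventually_in_kbox by (intro eventually_ball_finite) auto
  then show "eventually (\<lambda>N. finite (kbox N) \<and> X \<subseteq> kbox N \<and> kbox N \<subseteq> UNIV) sequentially"
    by eventually_elim auto
qed

lemma of_real_trig_poly:
  assumes "real_valued u"
  shows "of_real (trig_poly L N u x $ i) = (\<Sum>k\<in>kbox N. wexp L k x * u k $ i)"
proof -
  define S where "S = (\<Sum>k\<in>kbox N. wexp L k x * u k $ i)"
  have "cnj S = (\<Sum>k\<in>kbox N. wexp L (- k) x * u (- k) $ i)"
    using assms by (simp add: S_def wexp_minus real_valued_def)
  also have "\<dots> = S"
    unfolding S_def by (rule sum.reindex_bij_betw[OF uminus_kbox])
  finally have "Im S = 0" by (metis cnj.simps(2) neg_equal_zero)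
  then have "of_real (Re S) = S" by (simp add: complex_eq_iff)
  then show ?thesis by (simp add: trig_poly_def S_def kbox_def wexp_def)
qed

definition deriv_coeffs :: "real \<Rightarrow> 3 \<Rightarrow> coeffs \<Rightarrow> coeffs" where
  "deriv_coeffs L j u k = cscale (\<i> * of_real (wave L k $ j)) (u k)"

lemma real_valued_deriv_coeffs: "real_valued u \<Longrightarrow> real_valued (deriv_coeffs L j u)"
  by (simp add: real_valued_def deriv_coeffs_def cscale_def)

lemma partial_deriv_trig_poly:
  "partial_deriv j (\<lambda>y. trig_poly L N u y $ i) x = trig_poly L N (deriv_coeffs L j u) x $ i"
proof -
  have "((\<lambda>h. exp (\<i> * of_real (wave L k \<bullet> (x + h *\<^sub>R axis j 1)))) has_vector_derivative
      \<i> * of_real (wave L k $ j) * exp (\<i> * of_real (wave L k \<bullet> x))) (at 0)" for k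
  proof -
    have "((\<lambda>z. exp (\<i> * (of_real (wave L k \<bullet> x) + z * of_real (wave L k $ j)))) has_field_derivative
      \<i> * of_real (wave L k $ j) * exp (\<i> * of_real (wave L k \<bullet> x))) (at (of_real 0))"
      by (auto intro!: derivative_eq_intros)
    from has_vector_derivative_real_field[OF this] show ?thesis
      by (simp add: inner_add_right inner_axis)
  qed
  then have d: "((\<lambda>h. \<Sum>k\<in>kbox N. exp (\<i> * of_real (wave L k \<bullet> (x + h *\<^sub>R axis j 1))) * u k $ i) has_vector_derivative
      (\<Sum>k\<in>kbox N. \<i> * of_real (wave L k $ j) * exp (\<i> * of_real (wave L k \<bullet> x)) * u k $ i)) (at 0)"
    by (intro has_vector_derivative_sum has_vector_derivative_mult_left)
  have "((\<lambda>h. trig_poly L N u (x + h *\<^sub>R axis j 1) $ i) has_vector_derivative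
      (trig_poly L N (deriv_coeffs L j u) x $ i)) (at 0)"
    using bounded_linear.has_vector_derivative[OF bounded_linear_Re d] by (simp add: trig_poly_def kbox_def deriv_coeffs_def cscale_def mult_ac)
  then show ?thesis
    unfolding partial_deriv_def has_real_derivative_iff_has_vector_derivative[symmetric]
    by (rule DERIV_imp_deriv)
qed

text \<open>
  Multiplied out, the three sums give exponentials of the sum of three wave vectors, of which
  orthogonality keeps those with sum 0. Reality of \<open>w\<close> turns its coefficient at \<open>- k\<close> into the
  conjugate of that at \<open>k\<close>.
\<close>

lemma has_integral_trig_poly_product:
  assumes L: "0 < L" and r: "real_valued u" "real_valued v" "real_valued w"
  shows "((\<lambda>x. trig_poly L N u x $ a * trig_poly L N v x $ b * trig_poly L N w x $ c) has_integral
      Re (\<Sum>k\<in>kbox N. \<Sum>m\<in>kbox N. if k - m \<in> kbox N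
          then of_real (L ^ 3) * (u m $ a * v (k - m) $ b * cnj (w k $ c)) else 0)) (cbox 0 (\<chi> l. L))"
proof -
  define P where "P = (\<Sum>k\<in>kbox N. \<Sum>m\<in>kbox N. \<Sum>n\<in>kbox N.
      (if m + n - k = 0 then of_real (L ^ 3) else 0) * (u m $ a * v n $ b * cnj (w k $ c)))"
  have "((\<lambda>x. \<Sum>k\<in>kbox N. \<Sum>m\<in>kbox N. \<Sum>n\<in>kbox N. wexp L (m + n - k) x * (u m $ a * v n $ b * cnj (w k $ c)))
      has_integral P) (cbox 0 (\<chi> l. L))"
    unfolding P_def by (intro has_integral_sum finite_kbox has_integral_mult_left has_integral_wexp[OF L])
  moreover have "of_real (trig_poly L N u x $ a * trig_poly L N v x $ b * trig_poly L N w x $ c)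
      = (\<Sum>k\<in>kbox N. \<Sum>m\<in>kbox N. \<Sum>n\<in>kbox N. wexp L (m + n - k) x * (u m $ a * v n $ b * cnj (w k $ c)))" for x
  proof -
    have w: "of_real (trig_poly L N w x $ c) = (\<Sum>k\<in>kbox N. wexp L (- k) x * cnj (w k $ c))"
      unfolding of_real_trig_poly[OF r(3)]
      by (subst sum.reindex_bij_betw[OF uminus_kbox, symmetric]) (use r(3) in \<open>simp add: real_valued_def\<close>)
    have e: "wexp L (m + n - k) x = wexp L m x * wexp L n x * wexp L (- k) x" for k m n
      by (simp only: wexp_add[symmetric] diff_conv_add_uminus)
    have prod3: "sum A S * sum B S * sum C S = (\<Sum>k\<in>S. \<Sum>m\<in>S. \<Sum>n\<in>S. h k m n)"
      if "\<And>k m n. h k m n = A m * B n * C k" for A B C :: "int ^ 3 \<Rightarrow> complex" and h S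
    proof -
      have "sum A S * sum B S * sum C S = sum C S * (\<Sum>m\<in>S. \<Sum>n\<in>S. A m * B n)"
        by (simp only: sum_product mult.commute)
      also have "\<dots> = (\<Sum>k\<in>S. \<Sum>m\<in>S. C k * (\<Sum>n\<in>S. A m * B n))"
        by (rule sum_product)
      finally show ?thesis by (simp only: that sum_distrib_left mult.commute[of _ "C _"])
    qed
    show ?thesis
      unfolding of_real_mult w of_real_trig_poly[OF r(1)] of_real_trig_poly[OF r(2)] e
      by (rule prod3) (simp only: mult_ac)
  qed
  ultimately have "((\<lambda>x. complex_of_real (trig_poly L N u x $ a * trig_poly L N v x $ b * trig_poly L N w x $ c)) has_integral P)
      (cbox 0 (\<chi> l. L))" by simp
  from has_integral_linear[OF this bounded_linear_Re]
  have "((\<lambda>x. trig_poly L N u x $ a * trig_poly L N v x $ b * trig_poly L N w x $ c) has_integral Re P) (cbox 0 (\<chi> l. L))"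
    by (simp add: o_def)
  moreover have "P = (\<Sum>k\<in>kbox N. \<Sum>m\<in>kbox N. if k - m \<in> kbox N
          then of_real (L ^ 3) * (u m $ a * v (k - m) $ b * cnj (w k $ c)) else 0)"
    unfolding P_def
  proof (intro sum.cong refl)
    fix k m
    have "(\<Sum>n\<in>kbox N. (if m + n - k = 0 then complex_of_real (L ^ 3) else 0) * (u m $ a * v n $ b * cnj (w k $ c)))
      = (\<Sum>n\<in>kbox N. if n = k - m then of_real (L ^ 3) * (u m $ a * v n $ b * cnj (w k $ c)) else 0)"
      by (intro sum.cong refl) (auto simp: algebra_simps)
    also have "\<dots> = (if k - m \<in> kbox N
          then of_real (L ^ 3) * (u m $ a * v (k - m) $ b * cnj (w k $ c)) else 0)"
      by (simp add: sum.delta)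
    finally show "(\<Sum>n\<in>kbox N. (if m + n - k = 0 then complex_of_real (L ^ 3) else 0) * (u m $ a * v n $ b * cnj (w k $ c))) = \<dots>" .
  qed
  ultimately show ?thesis by simp
qed

lemma smooth_trilinear_trig_poly:
  assumes L: "0 < L" and u: "u \<in> adm L" and v: "v \<in> adm L" and w: "w \<in> adm L"
  shows "smooth_trilinear L (trig_poly L N u) (trig_poly L N v) (trig_poly L N w)
    = L ^ 3 * (\<Sum>(k, m)\<in>{(k, m). k \<in> kbox N \<and> m \<in> kbox N \<and> k - m \<in> kbox N}. inner (adv L k (u m) (v (k - m))) (w k))"
proof -
  have r: "real_valued u" "real_valued v" "real_valued w" using u v w by (auto simp: adm_def)
  have "smooth_trilinear L (trig_poly L N u) (trig_poly L N v) (trig_poly L N w)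
    = (\<Sum>i\<in>UNIV. \<Sum>j\<in>UNIV. Re (\<Sum>k\<in>kbox N. \<Sum>m\<in>kbox N. if k - m \<in> kbox N
          then of_real (L ^ 3) * (u m $ j * deriv_coeffs L j v (k - m) $ i * cnj (w k $ i)) else 0))"
    unfolding smooth_trilinear_def partial_deriv_trig_poly
    by (intro sum.cong refl integral_unique has_integral_trig_poly_product L r real_valued_deriv_coeffs)
  also have "\<dots> = Re (\<Sum>i\<in>UNIV. \<Sum>j\<in>UNIV. \<Sum>k\<in>kbox N. \<Sum>m\<in>kbox N. if k - m \<in> kbox N
          then of_real (L ^ 3) * (u m $ j * deriv_coeffs L j v (k - m) $ i * cnj (w k $ i)) else 0)"
    by (simp only: Re_sum)
  also have "(\<Sum>i\<in>UNIV. \<Sum>j\<in>UNIV. \<Sum>k\<in>kbox N. \<Sum>m\<in>kbox N. if k - m \<in> kbox N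
          then of_real (L ^ 3) * (u m $ j * deriv_coeffs L j v (k - m) $ i * cnj (w k $ i)) else 0)
    = (\<Sum>k\<in>kbox N. \<Sum>m\<in>kbox N. \<Sum>i\<in>UNIV. \<Sum>j\<in>UNIV. if k - m \<in> kbox N
          then of_real (L ^ 3) * (u m $ j * deriv_coeffs L j v (k - m) $ i * cnj (w k $ i)) else 0)"
  proof -
    have sw: "(\<Sum>i\<in>I. \<Sum>j\<in>J. \<Sum>k\<in>K. \<Sum>m\<in>M. g i j k m) = (\<Sum>k\<in>K. \<Sum>m\<in>M. \<Sum>i\<in>I. \<Sum>j\<in>J. g i j k m)"
      for g :: "3 \<Rightarrow> 3 \<Rightarrow> int ^ 3 \<Rightarrow> int ^ 3 \<Rightarrow> complex" and I J K M
    proof -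
      have "(\<Sum>i\<in>I. \<Sum>j\<in>J. \<Sum>k\<in>K. \<Sum>m\<in>M. g i j k m) = (\<Sum>i\<in>I. \<Sum>k\<in>K. \<Sum>j\<in>J. \<Sum>m\<in>M. g i j k m)"
        by (intro sum.cong refl sum.swap)
      also have "\<dots> = (\<Sum>k\<in>K. \<Sum>i\<in>I. \<Sum>m\<in>M. \<Sum>j\<in>J. g i j k m)"
        by (subst sum.swap) (intro sum.cong refl sum.swap)
      also have "\<dots> = (\<Sum>k\<in>K. \<Sum>m\<in>M. \<Sum>i\<in>I. \<Sum>j\<in>J. g i j k m)"
        by (intro sum.cong refl sum.swap)
      finally show ?thesis .
    qed
    show ?thesis by (rule sw)
  qed
  also have "Re \<dots> = (\<Sum>k\<in>kbox N. \<Sum>m\<in>kbox N. if k - m \<in> kbox N then L ^ 3 * inner (adv L k (u m) (v (k - m))) (w k) else 0)"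
    unfolding Re_sum
  proof (intro sum.cong refl)
    fix k m :: "int ^ 3"
    have z: "cdot (wave L m) (u m) = 0" using u by (simp add: adm_iff)
    have "(\<Sum>i\<in>UNIV. \<Sum>j\<in>UNIV. of_real (L ^ 3) * (u m $ j * deriv_coeffs L j v (k - m) $ i * cnj (w k $ i)))
      = of_real (L ^ 3) * (\<Sum>i\<in>UNIV. (\<i> * cdot (wave L (k - m)) (u m)) * v (k - m) $ i * cnj (w k $ i))"
      unfolding cdot_def deriv_coeffs_def cscale_def
      by (simp add: sum_distrib_left sum_distrib_right mult_ac)
    also have "(\<Sum>i\<in>UNIV. (\<i> * cdot (wave L (k - m)) (u m)) * v (k - m) $ i * cnj (w k $ i))
      = (\<Sum>i\<in>UNIV. adv L k (u m) (v (k - m)) $ i * cnj (w k $ i))"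
      using z by (simp add: adv_def cscale_def)
    finally have "Re (\<Sum>i\<in>UNIV. \<Sum>j\<in>UNIV. of_real (L ^ 3) * (u m $ j * deriv_coeffs L j v (k - m) $ i * cnj (w k $ i)))
       = L ^ 3 * inner (adv L k (u m) (v (k - m))) (w k)"
      by (simp add: inner_eq_Re)
    then show "(\<Sum>i\<in>UNIV. \<Sum>j\<in>UNIV. Re (if k - m \<in> kbox N
          then of_real (L ^ 3) * (u m $ j * deriv_coeffs L j v (k - m) $ i * cnj (w k $ i)) else 0))
      = (if k - m \<in> kbox N then L ^ 3 * inner (adv L k (u m) (v (k - m))) (w k) else 0)"
      by (simp add: Re_sum)
  qed
  also have "\<dots> = (\<Sum>(k, m)\<in>kbox N \<times> kbox N. if k - m \<in> kbox N then L ^ 3 * inner (adv L k (u m) (v (k - m))) (w k) else 0)"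
    by (rule sum.cartesian_product)
  also have "\<dots> = (\<Sum>(k, m)\<in>{(k, m). k \<in> kbox N \<and> m \<in> kbox N \<and> k - m \<in> kbox N}. L ^ 3 * inner (adv L k (u m) (v (k - m))) (w k))"
    by (intro sum.mono_neutral_cong_right) (auto split: if_splits)
  finally show ?thesis by (simp add: sum_distrib_left case_prod_unfold)
qed

text \<open>
  Weights of opposite orders cancel off the origin; at the origin, where both vanish, one of the
  factors has to vanish instead.
\<close>

lemma dual_summable:
  fixes x :: "int ^ 3 \<Rightarrow> 'b::real_normed_vector" and y :: "int ^ 3 \<Rightarrow> 'c::real_normed_vector"
  assumes L: "0 < L" and x: "x \<in> wl2 (sob L s)" and y: "y \<in> wl2 (sob L (- s))"
    and z: "x 0 = 0 \<or> y 0 = 0"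
  shows "(\<lambda>k. norm (x k) * norm (y k)) summable_on UNIV"
proof -
  have "(\<lambda>k. \<bar>(sob L s k * norm (x k)) * (sob L (- s) k * norm (y k))\<bar>) summable_on UNIV"
    by (rule summable_on_mult_if_square_summable) (use x y in \<open>auto simp: wl2_def\<close>)
  moreover have "\<bar>(sob L s k * norm (x k)) * (sob L (- s) k * norm (y k))\<bar> = norm (x k) * norm (y k)" for k
  proof (cases "k = 0")
    case False
    have "(sob L s k * norm (x k)) * (sob L (- s) k * norm (y k)) = (sob L (- s) k * sob L s k) * (norm (x k) * norm (y k))"
      by simp
    also have "\<dots> = norm (x k) * norm (y k)" using sob_cancel[OF L] False by simp
    finally show ?thesis by simp
  qed (use z in auto)
  ultimately show ?thesis by simp
qed

lemma wl2_weaken: 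
  assumes L: "0 < L" and le: "s \<le> t" and x: "x \<in> wl2 (sob L t)"
  shows "x \<in> wl2 (sob L s)"
proof (rule wl2_mono[OF x])
  show "\<bar>sob L s k * norm (x k)\<bar> \<le> (2 * pi / L) powr (s - t) * \<bar>sob L t k * norm (x k)\<bar>" for k
    using mult_right_mono[OF sob_weaken[OF L le, of k] norm_ge_zero[of "x k"]] by (simp add: mult.assoc)
qed simp

text \<open>
  The truncated integrals are finite sums over pairs of modes; since the whole double series
  converges absolutely, they tend to its sum.
\<close>

theorem trilinear_eq_pairing_nl:
  assumes L: "0 < L" and \<alpha>: "1 / 2 < \<alpha>"
    and u: "u \<in> V L (1 + \<alpha>)" and v: "v \<in> V L \<alpha>" and w: "w \<in> V L (1 + \<alpha>)"
  shows "trilinear L u v w = pairing L (nl L u v) w"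
proof -
  have cs: "conv_summable u v" and cw: "(\<lambda>k. \<Sum>\<^sub>\<infinity>m. norm (u m) * norm (v (k - m))) \<in> wl2 (sob L \<alpha>)"
    using nl_estimate[OF L \<alpha>] u v by blast+
  have adm: "u \<in> adm L" "v \<in> adm L" "w \<in> adm L" and w2: "w \<in> wl2 (sob L (1 + \<alpha>))"
    using u v w L \<alpha> by (auto simp: V_eq)
  define F where "F = (\<lambda>(k, m). inner (adv L k (u m) (v (k - m))) (w k))"
  define c where "c = (\<lambda>k. \<Sum>\<^sub>\<infinity>m. norm (u m) * norm (v (k - m)))"
  have Fle: "norm (F (k, m)) \<le> kap L k * norm (w k) * (norm (u m) * norm (v (k - m)))" for k m
  proof -
    have "norm (F (k, m)) \<le> norm (adv L k (u m) (v (k - m))) * norm (w k)"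
      unfolding F_def by (simp add: Cauchy_Schwarz_ineq2)
    also have "\<dots> \<le> kap L k * (norm (u m) * norm (v (k - m))) * norm (w k)"
      by (intro mult_right_mono norm_adv_le) simp
    finally show ?thesis by (simp add: mult_ac)
  qed
  have sm: "(\<lambda>m. norm (u m) * norm (v (k - m))) summable_on UNIV" for k
    using cs by (simp add: conv_summable_def)
  have kw: "(\<lambda>k. kap L k *\<^sub>R w k) \<in> wl2 (sob L (- \<alpha>))"
  proof (rule wl2_mono)
    show "w \<in> wl2 (sob L (1 - \<alpha>))" by (rule wl2_weaken[OF L _ w2]) (use \<alpha> in simp)
    show "\<bar>sob L (- \<alpha>) k * norm (kap L k *\<^sub>R w k)\<bar> \<le> 1 * \<bar>sob L (1 - \<alpha>) k * norm (w k)\<bar>" for k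
      using L by (cases "k = 0") (simp_all add: sob_def powr_diff powr_minus field_simps)
  qed simp
  have abs: "(\<lambda>x. norm (F x)) summable_on UNIV \<times> UNIV"
  proof -
    have Fm: "(\<lambda>m. norm (F (k, m))) summable_on UNIV" for k
      by (rule summable_on_comparison_test[OF summable_on_cmult_right[OF sm, of "kap L k * norm (w k)" k]])
        (use Fle in auto)
    have "(\<lambda>k. \<Sum>\<^sub>\<infinity>m. norm (F (k, m))) summable_on UNIV"
    proof (rule summable_on_comparison_test)
      show "(\<lambda>k. norm (c k) * norm (kap L k *\<^sub>R w k)) summable_on UNIV"
        by (rule dual_summable[OF L cw[folded c_def] kw]) simp
      fix k
      have "(\<Sum>\<^sub>\<infinity>m. norm (F (k, m))) \<le> (\<Sum>\<^sub>\<infinity>m. kap L k * norm (w k) * (norm (u m) * norm (v (k - m))))"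
        by (intro infsum_mono Fm Fle summable_on_cmult_right sm)
      also have "\<dots> = kap L k * norm (w k) * c k"
        unfolding c_def by (rule infsum_cmult_right[OF sm])
      finally show "(\<Sum>\<^sub>\<infinity>m. norm (F (k, m))) \<le> norm (c k) * norm (kap L k *\<^sub>R w k)"
        by (simp add: c_def infsum_nonneg mult_ac)
    qed (auto intro: infsum_nonneg)
    then have "(\<lambda>k. norm (\<Sum>\<^sub>\<infinity>m. norm (F (k, m)))) summable_on UNIV"
      by (simp add: infsum_nonneg)
    with Fm show ?thesis
      by (subst Infinite_Sum.abs_summable_on_Sigma_iff) auto
  qed
  then have Fs: "F summable_on UNIV \<times> UNIV" by (rule abs_summable_summable)
  \<comment> \<open>These index sets exhaust all pairs, although they are not products.\<close>
  define P where "P = (\<lambda>N. {(k, m). k \<in> kbox N \<and> m \<in> kbox N \<and> k - m \<in> kbox N})"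
  have P: "filterlim P (finite_subsets_at_top (UNIV \<times> UNIV)) sequentially"
    unfolding filterlim_finite_subsets_at_top
  proof (intro allI impI)
    fix X :: "((int ^ 3) \<times> (int ^ 3)) set" assume X: "finite X \<and> X \<subseteq> UNIV \<times> UNIV"
    have "eventually (\<lambda>N. fst x \<in> kbox N \<and> snd x \<in> kbox N \<and> fst x - snd x \<in> kbox N) sequentially" for x
      by (intro eventually_conj eventually_in_kbox)
    then have "eventually (\<lambda>N. \<forall>x\<in>X. fst x \<in> kbox N \<and> snd x \<in> kbox N \<and> fst x - snd x \<in> kbox N) sequentially"
      using X by (intro eventually_ball_finite) auto
    then show "eventually (\<lambda>N. finite (P N) \<and> X \<subseteq> P N \<and> P N \<subseteq> UNIV \<times> UNIV) sequentially"
    proof eventually_elim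
      case (elim N)
      have "finite (P N)" by (rule finite_subset[of _ "kbox N \<times> kbox N"]) (auto simp: P_def)
      then show ?case using elim by (auto simp: P_def)
    qed
  qed
  have "(\<lambda>N. sum F (P N)) \<longlonglongrightarrow> infsum F (UNIV \<times> UNIV)"
    by (rule filterlim_compose[OF infsum_tendsto[OF Fs] P])
  then have "(\<lambda>N. L ^ 3 * sum F (P N)) \<longlonglongrightarrow> L ^ 3 * infsum F (UNIV \<times> UNIV)"
    by (rule tendsto_mult_left)
  moreover have "smooth_trilinear L (trig_poly L N u) (trig_poly L N v) (trig_poly L N w) = L ^ 3 * sum F (P N)" for N
    unfolding smooth_trilinear_trig_poly[OF L adm] F_def P_def ..
  ultimately have "trilinear L u v w = L ^ 3 * infsum F (UNIV \<times> UNIV)"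
    unfolding trilinear_def by (simp add: limI)
  also have "infsum F (UNIV \<times> UNIV) = (\<Sum>\<^sub>\<infinity>k. \<Sum>\<^sub>\<infinity>m. F (k, m))"
    using infsum_Sigma_banach[OF Fs] by simp
  also have "\<dots> = (\<Sum>\<^sub>\<infinity>k. inner (nl L u v k) (w k))"
  proof (rule infsum_cong)
    fix k
    have "((\<lambda>m. inner (adv L k (u m) (v (k - m))) (w k)) has_sum
        inner (\<Sum>\<^sub>\<infinity>m. adv L k (u m) (v (k - m))) (w k)) UNIV"
      by (rule has_sum_bounded_linear[OF bounded_linear_inner_left has_sum_infsum[OF summable_on_adv[OF cs]]])
    then have "(\<Sum>\<^sub>\<infinity>m. F (k, m)) = inner (\<Sum>\<^sub>\<infinity>m. adv L k (u m) (v (k - m))) (w k)"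
      unfolding F_def by (simp add: infsumI)
    also have "\<dots> = inner (nl L u v k) (w k)"
      unfolding nl_def by (rule inner_leray[symmetric]) (use adm in \<open>simp add: adm_iff\<close>)
    finally show "(\<Sum>\<^sub>\<infinity>m. F (k, m)) = inner (nl L u v k) (w k)" .
  qed
  finally show ?thesis by (simp add: pairing_eq)
qed

section \<open>Smooth functions of compact support\<close>

text \<open>
  The derivative of \<open>exp (- 1 / x)\<close>, extended by 0, is again of this form with another
  polynomial in \<open>1 / x\<close>, so that the family is closed under differentiation.
\<close>

definition flat :: "real poly \<Rightarrow> real \<Rightarrow> real" where
  "flat p x = (if 0 < x then poly p (1 / x) * exp (- (1 / x)) else 0)"

lemma tendsto_poly_exp_0: "((\<lambda>y::real. poly p y * exp (- y)) \<longlongrightarrow> 0) at_top"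
proof -
  have "((\<lambda>y::real. coeff p i * (y ^ i / exp y)) \<longlongrightarrow> coeff p i * 0) at_top" for i
    by (intro tendsto_mult_left tendsto_power_div_exp_0)
  then have "((\<lambda>y::real. \<Sum>i\<le>degree p. coeff p i * (y ^ i / exp y)) \<longlongrightarrow> (\<Sum>i\<le>degree p. 0)) at_top"
    by (intro tendsto_sum) simp
  then show ?thesis
    by (simp add: poly_altdef sum_distrib_right exp_minus divide_inverse mult.assoc)
qed

lemma tendsto_flat_0: "(flat p \<longlongrightarrow> 0) (at 0)"
proof (rule filterlim_split_at)
  have "((\<lambda>x::real. poly p (inverse x) * exp (- inverse x)) \<longlongrightarrow> 0) (at_right 0)"
    by (rule filterlim_compose[OF tendsto_poly_exp_0 filterlim_inverse_at_top_right])
  then show "(flat p \<longlongrightarrow> 0) (at_right 0)"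
    by (rule Lim_transform_eventually) (auto simp: flat_def eventually_at_right_field inverse_eq_divide intro!: exI[of _ 1])
  show "(flat p \<longlongrightarrow> 0) (at_left 0)"
    by (rule Lim_transform_eventually[OF tendsto_const]) (auto simp: flat_def eventually_at_left_field intro!: exI[of _ "-1"])
qed

lemma flat_has_derivative: "(flat p has_real_derivative flat ([:0, 0, 1:] * (p - pderiv p)) x) (at x)"
proof (cases x "0::real" rule: linorder_cases)
  case less
  have "eventually (\<lambda>y. flat p y = 0) (nhds x)"
    using eventually_nhds_in_open[of "{..<0}" x] less by (auto elim!: eventually_mono simp: flat_def)
  then have "(flat p has_real_derivative 0) (at x) \<longleftrightarrow> ((\<lambda>_. 0) has_real_derivative 0) (at x)"
    by (intro DERIV_cong_ev) auto
  then show ?thesis using less by (simp add: flat_def)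
next
  case greater
  have "eventually (\<lambda>y. flat p y = poly p (1 / y) * exp (- (1 / y))) (nhds x)"
    using eventually_nhds_in_open[of "{0<..}" x] greater by (auto elim!: eventually_mono simp: flat_def)
  moreover have "((\<lambda>y. poly p (1 / y) * exp (- (1 / y))) has_real_derivative flat ([:0, 0, 1:] * (p - pderiv p)) x) (at x)"
    using greater
    by (auto intro!: derivative_eq_intros DERIV_chain2[OF poly_DERIV] simp: flat_def field_simps power2_eq_square)
  ultimately show ?thesis by (subst DERIV_cong_ev[OF refl _ refl]) auto
next
  case equal
  have "(flat ([:0, 1:] * p) \<longlongrightarrow> 0) (at 0)" by (rule tendsto_flat_0)
  then have "((\<lambda>h. (flat p (0 + h) - flat p 0) / h) \<longlongrightarrow> 0) (at 0)"
    by (rule Lim_transform_eventually) (auto simp: flat_def eventually_at_filter)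
  then show ?thesis using equal by (simp add: DERIV_def flat_def)
qed

text \<open>
  A class of functions that is closed under differentiation consists of smooth functions; it is
  closed under the operations needed to build bumps and steps.
\<close>

inductive smooth_gen :: "(real \<Rightarrow> real) \<Rightarrow> bool" where
  flat: "smooth_gen (\<lambda>x. flat p (c * x + d))"
| exp: "smooth_gen (\<lambda>x. exp (c * x))"
| const: "smooth_gen (\<lambda>x. c)"
| add: "smooth_gen f \<Longrightarrow> smooth_gen g \<Longrightarrow> smooth_gen (\<lambda>x. f x + g x)"
| mult: "smooth_gen f \<Longrightarrow> smooth_gen g \<Longrightarrow> smooth_gen (\<lambda>x. f x * g x)"
| inverse: "smooth_gen f \<Longrightarrow> (\<And>x. f x \<noteq> 0) \<Longrightarrow> smooth_gen (\<lambda>x. inverse (f x))"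

lemma smooth_gen_derivative:
  "smooth_gen f \<Longrightarrow> \<exists>f'. smooth_gen f' \<and> (\<forall>x. (f has_real_derivative f' x) (at x))"
proof (induction rule: smooth_gen.induct)
  case (flat p c d)
  have "((\<lambda>x. flat p (c * x + d)) has_real_derivative flat ([:0, 0, 1:] * (p - pderiv p)) (c * x + d) * c) (at x)" for x
    by (rule DERIV_chain2[OF flat_has_derivative]) (auto intro!: derivative_eq_intros)
  then show ?case by (blast intro: smooth_gen.intros)
next
  case (exp c)
  have "((\<lambda>x. exp (c * x)) has_real_derivative exp (c * x) * c) (at x)" for x
    by (auto intro!: derivative_eq_intros)
  then show ?case by (blast intro: smooth_gen.intros)
next
  case (const c)
  have "((\<lambda>x. c) has_real_derivative 0) (at x)" for x by simp
  then show ?case by (blast intro: smooth_gen.intros)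
next
  case (add f g)
  then obtain f' g' where "smooth_gen f'" "smooth_gen g'"
    and *: "\<And>x. (f has_real_derivative f' x) (at x)" "\<And>x. (g has_real_derivative g' x) (at x)" by blast
  moreover have "((\<lambda>x. f x + g x) has_real_derivative f' x + g' x) (at x)" for x
    by (intro derivative_intros *)
  ultimately show ?case by (blast intro: smooth_gen.intros)
next
  case (mult f g)
  then obtain f' g' where "smooth_gen f'" "smooth_gen g'"
    and *: "\<And>x. (f has_real_derivative f' x) (at x)" "\<And>x. (g has_real_derivative g' x) (at x)" by blast
  moreover have "((\<lambda>x. f x * g x) has_real_derivative f' x * g x + g' x * f x) (at x)" for x
    by (intro DERIV_mult *)
  ultimately show ?case using mult by (blast intro: smooth_gen.intros)
next
  case (inverse f)
  then obtain f' where f': "smooth_gen f'" and *: "\<And>x. (f has_real_derivative f' x) (at x)" by blast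
  have "((\<lambda>x. inverse (f x)) has_real_derivative (- 1) * ((inverse (f x) * f' x) * inverse (f x))) (at x)" for x
    using DERIV_inverse'[OF *[of x] inverse.hyps(2)[of x]] by simp
  moreover have "smooth_gen (\<lambda>x. (- 1) * ((inverse (f x) * f' x) * inverse (f x)))"
    using f' inverse.hyps by (intro smooth_gen.intros)
  ultimately show ?case by blast
qed

lemma smooth_gen_iterated_deriv: "smooth_gen f \<Longrightarrow> smooth_gen ((deriv ^^ n) f)"
proof (induction n)
  case (Suc n)
  then obtain f' where "smooth_gen f'" "\<forall>x. ((deriv ^^ n) f has_real_derivative f' x) (at x)"
    using smooth_gen_derivative by blast
  then have "(deriv ^^ Suc n) f = f'" by (auto simp: fun_eq_iff DERIV_imp_deriv)
  with \<open>smooth_gen f'\<close> show ?case by simp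
qed simp

lemma test_function_if_smooth_gen:
  assumes "smooth_gen \<phi>" "0 < a" "b < \<mu>" "\<And>t. t \<notin> {a..b} \<Longrightarrow> \<phi> t = 0"
  shows "test_function \<mu> \<phi>"
  unfolding test_function_def
  using smooth_gen_derivative[OF smooth_gen_iterated_deriv[OF assms(1)]] assms(2-4)
  by (meson real_differentiable_def)

text \<open>A smooth step from 0 to 1 whose transition takes place in the unit interval.\<close>

definition step :: "real \<Rightarrow> real" where
  "step x = flat 1 x * inverse (flat 1 x + flat 1 (1 - x))"

lemma flat_1_pos: "0 < x \<Longrightarrow> 0 < flat 1 x" and flat_1_nonneg: "0 \<le> flat 1 x"
  by (simp_all add: flat_def)

lemma step_denominator_pos: "0 < flat 1 x + flat 1 (1 - x)"
  using flat_1_pos[of x] flat_1_pos[of "1 - x"] flat_1_nonneg[of x] flat_1_nonneg[of "1 - x"]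
  by (cases "0 < x") linarith+

lemma step_0: "x \<le> 0 \<Longrightarrow> step x = 0" and step_1: "1 \<le> x \<Longrightarrow> step x = 1"
  by (simp_all add: step_def flat_def)

lemma step_bounds: "0 \<le> step x" "step x \<le> 1"
  using step_denominator_pos[of x] flat_1_nonneg[of x] flat_1_nonneg[of "1 - x"]
  by (simp_all add: step_def field_simps)

lemma smooth_gen_step: "smooth_gen (\<lambda>x. step (c * x + d))"
proof -
  have 1: "smooth_gen (\<lambda>x. flat 1 (c * x + d))" by (rule smooth_gen.flat)
  have "smooth_gen (\<lambda>x. flat 1 ((- c) * x + (1 - d)))" by (rule smooth_gen.flat)
  then have 2: "smooth_gen (\<lambda>x. flat 1 (1 - (c * x + d)))" by (simp add: algebra_simps)
  have "smooth_gen (\<lambda>x. inverse (flat 1 (c * x + d) + flat 1 (1 - (c * x + d))))"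
    by (intro smooth_gen.inverse smooth_gen.add 1 2) (use step_denominator_pos in \<open>auto simp: less_imp_neq[symmetric]\<close>)
  with 1 show ?thesis unfolding step_def by (rule smooth_gen.mult)
qed

lemma step_derivative:
  obtains \<sigma> K where "\<And>x. (step has_real_derivative \<sigma> x) (at x)" "continuous_on UNIV \<sigma>"
    "\<And>x. x \<notin> {0..1} \<Longrightarrow> \<sigma> x = 0" "\<And>x. \<bar>\<sigma> x\<bar> \<le> K" "0 < K"
proof -
  have "smooth_gen step" using smooth_gen_step[of 1 0] by simp
  then obtain \<sigma> where s: "smooth_gen \<sigma>" and d: "\<And>x. (step has_real_derivative \<sigma> x) (at x)"
    using smooth_gen_derivative by blast
  obtain \<sigma>' where "\<And>x. (\<sigma> has_real_derivative \<sigma>' x) (at x)" using smooth_gen_derivative[OF s] by blast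
  then have c: "continuous_on UNIV \<sigma>" by (intro DERIV_continuous_on) (auto intro: has_field_derivative_at_within)
  have z: "\<sigma> x = 0" if x: "x \<notin> {0..1}" for x
  proof -
    have "eventually (\<lambda>y. step y = (if x < 0 then 0 else 1)) (nhds x)"
    proof (cases "x < 0")
      case True
      then show ?thesis using eventually_nhds_in_open[of "{..<0}" x] by (auto elim!: eventually_mono simp: step_0)
    next
      case False
      then have "1 < x" using x by auto
      then show ?thesis using False eventually_nhds_in_open[of "{1<..}" x] by (auto elim!: eventually_mono simp: step_1)
    qed
    then have "(step has_real_derivative 0) (at x) \<longleftrightarrow> ((\<lambda>_. if x < 0 then 0 else 1) has_real_derivative 0) (at x)"
      by (intro DERIV_cong_ev) auto
    then have "(step has_real_derivative 0) (at x)" by simp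
    then show ?thesis using d DERIV_unique by blast
  qed
  have "bounded (\<sigma> ` {0..1})"
    by (intro compact_imp_bounded compact_continuous_image continuous_on_subset[OF c]) auto
  then obtain K where K: "0 < K" "\<And>x. x \<in> {0..1} \<Longrightarrow> \<bar>\<sigma> x\<bar> \<le> K" by (auto simp: bounded_pos)
  have "\<bar>\<sigma> x\<bar> \<le> K" for x using z[of x] K by (cases "x \<in> {0..1}") auto
  then show ?thesis using that d c z K(1) by blast
qed

section \<open>Scalar linear equations in distributional form\<close>

abbreviation Leb :: "real \<Rightarrow> real measure" where "Leb \<mu> \<equiv> lebesgue_on {0..\<mu>}"

lemma finite_measure_Leb: "finite_measure (Leb \<mu>)"
  by (rule finite_measureI) (simp add: emeasure_restrict_space emeasure_lborel_Icc_eq)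

lemma continuous_imp_measurable_Leb:
  "continuous_on {0..\<mu>} f \<Longrightarrow> (f :: real \<Rightarrow> 'b::euclidean_space) \<in> borel_measurable (Leb \<mu>)"
  by (rule continuous_imp_measurable_on_sets_lebesgue) auto

lemma continuous_imp_integrable_Leb:
  fixes f :: "real \<Rightarrow> 'b::euclidean_space"
  assumes "continuous_on {0..\<mu>} f"
  shows "integrable (Leb \<mu>) f"
proof -
  interpret finite_measure "Leb \<mu>" by (rule finite_measure_Leb)
  have "bounded (f ` {0..\<mu>})" by (intro compact_imp_bounded compact_continuous_image assms) auto
  then obtain K where "\<forall>y\<in>f ` {0..\<mu>}. norm y \<le> K" unfolding bounded_iff by blast
  then show ?thesis
    by (intro integrable_const_bound[where B = K] continuous_imp_measurable_Leb assms) (auto intro: AE_I2)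
qed

lemma AE_Leb_neq: "AE s in Leb \<mu>. s \<noteq> (t::real)"
proof -
  have "{t} \<in> null_sets lebesgue" by auto
  then have "AE s in lebesgue. s \<notin> {t}" by (rule AE_not_in)
  then show ?thesis by (subst AE_restrict_space_iff) (auto elim: eventually_mono)
qed

lemma integrable_bounded_scaleR:
  fixes g :: "real \<Rightarrow> 'b::{banach, second_countable_topology}" and h :: "real \<Rightarrow> real"
  assumes "integrable M g" "h \<in> borel_measurable M" "\<And>s. s \<in> space M \<Longrightarrow> \<bar>h s\<bar> \<le> K"
  shows "integrable M (\<lambda>s. h s *\<^sub>R g s)"
proof (rule Bochner_Integration.integrable_bound)
  show "integrable M (\<lambda>s. K * norm (g s))" using assms(1) by auto
  show "(\<lambda>s. h s *\<^sub>R g s) \<in> borel_measurable M" using assms(1,2) by measurable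
  show "AE s in M. norm (h s *\<^sub>R g s) \<le> norm (K * norm (g s))"
    using assms(3) by (intro AE_I2) (smt (verit) mult_right_mono norm_ge_zero norm_scaleR real_norm_def)
qed

lemma indicator_Leb_measurable: "A \<in> sets borel \<Longrightarrow> (\<lambda>x. indicator A x :: real) \<in> borel_measurable (Leb \<mu>)"
proof -
  assume A: "A \<in> sets borel"
  have "(\<lambda>x. indicator A x :: real) \<in> borel_measurable borel" using A by measurable
  moreover have "(\<lambda>x. x) \<in> Leb \<mu> \<rightarrow>\<^sub>M borel" by (rule continuous_imp_measurable_Leb) auto
  ultimately show ?thesis by (rule measurable_compose[rotated])
qed

lemma indicator_atMost_measurable_Leb [measurable]:
  "(\<lambda>s. indicator {..t} s :: real) \<in> borel_measurable (Leb \<mu>)"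
  by (rule indicator_Leb_measurable) simp

lemma continuous_on_indefinite_integral:
  fixes G :: "real \<Rightarrow> 'b::{banach, second_countable_topology}"
  assumes G: "integrable (Leb \<mu>) G"
  shows "continuous_on UNIV (\<lambda>t. LINT s|Leb \<mu>. indicator {..t} s *\<^sub>R G s)"
  unfolding continuous_on_sequentially
proof (intro ballI allI impI)
  fix x :: "nat \<Rightarrow> real" and t assume x: "(\<forall>n. x n \<in> UNIV) \<and> x \<longlonglongrightarrow> t"
  show "((\<lambda>t. LINT s|Leb \<mu>. indicator {..t} s *\<^sub>R G s) \<circ> x) \<longlonglongrightarrow> (LINT s|Leb \<mu>. indicator {..t} s *\<^sub>R G s)"
    unfolding o_def
  proof (rule integral_dominated_convergence[where w = "\<lambda>s. norm (G s)"])
    show "AE s in Leb \<mu>. (\<lambda>n. indicator {..x n} s *\<^sub>R G s) \<longlonglongrightarrow> indicator {..t} s *\<^sub>R G s"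
      using AE_Leb_neq[of t]
    proof eventually_elim
      case (elim s)
      have "eventually (\<lambda>n. indicator {..x n} s *\<^sub>R G s = indicator {..t} s *\<^sub>R G s) sequentially"
      proof (cases "s < t")
        case True
        then have "eventually (\<lambda>n. s < x n) sequentially" using x by (intro order_tendstoD(1)[of x t]) auto
        then show ?thesis by eventually_elim (use True in auto)
      next
        case False
        then have "t < s" using elim by simp
        then have "eventually (\<lambda>n. x n < s) sequentially" using x by (intro order_tendstoD(2)[of x t]) auto
        then show ?thesis by eventually_elim (use False elim in auto)
      qed
      then show ?case by (rule tendsto_eventually)
    qed
    show "(\<lambda>s. indicator {..x n} s *\<^sub>R G s) \<in> borel_measurable (Leb \<mu>)" for n
      using G by measurable
    show "(\<lambda>s. indicator {..t} s *\<^sub>R G s) \<in> borel_measurable (Leb \<mu>)"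
      using G by measurable
  qed (use G in \<open>auto simp: indicator_def intro!: AE_I2\<close>)
qed

text \<open>
  Duhamel's integral for the equation with decay rate \<open>r\<close> and right-hand side \<open>g\<close>. With the
  exponential factored out, the dependence on \<open>t\<close> under the integral is an indicator function
  only, which suits continuity and integration by parts.
\<close>

definition duh :: "real \<Rightarrow> real \<Rightarrow> (real \<Rightarrow> 'b) \<Rightarrow> real \<Rightarrow> 'b::{banach, second_countable_topology}" where
  "duh \<mu> r g t = exp (- r * t) *\<^sub>R (LINT s|Leb \<mu>. indicator {..t} s *\<^sub>R (exp (r * s) *\<^sub>R g s))"

lemma integrable_exp_scaleR:
  fixes g :: "real \<Rightarrow> 'b::{banach, second_countable_topology}"
  assumes "integrable (Leb \<mu>) g"
  shows "integrable (Leb \<mu>) (\<lambda>s. exp (r * s) *\<^sub>R g s)"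
proof -
  have c: "continuous_on {0..\<mu>} (\<lambda>s. exp (r * s))" by (intro continuous_intros)
  then have "bounded ((\<lambda>s. exp (r * s)) ` {0..\<mu>})"
    by (intro compact_imp_bounded compact_continuous_image) auto
  then obtain K where "\<forall>y\<in>(\<lambda>s. exp (r * s)) ` {0..\<mu>}. norm y \<le> K" unfolding bounded_iff by blast
  then show ?thesis
    by (intro integrable_bounded_scaleR[where K = K] assms continuous_imp_measurable_Leb c) auto
qed

lemma integrable_duh:
  fixes g :: "real \<Rightarrow> 'b::{banach, second_countable_topology}"
  assumes "integrable (Leb \<mu>) g"
  shows "integrable (Leb \<mu>) (\<lambda>s. indicator {..t} s *\<^sub>R (exp (r * s) *\<^sub>R g s))"
  by (rule integrable_bounded_scaleR[where K = 1, OF integrable_exp_scaleR[OF assms] indicator_atMost_measurable_Leb])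
    (simp add: indicator_def)

lemma continuous_on_duh:
  assumes "integrable (Leb \<mu>) g"
  shows "continuous_on UNIV (duh \<mu> r g)"
  unfolding duh_def
  by (intro continuous_intros continuous_on_indefinite_integral integrable_exp_scaleR assms)

text \<open>An approximate identity: the rescaled derivatives of the smooth step.\<close>

lemma approximate_identity:
  assumes \<sigma>: "\<And>x. (step has_real_derivative \<sigma> x) (at x)" "continuous_on UNIV \<sigma>"
      "\<And>x. x \<notin> {0..1} \<Longrightarrow> \<sigma> x = 0" "\<And>x. \<bar>\<sigma> x\<bar> \<le> K"
    and A: "continuous_on {0..\<mu>} A" and s: "0 < s" "s < \<mu>"
  shows "(\<lambda>n. LINT x|Leb \<mu>. A x * (real n * \<sigma> (real n * x + (- real n * s)))) \<longlonglongrightarrow> A s"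
proof (rule LIMSEQ_I)
  fix e :: real assume e: "0 < e"
  have K: "0 \<le> K" using \<sigma>(4)[of 0] by simp
  define e' where "e' = e / (2 * (K + 1))"
  have e': "0 < e'" using e K by (simp add: e'_def)
  obtain d where d: "0 < d" "\<And>x. x \<in> {0..\<mu>} \<Longrightarrow> \<bar>x - s\<bar> < d \<Longrightarrow> \<bar>A x - A s\<bar> < e'"
  proof -
    have "s \<in> {0..\<mu>}" using s by simp
    then obtain d where "0 < d" "\<forall>x\<in>{0..\<mu>}. dist x s < d \<longrightarrow> dist (A x) (A s) < e'"
      using A e' unfolding continuous_on_iff by blast
    then show ?thesis using that by (simp add: dist_real_def)
  qed
  obtain N :: nat where "max (1 / d) (1 / (\<mu> - s)) < real N" using reals_Archimedean2 by blast
  then have N: "1 / d < real N" "1 / (\<mu> - s) < real N" by auto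
  { fix n :: nat assume n: "N \<le> n"
    have n1: "1 / d < real n" "1 / (\<mu> - s) < real n" using N n by linarith+
    have npos: "0 < real n" using n1(1) d(1) by (meson less_trans zero_less_divide_1_iff)
    define \<eta> where "\<eta> = (\<lambda>x. real n * \<sigma> (real n * x + (- real n * s)))"
    have c\<eta>: "continuous_on {0..\<mu>} \<eta>"
      unfolding \<eta>_def by (intro continuous_intros continuous_on_compose2[OF \<sigma>(2)]) auto
    have "(\<eta> has_integral step (real n * \<mu> + (- real n * s)) - step (real n * 0 + (- real n * s))) {0..\<mu>}"
    proof (rule fundamental_theorem_of_calculus)
      fix x assume "x \<in> {0..\<mu>}"
      have "((\<lambda>x. step (real n * x + (- real n * s))) has_real_derivative \<sigma> (real n * x + (- real n * s)) * real n) (at x)"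
        by (rule DERIV_chain2[OF \<sigma>(1)]) (auto intro!: derivative_eq_intros)
      then show "((\<lambda>x. step (real n * x + (- real n * s))) has_vector_derivative \<eta> x) (at x within {0..\<mu>})"
        unfolding \<eta>_def has_real_derivative_iff_has_vector_derivative[symmetric]
        by (simp add: mult.commute has_field_derivative_at_within)
    qed (use s in auto)
    moreover have "1 \<le> real n * \<mu> + (- real n * s)" using n1(2) s by (simp add: field_simps)
    moreover have "real n * 0 + (- real n * s) \<le> 0" using npos s by simp
    ultimately have "(\<eta> has_integral 1) {0..\<mu>}" by (simp add: step_0 step_1)
    then have I1: "(LINT x|Leb \<mu>. \<eta> x) = 1"
      using continuous_imp_integrable_Leb[OF c\<eta>] by (simp add: lebesgue_integral_eq_integral integral_unique)
    have i1: "integrable (Leb \<mu>) \<eta>" "integrable (Leb \<mu>) (\<lambda>x. A x * \<eta> x)"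
      by (intro continuous_imp_integrable_Leb continuous_intros c\<eta> A)+
    have "(LINT x|Leb \<mu>. A x * \<eta> x) - A s = (LINT x|Leb \<mu>. A x * \<eta> x - A s * \<eta> x)"
      using i1 I1 by (subst Bochner_Integration.integral_diff) auto
    also have "\<bar>\<dots>\<bar> \<le> (LINT x|Leb \<mu>. e' * (real n * K) * indicator {s..s + 1 / real n} x)"
    proof (rule order_trans[OF integral_norm_bound[where 'a = real, unfolded real_norm_def]])
      have ind: "integrable (Leb \<mu>) (\<lambda>x. indicator {s..s + 1 / real n} x :: real)"
      proof -
        interpret finite_measure "Leb \<mu>" by (rule finite_measure_Leb)
        have "(\<lambda>x. indicator {s..s + 1 / real n} x :: real) \<in> borel_measurable (Leb \<mu>)"
          by (rule indicator_Leb_measurable) simp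
        then show ?thesis
          by (intro integrable_const_bound[where B = 1]) (auto simp: indicator_def)
      qed
      show "(LINT x|Leb \<mu>. \<bar>A x * \<eta> x - A s * \<eta> x\<bar>) \<le> (LINT x|Leb \<mu>. e' * (real n * K) * indicator {s..s + 1 / real n} x)"
      proof (rule integral_mono)
        show "integrable (Leb \<mu>) (\<lambda>x. \<bar>A x * \<eta> x - A s * \<eta> x\<bar>)" using i1 by auto
        show "integrable (Leb \<mu>) (\<lambda>x. e' * (real n * K) * indicator {s..s + 1 / real n} x)"
          using ind by auto
        fix x assume x: "x \<in> space (Leb \<mu>)"
        show "\<bar>A x * \<eta> x - A s * \<eta> x\<bar> \<le> e' * (real n * K) * indicator {s..s + 1 / real n} x"
        proof (cases "x \<in> {s..s + 1 / real n}")
          case True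
          then have "\<bar>x - s\<bar> \<le> 1 / real n" by auto
          also have "1 / real n < d" using n1(1) npos d(1) by (simp add: field_simps)
          finally have "\<bar>A x - A s\<bar> \<le> e'" using d(2)[of x] x by simp
          moreover have "\<bar>\<eta> x\<bar> \<le> real n * K" unfolding \<eta>_def abs_mult by (intro mult_mono \<sigma>(4)) auto
          ultimately have "\<bar>A x - A s\<bar> * \<bar>\<eta> x\<bar> \<le> e' * (real n * K)" using e' by (intro mult_mono) auto
          then show ?thesis using True by (simp add: abs_mult[symmetric] left_diff_distrib)
        next
          case False
          have "real n * x + (- real n * s) \<notin> {0..1}"
          proof
            assume "real n * x + (- real n * s) \<in> {0..1}"
            then have "0 \<le> real n * (x - s)" "real n * (x - s) \<le> 1" by (auto simp: algebra_simps)
            then have "0 \<le> x - s" "x - s \<le> 1 / real n" using npos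
              by (auto simp: zero_le_mult_iff field_simps)
            with False show False by auto
          qed
          then show ?thesis using False by (simp add: \<eta>_def \<sigma>(3))
        qed
      qed
    qed
    also have "\<dots> \<le> e' * (real n * K) * (1 / real n)"
    proof -
      have "(LINT x|Leb \<mu>. indicator {s..s + 1 / real n} x :: real) = measure lebesgue ({s..s + 1 / real n} \<inter> {0..\<mu>})"
        by (subst integral_restrict_space) (auto simp: indicator_inter_arith[symmetric] mult.commute)
      also have "\<dots> \<le> measure lebesgue {s..s + 1 / real n}"
        by (rule measure_mono_fmeasurable) auto
      also have "\<dots> = 1 / real n" using npos by simp
      finally have "e' * (real n * K) * (LINT x|Leb \<mu>. indicator {s..s + 1 / real n} x) \<le> e' * (real n * K) * (1 / real n)"
        using e' K by (intro mult_left_mono) auto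
      then show ?thesis unfolding integral_mult_right_zero .
    qed
    also have "\<dots> = e' * K" using npos by simp
    also have "\<dots> < e" using e K by (simp add: e'_def field_simps add_nonneg_pos)
    finally have "norm ((LINT x|Leb \<mu>. A x * \<eta> x) - A s) < e" by simp
    then have "norm ((LINT x|Leb \<mu>. A x * (real n * \<sigma> (real n * x + (- real n * s)))) - A s) < e"
      unfolding \<eta>_def . }
  then show "\<exists>N. \<forall>n\<ge>N. norm ((LINT x|Leb \<mu>. A x * (real n * \<sigma> (real n * x + (- real n * s)))) - A s) < e" by blast
qed

lemma deriv_has_derivative_test_function:
  assumes "test_function \<mu> \<phi>"
  shows "(\<phi> has_real_derivative deriv \<phi> t) (at t)" "continuous_on UNIV (deriv \<phi>)"
proof -
  have d: "((deriv ^^ n) \<phi>) differentiable (at t)" for n t using assms by (simp add: test_function_def)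
  show "(\<phi> has_real_derivative deriv \<phi> t) (at t)"
    using d[of 0 t] by (simp add: DERIV_deriv_iff_real_differentiable)
  have "(deriv \<phi>) differentiable (at t)" for t using d[of 1 t] by simp
  then show "continuous_on UNIV (deriv \<phi>)"
    by (intro differentiable_imp_continuous_on) (simp add: differentiable_on_def)
qed

lemma test_function_boundary:
  assumes "test_function \<mu> \<phi>"
  shows "\<phi> 0 = 0" "\<phi> \<mu> = 0"
  using assms by (auto simp: test_function_def)

text \<open>
  Testing with a product of the integrating factor and a smooth approximation of an indicator
  function turns the distributional equation into Duhamel's formula.
\<close>

theorem weak_imp_duhamel:
  fixes a g :: "real \<Rightarrow> real"
  assumes \<mu>: "0 < \<mu>" and a: "continuous_on {0..\<mu>} a" and g: "integrable (Leb \<mu>) g"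
    and weak: "\<And>\<phi>. test_function \<mu> \<phi> \<Longrightarrow>
      (LINT t|Leb \<mu>. - a t * deriv \<phi> t + (r * a t - g t) * \<phi> t) = 0"
    and t: "t \<in> {0..\<mu>}"
  shows "a t = exp (- r * t) * a 0 + duh \<mu> r g t"
proof -
  obtain \<sigma> K where \<sigma>: "\<And>x. (step has_real_derivative \<sigma> x) (at x)" "continuous_on UNIV \<sigma>"
    "\<And>x. x \<notin> {0..1} \<Longrightarrow> \<sigma> x = 0" "\<And>x. \<bar>\<sigma> x\<bar> \<le> K" "0 < K"
    by (rule step_derivative) (rule that)
  define A where "A = (\<lambda>t. exp (r * t) * a t)"
  define G where "G = (\<lambda>t. exp (r * t) * g t)"
  have A: "continuous_on {0..\<mu>} A" unfolding A_def by (intro continuous_intros a)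
  have G: "integrable (Leb \<mu>) G" using integrable_exp_scaleR[OF g, of r] by (simp add: G_def)
  define I where "I = (\<lambda>t. LINT s|Leb \<mu>. indicator {..t} s *\<^sub>R G s)"
  have I: "continuous_on UNIV I" unfolding I_def by (rule continuous_on_indefinite_integral[OF G])
  have iI: "integrable (Leb \<mu>) (\<lambda>s. indicator {..t} s *\<^sub>R G s)" for t
    by (rule integrable_bounded_scaleR[where K = 1, OF G indicator_atMost_measurable_Leb]) (simp add: indicator_def)
  define \<eta> where "\<eta> = (\<lambda>s n x. real n * \<sigma> (real n * x + (- real n * s)))"
  define \<zeta> where "\<zeta> = (\<lambda>s n x. step (real n * x + (- real n * s)))"
  have d\<zeta>: "(\<zeta> s n has_real_derivative \<eta> s n x) (at x)" for s n x
  proof -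
    have "((\<lambda>x. real n * x + (- real n * s)) has_real_derivative real n) (at x)"
      by (auto intro!: derivative_eq_intros)
    from DERIV_chain2[OF \<sigma>(1) this] show ?thesis
      unfolding \<zeta>_def \<eta>_def by (simp add: mult.commute)
  qed
  have c\<zeta>: "continuous_on S (\<zeta> s n)" for s n S
    using d\<zeta> by (intro DERIV_continuous_on) (auto intro: has_field_derivative_at_within)
  have c\<eta>: "continuous_on S (\<eta> s n)" for s n S
    unfolding \<eta>_def by (intro continuous_intros continuous_on_compose2[OF \<sigma>(2)]) auto
  have iA: "integrable (Leb \<mu>) (\<lambda>x. A x * \<eta> s n x)" for s n
    by (intro continuous_imp_integrable_Leb continuous_intros A c\<eta>)
  have mG: "(\<lambda>x. \<zeta> s n x) \<in> borel_measurable (Leb \<mu>)" for s n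
    by (intro continuous_imp_measurable_Leb c\<zeta>)
  have iG: "integrable (Leb \<mu>) (\<lambda>x. G x * \<zeta> s n x)" for s n
    using integrable_bounded_scaleR[where K = 1, OF G mG] step_bounds
    by (simp add: \<zeta>_def mult.commute)
  have limG: "(\<lambda>n. LINT x|Leb \<mu>. G x * \<zeta> s n x) \<longlonglongrightarrow> (LINT x|Leb \<mu>. G x) - I s" for s
  proof -
    have "(\<lambda>n. LINT x|Leb \<mu>. G x * \<zeta> s n x) \<longlonglongrightarrow> (LINT x|Leb \<mu>. G x - indicator {..s} x *\<^sub>R G x)"
    proof (rule integral_dominated_convergence[where w = "\<lambda>x. norm (G x)"])
      show "AE x in Leb \<mu>. (\<lambda>n. G x * \<zeta> s n x) \<longlonglongrightarrow> G x - indicator {..s} x *\<^sub>R G x"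
      proof (rule AE_I2)
        fix x
        have "eventually (\<lambda>n. G x * \<zeta> s n x = G x - indicator {..s} x *\<^sub>R G x) sequentially"
        proof (cases "x \<le> s")
          case True
          have "\<zeta> s n x = 0" for n
            unfolding \<zeta>_def using True by (intro step_0) (simp add: mult_left_mono)
          then show ?thesis using True by simp
        next
          case False
          obtain N :: nat where N: "1 / (x - s) < real N" using reals_Archimedean2 by blast
          have "\<zeta> s n x = 1" if "N \<le> n" for n
          proof -
            have "1 / (x - s) < real n" using N that by (meson less_le_trans of_nat_le_iff)
            then have "1 \<le> real n * x + (- real n * s)" using False by (simp add: field_simps)
            then show ?thesis unfolding \<zeta>_def by (rule step_1)
          qed
          then show ?thesis using False by (auto simp: eventually_sequentially)
        qed
        then show "(\<lambda>n. G x * \<zeta> s n x) \<longlonglongrightarrow> G x - indicator {..s} x *\<^sub>R G x" by (rule tendsto_eventually)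
      qed
      show "AE x in Leb \<mu>. norm (G x * \<zeta> s n x) \<le> norm (G x)" for n
        using step_bounds by (intro AE_I2) (simp add: abs_mult \<zeta>_def mult_left_le)
    qed (use G iG iI in \<open>auto intro: borel_measurable_integrable\<close>)
    also have "(LINT x|Leb \<mu>. G x - indicator {..s} x *\<^sub>R G x) = (LINT x|Leb \<mu>. G x) - I s"
      unfolding I_def by (rule Bochner_Integration.integral_diff[OF G iI])
    finally show ?thesis .
  qed
  have key: "A t - A s = I t - I s" if st: "0 < s" "s < t" "t < \<mu>" for s t
  proof -
    have ev: "eventually (\<lambda>n. (LINT x|Leb \<mu>. A x * \<eta> s n x) - (LINT x|Leb \<mu>. A x * \<eta> t n x)
        + ((LINT x|Leb \<mu>. G x * \<zeta> s n x) - (LINT x|Leb \<mu>. G x * \<zeta> t n x)) = 0) sequentially"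
    proof -
      obtain N :: nat where N: "1 / (\<mu> - t) < real N" using reals_Archimedean2 by blast
      have "(LINT x|Leb \<mu>. A x * \<eta> s n x) - (LINT x|Leb \<mu>. A x * \<eta> t n x)
        + ((LINT x|Leb \<mu>. G x * \<zeta> s n x) - (LINT x|Leb \<mu>. G x * \<zeta> t n x)) = 0" if n: "N \<le> n" for n
      proof -
        have n1: "1 / (\<mu> - t) < real n" using N n by (meson less_le_trans of_nat_le_iff)
        then have npos: "0 < real n" using st by (meson diff_gt_0_iff_gt less_trans zero_less_divide_1_iff)
        have inv: "t + 1 / real n < \<mu>" using n1 npos st by (simp add: field_simps)
        \<comment> \<open>Two steps of width \<open>1 / n\<close>, beginning at \<open>s\<close> and at \<open>t\<close>, form a smooth bump over \<open>{s..t}\<close>; its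
          support lies inside the open time interval once \<open>t + 1 / n < \<mu>\<close>.\<close>
        define \<phi> where "\<phi> = (\<lambda>x. exp (r * x) * (\<zeta> s n x + (- 1) * \<zeta> t n x))"
        have sm: "smooth_gen \<phi>"
          unfolding \<phi>_def \<zeta>_def by (intro smooth_gen.mult smooth_gen.exp smooth_gen.add smooth_gen.const smooth_gen_step)
        have z: "\<phi> x = 0" if x: "x \<notin> {s..t + 1 / real n}" for x
        proof (cases "x < s")
          case True
          then have "real n * x + (- real n * s) \<le> 0" "real n * x + (- real n * t) \<le> 0"
            using npos st by (auto simp: mult_left_mono)
          then show ?thesis by (simp add: \<phi>_def \<zeta>_def step_0)
        next
          case False
          then have "1 \<le> real n * (x - t)" using x npos by (simp add: field_simps)
          moreover have "real n * (x - t) \<le> real n * (x - s)" using npos st by (intro mult_left_mono) auto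
          ultimately have "1 \<le> real n * x + (- real n * s)" "1 \<le> real n * x + (- real n * t)"
            by (auto simp: algebra_simps)
          then show ?thesis by (simp add: \<phi>_def \<zeta>_def step_1)
        qed
        have tf: "test_function \<mu> \<phi>" by (rule test_function_if_smooth_gen[OF sm st(1) inv z])
        have d: "deriv \<phi> x = exp (r * x) * (\<eta> s n x - \<eta> t n x) + r * \<phi> x" for x
          unfolding \<phi>_def by (rule DERIV_imp_deriv) (auto intro!: derivative_eq_intros d\<zeta> simp: algebra_simps)
        have "- a x * deriv \<phi> x + (r * a x - g x) * \<phi> x
          = - ((A x * \<eta> s n x - A x * \<eta> t n x) + (G x * \<zeta> s n x - G x * \<zeta> t n x))" for x
          unfolding d by (simp add: A_def G_def \<phi>_def algebra_simps)
        then have "(LINT x|Leb \<mu>. - ((A x * \<eta> s n x - A x * \<eta> t n x) + (G x * \<zeta> s n x - G x * \<zeta> t n x))) = 0"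
          using weak[OF tf] by simp
        then show ?thesis using iA iG by simp
      qed
      then show ?thesis by (auto simp: eventually_sequentially)
    qed
    have "(\<lambda>n. (LINT x|Leb \<mu>. A x * \<eta> s n x) - (LINT x|Leb \<mu>. A x * \<eta> t n x)
        + ((LINT x|Leb \<mu>. G x * \<zeta> s n x) - (LINT x|Leb \<mu>. G x * \<zeta> t n x)))
      \<longlonglongrightarrow> A s - A t + (((LINT x|Leb \<mu>. G x) - I s) - ((LINT x|Leb \<mu>. G x) - I t))"
      unfolding \<eta>_def using st
      by (intro tendsto_intros limG approximate_identity[OF \<sigma>(1-4) A]) auto
    moreover have "(\<lambda>n. (LINT x|Leb \<mu>. A x * \<eta> s n x) - (LINT x|Leb \<mu>. A x * \<eta> t n x)
        + ((LINT x|Leb \<mu>. G x * \<zeta> s n x) - (LINT x|Leb \<mu>. G x * \<zeta> t n x))) \<longlonglongrightarrow> 0"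
      by (rule tendsto_eventually[OF ev])
    ultimately show ?thesis by (auto dest: LIMSEQ_unique)
  qed
  define c where "c = A (\<mu> / 2) - I (\<mu> / 2)"
  have cc: "A x - I x = c" if "x \<in> closure {0<..<\<mu>}" for x
  proof (rule continuous_constant_on_closure[OF _ _ that])
    show "continuous_on (closure {0<..<\<mu>}) (\<lambda>x. A x - I x)"
      using \<mu> by (simp add: closure_greaterThanLessThan) (intro continuous_intros A continuous_on_subset[OF I], auto)
    fix x assume x: "x \<in> {0<..<\<mu>}"
    show "A x - I x = c"
      using key[of x "\<mu> / 2"] key[of "\<mu> / 2" x] x \<mu> unfolding c_def
      by (cases x "\<mu> / 2" rule: linorder_cases) auto
  qed
  have "A t - I t = A 0 - I 0" using cc[of t] cc[of 0] t \<mu> by (simp add: closure_greaterThanLessThan)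
  moreover have "I 0 = 0"
  proof -
    have "I 0 = (LINT s|Leb \<mu>. 0)" unfolding I_def
    proof (rule integral_cong_AE)
      show "AE s in Leb \<mu>. indicator {..0} s *\<^sub>R G s = 0"
      proof -
        have "AE s in Leb \<mu>. s \<in> space (Leb \<mu>)" by (rule AE_space)
        with AE_Leb_neq[of 0] show ?thesis by eventually_elim auto
      qed
    qed (use iI[of 0] in auto)
    then show ?thesis by simp
  qed
  ultimately have e: "exp (r * t) * a t = a 0 + I t" by (simp add: A_def)
  have "a t = exp (- r * t) * (exp (r * t) * a t)" by (simp add: exp_minus)
  also have "\<dots> = exp (- r * t) * a 0 + duh \<mu> r g t"
    unfolding e by (simp add: duh_def I_def G_def distrib_left)
  finally show ?thesis .
qed

text \<open>Conversely, Duhamel's formula is tested by exchanging the order of integration.\<close>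

lemma integral_indefinite_by_parts:
  fixes G \<zeta> \<zeta>' :: "real \<Rightarrow> real"
  assumes G: "integrable (Leb \<mu>) G" and \<mu>: "0 < \<mu>"
    and \<zeta>: "\<And>t. (\<zeta> has_real_derivative \<zeta>' t) (at t)" "continuous_on UNIV \<zeta>'"
  shows "(LINT t|Leb \<mu>. (LINT s|Leb \<mu>. indicator {..t} s * G s) * \<zeta>' t) = (LINT s|Leb \<mu>. G s * (\<zeta> \<mu> - \<zeta> s))"
proof -
  interpret M: finite_measure "Leb \<mu>" by (rule finite_measure_Leb)
  interpret P: pair_sigma_finite "Leb \<mu>" "Leb \<mu>" ..
  have id: "(\<lambda>s. s) \<in> borel_measurable (Leb \<mu>)" by (rule continuous_imp_measurable_Leb) auto
  have mG: "G \<in> borel_measurable (Leb \<mu>)" using G by auto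
  have c': "continuous_on {0..\<mu>} \<zeta>'" by (rule continuous_on_subset[OF \<zeta>(2)]) auto
  have m\<zeta>: "\<zeta>' \<in> borel_measurable (Leb \<mu>)" by (rule continuous_imp_measurable_Leb[OF c'])
  have i\<zeta>: "integrable (Leb \<mu>) \<zeta>'" by (rule continuous_imp_integrable_Leb[OF c'])
  have mi: "(\<lambda>(s, t). indicator {..t} s :: real) \<in> borel_measurable (Leb \<mu> \<Otimes>\<^sub>M Leb \<mu>)"
  proof -
    have [measurable]: "fst \<in> borel_measurable (Leb \<mu> \<Otimes>\<^sub>M Leb \<mu>)" "snd \<in> borel_measurable (Leb \<mu> \<Otimes>\<^sub>M Leb \<mu>)"
      using measurable_compose[OF measurable_fst id] measurable_compose[OF measurable_snd id] by auto
    have "(\<lambda>x. if fst x \<le> snd x then 1 else 0 :: real) \<in> borel_measurable (Leb \<mu> \<Otimes>\<^sub>M Leb \<mu>)" by measurable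
    then show ?thesis by (simp add: case_prod_unfold indicator_def)
  qed
  define F where "F = (\<lambda>(s, t). indicator {..t} s * G s * \<zeta>' t)"
  have prod: "integrable (Leb \<mu> \<Otimes>\<^sub>M Leb \<mu>) (\<lambda>(s, t). G s * \<zeta>' t)"
  proof (rule P.Fubini_integrable)
    show "(\<lambda>(s, t). G s * \<zeta>' t) \<in> borel_measurable (Leb \<mu> \<Otimes>\<^sub>M Leb \<mu>)"
      using mG m\<zeta> by measurable
    show "integrable (Leb \<mu>) (\<lambda>x. LINT y|Leb \<mu>. norm (case (x, y) of (s, t) \<Rightarrow> G s * \<zeta>' t))"
      using G by (simp add: abs_mult)
    show "AE x in Leb \<mu>. integrable (Leb \<mu>) (\<lambda>y. case (x, y) of (s, t) \<Rightarrow> G s * \<zeta>' t)"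
      using i\<zeta> by (intro AE_I2) auto
  qed
  have F: "integrable (Leb \<mu> \<Otimes>\<^sub>M Leb \<mu>) F"
  proof (rule Bochner_Integration.integrable_bound[OF prod])
    show "F \<in> borel_measurable (Leb \<mu> \<Otimes>\<^sub>M Leb \<mu>)"
      using mi mG m\<zeta> unfolding F_def by measurable
  qed (auto simp: F_def indicator_def)
  have "(LINT t|Leb \<mu>. LINT s|Leb \<mu>. F (s, t)) = (LINT s|Leb \<mu>. LINT t|Leb \<mu>. F (s, t))"
    using P.Fubini_integral[of "\<lambda>s t. F (s, t)"] F by simp
  also have "\<dots> = (LINT s|Leb \<mu>. G s * (\<zeta> \<mu> - \<zeta> s))"
  proof (rule Bochner_Integration.integral_cong[OF refl])
    fix s assume s: "s \<in> space (Leb \<mu>)"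
    have "(\<zeta>' has_integral \<zeta> \<mu> - \<zeta> s) {s..\<mu>}"
      using \<zeta>(1) s by (intro fundamental_theorem_of_calculus)
        (auto simp: has_real_derivative_iff_has_vector_derivative[symmetric] intro: has_field_derivative_at_within)
    then have 1: "((\<lambda>t. if t \<in> {s..\<mu>} then \<zeta>' t else 0) has_integral \<zeta> \<mu> - \<zeta> s) {0..\<mu>}"
      using s by (subst has_integral_restrict) auto
    have 2: "integrable (Leb \<mu>) (\<lambda>t. if t \<in> {s..\<mu>} then \<zeta>' t else 0)"
    proof (rule Bochner_Integration.integrable_bound[OF i\<zeta>])
      have "(\<lambda>t. if s \<le> t then \<zeta>' t else 0) \<in> borel_measurable (Leb \<mu>)" 
        using id m\<zeta> by measurable
      moreover have "(\<lambda>t. if s \<le> t then \<zeta>' t else 0) \<in> borel_measurable (Leb \<mu>) \<longleftrightarrow>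
          (\<lambda>t. if t \<in> {s..\<mu>} then \<zeta>' t else 0) \<in> borel_measurable (Leb \<mu>)"
        by (rule measurable_cong) auto
      ultimately show "(\<lambda>t. if t \<in> {s..\<mu>} then \<zeta>' t else 0) \<in> borel_measurable (Leb \<mu>)" by simp
    qed (auto intro!: AE_I2)
    have "(LINT t|Leb \<mu>. F (s, t)) = (LINT t|Leb \<mu>. G s * (if t \<in> {s..\<mu>} then \<zeta>' t else 0))"
      by (rule Bochner_Integration.integral_cong[OF refl]) (auto simp: F_def indicator_def)
    also have "\<dots> = G s * (LINT t|Leb \<mu>. (if t \<in> {s..\<mu>} then \<zeta>' t else 0))" by simp
    also have "(LINT t|Leb \<mu>. (if t \<in> {s..\<mu>} then \<zeta>' t else 0)) = \<zeta> \<mu> - \<zeta> s"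
      using lebesgue_integral_eq_integral[OF 2] integral_unique[OF 1] by simp
    finally show "(LINT t|Leb \<mu>. F (s, t)) = G s * (\<zeta> \<mu> - \<zeta> s)" .
  qed
  finally show ?thesis by (simp add: F_def)
qed

theorem duhamel_imp_weak:
  fixes a g :: "real \<Rightarrow> real"
  assumes \<mu>: "0 < \<mu>" and g: "integrable (Leb \<mu>) g"
    and a: "\<And>t. t \<in> {0..\<mu>} \<Longrightarrow> a t = exp (- r * t) * a0 + duh \<mu> r g t"
    and \<phi>: "test_function \<mu> \<phi>"
  shows "(LINT t|Leb \<mu>. - a t * deriv \<phi> t + (r * a t - g t) * \<phi> t) = 0"
proof -
  define G where "G = (\<lambda>t. exp (r * t) * g t)"
  have G: "integrable (Leb \<mu>) G" using integrable_exp_scaleR[OF g, of r] by (simp add: G_def)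
  define I where "I = (\<lambda>t. LINT s|Leb \<mu>. indicator {..t} s * G s)"
  have I: "continuous_on UNIV I" unfolding I_def using continuous_on_indefinite_integral[OF G] by simp
  define \<zeta> where "\<zeta> = (\<lambda>t. exp (- r * t) * \<phi> t)"
  define \<zeta>' where "\<zeta>' = (\<lambda>t. exp (- r * t) * (deriv \<phi> t - r * \<phi> t))"
  note d\<phi> = deriv_has_derivative_test_function[OF \<phi>]
  have c\<phi>: "continuous_on UNIV \<phi>"
    using d\<phi>(1) by (intro DERIV_continuous_on) (auto intro: has_field_derivative_at_within)
  have d\<zeta>: "(\<zeta> has_real_derivative \<zeta>' t) (at t)" for t
    unfolding \<zeta>_def \<zeta>'_def by (auto intro!: derivative_eq_intros d\<phi>(1) simp: algebra_simps)
  have c\<zeta>: "continuous_on UNIV \<zeta>" "continuous_on UNIV \<zeta>'"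
    unfolding \<zeta>_def \<zeta>'_def by (intro continuous_intros c\<phi> d\<phi>(2))+
  have z: "\<zeta> 0 = 0" "\<zeta> \<mu> = 0" using test_function_boundary[OF \<phi>] by (auto simp: \<zeta>_def)
  have i1: "integrable (Leb \<mu>) (\<lambda>t. a0 * \<zeta>' t)" "integrable (Leb \<mu>) (\<lambda>t. I t * \<zeta>' t)"
    by (intro continuous_imp_integrable_Leb continuous_intros continuous_on_subset[OF c\<zeta>(2)] continuous_on_subset[OF I], auto)+
  obtain K where K: "\<forall>y\<in>\<zeta> ` {0..\<mu>}. norm y \<le> K"
  proof -
    have "bounded (\<zeta> ` {0..\<mu>})"
      by (intro compact_imp_bounded compact_continuous_image continuous_on_subset[OF c\<zeta>(1)]) auto
    then show ?thesis using that unfolding bounded_iff by blast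
  qed
  have i2: "integrable (Leb \<mu>) (\<lambda>t. G t * \<zeta> t)"
    using integrable_bounded_scaleR[where K = K, OF G continuous_imp_measurable_Leb[OF continuous_on_subset[OF c\<zeta>(1)]]] K
    by (auto simp: mult.commute)
  have "(LINT t|Leb \<mu>. a0 * \<zeta>' t) = a0 * (\<zeta> \<mu> - \<zeta> 0)"
  proof -
    have "(\<zeta>' has_integral \<zeta> \<mu> - \<zeta> 0) {0..\<mu>}"
      using d\<zeta> \<mu> by (intro fundamental_theorem_of_calculus)
        (auto simp: has_real_derivative_iff_has_vector_derivative[symmetric] intro: has_field_derivative_at_within)
    moreover have "integrable (Leb \<mu>) \<zeta>'" by (intro continuous_imp_integrable_Leb continuous_on_subset[OF c\<zeta>(2)]) auto
    ultimately show ?thesis by (simp add: lebesgue_integral_eq_integral integral_unique)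
  qed
  then have e1: "(LINT t|Leb \<mu>. a0 * \<zeta>' t) = 0" using z by simp
  have e2: "(LINT t|Leb \<mu>. I t * \<zeta>' t) = - (LINT s|Leb \<mu>. G s * \<zeta> s)"
    using integral_indefinite_by_parts[OF G \<mu> d\<zeta> c\<zeta>(2)] by (simp add: I_def z)
  have "(LINT t|Leb \<mu>. - a t * deriv \<phi> t + (r * a t - g t) * \<phi> t)
      = (LINT t|Leb \<mu>. - (a0 * \<zeta>' t + I t * \<zeta>' t + G t * \<zeta> t))"
  proof (rule Bochner_Integration.integral_cong[OF refl])
    fix t assume t: "t \<in> space (Leb \<mu>)"
    have "a t = exp (- r * t) * (a0 + I t)"
      using a[of t] t by (simp add: duh_def I_def G_def distrib_left)
    moreover have "G t * \<zeta> t = g t * \<phi> t"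
      by (simp add: G_def \<zeta>_def exp_minus)
    ultimately show "- a t * deriv \<phi> t + (r * a t - g t) * \<phi> t = - (a0 * \<zeta>' t + I t * \<zeta>' t + G t * \<zeta> t)"
      by (simp add: \<zeta>'_def algebra_simps)
  qed
  also have "\<dots> = - ((LINT t|Leb \<mu>. a0 * \<zeta>' t) + (LINT t|Leb \<mu>. I t * \<zeta>' t) + (LINT t|Leb \<mu>. G t * \<zeta> t))"
    using i1 i2 by simp
  also have "\<dots> = 0" using e1 e2 by simp
  finally show ?thesis .
qed

section \<open>Estimates for Duhamel's formula\<close>

lemma
  fixes f h :: "'a \<Rightarrow> real"
  assumes m: "f \<in> borel_measurable M" "h \<in> borel_measurable M"
    and f: "integrable M (\<lambda>x. (f x)\<^sup>2)" and h: "integrable M (\<lambda>x. (h x)\<^sup>2)"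
  shows integrable_mult_if_square_integrable: "integrable M (\<lambda>x. \<bar>f x * h x\<bar>)"
    and Cauchy_Schwarz_LINT: "(LINT x|M. \<bar>f x * h x\<bar>)\<^sup>2 \<le> (LINT x|M. (f x)\<^sup>2) * (LINT x|M. (h x)\<^sup>2)"
proof -
  show i: "integrable M (\<lambda>x. \<bar>f x * h x\<bar>)"
  proof (rule Bochner_Integration.integrable_bound)
    show "integrable M (\<lambda>x. (f x)\<^sup>2 + (h x)\<^sup>2)" using f h by simp
    show "(\<lambda>x. \<bar>f x * h x\<bar>) \<in> borel_measurable M" using m by measurable
    have "\<bar>a * b\<bar> \<le> a\<^sup>2 + b\<^sup>2" for a b :: real
      using sum_squares_bound[of "\<bar>a\<bar>" "\<bar>b\<bar>"] mult_nonneg_nonneg[of "\<bar>a\<bar>" "\<bar>b\<bar>"]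
      unfolding abs_mult power2_abs by linarith
    then show "AE x in M. norm \<bar>f x * h x\<bar> \<le> norm ((f x)\<^sup>2 + (h x)\<^sup>2)" by (intro AE_I2) simp
  qed
  define A where "A = (LINT x|M. (f x)\<^sup>2)"
  define B where "B = (LINT x|M. (h x)\<^sup>2)"
  define X where "X = (LINT x|M. \<bar>f x * h x\<bar>)"
  have q: "0 \<le> A - 2 * c * X + c\<^sup>2 * B" for c
  proof -
    have "0 \<le> (LINT x|M. (\<bar>f x\<bar> - c * \<bar>h x\<bar>)\<^sup>2)" by simp
    also have "(LINT x|M. (\<bar>f x\<bar> - c * \<bar>h x\<bar>)\<^sup>2) = (LINT x|M. (f x)\<^sup>2 - 2 * c * \<bar>f x * h x\<bar> + c\<^sup>2 * (h x)\<^sup>2)"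
      by (rule Bochner_Integration.integral_cong[OF refl])
        (simp add: power2_diff power_mult_distrib abs_mult)
    also have "\<dots> = A - 2 * c * X + c\<^sup>2 * B"
      using f h i by (simp add: A_def B_def X_def)
    finally show ?thesis .
  qed
  have X: "0 \<le> X" and B: "0 \<le> B" and A: "0 \<le> A" by (simp_all add: X_def B_def A_def)
  show "X\<^sup>2 \<le> A * B"
  proof (cases "B = 0")
    case True
    have "X = 0"
    proof (rule ccontr)
      assume "X \<noteq> 0"
      then show False using q[of "(A + 1) / (2 * X)"] True by simp
    qed
    then show ?thesis using True by simp
  next
    case False
    then have "0 < B" using B by simp
    have "0 \<le> A - 2 * (X / B) * X + (X / B)\<^sup>2 * B" by (rule q)
    also have "\<dots> = A - X\<^sup>2 / B" using \<open>0 < B\<close> by (simp add: power2_eq_square field_simps)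
    finally show ?thesis using \<open>0 < B\<close> by (simp add: field_simps)
  qed
qed

lemma integral_indicator_FTC:
  fixes F f :: "real \<Rightarrow> real"
  assumes ab: "0 \<le> a" "a \<le> b" "b \<le> \<mu>"
    and F: "\<And>x. (F has_real_derivative f x) (at x)" and f: "continuous_on UNIV f"
  shows "integrable (Leb \<mu>) (\<lambda>x. indicator {a..b} x * f x)"
    and "(LINT x|Leb \<mu>. indicator {a..b} x * f x) = F b - F a"
proof -
  show i: "integrable (Leb \<mu>) (\<lambda>x. indicator {a..b} x * f x)"
    using integrable_bounded_scaleR[where K = 1, OF continuous_imp_integrable_Leb[OF continuous_on_subset[OF f]]
        indicator_Leb_measurable[of "{a..b}"]] by (simp add: indicator_def)
  have "(f has_integral F b - F a) {a..b}"
    using F ab by (intro fundamental_theorem_of_calculus)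
      (auto simp: has_real_derivative_iff_has_vector_derivative[symmetric] intro: has_field_derivative_at_within)
  then have "((\<lambda>x. if x \<in> {a..b} then f x else 0) has_integral F b - F a) {0..\<mu>}"
    using ab by (subst has_integral_restrict) auto
  moreover have "(\<lambda>x. if x \<in> {a..b} then f x else 0) = (\<lambda>x. indicator {a..b} x * f x)" by auto
  ultimately show "(LINT x|Leb \<mu>. indicator {a..b} x * f x) = F b - F a"
    using lebesgue_integral_eq_integral[OF i] by (simp add: integral_unique)
qed

text \<open>
  The kernel of Duhamel's formula. Both of its marginal integrals are at most \<open>1 / r\<close>, and its
  square is the kernel of twice the rate.
\<close>

definition heat :: "real \<Rightarrow> real \<Rightarrow> real \<Rightarrow> real" where
  "heat r t s = indicator {..t} s * exp (- r * (t - s))"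

lemma heat_nonneg [simp]: "0 \<le> heat r t s" by (simp add: heat_def)

lemma heat_le_1: "0 < r \<Longrightarrow> heat r t s \<le> 1"
  by (auto simp: heat_def indicator_def)

lemma heat_power2: "(heat r t s)\<^sup>2 = heat (2 * r) t s"
  by (auto simp: heat_def power_mult_distrib exp_double[symmetric] indicator_def algebra_simps)

lemma
  assumes r: "0 < r" and t: "t \<in> {0..\<mu>}"
  shows integrable_heat_left: "integrable (Leb \<mu>) (\<lambda>s. heat r t s)"
    and integral_heat_left: "(LINT s|Leb \<mu>. heat r t s) \<le> 1 / r"
proof -
  have F: "((\<lambda>s. exp (- r * (t - s)) / r) has_real_derivative exp (- r * (t - x))) (at x)" for x
    using r by (auto intro!: derivative_eq_intros)
  have c: "continuous_on UNIV (\<lambda>x. exp (- r * (t - x)))" by (intro continuous_intros)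
  have e: "heat r t s = indicator {0..t} s * exp (- r * (t - s))" if "s \<in> space (Leb \<mu>)" for s
    using that by (auto simp: heat_def indicator_def)
  have "0 \<le> (0::real)" "0 \<le> t" "t \<le> \<mu>" using t by auto
  note * = integral_indicator_FTC[OF this F c]
  show "integrable (Leb \<mu>) (\<lambda>s. heat r t s)"
    using *(1) by (subst Bochner_Integration.integrable_cong[OF refl e]) auto
  have "(LINT s|Leb \<mu>. heat r t s) = (LINT s|Leb \<mu>. indicator {0..t} s * exp (- r * (t - s)))"
    by (rule Bochner_Integration.integral_cong[OF refl e])
  also have "\<dots> \<le> 1 / r" unfolding *(2) using r by (simp add: diff_divide_distrib[symmetric] divide_right_mono)
  finally show "(LINT s|Leb \<mu>. heat r t s) \<le> 1 / r" .
qed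

lemma integral_heat_right:
  assumes r: "0 < r" and s: "s \<in> {0..\<mu>}"
  shows "(LINT t|Leb \<mu>. heat r t s) \<le> 1 / r"
proof -
  have F: "((\<lambda>t. - exp (- r * (t - s)) / r) has_real_derivative exp (- r * (x - s))) (at x)" for x
    using r by (auto intro!: derivative_eq_intros)
  have c: "continuous_on UNIV (\<lambda>x. exp (- r * (x - s)))" by (intro continuous_intros)
  have e: "heat r t s = indicator {s..\<mu>} t * exp (- r * (t - s))" if "t \<in> space (Leb \<mu>)" for t
    using that by (auto simp: heat_def indicator_def)
  have "0 \<le> s" "s \<le> \<mu>" "\<mu> \<le> \<mu>" using s by auto
  note * = integral_indicator_FTC[OF this F c]
  have "(LINT t|Leb \<mu>. heat r t s) = (LINT t|Leb \<mu>. indicator {s..\<mu>} t * exp (- r * (t - s)))"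
    by (rule Bochner_Integration.integral_cong[OF refl e])
  also have "\<dots> \<le> 1 / r" unfolding *(2) using r by (simp add: field_simps)
  finally show "(LINT t|Leb \<mu>. heat r t s) \<le> 1 / r" .
qed

lemma integral_exp_le:
  assumes "0 < r" "0 < \<mu>"
  shows "(LINT t|Leb \<mu>. exp (- r * t)) \<le> 1 / r"
proof -
  have "(LINT t|Leb \<mu>. exp (- r * t)) = (LINT t|Leb \<mu>. heat r t 0)"
    by (rule Bochner_Integration.integral_cong[OF refl]) (auto simp: heat_def)
  also have "\<dots> \<le> 1 / r" using assms by (intro integral_heat_right) auto
  finally show ?thesis .
qed

lemma integrable_if_square_integrable:
  fixes g :: "real \<Rightarrow> 'b::{banach, second_countable_topology}"
  assumes m: "g \<in> borel_measurable (Leb \<mu>)" and g: "integrable (Leb \<mu>) (\<lambda>s. (norm (g s))\<^sup>2)"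
  shows "integrable (Leb \<mu>) g"
proof (rule Bochner_Integration.integrable_bound)
  interpret finite_measure "Leb \<mu>" by (rule finite_measure_Leb)
  show "integrable (Leb \<mu>) (\<lambda>s. 1 + (norm (g s))\<^sup>2)" using g by simp
  have "x \<le> 1 + x\<^sup>2" for x :: real using sum_squares_bound[of x 1] by (simp add: power2_eq_square) (smt (verit) zero_le_square)
  then show "AE s in Leb \<mu>. norm (g s) \<le> norm (1 + (norm (g s))\<^sup>2)" by (intro AE_I2) simp
qed (rule m)

lemma duh_eq_heat: "duh \<mu> r g t = (LINT s|Leb \<mu>. heat r t s *\<^sub>R g s)"
proof -
  have *: "exp (- r * t) *\<^sub>R (indicator {..t} s *\<^sub>R (exp (r * s) *\<^sub>R g s)) = heat r t s *\<^sub>R g s" for s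
    by (auto simp: heat_def indicator_def exp_add[symmetric] algebra_simps)
  show ?thesis unfolding duh_def integral_scaleR_right[symmetric] by (simp only: *)
qed

text \<open>
  Two ways to apply the Cauchy-Schwarz inequality: with the whole kernel as one factor, which is
  uniform in time, or with its square root in both factors, which can still be integrated in time.
\<close>

lemma
  fixes g :: "real \<Rightarrow> 'b::{banach, second_countable_topology}"
  assumes r: "0 < r" and t: "t \<in> {0..\<mu>}"
    and m: "g \<in> borel_measurable (Leb \<mu>)" and g: "integrable (Leb \<mu>) (\<lambda>s. (norm (g s))\<^sup>2)"
  shows norm_duh_le: "(norm (duh \<mu> r g t))\<^sup>2 \<le> (LINT s|Leb \<mu>. (norm (g s))\<^sup>2) / (2 * r)"
    and norm_duh_le_heat: "(norm (duh \<mu> r g t))\<^sup>2 \<le> (LINT s|Leb \<mu>. heat r t s * (norm (g s))\<^sup>2) / r"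
proof -
  have mh: "(\<lambda>s. heat r t s) \<in> borel_measurable (Leb \<mu>)" for r
    unfolding heat_def
    by (intro borel_measurable_times indicator_atMost_measurable_Leb continuous_imp_measurable_Leb continuous_intros)
  have mn: "(\<lambda>s. norm (g s)) \<in> borel_measurable (Leb \<mu>)" using m by measurable
  have le: "norm (duh \<mu> r g t) \<le> (LINT s|Leb \<mu>. \<bar>heat r t s * norm (g s)\<bar>)"
    unfolding duh_eq_heat using integral_norm_bound[of "Leb \<mu>" "\<lambda>s. heat r t s *\<^sub>R g s"] by (simp add: abs_mult)
  have "(norm (duh \<mu> r g t))\<^sup>2 \<le> (LINT s|Leb \<mu>. \<bar>heat r t s * norm (g s)\<bar>)\<^sup>2"
    by (intro power_mono le) simp
  also have "\<dots> \<le> (LINT s|Leb \<mu>. (heat r t s)\<^sup>2) * (LINT s|Leb \<mu>. (norm (g s))\<^sup>2)"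
    using integrable_heat_left[of "2 * r" t \<mu>] r t
    by (intro Cauchy_Schwarz_LINT mh mn g) (simp add: heat_power2)
  also have "\<dots> \<le> 1 / (2 * r) * (LINT s|Leb \<mu>. (norm (g s))\<^sup>2)"
    using integral_heat_left[of "2 * r" t \<mu>] r t by (intro mult_right_mono) (simp_all add: heat_power2)
  finally show "(norm (duh \<mu> r g t))\<^sup>2 \<le> (LINT s|Leb \<mu>. (norm (g s))\<^sup>2) / (2 * r)" by simp
  have ih: "integrable (Leb \<mu>) (\<lambda>s. heat r t s * (norm (g s))\<^sup>2)"
    using integrable_bounded_scaleR[where K = 1, OF g mh[of r]] heat_le_1[OF r] by simp
  have "(norm (duh \<mu> r g t))\<^sup>2 \<le> (LINT s|Leb \<mu>. \<bar>heat r t s * norm (g s)\<bar>)\<^sup>2"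
    by (intro power_mono le) simp
  also have "(\<lambda>s. \<bar>heat r t s * norm (g s)\<bar>) = (\<lambda>s. \<bar>sqrt (heat r t s) * (sqrt (heat r t s) * norm (g s))\<bar>)"
    by (simp add: abs_mult flip: mult.assoc)
  also have "(LINT s|Leb \<mu>. \<bar>sqrt (heat r t s) * (sqrt (heat r t s) * norm (g s))\<bar>)\<^sup>2
      \<le> (LINT s|Leb \<mu>. (sqrt (heat r t s))\<^sup>2) * (LINT s|Leb \<mu>. (sqrt (heat r t s) * norm (g s))\<^sup>2)"
    using integrable_heat_left[OF r t] ih mh[of r] mn
    by (intro Cauchy_Schwarz_LINT) (simp_all add: power_mult_distrib)
  also have "\<dots> \<le> 1 / r * (LINT s|Leb \<mu>. heat r t s * (norm (g s))\<^sup>2)"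
    using integral_heat_left[OF r t] by (simp only: power_mult_distrib) (simp add: mult_right_mono divide_inverse)
  finally show "(norm (duh \<mu> r g t))\<^sup>2 \<le> (LINT s|Leb \<mu>. heat r t s * (norm (g s))\<^sup>2) / r" by simp
qed

text \<open>
  The second bound gains a full power of the rate: the kernel is integrated in the later time
  variable first.
\<close>

lemma integral_norm_duh_le:
  fixes g :: "real \<Rightarrow> 'b::euclidean_space"
  assumes r: "0 < r"
    and m: "g \<in> borel_measurable (Leb \<mu>)" and g: "integrable (Leb \<mu>) (\<lambda>s. (norm (g s))\<^sup>2)"
  shows "integrable (Leb \<mu>) (\<lambda>t. (norm (duh \<mu> r g t))\<^sup>2)"
    and "(LINT t|Leb \<mu>. (norm (duh \<mu> r g t))\<^sup>2) \<le> (LINT s|Leb \<mu>. (norm (g s))\<^sup>2) / r\<^sup>2"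
proof -
  interpret M: finite_measure "Leb \<mu>" by (rule finite_measure_Leb)
  interpret P: pair_sigma_finite "Leb \<mu>" "Leb \<mu>" ..
  have c: "continuous_on {0..\<mu>} (duh \<mu> r g)"
    by (rule continuous_on_subset[OF continuous_on_duh[OF integrable_if_square_integrable[OF m g]]]) simp
  show i: "integrable (Leb \<mu>) (\<lambda>t. (norm (duh \<mu> r g t))\<^sup>2)"
    by (intro continuous_imp_integrable_Leb continuous_intros c)
  define F where "F = (\<lambda>(s, t). heat r t s * (norm (g s))\<^sup>2)"
  have id: "(\<lambda>s. s) \<in> borel_measurable (Leb \<mu>)" by (rule continuous_imp_measurable_Leb) auto
  have mf: "fst \<in> borel_measurable (Leb \<mu> \<Otimes>\<^sub>M Leb \<mu>)" and ms: "snd \<in> borel_measurable (Leb \<mu> \<Otimes>\<^sub>M Leb \<mu>)"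
    using measurable_compose[OF measurable_fst id] measurable_compose[OF measurable_snd id] by auto
  have mF: "F \<in> borel_measurable (Leb \<mu> \<Otimes>\<^sub>M Leb \<mu>)"
  proof -
    have "(\<lambda>x. (if fst x \<le> snd x then 1 else 0) * exp (- r * (snd x - fst x)) * (norm (g (fst x)))\<^sup>2)
        \<in> borel_measurable (Leb \<mu> \<Otimes>\<^sub>M Leb \<mu>)"
      using mf ms m by measurable
    moreover have "(\<lambda>x. (if fst x \<le> snd x then 1 else 0) * exp (- r * (snd x - fst x)) * (norm (g (fst x)))\<^sup>2) = F"
      by (auto simp: F_def heat_def indicator_def)
    ultimately show ?thesis by simp
  qed
  have F: "integrable (Leb \<mu> \<Otimes>\<^sub>M Leb \<mu>) F"
  proof (rule Bochner_Integration.integrable_bound)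
    show "integrable (Leb \<mu> \<Otimes>\<^sub>M Leb \<mu>) (\<lambda>(s, t). (norm (g s))\<^sup>2)"
    proof (rule P.Fubini_integrable)
      show "(\<lambda>(s, t). (norm (g s))\<^sup>2) \<in> borel_measurable (Leb \<mu> \<Otimes>\<^sub>M Leb \<mu>)" using m by measurable
    qed (use g in \<open>auto intro!: AE_I2\<close>)
    show "AE x in Leb \<mu> \<Otimes>\<^sub>M Leb \<mu>. norm (F x) \<le> norm (case x of (s, t) \<Rightarrow> (norm (g s))\<^sup>2)"
      using heat_le_1[OF r] by (intro AE_I2) (auto simp: F_def abs_mult intro!: mult_left_le_one_le)
  qed (rule mF)
  have F': "integrable (Leb \<mu>) (\<lambda>t. LINT s|Leb \<mu>. F (s, t))"
    using P.integrable_snd[of "\<lambda>s t. F (s, t)"] F by simp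
  have "(LINT t|Leb \<mu>. (norm (duh \<mu> r g t))\<^sup>2) \<le> (LINT t|Leb \<mu>. (LINT s|Leb \<mu>. F (s, t)) / r)"
    using norm_duh_le_heat[OF r _ m g] i F' by (intro integral_mono) (auto simp: F_def)
  also have "\<dots> = (LINT t|Leb \<mu>. LINT s|Leb \<mu>. F (s, t)) / r" by simp
  also have "(LINT t|Leb \<mu>. LINT s|Leb \<mu>. F (s, t)) = (LINT s|Leb \<mu>. LINT t|Leb \<mu>. F (s, t))"
    using P.Fubini_integral[of "\<lambda>s t. F (s, t)"] F by simp
  also have "\<dots> \<le> (LINT s|Leb \<mu>. 1 / r * (norm (g s))\<^sup>2)"
  proof (rule integral_mono)
    show "integrable (Leb \<mu>) (\<lambda>s. LINT t|Leb \<mu>. F (s, t))"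
      using P.integrable_fst[of "\<lambda>s t. F (s, t)"] F by simp
    show "integrable (Leb \<mu>) (\<lambda>s. 1 / r * (norm (g s))\<^sup>2)" using g by simp
    fix s assume "s \<in> space (Leb \<mu>)"
    then show "(LINT t|Leb \<mu>. F (s, t)) \<le> 1 / r * (norm (g s))\<^sup>2"
      using mult_right_mono[OF integral_heat_right[OF r, of s \<mu>], of "(norm (g s))\<^sup>2"] by (simp add: F_def)
  qed
  also have "\<dots> = (LINT s|Leb \<mu>. (norm (g s))\<^sup>2) / r" by simp
  finally show "(LINT t|Leb \<mu>. (norm (duh \<mu> r g t))\<^sup>2) \<le> (LINT s|Leb \<mu>. (norm (g s))\<^sup>2) / r\<^sup>2"
    using r by (simp add: power2_eq_square divide_right_mono flip: divide_divide_eq_left)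
qed

section \<open>Measurability of Fourier modes\<close>

lemma measurable_Leb_AE:
  fixes f g :: "real \<Rightarrow> 'b::euclidean_space"
  assumes f: "f \<in> borel_measurable (Leb \<mu>)" and ae: "AE t in Leb \<mu>. f t = g t"
  shows "g \<in> borel_measurable (Leb \<mu>)"
proof -
  have "(\<lambda>x. indicator {0..\<mu>} x *\<^sub>R f x) \<in> borel_measurable lebesgue"
    using f by (subst (asm) borel_measurable_restrict_space_iff) auto
  moreover have "AE x in lebesgue. indicator {0..\<mu>} x *\<^sub>R f x = indicator {0..\<mu>} x *\<^sub>R g x"
    using ae by (subst (asm) AE_restrict_space_iff) (auto elim!: eventually_mono simp: indicator_def)
  ultimately have "(\<lambda>x. indicator {0..\<mu>} x *\<^sub>R g x) \<in> borel_measurable lebesgue"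
    by (rule borel_measurable_AE)
  then show ?thesis by (subst borel_measurable_restrict_space_iff) auto
qed

lemma measurable_Leb_AE_limit:
  fixes f :: "nat \<Rightarrow> real \<Rightarrow> 'b::euclidean_space"
  assumes f: "\<And>n. f n \<in> borel_measurable (Leb \<mu>)" and ae: "AE t in Leb \<mu>. (\<lambda>n. f n t) \<longlonglongrightarrow> g t"
  shows "g \<in> borel_measurable (Leb \<mu>)"
proof (rule measurable_Leb_AE)
  show "(\<lambda>t. lim (\<lambda>n. f n t)) \<in> borel_measurable (Leb \<mu>)"
    using f by (rule borel_measurable_lim_metric)
  show "AE t in Leb \<mu>. lim (\<lambda>n. f n t) = g t"
    using ae by eventually_elim (rule limI)
qed

definition modes_measurable :: "real \<Rightarrow> (real \<Rightarrow> coeffs) \<Rightarrow> bool" where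
  "modes_measurable \<mu> u \<longleftrightarrow> (\<forall>k. (\<lambda>t. u t k) \<in> borel_measurable (Leb \<mu>))"

lemma tendsto_mode_if_V_norm:
  assumes L: "0 < L" and s: "0 \<le> s" and u: "\<And>n. S n \<in> V L s" "u \<in> V L s"
    and lim: "(\<lambda>n. V_dist L s (S n) u) \<longlonglongrightarrow> 0"
  shows "(\<lambda>n. S n k) \<longlonglongrightarrow> u k"
proof (cases "k = 0")
  case True
  have "S n \<in> adm L" "u \<in> adm L" for n using u(1)[of n] u(2) L s by (auto simp: V_eq)
  then have "S n 0 = 0" "u 0 = 0" for n using adm_0 by blast+
  with True show ?thesis by simp
next
  case False
  define c where "c = sqrt (L ^ 3) * sob L s k"
  have c: "0 < c" using sob_pos[OF L False] L by (simp add: c_def)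
  have "norm (S n k - u k) \<le> V_dist L s (S n) u / c" for n
  proof -
    have "S n - u \<in> wl2 (sob L s)" using u L s by (auto simp: V_eq intro!: wl2_diff)
    from mode_le_wnorm[OF this, of k] show ?thesis
      using L sob_pos[OF L False, of s] by (simp add: V_dist_def V_norm_eq c_def field_simps)
  qed
  moreover have "(\<lambda>n. V_dist L s (S n) u / c) \<longlonglongrightarrow> 0"
    using tendsto_divide[OF lim tendsto_const[of c]] c by simp
  ultimately have "(\<lambda>n. S n k - u k) \<longlonglongrightarrow> 0"
    by (rule Lim_null_comparison[OF always_eventually[OF allI]])
  then show ?thesis by (simp add: LIM_zero_iff)
qed

text \<open>
  Convergence in norm implies convergence of every nonzero mode, so measurability of modes is
  inherited from the approximating simple functions.
\<close>

lemma modes_measurable_if_strongly_measurable: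
  assumes L: "0 < L" and s: "0 \<le> s" and u: "strongly_measurable L \<mu> s u"
  shows "modes_measurable \<mu> u"
  unfolding modes_measurable_def
proof
  fix k
  obtain S where S: "\<And>n. simple_function (Leb \<mu>) (S n)" "\<And>n t. t \<in> {0..\<mu>} \<Longrightarrow> S n t \<in> V L s"
    and lim: "AE t in Leb \<mu>. (\<lambda>n. V_dist L s (S n t) (u t)) \<longlonglongrightarrow> 0" and uV: "AE t in Leb \<mu>. u t \<in> V L s"
    using u unfolding strongly_measurable_def by blast
  show "(\<lambda>t. u t k) \<in> borel_measurable (Leb \<mu>)"
  proof (rule measurable_Leb_AE_limit)
    show "(\<lambda>t. S n t k) \<in> borel_measurable (Leb \<mu>)" for n
      by (rule borel_measurable_simple_function[OF simple_function_compose1[OF S(1)]])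
    have "AE t in Leb \<mu>. t \<in> {0..\<mu>}" using AE_space[of "Leb \<mu>"] by simp
    then show "AE t in Leb \<mu>. (\<lambda>n. S n t k) \<longlonglongrightarrow> u t k"
      using lim uV by eventually_elim (rule tendsto_mode_if_V_norm[OF L s S(2)])
  qed
qed

lemma measurable_nl:
  assumes \<psi>: "modes_measurable \<mu> \<psi>" and u: "modes_measurable \<mu> u"
    and s: "AE t in Leb \<mu>. conv_summable (\<psi> t) (u t)"
  shows "modes_measurable \<mu> (\<lambda>t. nl L (\<psi> t) (u t))"
  unfolding modes_measurable_def
proof
  fix k
  have adv: "(\<lambda>t. adv L k (\<psi> t m) (u t n)) \<in> borel_measurable (Leb \<mu>)" for m n
  proof (rule borel_measurable_continuous_Pair[where H = "adv L k"])
    show "continuous_on UNIV (\<lambda>x. adv L k (fst x) (snd x))"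
      unfolding adv_def cscale_def cdot_def
      by (intro continuous_intros continuous_on_vec_lambda)
  qed (use \<psi> u in \<open>auto simp: modes_measurable_def\<close>)
  have "(\<lambda>t. \<Sum>\<^sub>\<infinity>m. adv L k (\<psi> t m) (u t (k - m))) \<in> borel_measurable (Leb \<mu>)"
  proof (rule measurable_Leb_AE_limit)
    show "(\<lambda>t. \<Sum>m\<in>kbox N. adv L k (\<psi> t m) (u t (k - m))) \<in> borel_measurable (Leb \<mu>)" for N
      by (intro borel_measurable_sum adv)
    show "AE t in Leb \<mu>. (\<lambda>N. \<Sum>m\<in>kbox N. adv L k (\<psi> t m) (u t (k - m))) \<longlonglongrightarrow> (\<Sum>\<^sub>\<infinity>m. adv L k (\<psi> t m) (u t (k - m)))"
      using s
    proof eventually_elim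
      case (elim t)
      show ?case by (rule filterlim_compose[OF infsum_tendsto[OF summable_on_adv[OF elim]] filterlim_kbox])
    qed
  qed
  then have "(\<lambda>t. leray L k (\<Sum>\<^sub>\<infinity>m. adv L k (\<psi> t m) (u t (k - m)))) \<in> borel_measurable (Leb \<mu>)"
    by (rule measurable_compose) (intro borel_measurable_continuous_onI linear_continuous_on bounded_linear_leray)
  then show "(\<lambda>t. nl L (\<psi> t) (u t) k) \<in> borel_measurable (Leb \<mu>)" by (simp add: nl_def)
qed

lemma tendsto_wnorm_power2:
  assumes "x \<in> wl2 \<omega>"
  shows "(\<lambda>N. \<Sum>k\<in>kbox N. (\<omega> k * norm (x k))\<^sup>2) \<longlonglongrightarrow> (wnorm \<omega> x)\<^sup>2"
  unfolding wnorm_power2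
  by (rule filterlim_compose[OF infsum_tendsto filterlim_kbox]) (use assms in \<open>simp add: wl2_def\<close>)

lemma V_norm_power2: "0 < L \<Longrightarrow> (V_norm L s u)\<^sup>2 = L ^ 3 * (wnorm (sob L s) u)\<^sup>2"
  by (simp add: V_norm_eq power_mult_distrib)

text \<open>
  Summing mode by mode commutes with integration in time because all terms are nonnegative.
\<close>

lemma square_integrable_if_mode_sums:
  assumes L: "0 < L" and m: "modes_measurable \<mu> d"
    and sq: "\<And>k. integrable (Leb \<mu>) (\<lambda>t. (norm (d t k))\<^sup>2)"
    and le: "\<And>F. finite F \<Longrightarrow> (\<Sum>k\<in>F. L ^ 3 * (sob L s k)\<^sup>2 * (LINT t|Leb \<mu>. (norm (d t k))\<^sup>2)) \<le> C"
  shows "AE t in Leb \<mu>. d t \<in> wl2 (sob L s)"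
    and "integrable (Leb \<mu>) (\<lambda>t. (V_norm L s (d t))\<^sup>2)"
    and "(LINT t|Leb \<mu>. (V_norm L s (d t))\<^sup>2) \<le> C"
proof -
  define S where "S = (\<lambda>N t. L ^ 3 * (\<Sum>k\<in>kbox N. (sob L s k * norm (d t k))\<^sup>2))"
  have S0: "0 \<le> S N t" for N t using L by (simp add: S_def sum_nonneg)
  have iS: "integrable (Leb \<mu>) (S N)" for N
    unfolding S_def power_mult_distrib using sq by simp
  have IS: "(LINT t|Leb \<mu>. S N t) \<le> C" for N
  proof -
    have "(LINT t|Leb \<mu>. S N t) = (\<Sum>k\<in>kbox N. L ^ 3 * (sob L s k)\<^sup>2 * (LINT t|Leb \<mu>. (norm (d t k))\<^sup>2))"
      unfolding S_def power_mult_distrib using sq by (simp add: sum_distrib_left mult.assoc)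
    then show ?thesis using le[of "kbox N"] by simp
  qed
  have mono: "S M t \<le> S N t" if "M \<le> N" for M N t
    unfolding S_def using L that
    by (intro mult_left_mono sum_mono2 finite_kbox) (auto simp: kbox_def intro: order_trans)
  have "AE t in Leb \<mu>. (SUP N. ennreal (S N t)) \<noteq> \<infinity>"
  proof (rule nn_integral_PInf_AE)
    show "(\<lambda>t. SUP N. ennreal (S N t)) \<in> borel_measurable (Leb \<mu>)"
      using iS by (intro borel_measurable_SUP) auto
    have "(\<integral>\<^sup>+ t. (SUP N. ennreal (S N t)) \<partial>Leb \<mu>) = (SUP N. \<integral>\<^sup>+ t. ennreal (S N t) \<partial>Leb \<mu>)"
      using iS mono by (intro nn_integral_monotone_convergence_SUP) (auto simp: incseq_def le_fun_def ennreal_leI)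
    also have "\<dots> \<le> ennreal C"
      using IS by (intro SUP_least) (simp add: nn_integral_eq_integral[OF iS] S0 ennreal_leI)
    also have "\<dots> < \<infinity>" by simp
    finally show "(\<integral>\<^sup>+ t. (SUP N. ennreal (S N t)) \<partial>Leb \<mu>) \<noteq> \<infinity>" by simp
  qed
  then show ae: "AE t in Leb \<mu>. d t \<in> wl2 (sob L s)"
  proof eventually_elim
    case (elim t)
    then obtain D where D: "(SUP N. ennreal (S N t)) = ennreal D" "0 \<le> D"
      by (cases "SUP N. ennreal (S N t)") auto
    have SD: "S N t \<le> D" for N
    proof -
      have "ennreal (S N t) \<le> ennreal D" unfolding D(1)[symmetric] by (rule SUP_upper) simp
      then show ?thesis using D(2) by (simp add: ennreal_le_iff)
    qed
    show ?case
    proof (rule wl2_if_finite_sums)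
      fix F :: "(int ^ 3) set" assume F: "finite F"
      have "eventually (\<lambda>N. \<forall>k\<in>F. k \<in> kbox N) sequentially"
        using F eventually_in_kbox by (intro eventually_ball_finite) auto
      then obtain N where "F \<subseteq> kbox N" by (auto simp: eventually_sequentially)
      then have "(\<Sum>k\<in>F. (sob L s k * norm (d t k))\<^sup>2) \<le> (\<Sum>k\<in>kbox N. (sob L s k * norm (d t k))\<^sup>2)"
        by (intro sum_mono2) auto
      also have "\<dots> \<le> D / L ^ 3" using SD[of N] L by (simp add: S_def field_simps)
      finally show "(\<Sum>k\<in>F. (sob L s k * norm (d t k))\<^sup>2) \<le> D / L ^ 3" .
    qed
  qed
  have lim: "AE t in Leb \<mu>. (\<lambda>N. S N t) \<longlonglongrightarrow> (V_norm L s (d t))\<^sup>2"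
    using ae
  proof eventually_elim
    case (elim t)
    show ?case unfolding S_def V_norm_power2[OF L]
      by (intro tendsto_mult_left tendsto_wnorm_power2 elim)
  qed
  have "incseq (\<lambda>N. LINT t|Leb \<mu>. S N t)"
    using mono iS by (auto simp: incseq_def intro!: integral_mono)
  then obtain I where I: "(\<lambda>N. LINT t|Leb \<mu>. S N t) \<longlonglongrightarrow> I"
    using incseq_convergent[of _ C] IS by metis
  have mV: "(\<lambda>t. (V_norm L s (d t))\<^sup>2) \<in> borel_measurable (Leb \<mu>)"
    by (rule measurable_Leb_AE_limit[OF borel_measurable_integrable[OF iS] lim])
  have "AE t in Leb \<mu>. mono (\<lambda>N. S N t)" using mono by (auto simp: incseq_def)
  note * = iS this lim I mV
  show "integrable (Leb \<mu>) (\<lambda>t. (V_norm L s (d t))\<^sup>2)"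
    by (rule integrable_monotone_convergence[OF *])
  have "(LINT t|Leb \<mu>. (V_norm L s (d t))\<^sup>2) = I"
    by (rule integral_monotone_convergence[OF *])
  then show "(LINT t|Leb \<mu>. (V_norm L s (d t))\<^sup>2) \<le> C"
    using LIMSEQ_le_const2[OF I] IS by auto
qed

text \<open>
  A right-hand side that is square integrable in time with values of order \<open>s\<close>, together with a
  majorant of its squared norm.
\<close>

definition forcing :: "real \<Rightarrow> real \<Rightarrow> real \<Rightarrow> (real \<Rightarrow> coeffs) \<Rightarrow> (real \<Rightarrow> real) \<Rightarrow> bool" where
  "forcing L \<mu> s h \<Gamma> \<longleftrightarrow> modes_measurable \<mu> h \<and> integrable (Leb \<mu>) \<Gamma> \<and>
     (AE t in Leb \<mu>. h t \<in> wl2 (sob L s) \<and> (V_norm L s (h t))\<^sup>2 \<le> \<Gamma> t \<and> h t 0 = 0)"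

lemma
  assumes L: "0 < L" and f: "forcing L \<mu> s h \<Gamma>"
  shows forcing_square_integrable: "integrable (Leb \<mu>) (\<lambda>t. (norm (h t k))\<^sup>2)"
    and forcing_integrable: "integrable (Leb \<mu>) (\<lambda>t. h t k)"
    and forcing_mode_sum: "finite F \<Longrightarrow>
      (\<Sum>k\<in>F. L ^ 3 * (sob L s k)\<^sup>2 * (LINT t|Leb \<mu>. (norm (h t k))\<^sup>2)) \<le> (LINT t|Leb \<mu>. \<Gamma> t)"
proof -
  have m: "(\<lambda>t. h t k) \<in> borel_measurable (Leb \<mu>)" for k
    using f by (simp add: forcing_def modes_measurable_def)
  have i\<Gamma>: "integrable (Leb \<mu>) \<Gamma>" using f by (simp add: forcing_def)
  have ae: "AE t in Leb \<mu>. h t \<in> wl2 (sob L s) \<and> (V_norm L s (h t))\<^sup>2 \<le> \<Gamma> t \<and> h t 0 = 0"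
    using f by (simp add: forcing_def)
  have sum: "AE t in Leb \<mu>. (\<Sum>k\<in>F. L ^ 3 * (sob L s k)\<^sup>2 * (norm (h t k))\<^sup>2) \<le> \<Gamma> t" if "finite F" for F
    using ae
  proof eventually_elim
    case (elim t)
    then have "L ^ 3 * (\<Sum>k\<in>F. (sob L s k * norm (h t k))\<^sup>2) \<le> L ^ 3 * (wnorm (sob L s) (h t))\<^sup>2"
      using L by (intro mult_left_mono finite_sum_le_wnorm that) auto
    also have "\<dots> \<le> \<Gamma> t" using elim V_norm_power2[OF L] by simp
    finally show ?case by (simp add: sum_distrib_left power_mult_distrib mult.assoc)
  qed
  show sq: "integrable (Leb \<mu>) (\<lambda>t. (norm (h t k))\<^sup>2)" for k
  proof (cases "k = 0")
    case True
    have "integrable (Leb \<mu>) (\<lambda>t. 0 :: real)" by simp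
    then show ?thesis
    proof (rule integrable_cong_AE_imp)
      show "(\<lambda>t. (norm (h t k))\<^sup>2) \<in> borel_measurable (Leb \<mu>)" using m[of k] by measurable
      show "AE t in Leb \<mu>. 0 = (norm (h t k))\<^sup>2" using ae by eventually_elim (simp add: True)
    qed
  next
    case False
    define c where "c = L ^ 3 * (sob L s k)\<^sup>2"
    have c: "0 < c" using sob_pos[OF L False, of s] L by (simp add: c_def)
    show ?thesis
    proof (rule Bochner_Integration.integrable_bound)
      show "integrable (Leb \<mu>) (\<lambda>t. \<Gamma> t / c)" using i\<Gamma> by simp
      show "(\<lambda>t. (norm (h t k))\<^sup>2) \<in> borel_measurable (Leb \<mu>)" using m[of k] by measurable
      have "finite {k}" by simp
      from sum[OF this] show "AE t in Leb \<mu>. norm ((norm (h t k))\<^sup>2) \<le> norm (\<Gamma> t / c)"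
      proof eventually_elim
        case (elim t)
        then have "c * (norm (h t k))\<^sup>2 \<le> \<Gamma> t" by (simp add: c_def)
        then have "(norm (h t k))\<^sup>2 \<le> \<Gamma> t / c" using c by (simp add: field_simps)
        also have "\<dots> \<le> norm (\<Gamma> t / c)" unfolding real_norm_def by (rule abs_ge_self)
        finally show ?case by simp
      qed
    qed
  qed
  show "integrable (Leb \<mu>) (\<lambda>t. h t k)" by (rule integrable_if_square_integrable[OF m sq])
  assume F: "finite F"
  have "(\<Sum>k\<in>F. L ^ 3 * (sob L s k)\<^sup>2 * (LINT t|Leb \<mu>. (norm (h t k))\<^sup>2))
      = (LINT t|Leb \<mu>. (\<Sum>k\<in>F. L ^ 3 * (sob L s k)\<^sup>2 * (norm (h t k))\<^sup>2))"
    using sq by simp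
  also have "\<dots> \<le> (LINT t|Leb \<mu>. \<Gamma> t)"
    using sq by (intro integral_mono_AE sum F i\<Gamma>) auto
  finally show "(\<Sum>k\<in>F. L ^ 3 * (sob L s k)\<^sup>2 * (LINT t|Leb \<mu>. (norm (h t k))\<^sup>2)) \<le> (LINT t|Leb \<mu>. \<Gamma> t)" .
qed

text \<open>
  Parabolic smoothing. In a mode with wave number \<open>\<kappa>\<close> the gain is a factor \<open>1 / (2 \<nu> \<kappa>\<^sup>2)\<close> in the
  square of the norm, that is, one order of differentiability. The values \<open>y k\<close> may be the
  coefficients at one time or the supremum norms of whole modes: the assumed bound is free of time.
\<close>

lemma
  fixes y :: "int ^ 3 \<Rightarrow> 'b::real_normed_vector"
  assumes L: "0 < L" and \<nu>: "0 < \<nu>" and f: "forcing L \<mu> (\<alpha> - 1) h \<Gamma>"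
    and y: "\<And>k. k \<noteq> 0 \<Longrightarrow> (norm (y k))\<^sup>2 \<le> (LINT t|Leb \<mu>. (norm (h t k))\<^sup>2) / (2 * (\<nu> * (kap L k)\<^sup>2))"
  shows smoothing_sup_wl2: "y \<in> wl2 (sob L \<alpha>)"
    and smoothing_sup: "L ^ 3 * (wnorm (sob L \<alpha>) y)\<^sup>2 \<le> (LINT t|Leb \<mu>. \<Gamma> t) / (2 * \<nu>)"
proof -
  have *: "(\<Sum>k\<in>F. (sob L \<alpha> k * norm (y k))\<^sup>2) \<le> (LINT t|Leb \<mu>. \<Gamma> t) / (2 * \<nu>) / L ^ 3" if F: "finite F" for F
  proof -
    have "(\<Sum>k\<in>F. (sob L \<alpha> k * norm (y k))\<^sup>2)
      \<le> (\<Sum>k\<in>F. L ^ 3 * (sob L (\<alpha> - 1) k)\<^sup>2 * (LINT t|Leb \<mu>. (norm (h t k))\<^sup>2) / (2 * \<nu> * L ^ 3))"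
    proof (rule sum_mono)
      fix k
      show "(sob L \<alpha> k * norm (y k))\<^sup>2 \<le> L ^ 3 * (sob L (\<alpha> - 1) k)\<^sup>2 * (LINT t|Leb \<mu>. (norm (h t k))\<^sup>2) / (2 * \<nu> * L ^ 3)"
      proof (cases "k = 0")
        case False
        have "(sob L \<alpha> k * norm (y k))\<^sup>2 \<le> (sob L \<alpha> k)\<^sup>2 * ((LINT t|Leb \<mu>. (norm (h t k))\<^sup>2) / (2 * (\<nu> * (kap L k)\<^sup>2)))"
          unfolding power_mult_distrib by (intro mult_left_mono y False) simp
        also have "\<dots> = L ^ 3 * (sob L (\<alpha> - 1) k)\<^sup>2 * (LINT t|Leb \<mu>. (norm (h t k))\<^sup>2) / (2 * \<nu> * L ^ 3)"
          unfolding sob_shift(1)[OF L, of \<alpha>] using kap_pos[OF L False] L \<nu> by (simp add: power_mult_distrib field_simps)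
        finally show ?thesis .
      qed simp
    qed
    also have "\<dots> = (\<Sum>k\<in>F. L ^ 3 * (sob L (\<alpha> - 1) k)\<^sup>2 * (LINT t|Leb \<mu>. (norm (h t k))\<^sup>2)) / (2 * \<nu> * L ^ 3)"
      by (rule sum_divide_distrib[symmetric])
    also have "\<dots> \<le> (LINT t|Leb \<mu>. \<Gamma> t) / (2 * \<nu> * L ^ 3)"
      using L \<nu> by (intro divide_right_mono forcing_mode_sum[OF L f F]) auto
    finally show ?thesis by simp
  qed
  show "y \<in> wl2 (sob L \<alpha>)" by (rule wl2_if_finite_sums[OF *])
  show "L ^ 3 * (wnorm (sob L \<alpha>) y)\<^sup>2 \<le> (LINT t|Leb \<mu>. \<Gamma> t) / (2 * \<nu>)"
    using mult_left_mono[OF wnorm_le_if_finite_sums[OF *], of "L ^ 3"] L by simp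
qed

section \<open>Weak solutions and Duhamel's formula\<close>

lemma V_diff: "0 < L \<Longrightarrow> 0 \<le> s \<Longrightarrow> u \<in> V L s \<Longrightarrow> v \<in> V L s \<Longrightarrow> u - v \<in> V L s"
  by (auto simp: V_eq wl2_diff adm_diff)

lemma V_adm: "u \<in> V L s \<Longrightarrow> u \<in> adm L"
  by (simp add: V_def adm_def)

lemma V_wl2: "0 < L \<Longrightarrow> 0 \<le> s \<Longrightarrow> u \<in> V L s \<Longrightarrow> u \<in> wl2 (sob L s)"
  by (simp add: V_eq)

lemma V_weaken: "0 < L \<Longrightarrow> 0 \<le> s \<Longrightarrow> s \<le> t \<Longrightarrow> u \<in> V L t \<Longrightarrow> u \<in> V L s"
  by (simp add: V_eq wl2_weaken)

lemma V_norm_eq_0D: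
  assumes L: "0 < L" and s: "0 \<le> s" and u: "u \<in> V L s" and z: "V_norm L s u = 0"
  shows "u k = 0"
proof (cases "k = 0")
  case True
  then show ?thesis using adm_0[OF V_adm[OF u]] by simp
next
  case False
  have "sob L s k * norm (u k) \<le> wnorm (sob L s) u" by (rule mode_le_wnorm[OF V_wl2[OF L s u]])
  also have "\<dots> = 0" using z L by (simp add: V_norm_eq)
  finally show ?thesis using sob_pos[OF L False, of s] by (simp add: mult_le_0_iff)
qed

lemma V_norm_triangle:
  assumes "0 < L" "0 \<le> s" "u \<in> V L s" "v \<in> V L s" "\<And>k. norm (w k) \<le> norm (u k) + norm (v k)"
  shows "V_norm L s w \<le> V_norm L s u + V_norm L s v"
  using wnorm_triangle[OF V_wl2[OF assms(1-3)] V_wl2[OF assms(1,2,4)] assms(5)] assms(1)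
  by (simp add: V_norm_eq distrib_left[symmetric] mult_left_mono)

lemma V_norm_le_dist:
  assumes "0 < L" "0 \<le> s" "u \<in> V L s" "v \<in> V L s"
  shows "V_norm L s u \<le> V_norm L s v + V_dist L s u v"
proof -
  have "norm (u k) \<le> norm (v k) + norm ((u - v) k)" for k
    using norm_triangle_ineq[of "v k" "u k - v k"] by simp
  then show ?thesis
    unfolding V_dist_def using assms by (intro V_norm_triangle V_diff) auto
qed

lemma V_dist_commute: "V_dist L s u v = V_dist L s v u"
proof -
  have "wnorm (sob L s) (u - v) = wnorm (sob L s) (v - u)" by (rule wnorm_minus_commute)
  then show ?thesis by (simp add: V_dist_def V_norm_eq)
qed

lemma C_fun_modes_continuous:
  assumes L: "0 < L" and s: "0 \<le> s" and u: "u \<in> C_fun L \<mu> s"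
  shows "continuous_on {0..\<mu>} (\<lambda>t. u t k)"
proof (cases "k = 0")
  case True
  have "u t \<in> V L s" if "t \<in> {0..\<mu>}" for t using u that by (simp add: C_fun_def)
  then have "u t 0 = 0" if "t \<in> {0..\<mu>}" for t using that by (blast intro: adm_0 V_adm)
  then show ?thesis using True continuous_on_cong[of "{0..\<mu>}" "{0..\<mu>}" "\<lambda>t. u t 0" "\<lambda>t. 0"] by simp
next
  case False
  define c where "c = sqrt (L ^ 3) * sob L s k"
  have c: "0 < c" using sob_pos[OF L False] L by (simp add: c_def)
  have le: "norm (u \<tau> k - u t k) \<le> V_dist L s (u \<tau>) (u t) / c" if "\<tau> \<in> {0..\<mu>}" "t \<in> {0..\<mu>}" for \<tau> t
  proof -
    have "u \<tau> - u t \<in> wl2 (sob L s)" using u that V_wl2[OF L s] by (auto simp: C_fun_def intro!: wl2_diff)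
    from mode_le_wnorm[OF this, of k] show ?thesis
      using L sob_pos[OF L False, of s] by (simp add: V_dist_def V_norm_eq c_def field_simps)
  qed
  show ?thesis
    unfolding continuous_on_def
  proof
    fix t assume t: "t \<in> {0..\<mu>}"
    have "((\<lambda>\<tau>. V_dist L s (u \<tau>) (u t)) \<longlongrightarrow> 0) (at t within {0..\<mu>})" using u t by (simp add: C_fun_def)
    from tendsto_divide[OF this tendsto_const[of c]] have "((\<lambda>\<tau>. V_dist L s (u \<tau>) (u t) / c) \<longlongrightarrow> 0) (at t within {0..\<mu>})"
      using c by simp
    moreover have "\<forall>\<^sub>F \<tau> in at t within {0..\<mu>}. norm (u \<tau> k - u t k) \<le> V_dist L s (u \<tau>) (u t) / c"
      unfolding eventually_at_filter using le[OF _ t] by (intro always_eventually) auto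
    ultimately have "((\<lambda>\<tau>. u \<tau> k - u t k) \<longlongrightarrow> 0) (at t within {0..\<mu>})"
      by (rule Lim_null_comparison[rotated])
    then show "((\<lambda>\<tau>. u \<tau> k) \<longlongrightarrow> u t k) (at t within {0..\<mu>})" by (simp add: LIM_zero_iff)
  qed
qed

lemma C_fun_modes_measurable:
  assumes "0 < L" "0 \<le> s" "u \<in> C_fun L \<mu> s"
  shows "modes_measurable \<mu> u"
  unfolding modes_measurable_def
  by (intro allI continuous_imp_measurable_Leb C_fun_modes_continuous[OF assms])

lemma C_fun_bounded:
  assumes L: "0 < L" and s: "0 \<le> s" and u: "u \<in> C_fun L \<mu> s"
  obtains S where "0 \<le> S" "\<And>t. t \<in> {0..\<mu>} \<Longrightarrow> V_norm L s (u t) \<le> S"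
proof -
  have uV: "u t \<in> V L s" if "t \<in> {0..\<mu>}" for t using u that by (simp add: C_fun_def)
  have "continuous_on {0..\<mu>} (\<lambda>t. V_norm L s (u t))"
    unfolding continuous_on_def
  proof
    fix t assume t: "t \<in> {0..\<mu>}"
    have l: "((\<lambda>\<tau>. V_dist L s (u \<tau>) (u t)) \<longlongrightarrow> 0) (at t within {0..\<mu>})" using u t by (simp add: C_fun_def)
    have "norm (V_norm L s (u \<tau>) - V_norm L s (u t)) \<le> V_dist L s (u \<tau>) (u t)" if "\<tau> \<in> {0..\<mu>}" for \<tau>
      using V_norm_le_dist[OF L s uV[OF that] uV[OF t]] V_norm_le_dist[OF L s uV[OF t] uV[OF that]]
      by (simp add: V_dist_commute[of L s "u t"])
    then have "\<forall>\<^sub>F \<tau> in at t within {0..\<mu>}. norm (V_norm L s (u \<tau>) - V_norm L s (u t)) \<le> V_dist L s (u \<tau>) (u t)"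
      unfolding eventually_at_filter by (intro always_eventually) auto
    from Lim_null_comparison[OF this l]
    show "((\<lambda>\<tau>. V_norm L s (u \<tau>)) \<longlongrightarrow> V_norm L s (u t)) (at t within {0..\<mu>})" by (simp add: LIM_zero_iff)
  qed
  then have "bounded ((\<lambda>t. V_norm L s (u t)) ` {0..\<mu>})"
    by (intro compact_imp_bounded compact_continuous_image) auto
  then obtain S where S: "0 < S" "\<forall>y\<in>(\<lambda>t. V_norm L s (u t)) ` {0..\<mu>}. norm y \<le> S" unfolding bounded_pos by blast
  have "V_norm L s (u t) \<le> S" if "t \<in> {0..\<mu>}" for t
  proof -
    have "norm (V_norm L s (u t)) \<le> S" using S(2) that by blast
    then show ?thesis by simp
  qed
  then show ?thesis using that[of S] S(1) by auto
qed

lemma test_function_continuous: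
  assumes "test_function \<mu> \<phi>"
  shows "continuous_on S \<phi>" "continuous_on S (deriv \<phi>)"
proof -
  note d = deriv_has_derivative_test_function[OF assms]
  show "continuous_on S \<phi>"
    using d(1) by (intro DERIV_continuous_on) (auto intro: has_field_derivative_at_within)
  show "continuous_on S (deriv \<phi>)" by (rule continuous_on_subset[OF d(2)]) simp
qed

lemma L2_fun_AE: "\<psi> \<in> L2_fun L \<mu> s \<Longrightarrow> AE t in Leb \<mu>. \<psi> t \<in> V L s"
  by (simp add: L2_fun_def strongly_measurable_def)

lemma forcing_diff:
  assumes L: "0 < L" and h: "forcing L \<mu> s h \<Gamma>" and h': "forcing L \<mu> s h' \<Gamma>'"
  shows "forcing L \<mu> s (\<lambda>t. h t - h' t) (\<lambda>t. 2 * \<Gamma> t + 2 * \<Gamma>' t)"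
  unfolding forcing_def
proof (intro conjI)
  show "modes_measurable \<mu> (\<lambda>t. h t - h' t)"
    using h h' by (auto simp: forcing_def modes_measurable_def intro!: borel_measurable_diff)
  show "integrable (Leb \<mu>) (\<lambda>t. 2 * \<Gamma> t + 2 * \<Gamma>' t)" using h h' by (simp add: forcing_def)
  have "AE t in Leb \<mu>. h t \<in> wl2 (sob L s) \<and> (V_norm L s (h t))\<^sup>2 \<le> \<Gamma> t \<and> h t 0 = 0"
    "AE t in Leb \<mu>. h' t \<in> wl2 (sob L s) \<and> (V_norm L s (h' t))\<^sup>2 \<le> \<Gamma>' t \<and> h' t 0 = 0"
    using h h' by (simp_all add: forcing_def)
  then show "AE t in Leb \<mu>. h t - h' t \<in> wl2 (sob L s) \<and>
      (V_norm L s (h t - h' t))\<^sup>2 \<le> 2 * \<Gamma> t + 2 * \<Gamma>' t \<and> (h t - h' t) 0 = 0"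
  proof eventually_elim
    case (elim t)
    have "wnorm (sob L s) (h t - h' t) \<le> wnorm (sob L s) (h t) + wnorm (sob L s) (h' t)"
      using elim by (intro wnorm_triangle) (auto simp: norm_triangle_ineq4)
    then have "V_norm L s (h t - h' t) \<le> V_norm L s (h t) + V_norm L s (h' t)"
      using L by (simp add: V_norm_eq distrib_left[symmetric] mult_left_mono)
    from square_sum_le[OF this V_norm_nonneg[OF L]] show ?case using elim by (auto intro: wl2_diff)
  qed
qed

lemma sum_dual_le:
  fixes x :: "int ^ 3 \<Rightarrow> 'b::real_normed_vector" and y :: "int ^ 3 \<Rightarrow> 'c::real_normed_vector"
  assumes L: "0 < L" and x: "x \<in> wl2 (sob L s)" and y: "y \<in> wl2 (sob L (- s))"
    and z: "x 0 = 0 \<or> y 0 = 0" and F: "finite F"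
  shows "(\<Sum>k\<in>F. norm (x k) * norm (y k)) \<le> wnorm (sob L s) x * wnorm (sob L (- s)) y"
proof -
  have "(\<Sum>k\<in>F. norm (x k) * norm (y k)) = (\<Sum>k\<in>F. \<bar>sob L s k * norm (x k)\<bar> * \<bar>sob L (- s) k * norm (y k)\<bar>)"
  proof (rule sum.cong[OF refl])
    fix k
    show "norm (x k) * norm (y k) = \<bar>sob L s k * norm (x k)\<bar> * \<bar>sob L (- s) k * norm (y k)\<bar>"
    proof (cases "k = 0")
      case False
      have "\<bar>sob L s k * norm (x k)\<bar> * \<bar>sob L (- s) k * norm (y k)\<bar> = (sob L (- s) k * sob L s k) * (norm (x k) * norm (y k))"
        by (simp add: abs_mult)
      then show ?thesis using sob_cancel[OF L, of s k] False by simp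
    qed (use z in auto)
  qed
  also have "\<dots> \<le> L2_set (\<lambda>k. sob L s k * norm (x k)) F * L2_set (\<lambda>k. sob L (- s) k * norm (y k)) F"
    by (rule L2_set_mult_ineq)
  also have "\<dots> \<le> wnorm (sob L s) x * wnorm (sob L (- s)) y"
    using finite_sum_le_wnorm[OF x F] finite_sum_le_wnorm[OF y F]
    by (intro mult_mono) (auto simp: L2_set_def intro!: real_le_lsqrt sum_nonneg)
  finally show ?thesis .
qed

lemma duh_bounded_linear:
  fixes T :: "'a::{banach, second_countable_topology} \<Rightarrow> 'b::{banach, second_countable_topology}"
  assumes T: "bounded_linear T" and g: "integrable (Leb \<mu>) g"
  shows "T (duh \<mu> r g t) = duh \<mu> r (\<lambda>s. T (g s)) t"
proof -
  interpret T: bounded_linear T by fact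
  from integral_bounded_linear[OF T integrable_duh[OF g]] show ?thesis
    by (simp add: duh_def T.scaleR)
qed

lemma duh_diff:
  fixes g :: "real \<Rightarrow> 'a::{banach, second_countable_topology}"
  assumes g: "integrable (Leb \<mu>) g" and g': "integrable (Leb \<mu>) g'"
  shows "duh \<mu> r (\<lambda>s. g s - g' s) t = duh \<mu> r g t - duh \<mu> r g' t"
  using Bochner_Integration.integral_diff[OF integrable_duh[OF g] integrable_duh[OF g']]
  by (simp add: duh_def scaleR_diff_right)

text \<open>
  The constant \<open>K\<close> is the one of \<open>nl_estimate\<close>; it depends on neither the viscosity nor the
  interval, so that \<open>\<nu>\<close> can be chosen large after it.
\<close>

locale linearized =
  fixes L \<mu> \<alpha> \<nu> K :: real and f :: coeffs
  assumes L: "0 < L" and \<mu>: "0 < \<mu>" and \<alpha>: "1 / 2 < \<alpha>" and \<nu>: "0 < \<nu>" and f: "f \<in> V L \<alpha>"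
    and K: "0 < K"
    and nl_bound: "\<And>\<psi> u. \<psi> \<in> V L (1 + \<alpha>) \<Longrightarrow> u \<in> V L \<alpha> \<Longrightarrow> conv_summable \<psi> u \<and>
      nl L \<psi> u \<in> wl2 (sob L (\<alpha> - 1)) \<and>
      V_norm L (\<alpha> - 1) (nl L \<psi> u) \<le> K * (V_norm L (1 + \<alpha>) \<psi> * V_norm L \<alpha> u)"
begin

lemma \<alpha>_nonneg [simp]: "0 \<le> \<alpha>" "0 \<le> 1 + \<alpha>"
  using \<alpha> by auto

definition rate :: "int ^ 3 \<Rightarrow> real" where
  "rate k = \<nu> * (kap L k)\<^sup>2"

lemma rate_pos: "k \<noteq> 0 \<Longrightarrow> 0 < rate k" and rate_nonneg [simp]: "0 \<le> rate k"
  using kap_pos[OF L, of k] \<nu> by (auto simp: rate_def)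

lemma L2_fun_integrable: "\<psi> \<in> L2_fun L \<mu> s \<Longrightarrow> integrable (Leb \<mu>) (\<lambda>t. (V_norm L s (\<psi> t))\<^sup>2)"
  by (simp add: L2_fun_def)

lemma L2_fun_modes: "\<psi> \<in> L2_fun L \<mu> (1 + \<alpha>) \<Longrightarrow> modes_measurable \<mu> \<psi>"
  using modes_measurable_if_strongly_measurable[OF L, of "1 + \<alpha>"] by (simp add: L2_fun_def)

lemma AE_Leb_mem: "AE t in Leb \<mu>. t \<in> {0..\<mu>}"
  using AE_space[of "Leb \<mu>"] by simp

lemma nl_0 [simp]: "nl L \<psi> u 0 = 0"
  by (simp add: nl_def adv_def cscale_def zero_vec_def[symmetric])

lemma forcing_nl:
  assumes \<psi>: "\<psi> \<in> L2_fun L \<mu> (1 + \<alpha>)" and m: "modes_measurable \<mu> u"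
    and u: "\<And>t. t \<in> {0..\<mu>} \<Longrightarrow> u t \<in> V L \<alpha> \<and> V_norm L \<alpha> (u t) \<le> S"
  shows "forcing L \<mu> (\<alpha> - 1) (\<lambda>t. nl L (\<psi> t) (u t)) (\<lambda>t. (K * S)\<^sup>2 * (V_norm L (1 + \<alpha>) (\<psi> t))\<^sup>2)"
  unfolding forcing_def
proof (intro conjI)
  have ae: "AE t in Leb \<mu>. \<psi> t \<in> V L (1 + \<alpha>) \<and> t \<in> {0..\<mu>}"
    using L2_fun_AE[OF \<psi>] AE_Leb_mem by eventually_elim auto
  then have "AE t in Leb \<mu>. conv_summable (\<psi> t) (u t)"
    by eventually_elim (use nl_bound u in blast)
  then show "modes_measurable \<mu> (\<lambda>t. nl L (\<psi> t) (u t))"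
    by (rule measurable_nl[OF L2_fun_modes[OF \<psi>] m])
  show "integrable (Leb \<mu>) (\<lambda>t. (K * S)\<^sup>2 * (V_norm L (1 + \<alpha>) (\<psi> t))\<^sup>2)"
    using L2_fun_integrable[OF \<psi>] by simp
  show "AE t in Leb \<mu>. nl L (\<psi> t) (u t) \<in> wl2 (sob L (\<alpha> - 1)) \<and>
      (V_norm L (\<alpha> - 1) (nl L (\<psi> t) (u t)))\<^sup>2 \<le> (K * S)\<^sup>2 * (V_norm L (1 + \<alpha>) (\<psi> t))\<^sup>2 \<and>
      nl L (\<psi> t) (u t) 0 = 0"
    using ae
  proof eventually_elim
    case (elim t)
    have b: "V_norm L (\<alpha> - 1) (nl L (\<psi> t) (u t)) \<le> K * (V_norm L (1 + \<alpha>) (\<psi> t) * V_norm L \<alpha> (u t))"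
      "nl L (\<psi> t) (u t) \<in> wl2 (sob L (\<alpha> - 1))"
      using nl_bound elim u by blast+
    have "V_norm L (1 + \<alpha>) (\<psi> t) * V_norm L \<alpha> (u t) \<le> V_norm L (1 + \<alpha>) (\<psi> t) * S"
      using u elim L by (intro mult_left_mono) auto
    then have "K * (V_norm L (1 + \<alpha>) (\<psi> t) * V_norm L \<alpha> (u t)) \<le> K * (V_norm L (1 + \<alpha>) (\<psi> t) * S)"
      by (rule mult_left_mono) (use K in simp)
    with b(1) have "V_norm L (\<alpha> - 1) (nl L (\<psi> t) (u t)) \<le> (K * S) * V_norm L (1 + \<alpha>) (\<psi> t)"
      by (simp add: mult_ac)
    then have "(V_norm L (\<alpha> - 1) (nl L (\<psi> t) (u t)))\<^sup>2 \<le> ((K * S) * V_norm L (1 + \<alpha>) (\<psi> t))\<^sup>2"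
      using L by (intro power_mono) auto
    then show ?case using b(2) by (simp add: power_mult_distrib)
  qed
qed

lemma f_wl2: "f \<in> wl2 (sob L (\<alpha> - 1))" and f_0 [simp]: "f 0 = 0"
  using wl2_weaken[OF L _ V_wl2[OF L _ f], of "\<alpha> - 1"] adm_0[OF V_adm[OF f]] by auto

lemma forcing_const: 
  assumes "c \<in> wl2 (sob L s)" "c 0 = 0"
  shows "forcing L \<mu> s (\<lambda>t. c) (\<lambda>t. (V_norm L s c)\<^sup>2)"
proof -
  interpret finite_measure "Leb \<mu>" by (rule finite_measure_Leb)
  show ?thesis using assms by (simp add: forcing_def modes_measurable_def)
qed

definition rhs :: "(real \<Rightarrow> coeffs) \<Rightarrow> (real \<Rightarrow> coeffs) \<Rightarrow> real \<Rightarrow> coeffs" where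
  "rhs \<psi> u t = f - nl L (\<psi> t) (u t)"

lemma rhs_0 [simp]: "rhs \<psi> u t 0 = 0"
  by (simp add: rhs_def)

lemma cdot_rhs [simp]: "cdot (wave L k) (rhs \<psi> u t k) = 0"
  using V_adm[OF f] by (simp add: rhs_def cdot_diff nl_def adm_iff)

lemma forcing_rhs:
  assumes "\<psi> \<in> L2_fun L \<mu> (1 + \<alpha>)" "modes_measurable \<mu> u"
    and "\<And>t. t \<in> {0..\<mu>} \<Longrightarrow> u t \<in> V L \<alpha> \<and> V_norm L \<alpha> (u t) \<le> S"
  shows "forcing L \<mu> (\<alpha> - 1) (rhs \<psi> u)
    (\<lambda>t. 2 * (V_norm L (\<alpha> - 1) f)\<^sup>2 + 2 * ((K * S)\<^sup>2 * (V_norm L (1 + \<alpha>) (\<psi> t))\<^sup>2))"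
  unfolding rhs_def by (rule forcing_diff[OF L forcing_const[OF f_wl2 f_0] forcing_nl[OF assms]])

text \<open>
  Duhamel's formula in every mode. The right-hand side contains the unknown through the nonlinear
  term, so this is an integral equation.
\<close>

definition mild :: "(real \<Rightarrow> coeffs) \<Rightarrow> coeffs \<Rightarrow> (real \<Rightarrow> coeffs) \<Rightarrow> bool" where
  "mild \<psi> u0 u \<longleftrightarrow> (\<forall>k. \<forall>t\<in>{0..\<mu>}.
     u t k = exp (- rate k * t) *\<^sub>R u0 k + duh \<mu> (rate k) (\<lambda>s. rhs \<psi> u s k) t)"

text \<open>A real divergence-free field with a single pair of modes.\<close>

definition single :: "int ^ 3 \<Rightarrow> complex ^ 3 \<Rightarrow> coeffs" where
  "single k z m = (if m = k then z else if m = - k then vcnj z else 0)"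

lemma k_neq_uminus: "k \<noteq> 0 \<Longrightarrow> k \<noteq> - (k :: int ^ 3)"
  by (auto simp: vec_eq_iff)

lemma single_V:
  assumes k: "k \<noteq> 0" and z: "cdot (wave L k) z = 0" and s: "0 \<le> s"
  shows "single k z \<in> V L s"
proof -
  have "(\<lambda>m. (sob L s m * norm (single k z m))\<^sup>2) summable_on UNIV"
    by (rule finite_nonzero_values_imp_summable_on, rule finite_subset[of _ "{k, - k}"])
      (auto simp: single_def split: if_splits)
  moreover have "single k z \<in> adm L"
    unfolding adm_iff using k k_neq_uminus[OF k] z by (auto simp: single_def)
  ultimately show ?thesis using L s by (simp add: V_eq wl2_def)
qed

lemma pairing_single:
  assumes k: "k \<noteq> 0" and x: "x (- k) = vcnj (x k)"
  shows "pairing L x (single k z) = 2 * L ^ 3 * inner (x k) z"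
proof -
  have "(\<Sum>\<^sub>\<infinity>m. inner (x m) (single k z m)) = (\<Sum>\<^sub>\<infinity>m\<in>{k, - k}. inner (x m) (single k z m))"
    by (rule infsum_cong_neutral) (auto simp: single_def)
  also have "\<dots> = inner (x k) z + inner (x (- k)) (vcnj z)"
    using k_neq_uminus[OF k] by (simp add: single_def)
  also have "\<dots> = 2 * inner (x k) z" by (simp add: x)
  finally show ?thesis by (simp add: pairing_eq)
qed

lemma trilinear_eq:
  "\<psi> \<in> V L (1 + \<alpha>) \<Longrightarrow> u \<in> V L \<alpha> \<Longrightarrow> v \<in> V L (1 + \<alpha>) \<Longrightarrow> trilinear L \<psi> u v = pairing L (nl L \<psi> u) v"
  by (rule trilinear_eq_pairing_nl[OF L \<alpha>])

lemma real_modes: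
  assumes "\<psi> \<in> V L (1 + \<alpha>)" "u \<in> V L \<alpha>"
  shows "nl L \<psi> u (- k) = vcnj (nl L \<psi> u k)" "u (- k) = vcnj (u k)" "stokes L u (- k) = vcnj (stokes L u k)"
    "f (- k) = vcnj (f k)"
proof -
  have "nl L \<psi> u \<in> adm L" using nl_bound[OF assms] assms V_adm by (intro nl_adm) auto
  then show "nl L \<psi> u (- k) = vcnj (nl L \<psi> u k)" by (simp add: adm_iff)
  show u: "u (- k) = vcnj (u k)" using V_adm[OF assms(2)] by (simp add: adm_iff)
  show "stokes L u (- k) = vcnj (stokes L u k)"
    using linear_scale[OF linear_vcnj] by (simp add: stokes_def u)
  show "f (- k) = vcnj (f k)" using V_adm[OF f] by (simp add: adm_iff)
qed

text \<open>
  Testing with a single pair of modes decouples the weak formulation into scalar equations.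
\<close>

theorem weak_solution_imp_mild:
  assumes \<psi>: "\<psi> \<in> L2_fun L \<mu> (1 + \<alpha>)" and w: "weak_solution L \<mu> \<alpha> \<nu> f \<psi> u0 u"
  shows "mild \<psi> u0 u"
  unfolding mild_def
proof (intro allI ballI)
  fix k t assume t: "t \<in> {0..\<mu>}"
  have u: "u \<in> C_fun L \<mu> \<alpha>" and u0: "u 0 = u0" using w by (auto simp: weak_solution_def)
  have uV: "u t \<in> V L \<alpha>" if "t \<in> {0..\<mu>}" for t using u that by (simp add: C_fun_def)
  obtain S where S: "0 \<le> S" "\<And>t. t \<in> {0..\<mu>} \<Longrightarrow> V_norm L \<alpha> (u t) \<le> S"
    by (rule C_fun_bounded[OF L \<alpha>_nonneg(1) u]) (rule that)
  note frc = forcing_rhs[OF \<psi> C_fun_modes_measurable[OF L \<alpha>_nonneg(1) u], of S]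
  have ir: "integrable (Leb \<mu>) (\<lambda>s. rhs \<psi> u s k)"
    by (rule forcing_integrable[OF L frc]) (use S uV in auto)
  show "u t k = exp (- rate k * t) *\<^sub>R u0 k + duh \<mu> (rate k) (\<lambda>s. rhs \<psi> u s k) t"
  proof (cases "k = 0")
    case True
    have "u t 0 = 0" "u0 0 = 0" using adm_0[OF V_adm[OF uV]] t u0 \<mu> by auto
    then show ?thesis using True by (simp add: duh_def)
  next
    case False
    define y where "y = exp (- rate k * t) *\<^sub>R u0 k + duh \<mu> (rate k) (\<lambda>s. rhs \<psi> u s k) t"
    \<comment> \<open>Test fields are divergence-free, so only directions orthogonal to the wave vector are tested;
      the difference of both sides is itself such a direction.\<close>
    have key: "inner (u t k) z = inner y z" if z: "cdot (wave L k) z = 0" for z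
    proof -
      define a where "a = (\<lambda>t. inner (u t k) z)"
      define g where "g = (\<lambda>t. inner (rhs \<psi> u t k) z)"
      have a: "continuous_on {0..\<mu>} a"
        unfolding a_def by (intro continuous_intros C_fun_modes_continuous[OF L \<alpha>_nonneg(1) u])
      have g: "integrable (Leb \<mu>) g" unfolding g_def using ir by auto
      have vV: "single k z \<in> V L (1 + \<alpha>)" by (rule single_V[OF False z]) simp
      have "a t = exp (- rate k * t) * a 0 + duh \<mu> (rate k) g t"
      proof (rule weak_imp_duhamel[OF \<mu> a g _ t])
        fix \<phi> assume \<phi>: "test_function \<mu> \<phi>"
        have c: "continuous_on {0..\<mu>} \<phi>" "continuous_on {0..\<mu>} (deriv \<phi>)"
          by (rule test_function_continuous[OF \<phi>])+
        obtain B where B: "\<forall>y\<in>\<phi> ` {0..\<mu>}. norm y \<le> B"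
          using compact_imp_bounded[OF compact_continuous_image[OF c(1)]] unfolding bounded_iff by auto
        have ig: "integrable (Leb \<mu>) (\<lambda>t. g t * \<phi> t)"
          using integrable_bounded_scaleR[where K = B, OF g continuous_imp_measurable_Leb[OF c(1)]] B
          by (auto simp: mult.commute)
        have ia: "integrable (Leb \<mu>) (\<lambda>t. - a t * deriv \<phi> t + rate k * a t * \<phi> t)"
          by (intro continuous_imp_integrable_Leb continuous_intros a c)
        have i\<phi>: "integrable (Leb \<mu>) (\<lambda>t. inner (f k) z * \<phi> t)"
          by (intro continuous_imp_integrable_Leb continuous_intros c)
        define A where "A = (\<lambda>t. - a t * deriv \<phi> t + rate k * a t * \<phi> t - g t * \<phi> t + inner (f k) z * \<phi> t)"
        have iA: "integrable (Leb \<mu>) A" unfolding A_def using ia ig i\<phi> by simp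
        have ae: "AE t in Leb \<mu>. 2 * L ^ 3 * A t = - pairing L (u t) (single k z) * deriv \<phi> t
            + (\<nu> * pairing L (stokes L (u t)) (single k z) + trilinear L (\<psi> t) (u t) (single k z)) * \<phi> t"
          using L2_fun_AE[OF \<psi>] AE_Leb_mem
        proof eventually_elim
          case (elim t)
          note r = real_modes[OF elim(1) uV[OF elim(2)]]
          show ?case
            unfolding trilinear_eq[OF elim(1) uV[OF elim(2)] vV]
              pairing_single[where x = "nl L (\<psi> t) (u t)", OF False r(1)]
              pairing_single[where x = "u t", OF False r(2)] pairing_single[where x = "stokes L (u t)", OF False r(3)]
            by (simp add: A_def a_def g_def rhs_def rate_def stokes_def inner_diff_left algebra_simps)
        qed
        have "2 * L ^ 3 * (LINT t|Leb \<mu>. A t) = (LINT t|Leb \<mu>. 2 * L ^ 3 * A t)" by simp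
        also have "\<dots> = (LINT t|Leb \<mu>. - pairing L (u t) (single k z) * deriv \<phi> t
            + (\<nu> * pairing L (stokes L (u t)) (single k z) + trilinear L (\<psi> t) (u t) (single k z)) * \<phi> t)"
          using iA measurable_Leb_AE[OF _ ae] by (intro integral_cong_AE ae) auto
        also have "\<dots> = (LINT t|Leb \<mu>. pairing L f (single k z) * \<phi> t)"
          using w vV \<phi> by (simp add: weak_solution_def)
        also have "\<dots> = 2 * L ^ 3 * (LINT t|Leb \<mu>. inner (f k) z * \<phi> t)"
          using pairing_single[OF False, of f z] V_adm[OF f] by (simp add: adm_iff)
        finally have "(LINT t|Leb \<mu>. A t) = (LINT t|Leb \<mu>. inner (f k) z * \<phi> t)" using L by simp
        then have "(LINT t|Leb \<mu>. A t - inner (f k) z * \<phi> t) = 0" using iA i\<phi> by simp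
        then show "(LINT t|Leb \<mu>. - a t * deriv \<phi> t + (rate k * a t - g t) * \<phi> t) = 0"
          by (simp add: A_def algebra_simps)
      qed
      moreover have "duh \<mu> (rate k) g t = inner (duh \<mu> (rate k) (\<lambda>s. rhs \<psi> u s k) t) z"
        unfolding g_def by (rule duh_bounded_linear[OF bounded_linear_inner_left ir, symmetric])
      ultimately show ?thesis by (simp add: a_def y_def u0 inner_add_left)
    qed
    have "cdot (wave L k) (u t k) = 0" "cdot (wave L k) (u0 k) = 0"
      using V_adm[OF uV] t u0 \<mu> by (auto simp: adm_iff)
    moreover have "cdot (wave L k) (duh \<mu> (rate k) (\<lambda>s. rhs \<psi> u s k) t) = 0"
      unfolding duh_bounded_linear[OF bounded_linear_cdot ir] by (simp add: duh_def)
    ultimately have "cdot (wave L k) (u t k - y) = 0"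
      by (simp add: y_def cdot_add cdot_diff cdot_scaleR)
    from key[OF this] have "inner (u t k - y) (u t k - y) = 0" by (simp add: inner_diff_left)
    then show ?thesis by (simp add: y_def)
  qed
qed

text \<open>
  Conversely the modewise equations are summed; the sums converge dominatedly because the test
  field pairs with every term by duality of the orders \<open>\<alpha> - 1\<close> and \<open>1 - \<alpha>\<close>.
\<close>

theorem mild_imp_weak_solution:
  assumes \<psi>: "\<psi> \<in> L2_fun L \<mu> (1 + \<alpha>)" and u: "u \<in> C_fun L \<mu> \<alpha>" "u \<in> L2_fun L \<mu> (1 + \<alpha>)"
    and u0: "u 0 = u0" and m: "mild \<psi> u0 u"
  shows "weak_solution L \<mu> \<alpha> \<nu> f \<psi> u0 u"
  unfolding weak_solution_def
proof (intro conjI ballI allI impI)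
  show "u \<in> C_fun L \<mu> \<alpha> \<inter> L2_fun L \<mu> (1 + \<alpha>)" "u 0 = u0" using u u0 by auto
  fix v \<phi> assume v: "v \<in> V L (1 + \<alpha>)" and \<phi>: "test_function \<mu> \<phi>"
  have uV: "u t \<in> V L \<alpha>" if "t \<in> {0..\<mu>}" for t using u that by (simp add: C_fun_def)
  obtain S where S: "0 \<le> S" "\<And>t. t \<in> {0..\<mu>} \<Longrightarrow> V_norm L \<alpha> (u t) \<le> S"
    by (rule C_fun_bounded[OF L \<alpha>_nonneg(1) u(1)]) (rule that)
  define \<Gamma> where "\<Gamma> = (\<lambda>t. 2 * (V_norm L (\<alpha> - 1) f)\<^sup>2 + 2 * ((K * S)\<^sup>2 * (V_norm L (1 + \<alpha>) (\<psi> t))\<^sup>2))"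
  have frc: "forcing L \<mu> (\<alpha> - 1) (rhs \<psi> u) \<Gamma>" unfolding \<Gamma>_def
    by (rule forcing_rhs[OF \<psi> C_fun_modes_measurable[OF L \<alpha>_nonneg(1) u(1)], of S]) (use S uV in auto)
  have ir: "integrable (Leb \<mu>) (\<lambda>s. rhs \<psi> u s k)" for k by (rule forcing_integrable[OF L frc])
  have c: "continuous_on {0..\<mu>} \<phi>" "continuous_on {0..\<mu>} (deriv \<phi>)"
    by (rule test_function_continuous[OF \<phi>])+
  obtain B where B: "\<forall>y\<in>\<phi> ` {0..\<mu>}. norm y \<le> B"
    using compact_imp_bounded[OF compact_continuous_image[OF c(1)]] unfolding bounded_iff by auto
  obtain B' where B': "\<forall>y\<in>deriv \<phi> ` {0..\<mu>}. norm y \<le> B'"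
    using compact_imp_bounded[OF compact_continuous_image[OF c(2)]] unfolding bounded_iff by auto
  define e where "e = (\<lambda>k t. - inner (u t k) (v k) * deriv \<phi> t
      + (rate k * inner (u t k) (v k) - inner (rhs \<psi> u t k) (v k)) * \<phi> t)"
  have ig: "integrable (Leb \<mu>) (\<lambda>t. inner (rhs \<psi> u t k) (v k) * \<phi> t)" for k
    using integrable_bounded_scaleR[where K = B, OF _ continuous_imp_measurable_Leb[OF c(1)],
        of "\<lambda>t. inner (rhs \<psi> u t k) (v k)"] B ir[of k]
    by (auto simp: mult.commute)
  have ie: "integrable (Leb \<mu>) (e k)" for k
  proof -
    have "integrable (Leb \<mu>) (\<lambda>t. (- inner (u t k) (v k) * deriv \<phi> t + rate k * inner (u t k) (v k) * \<phi> t)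
        - inner (rhs \<psi> u t k) (v k) * \<phi> t)"
      by (intro Bochner_Integration.integrable_diff ig continuous_imp_integrable_Leb continuous_intros c
          C_fun_modes_continuous[OF L \<alpha>_nonneg(1) u(1)])
    then show ?thesis by (simp add: e_def algebra_simps)
  qed
  have e0: "(LINT t|Leb \<mu>. e k t) = 0" for k
    unfolding e_def
  proof (rule duhamel_imp_weak[OF \<mu> _ _ \<phi>])
    show "integrable (Leb \<mu>) (\<lambda>t. inner (rhs \<psi> u t k) (v k))" using ir by auto
    fix t assume "t \<in> {0..\<mu>}"
    then have "u t k = exp (- rate k * t) *\<^sub>R u0 k + duh \<mu> (rate k) (\<lambda>s. rhs \<psi> u s k) t"
      using m by (simp add: mild_def)
    then show "inner (u t k) (v k) = exp (- rate k * t) * inner (u0 k) (v k)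
        + duh \<mu> (rate k) (\<lambda>t. inner (rhs \<psi> u t k) (v k)) t"
      using duh_bounded_linear[OF bounded_linear_inner_left[of "v k"] ir[of k], where r = "rate k" and t = t]
      by (simp add: inner_add_left)
  qed
  define Nv where "Nv = wnorm (sob L (1 - \<alpha>)) v"
  have v': "v \<in> wl2 (sob L (- (\<alpha> - 1)))" and v0: "v 0 = 0"
    using wl2_weaken[OF L _ V_wl2[OF L \<alpha>_nonneg(2) v], of "1 - \<alpha>"] adm_0[OF V_adm[OF v]] \<alpha> by auto
  define Y where "Y = (\<lambda>t k. B' * norm (u t k) + B * (norm (\<nu> *\<^sub>R stokes L (u t) k) + norm (rhs \<psi> u t k)))"
  have "norm (\<phi> 0) \<le> B" "norm (deriv \<phi> 0) \<le> B'" using B B' \<mu> by auto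
  then have B0: "0 \<le> B" "0 \<le> B'" using norm_ge_zero order_trans by blast+
  have eY: "norm (e k t) \<le> Y t k * norm (v k)" if t: "t \<in> {0..\<mu>}" for k t
  proof -
    have 1: "\<bar>inner (u t k) (v k) * deriv \<phi> t\<bar> \<le> norm (u t k) * norm (v k) * B'"
      unfolding abs_mult using B' t by (intro mult_mono Cauchy_Schwarz_ineq2) auto
    have 2: "\<bar>inner (\<nu> *\<^sub>R stokes L (u t) k) (v k) * \<phi> t\<bar> \<le> norm (\<nu> *\<^sub>R stokes L (u t) k) * norm (v k) * B"
      unfolding abs_mult using B t by (intro mult_mono Cauchy_Schwarz_ineq2) auto
    have 3: "\<bar>inner (rhs \<psi> u t k) (v k) * \<phi> t\<bar> \<le> norm (rhs \<psi> u t k) * norm (v k) * B"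
      unfolding abs_mult using B t by (intro mult_mono Cauchy_Schwarz_ineq2) auto
    have "e k t = - (inner (u t k) (v k) * deriv \<phi> t) + (inner (\<nu> *\<^sub>R stokes L (u t) k) (v k) * \<phi> t)
        - inner (rhs \<psi> u t k) (v k) * \<phi> t"
      by (simp add: e_def rate_def stokes_def algebra_simps)
    also have "\<bar>\<dots>\<bar> \<le> norm (u t k) * norm (v k) * B' + norm (\<nu> *\<^sub>R stokes L (u t) k) * norm (v k) * B + norm (rhs \<psi> u t k) * norm (v k) * B"
      using 1 2 3 by linarith
    also have "\<dots> = Y t k * norm (v k)" by (simp add: Y_def algebra_simps)
    finally show ?thesis by simp
  qed
  define W where "W = (\<lambda>t. B' * wnorm (sob L (\<alpha> - 1)) (u t) + B * (\<nu> * wnorm (sob L (1 + \<alpha>)) (u t) + wnorm (sob L (\<alpha> - 1)) (rhs \<psi> u t)))"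
  have dom: "AE t in Leb \<mu>. t \<in> {0..\<mu>} \<and> \<psi> t \<in> V L (1 + \<alpha>) \<and> u t \<in> V L (1 + \<alpha>) \<and>
      rhs \<psi> u t \<in> wl2 (sob L (\<alpha> - 1)) \<and> (V_norm L (\<alpha> - 1) (rhs \<psi> u t))\<^sup>2 \<le> \<Gamma> t"
  proof -
    have "AE t in Leb \<mu>. rhs \<psi> u t \<in> wl2 (sob L (\<alpha> - 1)) \<and> (V_norm L (\<alpha> - 1) (rhs \<psi> u t))\<^sup>2 \<le> \<Gamma> t \<and> rhs \<psi> u t 0 = 0"
      using frc by (simp only: forcing_def)
    then show ?thesis
      using AE_Leb_mem L2_fun_AE[OF \<psi>] L2_fun_AE[OF u(2)] by eventually_elim auto
  qed
  have stokes_w: "(\<lambda>k. \<nu> *\<^sub>R stokes L (u t) k) \<in> wl2 (sob L (\<alpha> - 1))"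
      "wnorm (sob L (\<alpha> - 1)) (\<lambda>k. \<nu> *\<^sub>R stokes L (u t) k) \<le> \<nu> * wnorm (sob L (1 + \<alpha>)) (u t)"
    if "u t \<in> V L (1 + \<alpha>)" for t
  proof -
    have le: "\<bar>sob L (\<alpha> - 1) k * norm (\<nu> *\<^sub>R stokes L (u t) k)\<bar> \<le> \<nu> * \<bar>sob L (1 + \<alpha>) k * norm (u t k)\<bar>" for k
      using \<nu> by (simp add: stokes_def abs_mult sob_shift(2)[OF L])
    show "(\<lambda>k. \<nu> *\<^sub>R stokes L (u t) k) \<in> wl2 (sob L (\<alpha> - 1))"
      by (rule wl2_mono[OF V_wl2[OF L _ that] le]) (use \<nu> in auto)
    show "wnorm (sob L (\<alpha> - 1)) (\<lambda>k. \<nu> *\<^sub>R stokes L (u t) k) \<le> \<nu> * wnorm (sob L (1 + \<alpha>)) (u t)"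
      by (rule wnorm_mono[OF V_wl2[OF L _ that] le]) (use \<nu> in auto)
  qed
  have sumW: "(\<Sum>k\<in>F. norm (e k t)) \<le> W t * Nv"
    if F: "finite F" and t: "t \<in> {0..\<mu>}" "u t \<in> V L (1 + \<alpha>)" "rhs \<psi> u t \<in> wl2 (sob L (\<alpha> - 1))" for F t
  proof -
    have u': "u t \<in> wl2 (sob L (\<alpha> - 1))" by (rule wl2_weaken[OF L _ V_wl2[OF L _ t(2)]]) auto
    have "(\<Sum>k\<in>F. norm (e k t)) \<le> (\<Sum>k\<in>F. Y t k * norm (v k))"
      by (intro sum_mono eY t)
    also have "\<dots> = B' * (\<Sum>k\<in>F. norm (u t k) * norm (v k))
        + B * ((\<Sum>k\<in>F. norm (\<nu> *\<^sub>R stokes L (u t) k) * norm (v k)) + (\<Sum>k\<in>F. norm (rhs \<psi> u t k) * norm (v k)))"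
      by (simp add: Y_def sum_distrib_left sum.distrib algebra_simps)
    also have "\<dots> \<le> B' * (wnorm (sob L (\<alpha> - 1)) (u t) * Nv)
        + B * ((\<nu> * wnorm (sob L (1 + \<alpha>)) (u t)) * Nv + wnorm (sob L (\<alpha> - 1)) (rhs \<psi> u t) * Nv)"
    proof (intro add_mono mult_left_mono B0)
      have n: "wnorm (sob L (- (\<alpha> - 1))) v = Nv" by (simp add: Nv_def)
      show "(\<Sum>k\<in>F. norm (u t k) * norm (v k)) \<le> wnorm (sob L (\<alpha> - 1)) (u t) * Nv"
        using sum_dual_le[OF L u' v' _ F] v0 n by simp
      show "(\<Sum>k\<in>F. norm (rhs \<psi> u t k) * norm (v k)) \<le> wnorm (sob L (\<alpha> - 1)) (rhs \<psi> u t) * Nv"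
        using sum_dual_le[OF L t(3) v' _ F] v0 n by simp
      have "(\<Sum>k\<in>F. norm (\<nu> *\<^sub>R stokes L (u t) k) * norm (v k)) \<le> wnorm (sob L (\<alpha> - 1)) (\<lambda>k. \<nu> *\<^sub>R stokes L (u t) k) * Nv"
        using sum_dual_le[OF L stokes_w(1)[OF t(2)] v' _ F] v0 n by simp
      also have "\<dots> \<le> (\<nu> * wnorm (sob L (1 + \<alpha>)) (u t)) * Nv"
        by (intro mult_right_mono stokes_w t) (simp add: Nv_def)
      finally show "(\<Sum>k\<in>F. norm (\<nu> *\<^sub>R stokes L (u t) k) * norm (v k)) \<le> (\<nu> * wnorm (sob L (1 + \<alpha>)) (u t)) * Nv" .
    qed
    also have "\<dots> = W t * Nv" by (simp add: W_def algebra_simps)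
    finally show ?thesis .
  qed
  \<comment> \<open>The dominating function \<open>W\<close> is linear in norms of which only the squares are known to be
    integrable; on the finite interval \<open>x \<le> 1 + x\<^sup>2\<close> suffices.\<close>
  define c1 where "c1 = (2 * pi / L) powr (\<alpha> - 1 - (1 + \<alpha>))"
  define D where "D = (\<lambda>t. (B' * c1 + B * \<nu>) * (1 + (V_norm L (1 + \<alpha>) (u t))\<^sup>2 / L ^ 3) + B * (1 + \<Gamma> t / L ^ 3))"
  have iD: "integrable (Leb \<mu>) D"
  proof -
    interpret finite_measure "Leb \<mu>" by (rule finite_measure_Leb)
    have "integrable (Leb \<mu>) \<Gamma>" using frc by (simp add: forcing_def)
    then show ?thesis unfolding D_def using L2_fun_integrable[OF u(2)] by simp
  qed
  have WD: "W t \<le> D t" if t: "u t \<in> V L (1 + \<alpha>)" "(V_norm L (\<alpha> - 1) (rhs \<psi> u t))\<^sup>2 \<le> \<Gamma> t" for t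
  proof -
    have sq: "x \<le> 1 + x\<^sup>2" for x :: real
    proof -
      have "0 \<le> (x - 1)\<^sup>2 + x\<^sup>2" by simp
      then have "2 * x \<le> 1 + 2 * x\<^sup>2" by (simp add: power2_diff)
      then show ?thesis by linarith
    qed
    have a: "wnorm (sob L (1 + \<alpha>)) (u t) \<le> 1 + (V_norm L (1 + \<alpha>) (u t))\<^sup>2 / L ^ 3"
      using sq[of "wnorm (sob L (1 + \<alpha>)) (u t)"] L by (simp add: V_norm_power2)
    have "wnorm (sob L (\<alpha> - 1)) (rhs \<psi> u t) \<le> 1 + (V_norm L (\<alpha> - 1) (rhs \<psi> u t))\<^sup>2 / L ^ 3"
      using sq[of "wnorm (sob L (\<alpha> - 1)) (rhs \<psi> u t)"] L by (simp add: V_norm_power2)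
    also have "\<dots> \<le> 1 + \<Gamma> t / L ^ 3" using t L by (simp add: divide_right_mono)
    finally have b: "wnorm (sob L (\<alpha> - 1)) (rhs \<psi> u t) \<le> 1 + \<Gamma> t / L ^ 3" .
    have "wnorm (sob L (\<alpha> - 1)) (u t) \<le> c1 * wnorm (sob L (1 + \<alpha>)) (u t)"
    proof (rule wnorm_mono[OF V_wl2[OF L _ t(1)]])
      show "\<bar>sob L (\<alpha> - 1) k * norm (u t k)\<bar> \<le> c1 * \<bar>sob L (1 + \<alpha>) k * norm (u t k)\<bar>" for k
        using mult_right_mono[OF sob_weaken[OF L, of "\<alpha> - 1" "1 + \<alpha>" k], of "norm (u t k)"] by (simp add: c1_def mult.assoc)
    qed (auto simp: c1_def)
    also have "\<dots> \<le> c1 * (1 + (V_norm L (1 + \<alpha>) (u t))\<^sup>2 / L ^ 3)"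
      by (intro mult_left_mono a) (simp add: c1_def)
    finally have "W t \<le> B' * (c1 * (1 + (V_norm L (1 + \<alpha>) (u t))\<^sup>2 / L ^ 3))
        + B * (\<nu> * (1 + (V_norm L (1 + \<alpha>) (u t))\<^sup>2 / L ^ 3) + (1 + \<Gamma> t / L ^ 3))"
      unfolding W_def using a b \<nu> B0 by (intro add_mono mult_left_mono) auto
    also have "\<dots> = D t" by (simp add: D_def algebra_simps add_divide_distrib)
    finally show ?thesis .
  qed
  have Nv0: "0 \<le> Nv" by (simp add: Nv_def)
  define E where "E = (\<lambda>t. \<Sum>\<^sub>\<infinity>k. e k t)"
  have abs_e: "(\<lambda>k. norm (e k t)) summable_on UNIV"
    if "t \<in> {0..\<mu>}" "u t \<in> V L (1 + \<alpha>)" "rhs \<psi> u t \<in> wl2 (sob L (\<alpha> - 1))" for t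
    using sumW[OF _ that] by (intro nonneg_bdd_above_summable_on bdd_aboveI2[where M = "W t * Nv"]) auto
  have limE: "AE t in Leb \<mu>. (\<lambda>N. \<Sum>k\<in>kbox N. e k t) \<longlonglongrightarrow> E t"
    using dom
  proof eventually_elim
    case (elim t)
    have "(\<lambda>k. e k t) summable_on UNIV" by (rule abs_summable_summable) (use abs_e elim in blast)
    then show ?case unfolding E_def by (rule filterlim_compose[OF infsum_tendsto filterlim_kbox])
  qed
  have mE: "E \<in> borel_measurable (Leb \<mu>)"
    by (rule measurable_Leb_AE_limit[OF _ limE]) (use ie in \<open>auto intro!: borel_measurable_sum\<close>)
  have domE: "AE t in Leb \<mu>. norm (\<Sum>k\<in>kbox N. e k t) \<le> D t * Nv" for N
    using dom
  proof eventually_elim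
    case (elim t)
    have "norm (\<Sum>k\<in>kbox N. e k t) \<le> (\<Sum>k\<in>kbox N. norm (e k t))" by (rule norm_sum)
    also have "\<dots> \<le> W t * Nv" using sumW[of "kbox N" t] elim by simp
    also have "\<dots> \<le> D t * Nv" using WD[of t] elim Nv0 by (intro mult_right_mono) auto
    finally show ?case .
  qed
  have iDN: "integrable (Leb \<mu>) (\<lambda>t. D t * Nv)" using iD by simp
  have mS: "(\<lambda>t. \<Sum>k\<in>kbox N. e k t) \<in> borel_measurable (Leb \<mu>)" for N
    using ie by (intro borel_measurable_sum) auto
  have iE: "integrable (Leb \<mu>) E"
    by (rule integrable_dominated_convergence[OF mE mS iDN limE domE])
  have "(\<lambda>N. LINT t|Leb \<mu>. (\<Sum>k\<in>kbox N. e k t)) \<longlonglongrightarrow> (LINT t|Leb \<mu>. E t)"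
    by (rule integral_dominated_convergence[OF mE mS iDN limE domE])
  moreover have "(LINT t|Leb \<mu>. (\<Sum>k\<in>kbox N. e k t)) = 0" for N
    using ie e0 by simp
  ultimately have E0: "(LINT t|Leb \<mu>. E t) = 0" by (simp add: LIMSEQ_const_iff)
  have i\<phi>: "integrable (Leb \<mu>) (\<lambda>t. pairing L f v * \<phi> t)"
    by (intro continuous_imp_integrable_Leb continuous_intros c)
  have ae: "AE t in Leb \<mu>. L ^ 3 * E t + pairing L f v * \<phi> t = - pairing L (u t) v * deriv \<phi> t
      + (\<nu> * pairing L (stokes L (u t)) v + trilinear L (\<psi> t) (u t) v) * \<phi> t"
    using dom
  proof eventually_elim
    case (elim t)
    have si: "(\<lambda>k. inner (x k) (v k)) summable_on UNIV" if "x \<in> wl2 (sob L (\<alpha> - 1))" for x :: coeffs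
    proof (rule abs_summable_summable, rule Infinite_Sum.abs_summable_on_comparison_test')
      show "(\<lambda>k. norm (x k) * norm (v k)) summable_on UNIV" by (rule dual_summable[OF L that v']) (simp add: v0)
    qed (simp add: Cauchy_Schwarz_ineq2)
    have "u t \<in> wl2 (sob L (1 + \<alpha>))" using elim V_wl2[OF L \<alpha>_nonneg(2)] by blast
    then have u': "u t \<in> wl2 (sob L (\<alpha> - 1))" by (rule wl2_weaken[OF L, rotated]) simp
    have st': "stokes L (u t) \<in> wl2 (sob L (\<alpha> - 1))"
    proof (rule wl2_mono[OF stokes_w(1)])
      show "\<bar>sob L (\<alpha> - 1) k * norm (stokes L (u t) k)\<bar> \<le> (1 / \<nu>) * \<bar>sob L (\<alpha> - 1) k * norm (\<nu> *\<^sub>R stokes L (u t) k)\<bar>" for k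
        using \<nu> by (simp add: abs_mult)
    qed (use elim \<nu> in auto)
    have n': "nl L (\<psi> t) (u t) \<in> wl2 (sob L (\<alpha> - 1))" using nl_bound uV elim by blast
    define p where "p = (\<lambda>x. \<Sum>\<^sub>\<infinity>k. inner (x k) (v k))"
    have hs: "((\<lambda>k. inner (x k) (v k)) has_sum p x) UNIV" if "x \<in> wl2 (sob L (\<alpha> - 1))" for x :: coeffs
      unfolding p_def by (rule has_sum_infsum[OF si[OF that]])
    have "((\<lambda>k. - deriv \<phi> t * inner (u t k) (v k) + (\<phi> t * \<nu> * inner (stokes L (u t) k) (v k)
        + (\<phi> t * inner (nl L (\<psi> t) (u t) k) (v k) + - \<phi> t * inner (f k) (v k)))) has_sum
        (- deriv \<phi> t * p (u t) + (\<phi> t * \<nu> * p (stokes L (u t)) + (\<phi> t * p (nl L (\<psi> t) (u t)) + - \<phi> t * p f)))) UNIV"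
      by (intro has_sum_add has_sum_cmult_right hs u' st' n' f_wl2)
    moreover have "(\<lambda>k. - deriv \<phi> t * inner (u t k) (v k) + (\<phi> t * \<nu> * inner (stokes L (u t) k) (v k)
        + (\<phi> t * inner (nl L (\<psi> t) (u t) k) (v k) + - \<phi> t * inner (f k) (v k)))) = (\<lambda>k. e k t)"
      by (simp add: fun_eq_iff e_def rhs_def rate_def stokes_def inner_diff_left algebra_simps)
    ultimately have Et: "E t = - deriv \<phi> t * p (u t) + (\<phi> t * \<nu> * p (stokes L (u t)) + (\<phi> t * p (nl L (\<psi> t) (u t)) + - \<phi> t * p f))"
      unfolding E_def by (simp add: infsumI)
    have pr: "pairing L x v = L ^ 3 * p x" for x by (simp add: pairing_eq p_def)
    have tri: "trilinear L (\<psi> t) (u t) v = pairing L (nl L (\<psi> t) (u t)) v"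
      using trilinear_eq uV elim v by blast
    show ?case unfolding tri pr Et by (simp add: algebra_simps)
  qed
  have "(LINT t|Leb \<mu>. L ^ 3 * E t + pairing L f v * \<phi> t) = (LINT t|Leb \<mu>. pairing L f v * \<phi> t)"
    using iE i\<phi> E0 by simp
  moreover have "(LINT t|Leb \<mu>. L ^ 3 * E t + pairing L f v * \<phi> t) = (LINT t|Leb \<mu>. - pairing L (u t) v * deriv \<phi> t
      + (\<nu> * pairing L (stokes L (u t)) v + trilinear L (\<psi> t) (u t) v) * \<phi> t)"
    using iE i\<phi> measurable_Leb_AE[OF _ ae] by (intro integral_cong_AE ae) auto
  ultimately show "(LINT t|Leb \<mu>. - pairing L (u t) v * deriv \<phi> t
      + (\<nu> * pairing L (stokes L (u t)) v + trilinear L (\<psi> t) (u t) v) * \<phi> t)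
      = (LINT t|Leb \<mu>. pairing L f v * \<phi> t)" by simp
qed

end

section \<open>Strong measurability of continuous curves\<close>

definition trunc :: "nat \<Rightarrow> coeffs \<Rightarrow> coeffs" where
  "trunc N u k = (if k \<in> kbox N then u k else 0)"

lemma trunc_V:
  assumes L: "0 < L" and s: "0 \<le> s" and u: "u \<in> adm L"
  shows "trunc N u \<in> V L s"
proof -
  have "(\<lambda>k. (sob L s k * norm (trunc N u k))\<^sup>2) summable_on UNIV"
    by (rule finite_nonzero_values_imp_summable_on, rule finite_subset[OF _ finite_kbox[of N]])
      (auto simp: trunc_def split: if_splits)
  moreover have "trunc N u \<in> adm L" using u by (auto simp: adm_iff trunc_def kbox_def)
  ultimately show ?thesis using L s by (simp add: V_eq wl2_def)
qed

lemma tendsto_trunc: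
  assumes L: "0 < L" and u: "u \<in> wl2 (sob L s)"
  shows "(\<lambda>N. V_norm L s (trunc N u - u)) \<longlonglongrightarrow> 0"
proof -
  define r where "r = (\<lambda>N. (wnorm (sob L s) u)\<^sup>2 - (\<Sum>k\<in>kbox N. (sob L s k * norm (u k))\<^sup>2))"
  have "(\<lambda>N. r N) \<longlonglongrightarrow> (wnorm (sob L s) u)\<^sup>2 - (wnorm (sob L s) u)\<^sup>2"
    unfolding r_def by (intro tendsto_diff tendsto_const tendsto_wnorm_power2 u)
  then have "(\<lambda>N. sqrt (L ^ 3) * sqrt (r N)) \<longlonglongrightarrow> sqrt (L ^ 3) * sqrt 0"
    by (intro tendsto_mult_left tendsto_real_sqrt) simp
  then have lim: "(\<lambda>N. sqrt (L ^ 3) * sqrt (r N)) \<longlonglongrightarrow> 0" by simp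
  have le: "V_norm L s (trunc N u - u) \<le> sqrt (L ^ 3) * sqrt (r N)" for N
  proof -
    have fs: "(\<Sum>k\<in>F. (sob L s k * norm ((trunc N u - u) k))\<^sup>2) \<le> r N" if F: "finite F" for F
    proof -
      have "(\<Sum>k\<in>F. (sob L s k * norm ((trunc N u - u) k))\<^sup>2) = (\<Sum>k\<in>F - kbox N. (sob L s k * norm (u k))\<^sup>2)"
        using F by (intro sum.mono_neutral_cong_right) (auto simp: trunc_def)
      also have "\<dots> = (\<Sum>k\<in>(F - kbox N) \<union> kbox N. (sob L s k * norm (u k))\<^sup>2) - (\<Sum>k\<in>kbox N. (sob L s k * norm (u k))\<^sup>2)"
        using F by (subst sum.union_disjoint) auto
      also have "\<dots> \<le> r N" unfolding r_def using F by (intro diff_right_mono finite_sum_le_wnorm u) auto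
      finally show ?thesis .
    qed
    have "(wnorm (sob L s) (trunc N u - u))\<^sup>2 \<le> r N" by (rule wnorm_le_if_finite_sums) (rule fs)
    then have "wnorm (sob L s) (trunc N u - u) \<le> sqrt (r N)" by (rule real_le_rsqrt)
    then show ?thesis using L by (simp add: V_norm_eq mult_left_mono)
  qed
  show ?thesis
    by (rule real_tendsto_sandwich[OF _ _ tendsto_const lim]) (use L le in auto)
qed

lemma V_norm_le_sum:
  assumes L: "0 < L" and z: "\<And>k. k \<notin> kbox N \<Longrightarrow> w k = 0"
  shows "V_norm L s w \<le> sqrt (L ^ 3) * (\<Sum>k\<in>kbox N. sob L s k * norm (w k))"
proof -
  have "(\<Sum>k\<in>F. (sob L s k * norm (w k))\<^sup>2) \<le> (\<Sum>k\<in>kbox N. sob L s k * norm (w k))\<^sup>2" if F: "finite F" for F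
  proof -
    have "(\<Sum>k\<in>F. (sob L s k * norm (w k))\<^sup>2) \<le> (\<Sum>k\<in>F \<union> kbox N. (sob L s k * norm (w k))\<^sup>2)"
      using F by (intro sum_mono2) auto
    also have "\<dots> = (\<Sum>k\<in>kbox N. (sob L s k * norm (w k))\<^sup>2)"
      using F z by (intro sum.mono_neutral_right) auto
    also have "\<dots> = (L2_set (\<lambda>k. sob L s k * norm (w k)) (kbox N))\<^sup>2"
      by (simp add: L2_set_def sum_nonneg)
    also have "\<dots> \<le> (\<Sum>k\<in>kbox N. sob L s k * norm (w k))\<^sup>2"
      by (intro power_mono L2_set_le_sum) auto
    finally show ?thesis .
  qed
  from wnorm_le_if_finite_sums[OF this]
  have "wnorm (sob L s) w \<le> (\<Sum>k\<in>kbox N. sob L s k * norm (w k))"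
    by (rule power2_le_imp_le) (auto intro: sum_nonneg)
  then show ?thesis using L by (simp add: V_norm_eq mult_left_mono)
qed

text \<open>
  The approximating simple functions are the Fourier truncations of the curve, sampled at
  finitely many times. Sampling keeps all values divergence-free.
\<close>

definition sample :: "real \<Rightarrow> nat \<Rightarrow> real \<Rightarrow> real" where
  "sample \<mu> n t = \<mu> * of_int \<lfloor>real n * t / \<mu>\<rfloor> / real n"

lemma sample_bounds:
  assumes \<mu>: "0 < \<mu>" and n: "0 < n" and t: "t \<in> {0..\<mu>}"
  shows "sample \<mu> n t \<in> {0..\<mu>}" "dist (sample \<mu> n t) t \<le> \<mu> / real n"
proof -
  define y where "y = real n * t / \<mu>"
  have y: "0 \<le> y" using \<mu> t by (simp add: y_def)
  have ty: "t = \<mu> * y / real n" using \<mu> n by (simp add: y_def)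
  have s: "sample \<mu> n t = \<mu> * of_int \<lfloor>y\<rfloor> / real n" by (simp add: sample_def y_def)
  have fl: "0 \<le> real_of_int \<lfloor>y\<rfloor>" "real_of_int \<lfloor>y\<rfloor> \<le> y" "y - real_of_int \<lfloor>y\<rfloor> \<le> 1"
    using y by (auto intro: less_imp_le) linarith
  have le: "sample \<mu> n t \<le> t"
    unfolding s by (subst ty) (intro divide_right_mono mult_left_mono fl, use \<mu> in auto)
  moreover have "0 \<le> sample \<mu> n t" unfolding s using fl \<mu> by simp
  ultimately show "sample \<mu> n t \<in> {0..\<mu>}" using t by auto
  have "t - sample \<mu> n t = \<mu> * (y - real_of_int \<lfloor>y\<rfloor>) / real n"
    unfolding s by (subst ty) (simp add: diff_divide_distrib right_diff_distrib)
  also have "\<dots> \<le> \<mu> * 1 / real n" by (intro divide_right_mono mult_left_mono fl) (use \<mu> in auto)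
  finally show "dist (sample \<mu> n t) t \<le> \<mu> / real n" using le by (simp add: dist_real_def)
qed

lemma simple_function_sample:
  assumes \<mu>: "0 < \<mu>"
  shows "simple_function (Leb \<mu>) (sample \<mu> n)"
proof -
  have "(\<lambda>t. t) \<in> Leb \<mu> \<rightarrow>\<^sub>M borel" by (rule continuous_imp_measurable_Leb) auto
  moreover have "sample \<mu> n \<in> borel_measurable borel" unfolding sample_def by measurable
  ultimately have "sample \<mu> n \<in> borel_measurable (Leb \<mu>)" by (rule measurable_compose)
  moreover have "finite (sample \<mu> n ` space (Leb \<mu>))"
  proof (rule finite_subset)
    show "sample \<mu> n ` space (Leb \<mu>) \<subseteq> (\<lambda>j. \<mu> * of_int j / real n) ` {0..int n}"
    proof
      fix x assume "x \<in> sample \<mu> n ` space (Leb \<mu>)"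
      then obtain t where t: "t \<in> {0..\<mu>}" and x: "x = sample \<mu> n t" by auto
      have "real n * t / \<mu> \<le> real n * \<mu> / \<mu>" using t \<mu> by (intro divide_right_mono mult_left_mono) auto
      then have "real n * t / \<mu> \<le> real n" using \<mu> by simp
      moreover have "0 \<le> real n * t / \<mu>" using t \<mu> by simp
      ultimately have "\<lfloor>real n * t / \<mu>\<rfloor> \<in> {0..int n}" by (auto simp: floor_le_iff)
      then show "x \<in> (\<lambda>j. \<mu> * of_int j / real n) ` {0..int n}" unfolding x sample_def by (rule imageI)
    qed
  qed auto
  ultimately show ?thesis by (rule simple_function_borel_measurable)
qed

lemma strongly_measurable_if_C_fun:
  assumes L: "0 < L" and \<mu>: "0 < \<mu>" and s: "0 \<le> s" and r: "0 \<le> r"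
    and u: "u \<in> C_fun L \<mu> s" and ae: "AE t in Leb \<mu>. u t \<in> V L r"
  shows "strongly_measurable L \<mu> r u"
proof -
  have uA: "u t \<in> adm L" if "t \<in> {0..\<mu>}" for t
  proof -
    have "u t \<in> V L s" using u that by (simp add: C_fun_def)
    then show ?thesis by (rule V_adm)
  qed
  have unif: "eventually (\<lambda>n. \<forall>t\<in>{0..\<mu>}. norm (u (sample \<mu> n t) k - u t k) < e) sequentially" if e: "0 < e" for k e
  proof -
    have "uniformly_continuous_on {0..\<mu>} (\<lambda>t. u t k)"
      by (rule compact_uniformly_continuous[OF C_fun_modes_continuous[OF L s u]]) simp
    then obtain d where d: "0 < d" "\<And>t t'. t \<in> {0..\<mu>} \<Longrightarrow> t' \<in> {0..\<mu>} \<Longrightarrow> dist t' t < d \<Longrightarrow> dist (u t' k) (u t k) < e"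
      using e unfolding uniformly_continuous_on_def by metis
    obtain N :: nat where N: "\<mu> / d < real N" using reals_Archimedean2 by blast
    have "norm (u (sample \<mu> n t) k - u t k) < e" if n: "N \<le> n" and t: "t \<in> {0..\<mu>}" for n t
    proof -
      have nd: "\<mu> / d < real n" using N n by (meson less_le_trans of_nat_le_iff)
      then have n0: "0 < n" using \<mu> d(1) by (metis divide_pos_pos less_trans of_nat_0_less_iff)
      have "\<mu> / real n < d" using nd n0 d(1) by (simp add: field_simps)
      then show ?thesis using sample_bounds[OF \<mu> n0 t] d(2)[OF t, of "sample \<mu> n t"] by (simp add: dist_norm)
    qed
    then show ?thesis unfolding eventually_sequentially by blast
  qed
  have "\<exists>n>0. \<forall>t\<in>{0..\<mu>}. V_norm L r (trunc N (u (sample \<mu> n t)) - trunc N (u t)) \<le> 1 / real (Suc N)" for N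
  proof -
    define C where "C = sqrt (L ^ 3) * (\<Sum>k\<in>kbox N. sob L r k) + 1"
    have C: "0 < C" using L by (simp add: C_def add_nonneg_pos sum_nonneg)
    define e where "e = 1 / real (Suc N) / C"
    have e: "0 < e" using C by (simp add: e_def)
    have "eventually (\<lambda>n. \<forall>k\<in>kbox N. \<forall>t\<in>{0..\<mu>}. norm (u (sample \<mu> n t) k - u t k) < e) sequentially"
      by (intro eventually_ball_finite finite_kbox ballI unif e)
    then have "eventually (\<lambda>n. (\<forall>k\<in>kbox N. \<forall>t\<in>{0..\<mu>}. norm (u (sample \<mu> n t) k - u t k) < e) \<and> 0 < n) sequentially"
      using eventually_gt_at_top[of "0::nat"] by eventually_elim auto
    then obtain n where n: "0 < n" "\<And>k t. k \<in> kbox N \<Longrightarrow> t \<in> {0..\<mu>} \<Longrightarrow> norm (u (sample \<mu> n t) k - u t k) < e"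
      unfolding eventually_sequentially by blast
    have "V_norm L r (trunc N (u (sample \<mu> n t)) - trunc N (u t)) \<le> 1 / real (Suc N)" if t: "t \<in> {0..\<mu>}" for t
    proof -
      define w where "w = trunc N (u (sample \<mu> n t)) - trunc N (u t)"
      have "V_norm L r w \<le> sqrt (L ^ 3) * (\<Sum>k\<in>kbox N. sob L r k * norm (w k))"
        by (rule V_norm_le_sum[OF L]) (simp add: w_def trunc_def)
      also have "\<dots> \<le> sqrt (L ^ 3) * (\<Sum>k\<in>kbox N. sob L r k * e)"
        using L n(2)[OF _ t] by (intro mult_left_mono sum_mono) (auto simp: w_def trunc_def less_imp_le)
      also have "\<dots> = sqrt (L ^ 3) * (\<Sum>k\<in>kbox N. sob L r k) * e" by (simp add: sum_distrib_right mult.assoc)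
      also have "\<dots> \<le> C * e" using e by (intro mult_right_mono) (auto simp: C_def)
      also have "\<dots> = 1 / real (Suc N)" using C by (simp add: e_def)
      finally show ?thesis by (simp add: w_def)
    qed
    then show ?thesis using n(1) by blast
  qed
  then obtain n where n: "\<And>N. 0 < n N"
    "\<And>N t. t \<in> {0..\<mu>} \<Longrightarrow> V_norm L r (trunc N (u (sample \<mu> (n N) t)) - trunc N (u t)) \<le> 1 / real (Suc N)"
    by metis
  define S where "S = (\<lambda>N t. trunc N (u (sample \<mu> (n N) t)))"
  have S1: "simple_function (Leb \<mu>) (S N)" for N
    unfolding S_def by (rule simple_function_compose1[OF simple_function_sample[OF \<mu>]])
  have S2: "S N t \<in> V L r" if "t \<in> {0..\<mu>}" for N t
    unfolding S_def by (rule trunc_V[OF L r uA[OF sample_bounds(1)[OF \<mu> n(1) that]]])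
  have mem: "AE t in Leb \<mu>. t \<in> {0..\<mu>}" using AE_space[of "Leb \<mu>"] by simp
  have S3: "AE t in Leb \<mu>. (\<lambda>N. V_dist L r (S N t) (u t)) \<longlonglongrightarrow> 0"
    using ae mem
  proof eventually_elim
    case (elim t)
    have tr: "trunc N (u t) \<in> V L r" for N by (rule trunc_V[OF L r uA[OF elim(2)]])
    have le: "V_dist L r (S N t) (u t) \<le> 1 / real (Suc N) + V_norm L r (trunc N (u t) - u t)" for N
    proof -
      have t: "norm ((S N t - u t) k) \<le> norm ((S N t - trunc N (u t)) k) + norm ((trunc N (u t) - u t) k)" for k
        using norm_triangle_ineq[of "S N t k - trunc N (u t) k" "trunc N (u t) k - u t k"] by simp
      have "V_dist L r (S N t) (u t) \<le> V_norm L r (S N t - trunc N (u t)) + V_norm L r (trunc N (u t) - u t)"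
        unfolding V_dist_def using S2[OF elim(2)] tr elim(1) t
        by (intro V_norm_triangle[OF L r] V_diff[OF L r]) auto
      then show ?thesis using n(2)[OF elim(2), of N] by (simp add: S_def)
    qed
    have "(\<lambda>N. 1 / real (Suc N) + V_norm L r (trunc N (u t) - u t)) \<longlonglongrightarrow> 0 + 0"
      by (intro tendsto_add lim_inverse_n' LIMSEQ_Suc[OF lim_inverse_n'] tendsto_trunc[OF L V_wl2[OF L r elim(1)]])
    then have lim: "(\<lambda>N. 1 / real (Suc N) + V_norm L r (trunc N (u t) - u t)) \<longlonglongrightarrow> 0" by simp
    show ?case
      by (rule real_tendsto_sandwich[OF _ _ tendsto_const lim]) (use le L in \<open>auto simp: V_dist_def\<close>)
  qed
  show ?thesis unfolding strongly_measurable_def using ae S1 S2 S3 by blast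
qed

section \<open>Energy estimates and uniqueness\<close>

lemma duh_cong_AE:
  fixes g g' :: "real \<Rightarrow> complex ^ 3"
  assumes "integrable (Leb \<mu>) g" "integrable (Leb \<mu>) g'" "AE s in Leb \<mu>. g s = g' s"
  shows "duh \<mu> r g t = duh \<mu> r g' t"
proof -
  have "(LINT s|Leb \<mu>. indicator {..t} s *\<^sub>R (exp (r * s) *\<^sub>R g s)) = (LINT s|Leb \<mu>. indicator {..t} s *\<^sub>R (exp (r * s) *\<^sub>R g' s))"
    using assms(3) integrable_duh[OF assms(1)] integrable_duh[OF assms(2)]
    by (intro integral_cong_AE) (auto elim!: eventually_mono)
  then show ?thesis by (simp add: duh_def)
qed

lemma duh_uminus: "duh \<mu> r (\<lambda>s. - g s) t = - duh \<mu> r g t"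
  by (simp add: duh_def)

context linearized
begin

text \<open>
  The smallest decay rate, attained on the wave vectors of length \<open>2 * pi / L\<close>.
\<close>

definition lowest :: real where "lowest = \<nu> * (2 * pi / L)\<^sup>2"

lemma lowest_pos: "0 < lowest" using \<nu> L by (simp add: lowest_def)

lemma lowest_le: "k \<noteq> 0 \<Longrightarrow> lowest \<le> rate k"
  unfolding lowest_def rate_def using kap_ge[OF L, of k] \<nu> L by (intro mult_left_mono power_mono) auto

lemma norm_duh_forcing:
  assumes h: "forcing L \<mu> s h \<Gamma>" and k: "k \<noteq> 0" and t: "t \<in> {0..\<mu>}"
  shows "(norm (duh \<mu> (rate k) (\<lambda>s. h s k) t))\<^sup>2 \<le> (LINT s|Leb \<mu>. (norm (h s k))\<^sup>2) / (2 * (\<nu> * (kap L k)\<^sup>2))"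
  unfolding rate_def[symmetric]
  by (rule norm_duh_le[OF rate_pos[OF k] t _ forcing_square_integrable[OF L h]])
    (use h in \<open>simp add: forcing_def modes_measurable_def\<close>)

lemma duh_forcing:
  assumes h: "forcing L \<mu> (\<alpha> - 1) h \<Gamma>" and t: "t \<in> {0..\<mu>}"
  shows "(\<lambda>k. duh \<mu> (rate k) (\<lambda>s. h s k) t) \<in> wl2 (sob L \<alpha>)"
    and "(V_norm L \<alpha> (\<lambda>k. duh \<mu> (rate k) (\<lambda>s. h s k) t))\<^sup>2 \<le> (LINT s|Leb \<mu>. \<Gamma> s) / (2 * \<nu>)"
proof -
  have *: "\<And>k. k \<noteq> 0 \<Longrightarrow> (norm (duh \<mu> (rate k) (\<lambda>s. h s k) t))\<^sup>2 \<le> (LINT s|Leb \<mu>. (norm (h s k))\<^sup>2) / (2 * (\<nu> * (kap L k)\<^sup>2))"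
    by (rule norm_duh_forcing[OF h _ t])
  show "(\<lambda>k. duh \<mu> (rate k) (\<lambda>s. h s k) t) \<in> wl2 (sob L \<alpha>)"
    by (rule smoothing_sup_wl2[OF L \<nu> h *])
  show "(V_norm L \<alpha> (\<lambda>k. duh \<mu> (rate k) (\<lambda>s. h s k) t))\<^sup>2 \<le> (LINT s|Leb \<mu>. \<Gamma> s) / (2 * \<nu>)"
    unfolding V_norm_power2[OF L] by (rule smoothing_sup[OF L \<nu> h *])
qed

text \<open>
  The factor 2 from \<open>square_sum_le\<close> is the price for treating the initial value and the forcing
  separately. The decay factor is kept because at the final time it has to beat this 2.
\<close>

lemma
  assumes h: "forcing L \<mu> (\<alpha> - 1) h \<Gamma>" and c: "c \<in> V L \<alpha>" and t: "t \<in> {0..\<mu>}"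
    and d: "\<And>k. d k = exp (- rate k * t) *\<^sub>R c k + duh \<mu> (rate k) (\<lambda>s. h s k) t"
  shows energy_sup: "(V_norm L \<alpha> d)\<^sup>2 \<le> 2 * exp (- 2 * lowest * t) * (V_norm L \<alpha> c)\<^sup>2 + (LINT s|Leb \<mu>. \<Gamma> s) / \<nu>"
proof -
  define a where "a = (\<lambda>k. exp (- rate k * t) *\<^sub>R c k)"
  define y where "y = (\<lambda>k. duh \<mu> (rate k) (\<lambda>s. h s k) t)"
  have le: "\<bar>sob L \<alpha> k * norm (a k)\<bar> \<le> exp (- lowest * t) * \<bar>sob L \<alpha> k * norm (c k)\<bar>" for k
  proof (cases "k = 0")
    case False
    have "exp (- rate k * t) \<le> exp (- lowest * t)"
      using lowest_le[OF False] t by (simp add: mult_right_mono)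
    then have "exp (- rate k * t) * (sob L \<alpha> k * norm (c k)) \<le> exp (- lowest * t) * (sob L \<alpha> k * norm (c k))"
      by (intro mult_right_mono) auto
    then show ?thesis by (simp add: a_def abs_mult mult_ac)
  qed simp
  have a: "a \<in> wl2 (sob L \<alpha>)" "wnorm (sob L \<alpha>) a \<le> exp (- lowest * t) * wnorm (sob L \<alpha>) c"
    using wl2_mono[OF V_wl2[OF L _ c] le] wnorm_mono[OF V_wl2[OF L _ c] le] by simp_all
  have y: "y \<in> wl2 (sob L \<alpha>)" "(V_norm L \<alpha> y)\<^sup>2 \<le> (LINT s|Leb \<mu>. \<Gamma> s) / (2 * \<nu>)"
    unfolding y_def by (rule duh_forcing[OF h t])+
  have n: "norm (d k) \<le> norm (a k) + norm (y k)" for k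
    unfolding d a_def y_def by (rule norm_triangle_ineq)
  have "wnorm (sob L \<alpha>) d \<le> wnorm (sob L \<alpha>) a + wnorm (sob L \<alpha>) y" by (rule wnorm_triangle[OF a(1) y(1) n])
  then have "V_norm L \<alpha> d \<le> V_norm L \<alpha> a + V_norm L \<alpha> y"
    using L by (simp add: V_norm_eq distrib_left[symmetric] mult_left_mono)
  then have "(V_norm L \<alpha> d)\<^sup>2 \<le> 2 * (V_norm L \<alpha> a)\<^sup>2 + 2 * (V_norm L \<alpha> y)\<^sup>2"
    by (rule square_sum_le[OF _ V_norm_nonneg[OF L]])
  also have "\<dots> \<le> 2 * (exp (- lowest * t) * V_norm L \<alpha> c)\<^sup>2 + 2 * ((LINT s|Leb \<mu>. \<Gamma> s) / (2 * \<nu>))"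
  proof -
    have "V_norm L \<alpha> a \<le> exp (- lowest * t) * V_norm L \<alpha> c"
      using mult_left_mono[OF a(2), of "sqrt (L ^ 3)"] L by (simp add: V_norm_eq mult_ac)
    then have "(V_norm L \<alpha> a)\<^sup>2 \<le> (exp (- lowest * t) * V_norm L \<alpha> c)\<^sup>2" using L by (intro power_mono) auto
    then show ?thesis using y(2) by linarith
  qed
  also have "\<dots> = 2 * exp (- 2 * lowest * t) * (V_norm L \<alpha> c)\<^sup>2 + (LINT s|Leb \<mu>. \<Gamma> s) / \<nu>"
    by (simp add: power_mult_distrib exp_double[symmetric] mult.assoc)
  finally show "(V_norm L \<alpha> d)\<^sup>2 \<le> 2 * exp (- 2 * lowest * t) * (V_norm L \<alpha> c)\<^sup>2 + (LINT s|Leb \<mu>. \<Gamma> s) / \<nu>" .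
qed

text \<open>
  Maximal regularity. Integration over time gains \<open>1 / rate\<close> on the squared initial value and
  \<open>1 / rate\<^sup>2\<close> on the squared forcing, which is one order and two orders of differentiability.
\<close>

lemma
  assumes h: "forcing L \<mu> (\<alpha> - 1) h \<Gamma>" and c: "c \<in> V L \<alpha>"
    and d: "\<And>k t. t \<in> {0..\<mu>} \<Longrightarrow> d t k = exp (- rate k * t) *\<^sub>R c k + duh \<mu> (rate k) (\<lambda>s. h s k) t"
  shows energy_L2_wl2: "AE t in Leb \<mu>. d t \<in> wl2 (sob L (1 + \<alpha>))"
    and energy_L2_integrable: "integrable (Leb \<mu>) (\<lambda>t. (V_norm L (1 + \<alpha>) (d t))\<^sup>2)"
    and energy_L2: "(LINT t|Leb \<mu>. (V_norm L (1 + \<alpha>) (d t))\<^sup>2) \<le> (V_norm L \<alpha> c)\<^sup>2 / \<nu> + 2 * (LINT s|Leb \<mu>. \<Gamma> s) / \<nu>\<^sup>2"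
proof -
  have hk: "(\<lambda>s. h s k) \<in> borel_measurable (Leb \<mu>)" for k
    using h by (simp add: forcing_def modes_measurable_def)
  note hsq = forcing_square_integrable[OF L h]
  have ih: "integrable (Leb \<mu>) (\<lambda>s. h s k)" for k by (rule forcing_integrable[OF L h])
  have cont: "continuous_on {0..\<mu>} (\<lambda>t. d t k)" for k
  proof -
    have "continuous_on {0..\<mu>} (\<lambda>t. exp (- rate k * t) *\<^sub>R c k + duh \<mu> (rate k) (\<lambda>s. h s k) t)"
      by (intro continuous_intros continuous_on_subset[OF continuous_on_duh[OF ih]]) auto
    then show ?thesis using d continuous_on_cong[OF refl] by (metis (no_types, lifting))
  qed
  have m: "modes_measurable \<mu> d" unfolding modes_measurable_def by (intro allI continuous_imp_measurable_Leb cont)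
  have sq: "integrable (Leb \<mu>) (\<lambda>t. (norm (d t k))\<^sup>2)" for k
    by (intro continuous_imp_integrable_Leb continuous_intros cont)
  define H where "H = (\<lambda>k. LINT s|Leb \<mu>. (norm (h s k))\<^sup>2)"
  have mode: "(LINT t|Leb \<mu>. (norm (d t k))\<^sup>2) \<le> (norm (c k))\<^sup>2 / rate k + 2 * H k / (rate k)\<^sup>2" if k: "k \<noteq> 0" for k
  proof -
    note E = integral_norm_duh_le[OF rate_pos[OF k] hk hsq]
    have ie: "integrable (Leb \<mu>) (\<lambda>t. exp (- (2 * rate k) * t))"
      by (intro continuous_imp_integrable_Leb continuous_intros)
    have "(LINT t|Leb \<mu>. (norm (d t k))\<^sup>2) \<le> (LINT t|Leb \<mu>. 2 * (norm (c k))\<^sup>2 * exp (- (2 * rate k) * t)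
        + 2 * (norm (duh \<mu> (rate k) (\<lambda>s. h s k) t))\<^sup>2)"
    proof (rule integral_mono)
      fix t assume "t \<in> space (Leb \<mu>)"
      then have "d t k = exp (- rate k * t) *\<^sub>R c k + duh \<mu> (rate k) (\<lambda>s. h s k) t" by (intro d) simp
      then have "norm (d t k) \<le> exp (- rate k * t) * norm (c k) + norm (duh \<mu> (rate k) (\<lambda>s. h s k) t)"
        using norm_triangle_ineq[of "exp (- rate k * t) *\<^sub>R c k"] by simp
      from square_sum_le[OF this norm_ge_zero]
      show "(norm (d t k))\<^sup>2 \<le> 2 * (norm (c k))\<^sup>2 * exp (- (2 * rate k) * t) + 2 * (norm (duh \<mu> (rate k) (\<lambda>s. h s k) t))\<^sup>2"
        by (simp add: power_mult_distrib exp_double[symmetric] mult_ac)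
    qed (use sq ie E(1) in auto)
    also have "\<dots> = 2 * (norm (c k))\<^sup>2 * (LINT t|Leb \<mu>. exp (- (2 * rate k) * t))
        + 2 * (LINT t|Leb \<mu>. (norm (duh \<mu> (rate k) (\<lambda>s. h s k) t))\<^sup>2)"
      using ie E(1) by (simp del: mult_minus_left)
    also have "\<dots> \<le> 2 * (norm (c k))\<^sup>2 * (1 / (2 * rate k)) + 2 * (H k / (rate k)\<^sup>2)"
      unfolding H_def using rate_pos[OF k] \<mu>
      by (intro add_mono mult_left_mono integral_exp_le E(2)) auto
    finally show ?thesis by simp
  qed
  have sums: "(\<Sum>k\<in>F. L ^ 3 * (sob L (1 + \<alpha>) k)\<^sup>2 * (LINT t|Leb \<mu>. (norm (d t k))\<^sup>2))
      \<le> (V_norm L \<alpha> c)\<^sup>2 / \<nu> + 2 * (LINT s|Leb \<mu>. \<Gamma> s) / \<nu>\<^sup>2" if F: "finite F" for F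
  proof -
    have "(\<Sum>k\<in>F. L ^ 3 * (sob L (1 + \<alpha>) k)\<^sup>2 * (LINT t|Leb \<mu>. (norm (d t k))\<^sup>2))
      \<le> (\<Sum>k\<in>F. L ^ 3 / \<nu> * (sob L \<alpha> k * norm (c k))\<^sup>2 + 2 / \<nu>\<^sup>2 * (L ^ 3 * (sob L (\<alpha> - 1) k)\<^sup>2 * H k))"
    proof (rule sum_mono)
      fix k
      show "L ^ 3 * (sob L (1 + \<alpha>) k)\<^sup>2 * (LINT t|Leb \<mu>. (norm (d t k))\<^sup>2)
        \<le> L ^ 3 / \<nu> * (sob L \<alpha> k * norm (c k))\<^sup>2 + 2 / \<nu>\<^sup>2 * (L ^ 3 * (sob L (\<alpha> - 1) k)\<^sup>2 * H k)"
      proof (cases "k = 0")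
        case False
        define \<kappa> where "\<kappa> = kap L k"
        have \<kappa>: "0 < \<kappa>" using kap_pos[OF L False] by (simp add: \<kappa>_def)
        have s1: "sob L (1 + \<alpha>) k = sob L (\<alpha> - 1) k * \<kappa>\<^sup>2" "sob L \<alpha> k = sob L (\<alpha> - 1) k * \<kappa>"
          unfolding \<kappa>_def by (rule sob_shift[OF L])+
        have "L ^ 3 * (sob L (1 + \<alpha>) k)\<^sup>2 * (LINT t|Leb \<mu>. (norm (d t k))\<^sup>2)
          \<le> L ^ 3 * (sob L (1 + \<alpha>) k)\<^sup>2 * ((norm (c k))\<^sup>2 / rate k + 2 * H k / (rate k)\<^sup>2)"
          using L by (intro mult_left_mono mode False) auto
        also have "\<dots> = L ^ 3 / \<nu> * (sob L \<alpha> k * norm (c k))\<^sup>2 + 2 / \<nu>\<^sup>2 * (L ^ 3 * (sob L (\<alpha> - 1) k)\<^sup>2 * H k)"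
          unfolding s1 rate_def \<kappa>_def[symmetric] using \<kappa> \<nu> by (simp add: power_mult_distrib field_simps)
        finally show ?thesis .
      qed simp
    qed
    also have "\<dots> = L ^ 3 / \<nu> * (\<Sum>k\<in>F. (sob L \<alpha> k * norm (c k))\<^sup>2) + 2 / \<nu>\<^sup>2 * (\<Sum>k\<in>F. L ^ 3 * (sob L (\<alpha> - 1) k)\<^sup>2 * H k)"
      by (simp add: sum.distrib sum_distrib_left)
    also have "\<dots> \<le> L ^ 3 / \<nu> * (wnorm (sob L \<alpha>) c)\<^sup>2 + 2 / \<nu>\<^sup>2 * (LINT s|Leb \<mu>. \<Gamma> s)"
      unfolding H_def using L \<nu>
      by (intro add_mono mult_left_mono finite_sum_le_wnorm[OF V_wl2[OF L _ c] F] forcing_mode_sum[OF L h F]) auto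
    finally show ?thesis by (simp add: V_norm_power2[OF L])
  qed
  show "AE t in Leb \<mu>. d t \<in> wl2 (sob L (1 + \<alpha>))" by (rule square_integrable_if_mode_sums(1)[OF L m sq sums])
  show "integrable (Leb \<mu>) (\<lambda>t. (V_norm L (1 + \<alpha>) (d t))\<^sup>2)" by (rule square_integrable_if_mode_sums(2)[OF L m sq sums])
  show "(LINT t|Leb \<mu>. (V_norm L (1 + \<alpha>) (d t))\<^sup>2) \<le> (V_norm L \<alpha> c)\<^sup>2 / \<nu> + 2 * (LINT s|Leb \<mu>. \<Gamma> s) / \<nu>\<^sup>2"
    by (rule square_integrable_if_mode_sums(3)[OF L m sq sums])
qed

text \<open>
  The drift is small relative to the viscosity: this makes the nonlinear term a contraction on
  continuous curves.
\<close>

definition small :: "(real \<Rightarrow> coeffs) \<Rightarrow> bool" where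
  "small \<psi> \<longleftrightarrow> \<psi> \<in> L2_fun L \<mu> (1 + \<alpha>) \<and> K\<^sup>2 * (LINT t|Leb \<mu>. (V_norm L (1 + \<alpha>) (\<psi> t))\<^sup>2) \<le> \<nu> / 2"

lemma small_L2_fun: "small \<psi> \<Longrightarrow> \<psi> \<in> L2_fun L \<mu> (1 + \<alpha>)"
  by (simp add: small_def)

lemma rhs_diff_AE:
  assumes \<psi>: "\<psi> \<in> L2_fun L \<mu> (1 + \<alpha>)"
    and u: "\<And>t. t \<in> {0..\<mu>} \<Longrightarrow> u t \<in> V L \<alpha>" "\<And>t. t \<in> {0..\<mu>} \<Longrightarrow> u' t \<in> V L \<alpha>"
  shows "AE s in Leb \<mu>. rhs \<psi> u s - rhs \<psi> u' s = (\<lambda>k. - nl L (\<psi> s) (u s - u' s) k)"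
  using L2_fun_AE[OF \<psi>] AE_Leb_mem
proof eventually_elim
  case (elim s)
  have "conv_summable (\<psi> s) (u s)" "conv_summable (\<psi> s) (u' s)"
    using nl_bound elim u by blast+
  from nl_diff_right[OF this, of L] show ?case by (auto simp: rhs_def)
qed

lemma small_nl_integral:
  assumes "small \<psi>"
  shows "(LINT t|Leb \<mu>. (K * S)\<^sup>2 * (V_norm L (1 + \<alpha>) (\<psi> t))\<^sup>2) / (2 * \<nu>) \<le> (S / 2)\<^sup>2"
proof -
  have "(LINT t|Leb \<mu>. (K * S)\<^sup>2 * (V_norm L (1 + \<alpha>) (\<psi> t))\<^sup>2) = S\<^sup>2 * (K\<^sup>2 * (LINT t|Leb \<mu>. (V_norm L (1 + \<alpha>) (\<psi> t))\<^sup>2))"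
    by (simp add: power_mult_distrib)
  also have "\<dots> \<le> S\<^sup>2 * (\<nu> / 2)" using assms unfolding small_def by (intro mult_left_mono) auto
  finally show ?thesis using \<nu> by (simp add: power_divide field_simps)
qed

text \<open>
  Solutions stay bounded, so their difference has some bound; the smallness of the drift halves
  any such bound, and therefore the difference is 0.
\<close>

theorem mild_unique:
  assumes \<psi>: "small \<psi>" and u: "u \<in> C_fun L \<mu> \<alpha>" "mild \<psi> u0 u" and u': "u' \<in> C_fun L \<mu> \<alpha>" "mild \<psi> u0 u'"
    and t: "t \<in> {0..\<mu>}"
  shows "u t = u' t"
proof -
  have uV: "u t \<in> V L \<alpha>" "u' t \<in> V L \<alpha>" if "t \<in> {0..\<mu>}" for t using u u' that by (simp_all add: C_fun_def)
  define d where "d = (\<lambda>t. u t - u' t)"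
  have dV: "d t \<in> V L \<alpha>" if "t \<in> {0..\<mu>}" for t unfolding d_def by (intro V_diff L uV that) simp
  obtain S S' where S: "0 \<le> S" "\<And>t. t \<in> {0..\<mu>} \<Longrightarrow> V_norm L \<alpha> (u t) \<le> S"
    and S': "0 \<le> S'" "\<And>t. t \<in> {0..\<mu>} \<Longrightarrow> V_norm L \<alpha> (u' t) \<le> S'"
    using C_fun_bounded[OF L \<alpha>_nonneg(1) u(1)] C_fun_bounded[OF L \<alpha>_nonneg(1) u'(1)] by metis
  have m: "modes_measurable \<mu> u" "modes_measurable \<mu> u'"
    using C_fun_modes_measurable[OF L \<alpha>_nonneg(1)] u(1) u'(1) by blast+
  then have md: "modes_measurable \<mu> d" by (simp add: modes_measurable_def d_def borel_measurable_diff)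
  have fr: "forcing L \<mu> (\<alpha> - 1) (rhs \<psi> u) (\<lambda>t. 2 * (V_norm L (\<alpha> - 1) f)\<^sup>2 + 2 * ((K * S)\<^sup>2 * (V_norm L (1 + \<alpha>) (\<psi> t))\<^sup>2))"
    "forcing L \<mu> (\<alpha> - 1) (rhs \<psi> u') (\<lambda>t. 2 * (V_norm L (\<alpha> - 1) f)\<^sup>2 + 2 * ((K * S')\<^sup>2 * (V_norm L (1 + \<alpha>) (\<psi> t))\<^sup>2))"
    using S S' uV m by (intro forcing_rhs small_L2_fun[OF \<psi>]; simp)+
  have half: "\<forall>t\<in>{0..\<mu>}. V_norm L \<alpha> (d t) \<le> D / 2" if D: "0 \<le> D" "\<forall>t\<in>{0..\<mu>}. V_norm L \<alpha> (d t) \<le> D" for D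
  proof
    fix t assume t: "t \<in> {0..\<mu>}"
    have fn: "forcing L \<mu> (\<alpha> - 1) (\<lambda>t. nl L (\<psi> t) (d t)) (\<lambda>t. (K * D)\<^sup>2 * (V_norm L (1 + \<alpha>) (\<psi> t))\<^sup>2)"
      using dV D by (intro forcing_nl small_L2_fun[OF \<psi>] md) auto
    have dk: "d t k = - duh \<mu> (rate k) (\<lambda>s. nl L (\<psi> s) (d s) k) t" for k
    proof -
      have i: "integrable (Leb \<mu>) (\<lambda>s. rhs \<psi> u s k)" "integrable (Leb \<mu>) (\<lambda>s. rhs \<psi> u' s k)"
        "integrable (Leb \<mu>) (\<lambda>s. nl L (\<psi> s) (d s) k)"
        using forcing_integrable[OF L] fr fn by blast+
      have "d t k = duh \<mu> (rate k) (\<lambda>s. rhs \<psi> u s k) t - duh \<mu> (rate k) (\<lambda>s. rhs \<psi> u' s k) t"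
        using u(2) u'(2) t by (simp add: d_def mild_def)
      also have "\<dots> = duh \<mu> (rate k) (\<lambda>s. rhs \<psi> u s k - rhs \<psi> u' s k) t" by (rule duh_diff[symmetric]) (rule i)+
      also have "\<dots> = duh \<mu> (rate k) (\<lambda>s. - nl L (\<psi> s) (d s) k) t"
      proof (rule duh_cong_AE)
        have "AE s in Leb \<mu>. rhs \<psi> u s - rhs \<psi> u' s = (\<lambda>k. - nl L (\<psi> s) (u s - u' s) k)"
          by (rule rhs_diff_AE[OF small_L2_fun[OF \<psi>]]) (fact uV)+
        then show "AE s in Leb \<mu>. rhs \<psi> u s k - rhs \<psi> u' s k = - nl L (\<psi> s) (d s) k"
          by eventually_elim (simp add: d_def fun_eq_iff)
      qed (use i in auto)
      finally show ?thesis by (simp add: duh_uminus)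
    qed
    have "V_norm L \<alpha> (d t) = V_norm L \<alpha> (\<lambda>k. duh \<mu> (rate k) (\<lambda>s. nl L (\<psi> s) (d s) k) t)"
      by (simp add: V_norm_eq wnorm_def dk)
    then have "(V_norm L \<alpha> (d t))\<^sup>2 \<le> (LINT t|Leb \<mu>. (K * D)\<^sup>2 * (V_norm L (1 + \<alpha>) (\<psi> t))\<^sup>2) / (2 * \<nu>)"
      using duh_forcing(2)[OF fn t] by simp
    also have "\<dots> \<le> (D / 2)\<^sup>2" by (rule small_nl_integral[OF \<psi>])
    finally show "V_norm L \<alpha> (d t) \<le> D / 2" by (rule power2_le_imp_le) (use D in simp)
  qed
  have b: "\<forall>t\<in>{0..\<mu>}. V_norm L \<alpha> (d t) \<le> (S + S') / 2 ^ n" for n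
  proof (induction n)
    case 0
    have "V_norm L \<alpha> (d t) \<le> S + S'" if "t \<in> {0..\<mu>}" for t
    proof -
      have "norm (d t k) \<le> norm (u t k) + norm (u' t k)" for k unfolding d_def by (simp add: norm_triangle_ineq4)
      from V_norm_triangle[OF L \<alpha>_nonneg(1) uV(1)[OF that] uV(2)[OF that] this] show ?thesis
        using S(2)[OF that] S'(2)[OF that] by linarith
    qed
    then show ?case by simp
  next
    case (Suc n)
    have "0 \<le> (S + S') / 2 ^ n" using S(1) S'(1) by simp
    from half[OF this Suc] show ?case by (simp add: mult.commute)
  qed
  have "(\<lambda>n. (S + S') * (1 / 2) ^ n) \<longlonglongrightarrow> (S + S') * 0"
    by (intro tendsto_mult_left LIMSEQ_power_zero) simp
  then have "V_norm L \<alpha> (d t) \<le> 0"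
    using b t by (intro LIMSEQ_le_const[of "\<lambda>n. (S + S') * (1 / 2) ^ n"]) (auto simp: power_one_over)
  then have z: "V_norm L \<alpha> (d t) = 0" using L by (simp add: order_antisym)
  have "d t k = 0" for k by (rule V_norm_eq_0D[OF L \<alpha>_nonneg(1) dV[OF t] z])
  then show ?thesis by (auto simp: d_def fun_eq_iff)
qed

end

section \<open>Existence for small drift\<close>

instance bcontfun :: (metric_space, banach) banach ..

text \<open>
  A family of modes, each of which is a bounded continuous function of time, with the weighted sum
  of squares of the supremum norms. This norm is stronger than the supremum over time of the norm
  of order \<open>\<alpha>\<close>, but the smoothing estimate controls it equally well.
\<close>

type_synonym curves = "int ^ 3 \<Rightarrow> (real \<Rightarrow>\<^sub>C (complex ^ 3))"

definition curve :: "curves \<Rightarrow> real \<Rightarrow> coeffs" where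
  "curve x t k = apply_bcontfun (x k) t"

definition curve_space :: "real \<Rightarrow> real \<Rightarrow> curves set" where
  "curve_space L \<alpha> = {x \<in> wl2 (sob L \<alpha>). \<forall>t. curve x t \<in> adm L}"

text \<open>
  Bounded continuous functions live on the whole line; curves on \<open>{0..\<mu>}\<close> are extended by their
  boundary values.
\<close>

definition clamp :: "real \<Rightarrow> real \<Rightarrow> real" where
  "clamp \<mu> t = max 0 (min \<mu> t)"

lemma clamp_mem: "0 < \<mu> \<Longrightarrow> clamp \<mu> t \<in> {0..\<mu>}"
  and clamp_id: "t \<in> {0..\<mu>} \<Longrightarrow> clamp \<mu> t = t"
  by (auto simp: clamp_def)

lemma bcontfun_clamp:
  fixes F :: "real \<Rightarrow> 'b::euclidean_space"
  assumes \<mu>: "0 < \<mu>" and F: "continuous_on {0..\<mu>} F"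
  shows "(\<lambda>t. F (clamp \<mu> t)) \<in> bcontfun"
  unfolding bcontfun_def mem_Collect_eq
proof
  have "continuous_on UNIV (clamp \<mu>)" unfolding clamp_def by (intro continuous_intros)
  then show "continuous_on UNIV (\<lambda>t. F (clamp \<mu> t))"
    by (rule continuous_on_compose2[OF F]) (use clamp_mem[OF \<mu>] in auto)
  have "bounded (F ` {0..\<mu>})" by (intro compact_imp_bounded compact_continuous_image F) auto
  then show "bounded (range (\<lambda>t. F (clamp \<mu> t)))"
    by (rule bounded_subset) (use clamp_mem[OF \<mu>] in auto)
qed

lemma V_norm_curve:
  assumes L: "0 < L" and x: "x \<in> wl2 (sob L \<alpha>)"
  shows "curve x t \<in> wl2 (sob L \<alpha>)" "V_norm L \<alpha> (curve x t) \<le> sqrt (L ^ 3) * wnorm (sob L \<alpha>) x"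
proof -
  have le: "\<bar>sob L \<alpha> k * norm (curve x t k)\<bar> \<le> 1 * \<bar>sob L \<alpha> k * norm (x k)\<bar>" for k
    by (simp add: curve_def mult_left_mono norm_bounded)
  show "curve x t \<in> wl2 (sob L \<alpha>)" by (rule wl2_mono[OF x le]) simp
  have "wnorm (sob L \<alpha>) (curve x t) \<le> 1 * wnorm (sob L \<alpha>) x" by (rule wnorm_mono[OF x le]) simp
  then show "V_norm L \<alpha> (curve x t) \<le> sqrt (L ^ 3) * wnorm (sob L \<alpha>) x"
    using L by (simp add: V_norm_eq mult_left_mono)
qed

lemma curve_V:
  assumes "0 < L" "0 \<le> \<alpha>" "x \<in> curve_space L \<alpha>"
  shows "curve x t \<in> V L \<alpha>"
  using assms V_norm_curve(1)[of L x \<alpha> t] by (simp add: curve_space_def V_eq)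

lemma curve_modes_continuous: "continuous_on S (\<lambda>t. curve x t k)"
  by (simp add: curve_def)

text \<open>
  The norm of the space of curves dominates the modes uniformly in time, whence continuity in
  \<open>V L \<alpha>\<close> by the Weierstrass test.
\<close>

lemma curve_C_fun:
  assumes L: "0 < L" and \<alpha>: "0 \<le> \<alpha>" and x: "x \<in> curve_space L \<alpha>"
  shows "curve x \<in> C_fun L \<mu> \<alpha>"
  unfolding C_fun_def mem_Collect_eq
proof (intro ballI conjI)
  fix t
  show "curve x t \<in> V L \<alpha>" by (rule curve_V[OF L \<alpha> x])
  define \<Phi> where "\<Phi> = (\<lambda>\<tau>. \<Sum>\<^sub>\<infinity>k. (sob L \<alpha> k * norm (curve x \<tau> k - curve x t k))\<^sup>2)"
  have xw: "x \<in> wl2 (sob L \<alpha>)" using x by (simp add: curve_space_def)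
  have "uniform_limit UNIV (\<lambda>F \<tau>. \<Sum>k\<in>F. (sob L \<alpha> k * norm (curve x \<tau> k - curve x t k))\<^sup>2) \<Phi> (finite_subsets_at_top UNIV)"
    unfolding \<Phi>_def
  proof (rule Weierstrass_m_test_general)
    show "(\<lambda>k. 4 * (sob L \<alpha> k * norm (x k))\<^sup>2) summable_on UNIV"
      using xw unfolding wl2_def mem_Collect_eq by (rule summable_on_cmult_right)
    fix k \<tau>
    have "norm (curve x \<tau> k - curve x t k) \<le> norm (x k) + norm (x k)"
      unfolding curve_def by (intro order_trans[OF norm_triangle_ineq4] add_mono norm_bounded)
    then have "sob L \<alpha> k * norm (curve x \<tau> k - curve x t k) \<le> 2 * (sob L \<alpha> k * norm (x k))"
      using mult_left_mono[of _ _ "sob L \<alpha> k"] by fastforce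
    then have "(sob L \<alpha> k * norm (curve x \<tau> k - curve x t k))\<^sup>2 \<le> (2 * (sob L \<alpha> k * norm (x k)))\<^sup>2"
      by (intro power_mono) auto
    then show "norm ((sob L \<alpha> k * norm (curve x \<tau> k - curve x t k))\<^sup>2) \<le> 4 * (sob L \<alpha> k * norm (x k))\<^sup>2"
      by (simp add: power_mult_distrib)
  qed
  moreover have "\<forall>\<^sub>F F in finite_subsets_at_top UNIV. continuous_on UNIV (\<lambda>\<tau>. \<Sum>k\<in>F. (sob L \<alpha> k * norm (curve x \<tau> k - curve x t k))\<^sup>2)"
    by (intro always_eventually allI continuous_intros curve_modes_continuous)
  ultimately have "continuous_on UNIV \<Phi>"
    by (intro uniform_limit_theorem) auto
  then have "(\<Phi> \<longlongrightarrow> \<Phi> t) (at t within {0..\<mu>})"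
    unfolding continuous_on_def by (meson UNIV_I tendsto_within_subset top_greatest)
  then have "((\<lambda>\<tau>. sqrt (L ^ 3) * sqrt (\<Phi> \<tau>)) \<longlongrightarrow> sqrt (L ^ 3) * sqrt (\<Phi> t)) (at t within {0..\<mu>})"
    by (intro tendsto_intros)
  then show "((\<lambda>\<tau>. V_dist L \<alpha> (curve x \<tau>) (curve x t)) \<longlongrightarrow> 0) (at t within {0..\<mu>})"
    by (simp add: V_dist_def V_norm_eq wnorm_def \<Phi>_def)
qed

lemma C_fun_cong:
  assumes "u \<in> C_fun L \<mu> s" "\<And>t. t \<in> {0..\<mu>} \<Longrightarrow> v t = u t"
  shows "v \<in> C_fun L \<mu> s"
  unfolding C_fun_def mem_Collect_eq
proof (intro ballI conjI)
  fix t assume t: "t \<in> {0..\<mu>}"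
  show "v t \<in> V L s" using assms t by (simp add: C_fun_def)
  have "((\<lambda>\<tau>. V_dist L s (u \<tau>) (u t)) \<longlongrightarrow> 0) (at t within {0..\<mu>})" using assms(1) t by (simp add: C_fun_def)
  moreover have "\<forall>\<^sub>F \<tau> in at t within {0..\<mu>}. V_dist L s (u \<tau>) (u t) = V_dist L s (v \<tau>) (v t)"
    unfolding eventually_at_filter using assms(2) t by (intro always_eventually) auto
  ultimately show "((\<lambda>\<tau>. V_dist L s (v \<tau>) (v t)) \<longlongrightarrow> 0) (at t within {0..\<mu>})"
    by (rule Lim_transform_eventually)
qed

context linearized
begin

definition picard :: "(real \<Rightarrow> coeffs) \<Rightarrow> coeffs \<Rightarrow> curves \<Rightarrow> curves" where
  "picard \<psi> u0 x k = Bcontfun (\<lambda>t. exp (- rate k * clamp \<mu> t) *\<^sub>R u0 k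
      + duh \<mu> (rate k) (\<lambda>s. rhs \<psi> (curve x) s k) (clamp \<mu> t))"

lemma curve_forcing:
  assumes \<psi>: "\<psi> \<in> L2_fun L \<mu> (1 + \<alpha>)" and x: "x \<in> curve_space L \<alpha>"
  shows "forcing L \<mu> (\<alpha> - 1) (rhs \<psi> (curve x))
    (\<lambda>t. 2 * (V_norm L (\<alpha> - 1) f)\<^sup>2 + 2 * ((K * (sqrt (L ^ 3) * wnorm (sob L \<alpha>) x))\<^sup>2 * (V_norm L (1 + \<alpha>) (\<psi> t))\<^sup>2))"
proof (rule forcing_rhs[OF \<psi>])
  show "modes_measurable \<mu> (curve x)"
    unfolding modes_measurable_def by (intro allI continuous_imp_measurable_Leb curve_modes_continuous)
  show "curve x t \<in> V L \<alpha> \<and> V_norm L \<alpha> (curve x t) \<le> sqrt (L ^ 3) * wnorm (sob L \<alpha>) x" for t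
    using curve_V[OF L _ x] V_norm_curve(2)[OF L, of x] x by (simp add: curve_space_def)
qed

lemma curve_picard:
  assumes \<psi>: "\<psi> \<in> L2_fun L \<mu> (1 + \<alpha>)" and x: "x \<in> curve_space L \<alpha>"
  shows "curve (picard \<psi> u0 x) t k = exp (- rate k * clamp \<mu> t) *\<^sub>R u0 k
      + duh \<mu> (rate k) (\<lambda>s. rhs \<psi> (curve x) s k) (clamp \<mu> t)"
proof -
  have i: "integrable (Leb \<mu>) (\<lambda>s. rhs \<psi> (curve x) s k)" by (rule forcing_integrable[OF L curve_forcing[OF \<psi> x]])
  have "continuous_on {0..\<mu>} (\<lambda>t. exp (- rate k * t) *\<^sub>R u0 k + duh \<mu> (rate k) (\<lambda>s. rhs \<psi> (curve x) s k) t)"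
    by (intro continuous_intros continuous_on_subset[OF continuous_on_duh[OF i]]) auto
  from bcontfun_clamp[OF \<mu> this] show ?thesis
    by (simp add: curve_def picard_def Bcontfun_inverse)
qed

text \<open>
  The product with the wave vector and complex conjugation both commute with integration in time,
  and the zero mode of the right-hand side vanishes, so Duhamel's formula preserves the constraints.
\<close>

lemma mild_adm:
  assumes \<psi>: "\<psi> \<in> L2_fun L \<mu> (1 + \<alpha>)" and u0: "u0 \<in> V L \<alpha>"
    and u: "\<And>t. t \<in> {0..\<mu>} \<Longrightarrow> u t \<in> V L \<alpha>" and frc: "forcing L \<mu> (\<alpha> - 1) (rhs \<psi> u) \<Gamma>"
  shows "(\<lambda>k. exp (- rate k * t) *\<^sub>R u0 k + duh \<mu> (rate k) (\<lambda>s. rhs \<psi> u s k) t) \<in> adm L"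
  unfolding adm_iff
proof (intro conjI allI)
  have i: "integrable (Leb \<mu>) (\<lambda>s. rhs \<psi> u s k)" for k by (rule forcing_integrable[OF L frc])
  have u0': "u0 (- k) = vcnj (u0 k)" "u0 0 = 0" "cdot (wave L k) (u0 k) = 0" for k
    using V_adm[OF u0] by (auto simp: adm_iff)
  show "exp (- rate 0 * t) *\<^sub>R u0 0 + duh \<mu> (rate 0) (\<lambda>s. rhs \<psi> u s 0) t = 0"
    by (simp add: u0' duh_def)
  fix k
  have r: "rate (- k) = rate k" by (simp add: rate_def)
  have ae: "AE s in Leb \<mu>. rhs \<psi> u s (- k) = vcnj (rhs \<psi> u s k)"
    using L2_fun_AE[OF \<psi>] AE_Leb_mem
  proof eventually_elim
    case (elim s)
    note rm = real_modes[OF elim(1) u[OF elim(2)]]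
    show ?case using rm(1)[of k] rm(4)[of k] linear_diff[OF linear_vcnj] by (simp add: rhs_def)
  qed
  have "duh \<mu> (rate k) (\<lambda>s. rhs \<psi> u s (- k)) t = duh \<mu> (rate k) (\<lambda>s. vcnj (rhs \<psi> u s k)) t"
    by (rule duh_cong_AE[OF i integrable_bounded_linear[OF bounded_linear_vcnj i] ae])
  also have "\<dots> = vcnj (duh \<mu> (rate k) (\<lambda>s. rhs \<psi> u s k) t)"
    by (rule duh_bounded_linear[OF bounded_linear_vcnj i, symmetric])
  finally show "exp (- rate (- k) * t) *\<^sub>R u0 (- k) + duh \<mu> (rate (- k)) (\<lambda>s. rhs \<psi> u s (- k)) t
      = vcnj (exp (- rate k * t) *\<^sub>R u0 k + duh \<mu> (rate k) (\<lambda>s. rhs \<psi> u s k) t)"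
    using linear_add[OF linear_vcnj] linear_scale[OF linear_vcnj] by (simp add: r u0'(1))
  show "cdot (wave L k) (exp (- rate k * t) *\<^sub>R u0 k + duh \<mu> (rate k) (\<lambda>s. rhs \<psi> u s k) t) = 0"
    unfolding cdot_add cdot_scaleR duh_bounded_linear[OF bounded_linear_cdot i] by (simp add: u0' duh_def)
qed

lemma picard_maps:
  assumes \<psi>: "\<psi> \<in> L2_fun L \<mu> (1 + \<alpha>)" and u0: "u0 \<in> V L \<alpha>" and x: "x \<in> curve_space L \<alpha>"
  shows "picard \<psi> u0 x \<in> curve_space L \<alpha>"
  unfolding curve_space_def mem_Collect_eq
proof (intro conjI allI)
  note frc = curve_forcing[OF \<psi> x]
  define b where "b = (\<lambda>k. sqrt ((LINT s|Leb \<mu>. (norm (rhs \<psi> (curve x) s k))\<^sup>2) / (2 * (\<nu> * (kap L k)\<^sup>2))))"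
  have b: "b \<in> wl2 (sob L \<alpha>)"
    by (rule smoothing_sup_wl2[OF L \<nu> frc]) (use \<nu> in \<open>simp add: b_def\<close>)
  have u0w: "(\<lambda>k. norm (u0 k)) \<in> wl2 (sob L \<alpha>)" using V_wl2[OF L _ u0] by (simp add: wl2_norm_iff)
  have s: "(\<lambda>k. norm (u0 k) + b k) \<in> wl2 (sob L \<alpha>)"
    by (rule wl2_triangle[OF u0w b]) (rule norm_triangle_ineq)
  show "picard \<psi> u0 x \<in> wl2 (sob L \<alpha>)"
  proof (rule wl2_mono[OF s])
    show "\<bar>sob L \<alpha> k * norm (picard \<psi> u0 x k)\<bar> \<le> 1 * \<bar>sob L \<alpha> k * norm (norm (u0 k) + b k)\<bar>" for k
    proof (cases "k = 0")
      case False
      have "norm (picard \<psi> u0 x k) \<le> norm (u0 k) + b k"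
      proof (rule norm_bound)
        fix t
        have t: "clamp \<mu> t \<in> {0..\<mu>}" by (rule clamp_mem[OF \<mu>])
        have "norm (duh \<mu> (rate k) (\<lambda>s. rhs \<psi> (curve x) s k) (clamp \<mu> t)) \<le> b k"
          unfolding b_def by (rule real_le_rsqrt[OF norm_duh_forcing[OF frc False t]])
        moreover have "exp (- rate k * clamp \<mu> t) * norm (u0 k) \<le> 1 * norm (u0 k)"
          using t by (intro mult_right_mono) auto
        ultimately have "norm (curve (picard \<psi> u0 x) t k) \<le> norm (u0 k) + b k"
          unfolding curve_picard[OF \<psi> x]
          by (intro order_trans[OF norm_triangle_ineq add_mono]) auto
        then show "norm (apply_bcontfun (picard \<psi> u0 x k) t) \<le> norm (u0 k) + b k" by (simp add: curve_def)
      qed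
      moreover have "0 \<le> b k" using \<nu> by (simp add: b_def)
      ultimately show ?thesis by (simp add: abs_mult mult_left_mono)
    qed simp
  qed simp
  show "curve (picard \<psi> u0 x) t \<in> adm L" for t
    using mild_adm[OF \<psi> u0 curve_V[OF L _ x] frc, of "clamp \<mu> t"]
    by (simp add: curve_picard[OF \<psi> x, abs_def] fun_eq_iff[symmetric] eta_contract_eq)
qed

lemma picard_contracts:
  assumes \<psi>: "small \<psi>" and x: "x \<in> curve_space L \<alpha>" and y: "y \<in> curve_space L \<alpha>"
  shows "wnorm (sob L \<alpha>) (picard \<psi> u0 x - picard \<psi> u0 y) \<le> 1 / 2 * wnorm (sob L \<alpha>) (x - y)"
proof -
  note \<psi>' = small_L2_fun[OF \<psi>]
  define S where "S = sqrt (L ^ 3) * wnorm (sob L \<alpha>) (x - y)"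
  have S: "0 \<le> S" using L by (simp add: S_def)
  have xyw: "x - y \<in> wl2 (sob L \<alpha>)" using x y by (auto simp: curve_space_def intro: wl2_diff)
  define d where "d = (\<lambda>t. curve x t - curve y t)"
  have dc: "d = curve (x - y)" by (simp add: d_def curve_def fun_eq_iff)
  have dV: "d t \<in> V L \<alpha>" for t unfolding d_def by (intro V_diff curve_V L x y) auto
  have dS: "V_norm L \<alpha> (d t) \<le> S" for t unfolding dc S_def by (rule V_norm_curve(2)[OF L xyw])
  have md: "modes_measurable \<mu> d"
    unfolding modes_measurable_def dc by (intro allI continuous_imp_measurable_Leb curve_modes_continuous)
  have fn: "forcing L \<mu> (\<alpha> - 1) (\<lambda>t. nl L (\<psi> t) (d t)) (\<lambda>t. (K * S)\<^sup>2 * (V_norm L (1 + \<alpha>) (\<psi> t))\<^sup>2)"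
    using dV dS by (intro forcing_nl \<psi>' md) auto
  have mode: "curve (picard \<psi> u0 x) t k - curve (picard \<psi> u0 y) t k
      = - duh \<mu> (rate k) (\<lambda>s. nl L (\<psi> s) (d s) k) (clamp \<mu> t)" for t k
  proof -
    have i: "integrable (Leb \<mu>) (\<lambda>s. rhs \<psi> (curve x) s k)" "integrable (Leb \<mu>) (\<lambda>s. rhs \<psi> (curve y) s k)"
      "integrable (Leb \<mu>) (\<lambda>s. nl L (\<psi> s) (d s) k)"
      using forcing_integrable[OF L] curve_forcing[OF \<psi>'] x y fn by blast+
    have "curve (picard \<psi> u0 x) t k - curve (picard \<psi> u0 y) t k
      = duh \<mu> (rate k) (\<lambda>s. rhs \<psi> (curve x) s k - rhs \<psi> (curve y) s k) (clamp \<mu> t)"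
      unfolding curve_picard[OF \<psi>' x] curve_picard[OF \<psi>' y] duh_diff[OF i(1,2)] by simp
    also have "\<dots> = duh \<mu> (rate k) (\<lambda>s. - nl L (\<psi> s) (d s) k) (clamp \<mu> t)"
    proof (rule duh_cong_AE)
      have "AE s in Leb \<mu>. rhs \<psi> (curve x) s - rhs \<psi> (curve y) s = (\<lambda>k. - nl L (\<psi> s) (curve x s - curve y s) k)"
        by (rule rhs_diff_AE[OF \<psi>']) (intro curve_V L x y \<alpha>_nonneg)+
      then show "AE s in Leb \<mu>. rhs \<psi> (curve x) s k - rhs \<psi> (curve y) s k = - nl L (\<psi> s) (d s) k"
        by eventually_elim (simp add: d_def fun_eq_iff)
    qed (use i in auto)
    finally show ?thesis by (simp add: duh_uminus)
  qed
  have bound: "(norm ((picard \<psi> u0 x - picard \<psi> u0 y) k))\<^sup>2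
      \<le> (LINT s|Leb \<mu>. (norm (nl L (\<psi> s) (d s) k))\<^sup>2) / (2 * (\<nu> * (kap L k)\<^sup>2))" if k: "k \<noteq> 0" for k
  proof -
    define B where "B = (LINT s|Leb \<mu>. (norm (nl L (\<psi> s) (d s) k))\<^sup>2) / (2 * (\<nu> * (kap L k)\<^sup>2))"
    have B: "0 \<le> B" using \<nu> by (simp add: B_def)
    have "norm ((picard \<psi> u0 x - picard \<psi> u0 y) k) \<le> sqrt B"
    proof (rule norm_bound)
      fix t
      have "norm (apply_bcontfun ((picard \<psi> u0 x - picard \<psi> u0 y) k) t)
          = norm (duh \<mu> (rate k) (\<lambda>s. nl L (\<psi> s) (d s) k) (clamp \<mu> t))"
        using mode[of t k] by (simp add: curve_def)
      also have "\<dots> \<le> sqrt B"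
        unfolding B_def by (rule real_le_rsqrt[OF norm_duh_forcing[OF fn k clamp_mem[OF \<mu>]]])
      finally show "norm (apply_bcontfun ((picard \<psi> u0 x - picard \<psi> u0 y) k) t) \<le> sqrt B" .
    qed
    then have "(norm ((picard \<psi> u0 x - picard \<psi> u0 y) k))\<^sup>2 \<le> (sqrt B)\<^sup>2" by (intro power_mono) auto
    then show ?thesis using B by (simp add: B_def)
  qed
  have "L ^ 3 * (wnorm (sob L \<alpha>) (picard \<psi> u0 x - picard \<psi> u0 y))\<^sup>2
      \<le> (LINT t|Leb \<mu>. (K * S)\<^sup>2 * (V_norm L (1 + \<alpha>) (\<psi> t))\<^sup>2) / (2 * \<nu>)"
    by (rule smoothing_sup[OF L \<nu> fn bound])
  also have "\<dots> \<le> (S / 2)\<^sup>2" by (rule small_nl_integral[OF \<psi>])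
  also have "\<dots> = L ^ 3 * (1 / 2 * wnorm (sob L \<alpha>) (x - y))\<^sup>2"
    using L by (simp add: S_def power_mult_distrib power_divide)
  finally have "(wnorm (sob L \<alpha>) (picard \<psi> u0 x - picard \<psi> u0 y))\<^sup>2 \<le> (1 / 2 * wnorm (sob L \<alpha>) (x - y))\<^sup>2"
    using L by simp
  then show ?thesis by (rule power2_le_imp_le) simp
qed

lemma tendsto_curve:
  assumes "(\<lambda>n. X n k) \<longlonglongrightarrow> x k"
  shows "(\<lambda>n. curve (X n) t k) \<longlonglongrightarrow> curve x t k"
  by (rule metric_tendsto_imp_tendsto[OF assms]) (simp add: curve_def dist_bounded)

text \<open>
  The space of curves is closed under modewise limits, and its members vanish at the zero mode,
  the only one of weight 0; so the contraction principle applies to it.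
\<close>

theorem mild_exists:
  assumes \<psi>: "small \<psi>" and u0: "u0 \<in> V L \<alpha>"
  obtains u where "u \<in> extensional {0..\<mu>}" "u \<in> C_fun L \<mu> \<alpha>" "mild \<psi> u0 u" "u 0 = u0"
proof -
  note \<psi>' = small_L2_fun[OF \<psi>]
  have zero: "(\<lambda>k. 0) \<in> curve_space L \<alpha>" 
    by (simp add: curve_space_def curve_def adm_iff)
  have vanish: "x k = 0" if "x \<in> curve_space L \<alpha>" "sob L \<alpha> k = 0" for x k
  proof -
    have "k = 0" using that(2) sob_pos[OF L, of k \<alpha>] by auto
    moreover have "curve x t 0 = 0" for t
    proof -
      have "curve x t \<in> adm L" using that(1) by (simp add: curve_space_def)
      then show ?thesis by (rule adm_0)
    qed
    ultimately show ?thesis by (intro bcontfun_eqI) (simp add: curve_def)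
  qed
  have closed: "x \<in> curve_space L \<alpha>"
    if X: "\<And>n. X n \<in> curve_space L \<alpha>" and x: "x \<in> wl2 (sob L \<alpha>)" and lim: "\<And>k. (\<lambda>n. X n k) \<longlonglongrightarrow> x k" for X x
    unfolding curve_space_def mem_Collect_eq
  proof (intro conjI allI x)
    fix t
    show "curve x t \<in> adm L"
    proof (rule adm_limit)
      show "curve (X n) t \<in> adm L" for n using X[of n] by (simp add: curve_space_def)
      show "(\<lambda>n. curve (X n) t k) \<longlonglongrightarrow> curve x t k" for k by (rule tendsto_curve[of X, OF lim])
    qed
  qed
  obtain x where x: "x \<in> curve_space L \<alpha>" and fixp: "picard \<psi> u0 x = x"
  proof (rule wl2_contraction_fixpoint[where \<omega> = "sob L \<alpha>" and S = "curve_space L \<alpha>" and T = "picard \<psi> u0" and q = "1 / 2"])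
    show "curve_space L \<alpha> \<subseteq> wl2 (sob L \<alpha>)" by (auto simp: curve_space_def)
    show "curve_space L \<alpha> \<noteq> {}" using zero by blast
    show "x \<in> curve_space L \<alpha>"
      if "\<And>n. X n \<in> curve_space L \<alpha>" "x \<in> wl2 (sob L \<alpha>)" "\<And>k. (\<lambda>n. X n k) \<longlonglongrightarrow> x k" for X x
      by (rule closed[OF that])
  qed (use vanish picard_maps[OF \<psi>' u0] picard_contracts[OF \<psi>] in \<open>auto\<close>)
  define u where "u = restrict (curve x) {0..\<mu>}"
  have ut: "u t = curve x t" if "t \<in> {0..\<mu>}" for t using that by (simp add: u_def)
  have m: "mild \<psi> u0 u"
    unfolding mild_def
  proof (intro allI ballI)
    fix k t assume t: "t \<in> {0..\<mu>}"
    have "duh \<mu> (rate k) (\<lambda>s. rhs \<psi> u s k) t = duh \<mu> (rate k) (\<lambda>s. rhs \<psi> (curve x) s k) t"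
      unfolding duh_def
      by (rule arg_cong[where f = "\<lambda>z. exp (- rate k * t) *\<^sub>R z"], rule Bochner_Integration.integral_cong[OF refl])
        (simp add: rhs_def ut)
    then show "u t k = exp (- rate k * t) *\<^sub>R u0 k + duh \<mu> (rate k) (\<lambda>s. rhs \<psi> u s k) t"
      using curve_picard[OF \<psi>' x, of u0 t k] t by (simp add: fixp ut clamp_id)
  qed
  have C: "u \<in> C_fun L \<mu> \<alpha>" by (rule C_fun_cong[OF curve_C_fun[OF L _ x]]) (auto simp: ut)
  have "u 0 k = u0 k" for k
  proof -
    have "curve x 0 k = exp (- rate k * 0) *\<^sub>R u0 k + duh \<mu> (rate k) (\<lambda>s. rhs \<psi> (curve x) s k) 0"
      using curve_picard[OF \<psi>' x, of u0 0 k] \<mu> by (simp add: fixp clamp_id)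
    moreover have "duh \<mu> (rate k) g 0 = 0" for g :: "real \<Rightarrow> complex ^ 3"
    proof -
      have "(LINT s|Leb \<mu>. indicator {..0} s *\<^sub>R (exp (rate k * s) *\<^sub>R g s)) = 0"
      proof (rule integral_eq_zero_AE)
        show "AE s in Leb \<mu>. indicator {..0} s *\<^sub>R (exp (rate k * s) *\<^sub>R g s) = 0"
          using AE_Leb_neq[of 0] AE_Leb_mem by eventually_elim auto
      qed
      then show ?thesis by (simp add: duh_def)
    qed
    ultimately show ?thesis using \<mu> by (simp add: ut)
  qed
  then show ?thesis using that[of u] m C by (auto simp: u_def)
qed

lemma mild_L2_fun:
  assumes \<psi>: "\<psi> \<in> L2_fun L \<mu> (1 + \<alpha>)" and u: "u \<in> C_fun L \<mu> \<alpha>" "mild \<psi> u0 u" and u0: "u0 \<in> V L \<alpha>"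
  shows "u \<in> L2_fun L \<mu> (1 + \<alpha>)"
proof -
  have uV: "u t \<in> V L \<alpha>" if "t \<in> {0..\<mu>}" for t using u that by (simp add: C_fun_def)
  obtain S where S: "0 \<le> S" "\<And>t. t \<in> {0..\<mu>} \<Longrightarrow> V_norm L \<alpha> (u t) \<le> S"
    by (rule C_fun_bounded[OF L \<alpha>_nonneg(1) u(1)]) (rule that)
  have frc: "forcing L \<mu> (\<alpha> - 1) (rhs \<psi> u)
      (\<lambda>t. 2 * (V_norm L (\<alpha> - 1) f)\<^sup>2 + 2 * ((K * S)\<^sup>2 * (V_norm L (1 + \<alpha>) (\<psi> t))\<^sup>2))"
    by (rule forcing_rhs[OF \<psi> C_fun_modes_measurable[OF L \<alpha>_nonneg(1) u(1)]]) (use S uV in auto)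
  have d: "\<And>k t. t \<in> {0..\<mu>} \<Longrightarrow> u t k = exp (- rate k * t) *\<^sub>R u0 k + duh \<mu> (rate k) (\<lambda>s. rhs \<psi> u s k) t"
    using u(2) by (simp add: mild_def)
  have "AE t in Leb \<mu>. u t \<in> wl2 (sob L (1 + \<alpha>))" by (rule energy_L2_wl2[OF frc u0 d])
  then have ae: "AE t in Leb \<mu>. u t \<in> V L (1 + \<alpha>)"
    using AE_Leb_mem
  proof eventually_elim
    case (elim t)
    then show ?case using V_adm[OF uV[OF elim(2)]] by (simp add: V_eq[OF L])
  qed
  have "strongly_measurable L \<mu> (1 + \<alpha>) u"
    by (rule strongly_measurable_if_C_fun[OF L \<mu> \<alpha>_nonneg u(1) ae])
  moreover have "integrable (Leb \<mu>) (\<lambda>t. (V_norm L (1 + \<alpha>) (u t))\<^sup>2)"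
    by (rule energy_L2_integrable[OF frc u0 d])
  ultimately show ?thesis by (simp add: L2_fun_def)
qed

text \<open>
  Existence and uniqueness make the definite description denote the mild solution.
\<close>

theorem solution_mild:
  assumes \<psi>: "small (rep (fst X))" and X: "snd X \<in> V L \<alpha>"
  defines "u \<equiv> solution L \<mu> \<alpha> \<nu> f X"
  shows "u \<in> extensional {0..\<mu>}" "u \<in> C_fun L \<mu> \<alpha>" "u \<in> L2_fun L \<mu> (1 + \<alpha>)" "mild (rep (fst X)) (snd X) u"
proof -
  note \<psi>' = small_L2_fun[OF \<psi>]
  obtain u' where u': "u' \<in> extensional {0..\<mu>}" "u' \<in> C_fun L \<mu> \<alpha>" "mild (rep (fst X)) (snd X) u'" "u' 0 = snd X"
    by (rule mild_exists[OF \<psi> X]) (rule that)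
  have w: "weak_solution L \<mu> \<alpha> \<nu> f (rep (fst X)) (snd X) u'"
    by (rule mild_imp_weak_solution[OF \<psi>' u'(2) mild_L2_fun[OF \<psi>' u'(2,3) X] u'(4,3)])
  have "u = u'"
    unfolding u_def solution_def
  proof (rule the_equality)
    show "u' \<in> extensional {0..\<mu>} \<and> weak_solution L \<mu> \<alpha> \<nu> f (rep (fst X)) (snd X) u'" using u'(1) w by blast
    fix v assume v: "v \<in> extensional {0..\<mu>} \<and> weak_solution L \<mu> \<alpha> \<nu> f (rep (fst X)) (snd X) v"
    then have "v \<in> C_fun L \<mu> \<alpha>" by (auto simp: weak_solution_def)
    moreover have "mild (rep (fst X)) (snd X) v" using weak_solution_imp_mild[OF \<psi>'] v by blast
    ultimately have "v t = u' t" if "t \<in> {0..\<mu>}" for t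
      using mild_unique[OF \<psi> _ _ u'(2,3) that] by blast
    then show "v = u'" using v u'(1) by (intro extensionalityI[of _ "{0..\<mu>}"]) auto
  qed
  then show "u \<in> extensional {0..\<mu>}" "u \<in> C_fun L \<mu> \<alpha>" "u \<in> L2_fun L \<mu> (1 + \<alpha>)" "mild (rep (fst X)) (snd X) u"
    using u' mild_L2_fun[OF \<psi>' u'(2,3) X] by auto
qed

end

section \<open>The phase space as a metric space\<close>

lemma measurable_V_norm_power2:
  assumes L: "0 < L" and m: "modes_measurable \<mu> d" and ae: "AE t in Leb \<mu>. d t \<in> wl2 (sob L s)"
  shows "(\<lambda>t. (V_norm L s (d t))\<^sup>2) \<in> borel_measurable (Leb \<mu>)"
proof (rule measurable_Leb_AE_limit)
  show "(\<lambda>t. L ^ 3 * (\<Sum>k\<in>kbox N. (sob L s k * norm (d t k))\<^sup>2)) \<in> borel_measurable (Leb \<mu>)" for N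
  proof -
    have [measurable]: "(\<lambda>t. d t k) \<in> borel_measurable (Leb \<mu>)" for k using m by (simp add: modes_measurable_def)
    show ?thesis by measurable
  qed
  show "AE t in Leb \<mu>. (\<lambda>N. L ^ 3 * (\<Sum>k\<in>kbox N. (sob L s k * norm (d t k))\<^sup>2)) \<longlonglongrightarrow> (V_norm L s (d t))\<^sup>2"
    using ae
  proof eventually_elim
    case (elim t)
    show ?case unfolding V_norm_power2[OF L] by (intro tendsto_mult_left tendsto_wnorm_power2 elim)
  qed
qed

lemma LINT_cong_AE_Leb:
  fixes f g :: "real \<Rightarrow> real"
  assumes "f \<in> borel_measurable (Leb \<mu>)" "AE t in Leb \<mu>. f t = g t"
  shows "(LINT t|Leb \<mu>. g t) = (LINT t|Leb \<mu>. f t)"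
  using integral_cong_AE[OF assms(1) measurable_Leb_AE[OF assms] assms(2)] by simp

text \<open>
  Stated with an inequality for \<open>h\<close>, as it is used to pass from the triangle inequality of the
  values at almost every time to that of the square integral distance.
\<close>

lemma Minkowski_LINT:
  fixes f g h :: "'a \<Rightarrow> real"
  assumes m: "f \<in> borel_measurable M" "g \<in> borel_measurable M"
    and f: "integrable M (\<lambda>x. (f x)\<^sup>2)" and g: "integrable M (\<lambda>x. (g x)\<^sup>2)" and h: "integrable M (\<lambda>x. (h x)\<^sup>2)"
    and nn: "\<And>x. 0 \<le> h x" and le: "AE x in M. h x \<le> f x + g x"
  shows "sqrt (LINT x|M. (h x)\<^sup>2) \<le> sqrt (LINT x|M. (f x)\<^sup>2) + sqrt (LINT x|M. (g x)\<^sup>2)"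
proof -
  define A where "A = (LINT x|M. (f x)\<^sup>2)"
  define B where "B = (LINT x|M. (g x)\<^sup>2)"
  note i = integrable_mult_if_square_integrable[OF m f g]
  have AB: "0 \<le> A" "0 \<le> B" by (simp_all add: A_def B_def)
  have "(LINT x|M. \<bar>f x * g x\<bar>) \<le> sqrt (A * B)"
    unfolding A_def B_def by (rule real_le_rsqrt[OF Cauchy_Schwarz_LINT[OF m f g]])
  moreover have "(LINT x|M. (h x)\<^sup>2) \<le> (LINT x|M. (f x)\<^sup>2 + 2 * \<bar>f x * g x\<bar> + (g x)\<^sup>2)"
  proof (rule integral_mono_AE[OF h])
    show "AE x in M. (h x)\<^sup>2 \<le> (f x)\<^sup>2 + 2 * \<bar>f x * g x\<bar> + (g x)\<^sup>2"
      using le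
    proof eventually_elim
      case (elim x)
      have "(h x)\<^sup>2 \<le> (f x + g x)\<^sup>2" using elim nn by (intro power_mono) auto
      also have "\<dots> = (f x)\<^sup>2 + 2 * (f x * g x) + (g x)\<^sup>2" by (simp add: power2_sum)
      finally show ?case using abs_ge_self[of "f x * g x"] by linarith
    qed
  qed (use f g i in simp)
  moreover have "(LINT x|M. (f x)\<^sup>2 + 2 * \<bar>f x * g x\<bar> + (g x)\<^sup>2) = A + 2 * (LINT x|M. \<bar>f x * g x\<bar>) + B"
    using f g i by (simp add: A_def B_def)
  ultimately have "(LINT x|M. (h x)\<^sup>2) \<le> A + 2 * sqrt (A * B) + B" by linarith
  also have "\<dots> = (sqrt A + sqrt B)\<^sup>2" using AB by (simp add: power2_sum real_sqrt_mult)
  finally show ?thesis unfolding A_def[symmetric] B_def[symmetric] using AB by (intro real_le_lsqrt) auto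
qed

lemma strongly_measurable_diff:
  assumes L: "0 < L" and s: "0 \<le> s" and u: "strongly_measurable L \<mu> s u" and v: "strongly_measurable L \<mu> s v"
  shows "strongly_measurable L \<mu> s (\<lambda>t. u t - v t)"
proof -
  obtain S where S: "\<And>n. simple_function (Leb \<mu>) (S n)" "\<And>n t. t \<in> {0..\<mu>} \<Longrightarrow> S n t \<in> V L s"
    and limS: "AE t in Leb \<mu>. (\<lambda>n. V_dist L s (S n t) (u t)) \<longlonglongrightarrow> 0" and uV: "AE t in Leb \<mu>. u t \<in> V L s"
    using u unfolding strongly_measurable_def by blast
  obtain T where T: "\<And>n. simple_function (Leb \<mu>) (T n)" "\<And>n t. t \<in> {0..\<mu>} \<Longrightarrow> T n t \<in> V L s"
    and limT: "AE t in Leb \<mu>. (\<lambda>n. V_dist L s (T n t) (v t)) \<longlonglongrightarrow> 0" and vV: "AE t in Leb \<mu>. v t \<in> V L s"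
    using v unfolding strongly_measurable_def by blast
  have "AE t in Leb \<mu>. u t - v t \<in> V L s"
    using uV vV by eventually_elim (rule V_diff[OF L s])
  moreover have "simple_function (Leb \<mu>) (\<lambda>t. S n t - T n t)" for n
    by (rule simple_function_compose2[OF S(1) T(1)])
  moreover have "S n t - T n t \<in> V L s" if "t \<in> {0..\<mu>}" for n t by (intro V_diff L s S T that)
  moreover have "AE t in Leb \<mu>. (\<lambda>n. V_dist L s (S n t - T n t) (u t - v t)) \<longlonglongrightarrow> 0"
  proof -
    have "AE t in Leb \<mu>. t \<in> {0..\<mu>}" using AE_space[of "Leb \<mu>"] by simp
    then show ?thesis
      using limS limT uV vV
    proof eventually_elim
      case (elim t)
      have "V_dist L s (S n t - T n t) (u t - v t) \<le> V_dist L s (S n t) (u t) + V_dist L s (T n t) (v t)" for n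
        unfolding V_dist_def
      proof (rule V_norm_triangle[OF L s])
        show "S n t - u t \<in> V L s" "T n t - v t \<in> V L s" by (intro V_diff L s S T elim)+
        show "norm ((S n t - T n t - (u t - v t)) k) \<le> norm ((S n t - u t) k) + norm ((T n t - v t) k)" for k
          using norm_triangle_ineq4[of "S n t k - u t k" "T n t k - v t k"] by (simp add: algebra_simps)
      qed
      moreover have lim: "(\<lambda>n. V_dist L s (S n t) (u t) + V_dist L s (T n t) (v t)) \<longlonglongrightarrow> 0"
        using tendsto_add[OF elim(2,3)] by simp
      ultimately show ?case
        by (intro real_tendsto_sandwich[OF _ _ tendsto_const lim]) (use L in \<open>auto simp: V_dist_def\<close>)
    qed
  qed
  ultimately show ?thesis unfolding strongly_measurable_def
    by (intro conjI exI[of _ "\<lambda>n t. S n t - T n t"]) auto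
qed

lemma L2_fun_diff:
  assumes L: "0 < L" and s: "0 \<le> s" and u: "u \<in> L2_fun L \<mu> s" and v: "v \<in> L2_fun L \<mu> s"
  shows "(\<lambda>t. u t - v t) \<in> L2_fun L \<mu> s"
proof -
  have sm: "strongly_measurable L \<mu> s (\<lambda>t. u t - v t)"
    using u v by (intro strongly_measurable_diff L s) (auto simp: L2_fun_def)
  have ae: "AE t in Leb \<mu>. u t \<in> V L s" "AE t in Leb \<mu>. v t \<in> V L s"
    using u v by (auto simp: L2_fun_def strongly_measurable_def)
  have "AE t in Leb \<mu>. u t - v t \<in> wl2 (sob L s)"
    using ae by eventually_elim (intro V_wl2[OF L s] V_diff[OF L s])
  note m = measurable_V_norm_power2[OF L modes_measurable_if_strongly_measurable[OF L s sm] this]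
  have "integrable (Leb \<mu>) (\<lambda>t. (V_norm L s (u t - v t))\<^sup>2)"
  proof (rule Bochner_Integration.integrable_bound[OF _ m])
    show "integrable (Leb \<mu>) (\<lambda>t. 2 * (V_norm L s (u t))\<^sup>2 + 2 * (V_norm L s (v t))\<^sup>2)"
      using u v by (simp add: L2_fun_def)
    show "AE t in Leb \<mu>. norm ((V_norm L s (u t - v t))\<^sup>2) \<le> norm (2 * (V_norm L s (u t))\<^sup>2 + 2 * (V_norm L s (v t))\<^sup>2)"
      using ae
    proof eventually_elim
      case (elim t)
      have "V_norm L s (u t - v t) \<le> V_norm L s (u t) + V_norm L s (v t)"
        by (rule V_norm_triangle[OF L s elim]) (simp add: norm_triangle_ineq4)
      from square_sum_le[OF this V_norm_nonneg[OF L]] show ?case by simp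
    qed
  qed
  with sm show ?thesis by (simp add: L2_fun_def)
qed

lemma L2_fun_V_dist:
  assumes L: "0 < L" and s: "0 \<le> s" and u: "u \<in> L2_fun L \<mu> s" and v: "v \<in> L2_fun L \<mu> s"
  shows "integrable (Leb \<mu>) (\<lambda>t. (V_dist L s (u t) (v t))\<^sup>2)"
    and "(\<lambda>t. V_dist L s (u t) (v t)) \<in> borel_measurable (Leb \<mu>)"
proof -
  show i: "integrable (Leb \<mu>) (\<lambda>t. (V_dist L s (u t) (v t))\<^sup>2)"
    using L2_fun_diff[OF assms] by (simp add: L2_fun_def V_dist_def)
  then have "(\<lambda>t. sqrt ((V_dist L s (u t) (v t))\<^sup>2)) \<in> borel_measurable (Leb \<mu>)"
    using borel_measurable_integrable by measurable
  then show "(\<lambda>t. V_dist L s (u t) (v t)) \<in> borel_measurable (Leb \<mu>)" using L by (simp add: V_dist_def)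
qed

lemma L2_eq_iff: "(u, v) \<in> L2_eq L \<mu> s \<longleftrightarrow> u \<in> L2_fun L \<mu> s \<and> v \<in> L2_fun L \<mu> s \<and> (AE t in Leb \<mu>. u t = v t)"
  by (simp add: L2_eq_def)

lemma equiv_L2_eq: "equiv (L2_fun L \<mu> s) (L2_eq L \<mu> s)"
proof (rule equivI)
  show "L2_eq L \<mu> s \<subseteq> L2_fun L \<mu> s \<times> L2_fun L \<mu> s" by (auto simp: L2_eq_def)
  show "refl_on (L2_fun L \<mu> s) (L2_eq L \<mu> s)" by (auto simp: refl_on_def L2_eq_def)
  show "sym (L2_eq L \<mu> s)" by (auto simp: sym_def L2_eq_iff elim: eventually_mono)
  show "trans (L2_eq L \<mu> s)"
  proof (rule transI)
    fix u v w assume "(u, v) \<in> L2_eq L \<mu> s" "(v, w) \<in> L2_eq L \<mu> s"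
    then have "AE t in Leb \<mu>. u t = v t" "AE t in Leb \<mu>. v t = w t" "u \<in> L2_fun L \<mu> s" "w \<in> L2_fun L \<mu> s"
      by (auto simp: L2_eq_iff)
    moreover from this(1,2) have "AE t in Leb \<mu>. u t = w t" by eventually_elim simp
    ultimately show "(u, w) \<in> L2_eq L \<mu> s" by (simp add: L2_eq_iff)
  qed
qed

lemma rep_mem: "u \<in> \<Psi> \<Longrightarrow> rep \<Psi> \<in> \<Psi>"
  unfolding rep_def by (rule someI[where P = "\<lambda>\<psi>. \<psi> \<in> \<Psi>"])

lemma rep_L2:
  assumes "\<Psi> \<in> L2 L \<mu> s"
  shows "rep \<Psi> \<in> L2_fun L \<mu> s" "\<Psi> = L2_class_of L \<mu> s (rep \<Psi>)"
proof -
  obtain u where u: "u \<in> L2_fun L \<mu> s" "\<Psi> = L2_eq L \<mu> s `` {u}" using assms unfolding L2_def by (rule quotientE)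
  then have "u \<in> \<Psi>" by (simp add: L2_eq_iff)
  then have "rep \<Psi> \<in> \<Psi>" by (rule rep_mem)
  then have r: "(u, rep \<Psi>) \<in> L2_eq L \<mu> s" using u by simp
  then show "rep \<Psi> \<in> L2_fun L \<mu> s" by (simp add: L2_eq_iff)
  show "\<Psi> = L2_class_of L \<mu> s (rep \<Psi>)"
    using equiv_class_eq[OF equiv_L2_eq r] u by (simp add: L2_class_of_def)
qed

lemma L2_class_of_mem: "u \<in> L2_fun L \<mu> s \<Longrightarrow> L2_class_of L \<mu> s u \<in> L2 L \<mu> s"
  by (simp add: L2_class_of_def L2_def quotientI)

lemma rep_class_AE:
  assumes u: "u \<in> L2_fun L \<mu> s"
  shows "AE t in Leb \<mu>. rep (L2_class_of L \<mu> s u) t = u t"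
proof -
  have "u \<in> L2_class_of L \<mu> s u" using u by (simp add: L2_class_of_def L2_eq_iff)
  then have "rep (L2_class_of L \<mu> s u) \<in> L2_class_of L \<mu> s u" by (rule rep_mem)
  then have "AE t in Leb \<mu>. u t = rep (L2_class_of L \<mu> s u) t" by (simp add: L2_class_of_def L2_eq_iff)
  then show ?thesis by eventually_elim simp
qed

lemma V_dist_triangle:
  assumes L: "0 < L" and s: "0 \<le> s" and V: "u \<in> V L s" "v \<in> V L s" "w \<in> V L s"
  shows "V_dist L s u w \<le> V_dist L s u v + V_dist L s v w"
  unfolding V_dist_def
proof (rule V_norm_triangle[OF L s])
  show "norm ((u - w) k) \<le> norm ((u - v) k) + norm ((v - w) k)" for k
    using norm_triangle_ineq[of "u k - v k" "v k - w k"] by simp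
qed (intro V_diff L s V)+

lemma Metric_space_V:
  assumes L: "0 < L" and s: "0 \<le> s"
  shows "Metric_space (V L s) (V_dist L s)"
proof
  show "0 \<le> V_dist L s u v" for u v using L by (simp add: V_dist_def)
  show "V_dist L s u v = V_dist L s v u" for u v by (rule V_dist_commute)
  show "V_dist L s u v = 0 \<longleftrightarrow> u = v" if "u \<in> V L s" "v \<in> V L s" for u v
  proof
    assume "V_dist L s u v = 0"
    then have "(u - v) k = 0" for k using V_norm_eq_0D[OF L s V_diff[OF L s that]] by (simp add: V_dist_def)
    then show "u = v" by (auto simp: fun_eq_iff)
  next
    assume "u = v" then show "V_dist L s u v = 0" by (simp add: V_dist_def V_norm_eq wnorm_def)
  qed
  show "V_dist L s u w \<le> V_dist L s u v + V_dist L s v w" if "u \<in> V L s" "v \<in> V L s" "w \<in> V L s" for u v w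
    by (rule V_dist_triangle[OF L s that])
qed

lemma Metric_space_L2:
  assumes L: "0 < L" and s: "0 \<le> s"
  shows "Metric_space (L2 L \<mu> s) (L2_dist L \<mu> s)"
proof
  show "0 \<le> L2_dist L \<mu> s u v" for u v by (simp add: L2_dist_def)
  show "L2_dist L \<mu> s u v = L2_dist L \<mu> s v u" for u v by (simp add: L2_dist_def V_dist_commute)
  show "L2_dist L \<mu> s u v = 0 \<longleftrightarrow> u = v" if uv: "u \<in> L2 L \<mu> s" "v \<in> L2 L \<mu> s" for u v
  proof
    note r = rep_L2[OF uv(1)] rep_L2[OF uv(2)]
    assume "L2_dist L \<mu> s u v = 0"
    then have "(LINT t|Leb \<mu>. (V_dist L s (rep u t) (rep v t))\<^sup>2) = 0" by (simp add: L2_dist_def)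
    then have "AE t in Leb \<mu>. (V_dist L s (rep u t) (rep v t))\<^sup>2 = 0"
      using L2_fun_V_dist(1)[OF L s r(1,3)] by (subst (asm) integral_nonneg_eq_0_iff_AE) auto
    then have "AE t in Leb \<mu>. rep u t = rep v t"
      using L2_fun_AE[OF r(1)] L2_fun_AE[OF r(3)]
    proof eventually_elim
      case (elim t)
      then have "(rep u t - rep v t) k = 0" for k
        using V_norm_eq_0D[OF L s V_diff[OF L s elim(2,3)]] by (simp add: V_dist_def)
      then show ?case by (auto simp: fun_eq_iff)
    qed
    then have "(rep u, rep v) \<in> L2_eq L \<mu> s" using r by (simp add: L2_eq_iff)
    from equiv_class_eq[OF equiv_L2_eq this] show "u = v" using r(2,4) by (simp add: L2_class_of_def)
  next
    assume "u = v"
    moreover have "V_dist L s a a = 0" for a by (simp add: V_dist_def V_norm_eq wnorm_def)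
    ultimately show "L2_dist L \<mu> s u v = 0" by (simp add: L2_dist_def)
  qed
  show "L2_dist L \<mu> s u w \<le> L2_dist L \<mu> s u v + L2_dist L \<mu> s v w"
    if uvw: "u \<in> L2 L \<mu> s" "v \<in> L2 L \<mu> s" "w \<in> L2 L \<mu> s" for u v w
  proof -
    note r = rep_L2(1)[OF uvw(1)] rep_L2(1)[OF uvw(2)] rep_L2(1)[OF uvw(3)]
    have "AE t in Leb \<mu>. V_dist L s (rep u t) (rep w t) \<le> V_dist L s (rep u t) (rep v t) + V_dist L s (rep v t) (rep w t)"
      using L2_fun_AE[OF r(1)] L2_fun_AE[OF r(2)] L2_fun_AE[OF r(3)]
      by eventually_elim (rule V_dist_triangle[OF L s])
    then show ?thesis
      unfolding L2_dist_def using L2_fun_V_dist[OF L s] r L by (intro Minkowski_LINT) (auto simp: V_dist_def)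
  qed
qed

lemma Metric_space_phase:
  assumes "0 < L" "0 \<le> \<alpha>"
  shows "Metric_space (phase_space L \<mu> \<alpha>) (phase_dist L \<mu> \<alpha>)"
proof -
  interpret Metric_space12 "L2 L \<mu> (1 + \<alpha>)" "L2_dist L \<mu> (1 + \<alpha>)" "V L \<alpha>" "V_dist L \<alpha>"
    unfolding Metric_space12_def using assms by (intro conjI Metric_space_L2 Metric_space_V) auto
  show ?thesis unfolding phase_space_def phase_dist_def by (rule prod_metric)
qed

section \<open>The stationary solution\<close>

context linearized
begin

text \<open>
  The norm of the embedding of order \<open>1 + \<alpha>\<close> into order \<open>\<alpha>\<close>: the reciprocal of the smallest
  wave number.
\<close>

definition emb :: real where "emb = L / (2 * pi)"

lemma emb_pos: "0 < emb" using L by (simp add: emb_def)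

lemma V_norm_weaken:
  assumes u: "u \<in> V L (1 + \<alpha>)"
  shows "V_norm L \<alpha> u \<le> emb * V_norm L (1 + \<alpha>) u"
proof -
  have e: "(2 * pi / L) powr (\<alpha> - (1 + \<alpha>)) = emb" using L by (simp add: emb_def powr_minus_divide)
  have "wnorm (sob L \<alpha>) u \<le> emb * wnorm (sob L (1 + \<alpha>)) u"
  proof (rule wnorm_mono[OF V_wl2[OF L _ u]])
    show "\<bar>sob L \<alpha> k * norm (u k)\<bar> \<le> emb * \<bar>sob L (1 + \<alpha>) k * norm (u k)\<bar>" for k
      using mult_right_mono[OF sob_weaken[OF L, of \<alpha> "1 + \<alpha>" k], of "norm (u k)"] unfolding e by (simp add: mult.assoc)
  qed (use emb_pos in auto)
  from mult_left_mono[OF this, of "sqrt (L ^ 3)"] show ?thesis using L by (simp add: V_norm_eq mult_ac)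
qed

text \<open>
  The inverse of \<open>\<nu> A\<close>, which gains two orders and a factor \<open>1 / \<nu>\<close>.
\<close>

definition resolvent :: "coeffs \<Rightarrow> coeffs" where
  "resolvent y k = (1 / rate k) *\<^sub>R y k"

lemma
  assumes y: "y \<in> wl2 (sob L (\<alpha> - 1))"
  shows resolvent_wl2: "resolvent y \<in> wl2 (sob L (1 + \<alpha>))"
    and V_norm_resolvent: "V_norm L (1 + \<alpha>) (resolvent y) \<le> V_norm L (\<alpha> - 1) y / \<nu>"
proof -
  have le: "\<bar>sob L (1 + \<alpha>) k * norm (resolvent y k)\<bar> \<le> 1 / \<nu> * \<bar>sob L (\<alpha> - 1) k * norm (y k)\<bar>" for k
  proof (cases "k = 0")
    case False
    show ?thesis using \<nu> kap_pos[OF L False] by (simp add: sob_shift(2)[OF L] resolvent_def rate_def abs_mult field_simps)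
  qed simp
  show "resolvent y \<in> wl2 (sob L (1 + \<alpha>))" by (rule wl2_mono[OF y le]) (use \<nu> in simp)
  have "wnorm (sob L (1 + \<alpha>)) (resolvent y) \<le> 1 / \<nu> * wnorm (sob L (\<alpha> - 1)) y"
    by (rule wnorm_mono[OF y le]) (use \<nu> in simp)
  from mult_left_mono[OF this, of "sqrt (L ^ 3)"] show "V_norm L (1 + \<alpha>) (resolvent y) \<le> V_norm L (\<alpha> - 1) y / \<nu>"
    using L by (simp add: V_norm_eq)
qed

lemma resolvent_adm: "y \<in> adm L \<Longrightarrow> resolvent y \<in> adm L"
  using linear_scale[OF linear_vcnj] by (simp add: adm_iff resolvent_def rate_def cdot_scaleR)

lemma V_norm_wl2_triangle:
  assumes "x \<in> wl2 (sob L s)" "y \<in> wl2 (sob L s)" "\<And>k. norm (z k) \<le> norm (x k) + norm (y k)"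
  shows "V_norm L s z \<le> V_norm L s x + V_norm L s y"
  using wnorm_triangle[OF assms] L by (simp add: V_norm_eq distrib_left[symmetric] mult_left_mono)

lemma nl_difference:
  assumes \<psi>: "\<psi> \<in> V L (1 + \<alpha>)" "\<phi> \<in> V L (1 + \<alpha>)" and u: "u \<in> V L \<alpha>" "v \<in> V L \<alpha>"
  shows "nl L \<psi> u k - nl L \<phi> v k = nl L \<psi> (u - v) k + nl L (\<psi> - \<phi>) v k"
proof -
  have "conv_summable \<psi> u" "conv_summable \<psi> v" "conv_summable \<phi> v" using nl_bound \<psi> u by blast+
  then show ?thesis by (simp add: nl_diff_left nl_diff_right)
qed

text \<open>
  The equation is the fixed point equation of \<open>resolvent (f - nl L w w)\<close>. The first condition on
  \<open>\<nu>\<close> says that this map preserves the ball of radius \<open>r\<close>; by the second one each of the two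
  parts of the difference of quadratic terms (\<open>nl_difference\<close>) has a Lipschitz constant of at most \<open>\<nu> / 4\<close>.
\<close>

theorem stationary_exists:
  assumes r: "0 < r" and big: "V_norm L (\<alpha> - 1) f + K * emb * r\<^sup>2 \<le> \<nu> * r" "4 * (K * emb * r) \<le> \<nu>"
  obtains w where "w \<in> V L (1 + \<alpha>)" "V_norm L (1 + \<alpha>) w \<le> r"
    "\<And>k. rate k *\<^sub>R w k = f k - nl L w w k"
proof -
  define S where "S = {x \<in> V L (1 + \<alpha>). V_norm L (1 + \<alpha>) x \<le> r}"
  define T where "T = (\<lambda>x. resolvent (f - nl L x x))"
  have SV: "x \<in> V L (1 + \<alpha>)" "x \<in> V L \<alpha>" "V_norm L (1 + \<alpha>) x \<le> r" "V_norm L \<alpha> x \<le> emb * r"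
    "nl L x x \<in> wl2 (sob L (\<alpha> - 1))" "nl L x x \<in> adm L" if "x \<in> S" for x
  proof -
    show 1: "x \<in> V L (1 + \<alpha>)" "V_norm L (1 + \<alpha>) x \<le> r" using that by (auto simp: S_def)
    show 2: "x \<in> V L \<alpha>" by (rule V_weaken[OF L _ _ 1(1)]) auto
    show "V_norm L \<alpha> x \<le> emb * r"
      using V_norm_weaken[OF 1(1)] mult_left_mono[OF 1(2), of emb] emb_pos by linarith
    show "nl L x x \<in> wl2 (sob L (\<alpha> - 1))" using nl_bound[OF 1(1) 2] by blast
    show "nl L x x \<in> adm L" using nl_bound[OF 1(1) 2] V_adm[OF 2] by (intro nl_adm) auto
  qed
  have bnd: "V_norm L (\<alpha> - 1) (nl L x u) \<le> K * (A * B)"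
    if "x \<in> V L (1 + \<alpha>)" "u \<in> V L \<alpha>" "V_norm L (1 + \<alpha>) x \<le> A" "V_norm L \<alpha> u \<le> B" for x u A B
  proof -
    have "V_norm L (1 + \<alpha>) x * V_norm L \<alpha> u \<le> A * B"
      using that L by (intro mult_mono) (auto intro: order_trans[OF V_norm_nonneg[OF L]])
    then have "K * (V_norm L (1 + \<alpha>) x * V_norm L \<alpha> u) \<le> K * (A * B)" by (rule mult_left_mono) (use K in simp)
    with nl_bound[OF that(1,2)] show ?thesis by (blast intro: order_trans)
  qed
  have T_in: "T x \<in> S" if x: "x \<in> S" for x
  proof -
    note sx = SV[OF x]
    have y: "f - nl L x x \<in> wl2 (sob L (\<alpha> - 1))" by (rule wl2_diff[OF f_wl2 sx(5)])
    have "V_norm L (\<alpha> - 1) (f - nl L x x) \<le> V_norm L (\<alpha> - 1) f + V_norm L (\<alpha> - 1) (nl L x x)"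
      by (rule V_norm_wl2_triangle[OF f_wl2 sx(5)]) (simp add: norm_triangle_ineq4)
    also have "\<dots> \<le> V_norm L (\<alpha> - 1) f + K * (r * (emb * r))"
      using bnd[OF sx(1,2,3,4)] by simp
    also have "\<dots> \<le> \<nu> * r" using big(1) by (simp add: power2_eq_square mult_ac)
    finally have "V_norm L (\<alpha> - 1) (f - nl L x x) / \<nu> \<le> r" using \<nu> by (simp add: field_simps)
    then have "V_norm L (1 + \<alpha>) (T x) \<le> r" unfolding T_def using V_norm_resolvent[OF y] by linarith
    moreover have "T x \<in> V L (1 + \<alpha>)"
      unfolding T_def using resolvent_wl2[OF y] resolvent_adm[OF adm_diff[OF V_adm[OF f] sx(6)]] by (simp add: V_eq[OF L])
    ultimately show ?thesis by (simp add: S_def)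
  qed
  have contr: "wnorm (sob L (1 + \<alpha>)) (T x - T y) \<le> 1 / 2 * wnorm (sob L (1 + \<alpha>)) (x - y)" if x: "x \<in> S" and y: "y \<in> S" for x y
  proof -
    note sx = SV[OF x] and sy = SV[OF y]
    define D where "D = V_norm L (1 + \<alpha>) (x - y)"
    have d: "x - y \<in> V L (1 + \<alpha>)" "x - y \<in> V L \<alpha>" by (intro V_diff L sx sy; simp)+
    have dn: "V_norm L \<alpha> (x - y) \<le> emb * D" unfolding D_def by (rule V_norm_weaken[OF d(1)])
    have n1: "V_norm L (\<alpha> - 1) (nl L x (x - y)) \<le> K * (r * (emb * D))" by (rule bnd[OF sx(1) d(2) sx(3) dn])
    have n2: "V_norm L (\<alpha> - 1) (nl L (x - y) y) \<le> K * (D * (emb * r))"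
      by (rule bnd[OF d(1) sy(2) _ sy(4)]) (simp add: D_def)
    have w: "nl L x (x - y) \<in> wl2 (sob L (\<alpha> - 1))" "nl L (x - y) y \<in> wl2 (sob L (\<alpha> - 1))"
      using nl_bound sx(1) sy(2) d by blast+
    define z where "z = (\<lambda>k. - (nl L x x k - nl L y y k))"
    have zk: "norm (z k) \<le> norm (nl L x (x - y) k) + norm (nl L (x - y) y k)" for k
      unfolding z_def nl_difference[OF sx(1) sy(1) sx(2) sy(2)] norm_minus_cancel by (rule norm_triangle_ineq)
    have zw: "z \<in> wl2 (sob L (\<alpha> - 1))" by (rule wl2_triangle[OF w zk])
    have "V_norm L (\<alpha> - 1) z \<le> K * (r * (emb * D)) + K * (D * (emb * r))"
      using V_norm_wl2_triangle[OF w zk] n1 n2 by linarith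
    also have "\<dots> = 2 * (K * emb * r) * D" by (simp add: algebra_simps)
    also have "\<dots> \<le> (\<nu> / 2) * D" using big(2) L by (intro mult_right_mono) (auto simp: D_def)
    finally have "V_norm L (\<alpha> - 1) z / \<nu> \<le> D / 2" using \<nu> by (simp add: field_simps)
    then have rz: "V_norm L (1 + \<alpha>) (resolvent z) \<le> D / 2" using V_norm_resolvent[OF zw] by linarith
    have Tz: "T x - T y = resolvent z"
      by (rule ext) (simp add: T_def resolvent_def z_def scaleR_diff_right)
    show ?thesis using rz L unfolding Tz by (simp add: V_norm_eq D_def)
  qed
  obtain w where w: "w \<in> S" "T w = w"
  proof (rule wl2_contraction_fixpoint[where \<omega> = "sob L (1 + \<alpha>)" and S = S and T = T and q = "1 / 2"])
    show "S \<subseteq> wl2 (sob L (1 + \<alpha>))" using V_wl2[OF L] by (auto simp: S_def)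
    have "(\<lambda>k. 0) \<in> S" using r L by (simp add: S_def V_eq adm_iff V_norm_eq)
    then show "S \<noteq> {}" by blast
    show "x k = 0" if "x \<in> S" "sob L (1 + \<alpha>) k = 0" for x k
    proof -
      have "k = 0" using that(2) sob_pos[OF L, of k "1 + \<alpha>"] by auto
      then show ?thesis using adm_0[OF V_adm[OF SV(1)[OF that(1)]]] by simp
    qed
    show "x \<in> S" if X: "\<And>n. X n \<in> S" and x: "x \<in> wl2 (sob L (1 + \<alpha>))" and lim: "\<And>k. (\<lambda>n. X n k) \<longlonglongrightarrow> x k" for X x
    proof -
      have "x \<in> adm L" by (rule adm_limit[OF V_adm[OF SV(1)[OF X]] lim])
      moreover have "wnorm (sob L (1 + \<alpha>)) x \<le> r / sqrt (L ^ 3)"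
      proof (rule wnorm_Fatou)
        show "X n \<in> wl2 (sob L (1 + \<alpha>))" for n using V_wl2[OF L _ SV(1)[OF X]] by simp
        show "eventually (\<lambda>n. wnorm (sob L (1 + \<alpha>)) (X n) \<le> r / sqrt (L ^ 3)) sequentially"
          using SV(3)[OF X] L by (intro always_eventually allI) (simp add: V_norm_eq field_simps)
        show "(\<lambda>n. X n k) \<longlonglongrightarrow> x k" for k by (rule lim)
      qed
      ultimately show ?thesis using x L by (simp add: S_def V_eq V_norm_eq field_simps)
    qed
  qed (use T_in contr in auto)
  have "rate k *\<^sub>R w k = f k - nl L w w k" for k
  proof (cases "k = 0")
    case True
    then show ?thesis by (simp add: rate_def)
  next
    case False
    have "w k = (1 / rate k) *\<^sub>R (f k - nl L w w k)"
      using fun_cong[OF w(2), of k] by (simp add: T_def resolvent_def)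
    from arg_cong[OF this, of "scaleR (rate k)"] show ?thesis using rate_pos[OF False] by simp
  qed
  then show ?thesis using that SV(1,3)[OF w(1)] by blast
qed

text \<open>
  A constant right-hand side equal to \<open>rate k\<close> times the value reproduces that value up to the
  decay of the initial data, which is how a stationary solution satisfies Duhamel's formula.
\<close>

lemma duh_const:
  assumes t: "t \<in> {0..\<mu>}"
  shows "duh \<mu> (rate k) (\<lambda>s. rate k *\<^sub>R c) t = (1 - exp (- rate k * t)) *\<^sub>R (c :: complex ^ 3)"
proof (cases "k = 0")
  case True
  then show ?thesis by (simp add: rate_def duh_def)
next
  case False
  have r: "0 < rate k" by (rule rate_pos[OF False])
  have F: "((\<lambda>s. exp (- rate k * (t - s)) / rate k) has_real_derivative exp (- rate k * (t - x))) (at x)" for x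
    using r by (auto intro!: derivative_eq_intros)
  have c: "continuous_on UNIV (\<lambda>x. exp (- rate k * (t - x)))" by (intro continuous_intros)
  have "0 \<le> (0::real)" "0 \<le> t" "t \<le> \<mu>" using t by auto
  note * = integral_indicator_FTC[OF this F c]
  have "(LINT s|Leb \<mu>. heat (rate k) t s) = (LINT s|Leb \<mu>. indicator {0..t} s * exp (- rate k * (t - s)))"
    by (rule Bochner_Integration.integral_cong[OF refl]) (auto simp: heat_def indicator_def)
  also have "\<dots> = (1 - exp (- rate k * t)) / rate k" unfolding *(2) by (simp add: diff_divide_distrib)
  finally have "(LINT s|Leb \<mu>. heat (rate k) t s *\<^sub>R (rate k *\<^sub>R c)) = ((1 - exp (- rate k * t)) / rate k) *\<^sub>R (rate k *\<^sub>R c)"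
    using integrable_heat_left[OF r t] by simp
  then show ?thesis using r by (simp add: duh_eq_heat)
qed

end

section \<open>Contraction towards the stationary solution\<close>

text \<open>
  The bounds on \<open>w\<close> and \<open>r\<close> place the fixed point in the unit ball: the square of the norm of
  the constant curve is at most \<open>\<mu> r\<^sup>2 \<le> 1\<close>. The three conditions on \<open>\<nu>\<close> serve, in this order, to
  absorb the nonlinear term, to gain from integration in time, and to damp the initial value.
\<close>

locale stationary = linearized +
  fixes w :: coeffs and r :: real
  assumes wV: "w \<in> V L (1 + \<alpha>)" and w_r: "V_norm L (1 + \<alpha>) w \<le> r" and w_1: "V_norm L \<alpha> w \<le> 1"
    and r: "0 \<le> r" "\<mu> * r\<^sup>2 \<le> 1"
    and stat: "\<And>k. rate k *\<^sub>R w k = f k - nl L w w k"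
    and \<nu>_K: "4352 * K\<^sup>2 \<le> \<nu>" and \<nu>_16: "16 \<le> \<nu>" and \<nu>_low: "16 \<le> lowest * \<mu>"
begin

lemma wV\<alpha>: "w \<in> V L \<alpha>" by (rule V_weaken[OF L _ _ wV]) auto

lemma measure_Leb: "measure (Leb \<mu>) {0..\<mu>} = \<mu>"
  using \<mu> by (subst measure_restrict_space) auto

lemma w_C_fun: "(\<lambda>t. w) \<in> C_fun L \<mu> \<alpha>"
  using wV\<alpha> by (simp add: C_fun_def V_dist_def V_norm_eq wnorm_def)

lemma w_L2_fun: "(\<lambda>t. w) \<in> L2_fun L \<mu> (1 + \<alpha>)"
proof -
  interpret finite_measure "Leb \<mu>" by (rule finite_measure_Leb)
  have "strongly_measurable L \<mu> (1 + \<alpha>) (\<lambda>t. w)"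
    by (rule strongly_measurable_if_C_fun[OF L \<mu> \<alpha>_nonneg w_C_fun]) (simp add: wV)
  then show ?thesis by (simp add: L2_fun_def)
qed

lemma w_L2_norm: "(LINT t|Leb \<mu>. (V_norm L (1 + \<alpha>) w)\<^sup>2) \<le> 1"
proof -
  have "(LINT t|Leb \<mu>. (V_norm L (1 + \<alpha>) w)\<^sup>2) = \<mu> * (V_norm L (1 + \<alpha>) w)\<^sup>2"
    by (simp add: measure_Leb)
  also have "\<dots> \<le> \<mu> * r\<^sup>2" using w_r L \<mu> by (intro mult_left_mono power_mono) auto
  finally show ?thesis using r by linarith
qed

definition fixpoint :: phase where
  "fixpoint = (L2_class_of L \<mu> (1 + \<alpha>) (\<lambda>t. w), w)"

lemma fixpoint_phase: "fixpoint \<in> phase_space L \<mu> \<alpha>"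
  using L2_class_of_mem[OF w_L2_fun] wV\<alpha> by (simp add: fixpoint_def phase_space_def)

lemma rep_fixpoint_AE: "AE t in Leb \<mu>. rep (fst fixpoint) t = w"
  using rep_class_AE[OF w_L2_fun] by (simp add: fixpoint_def)

lemma L2_dist_fixpoint:
  assumes "\<psi> \<in> L2_fun L \<mu> (1 + \<alpha>)" and "AE t in Leb \<mu>. rep \<Psi> t = \<psi> t"
  shows "(L2_dist L \<mu> (1 + \<alpha>) \<Psi> (fst fixpoint))\<^sup>2 = (LINT t|Leb \<mu>. (V_norm L (1 + \<alpha>) (\<psi> t - w))\<^sup>2)"
proof -
  have m: "(\<lambda>t. (V_norm L (1 + \<alpha>) (\<psi> t - w))\<^sup>2) \<in> borel_measurable (Leb \<mu>)"
    using L2_fun_V_dist(1)[OF L \<alpha>_nonneg(2) assms(1) w_L2_fun] by (auto simp: V_dist_def)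
  have ae: "AE t in Leb \<mu>. (V_norm L (1 + \<alpha>) (\<psi> t - w))\<^sup>2 = (V_dist L (1 + \<alpha>) (rep \<Psi> t) (rep (fst fixpoint) t))\<^sup>2"
    using assms(2) rep_fixpoint_AE by eventually_elim (simp add: V_dist_def)
  show ?thesis
    unfolding L2_dist_def LINT_cong_AE_Leb[OF m ae] by simp
qed

text \<open>
  Twice the square of the norm of the constant curve, which is at most 1, plus twice 16: this is
  where the bound 34 comes from.
\<close>

lemma near_norm_le:
  assumes \<psi>: "\<psi> \<in> L2_fun L \<mu> (1 + \<alpha>)" and near: "(LINT t|Leb \<mu>. (V_norm L (1 + \<alpha>) (\<psi> t - w))\<^sup>2) \<le> 16"
  shows "(LINT t|Leb \<mu>. (V_norm L (1 + \<alpha>) (\<psi> t))\<^sup>2) \<le> 34"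
proof -
  have i: "integrable (Leb \<mu>) (\<lambda>t. (V_norm L (1 + \<alpha>) (\<psi> t - w))\<^sup>2)"
    using L2_fun_V_dist(1)[OF L \<alpha>_nonneg(2) \<psi> w_L2_fun] by (simp add: V_dist_def)
  have iw: "integrable (Leb \<mu>) (\<lambda>t. (V_norm L (1 + \<alpha>) w)\<^sup>2)" using L2_fun_integrable[OF w_L2_fun] .
  have "(LINT t|Leb \<mu>. (V_norm L (1 + \<alpha>) (\<psi> t))\<^sup>2)
      \<le> (LINT t|Leb \<mu>. 2 * (V_norm L (1 + \<alpha>) w)\<^sup>2 + 2 * (V_norm L (1 + \<alpha>) (\<psi> t - w))\<^sup>2)"
  proof (rule integral_mono_AE[OF L2_fun_integrable[OF \<psi>]])
    show "AE t in Leb \<mu>. (V_norm L (1 + \<alpha>) (\<psi> t))\<^sup>2 \<le> 2 * (V_norm L (1 + \<alpha>) w)\<^sup>2 + 2 * (V_norm L (1 + \<alpha>) (\<psi> t - w))\<^sup>2"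
      using L2_fun_AE[OF \<psi>]
    proof eventually_elim
      case (elim t)
      then show ?case using V_norm_le_dist[OF L \<alpha>_nonneg(2) elim wV] L by (intro square_sum_le) (auto simp: V_dist_def)
    qed
  qed (use i iw in simp)
  also have "\<dots> = 2 * (LINT t|Leb \<mu>. (V_norm L (1 + \<alpha>) w)\<^sup>2) + 2 * (LINT t|Leb \<mu>. (V_norm L (1 + \<alpha>) (\<psi> t - w))\<^sup>2)"
    using i iw by (simp only: Bochner_Integration.integral_add integral_mult_right_zero integrable_mult_right)
  finally show ?thesis using near w_L2_norm by linarith
qed

lemma K_bound: "68 * K\<^sup>2 \<le> \<nu>" "136 * K\<^sup>2 \<le> \<nu>" "128 * K\<^sup>2 \<le> \<nu>"
  using \<nu>_K zero_le_power2[of K] by linarith+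

text \<open>
  The difference from the stationary solution solves a linear equation whose right-hand side
  is controlled by the distance of the data and by the difference itself; the latter part is
  absorbed, and what remains carries a factor that is small for large viscosity.
\<close>

lemma difference_estimate:
  assumes \<psi>: "\<psi> \<in> L2_fun L \<mu> (1 + \<alpha>)" and u: "u \<in> C_fun L \<mu> \<alpha>" "mild \<psi> u0 u" and u0: "u0 \<in> V L \<alpha>"
    and A: "(LINT t|Leb \<mu>. (V_norm L (1 + \<alpha>) (\<psi> t - w))\<^sup>2) = A" "A \<le> 16"
  defines "B \<equiv> (V_norm L \<alpha> (u0 - w))\<^sup>2"
  shows "(LINT t|Leb \<mu>. (V_norm L (1 + \<alpha>) (u t - w))\<^sup>2) + (V_norm L \<alpha> (u \<mu> - w))\<^sup>2 \<le> (A + B) / 4"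
proof -
  define d where "d = (\<lambda>t. u t - w)"
  define c where "c = u0 - w"
  define P where "P = (LINT t|Leb \<mu>. (V_norm L (1 + \<alpha>) (\<psi> t))\<^sup>2)"
  have P: "P \<le> 34" unfolding P_def using near_norm_le[OF \<psi>] A by simp
  have A0: "0 \<le> A" "0 \<le> B" using A(1) by (auto simp: B_def intro: integral_nonneg)
  have uV: "u t \<in> V L \<alpha>" if "t \<in> {0..\<mu>}" for t using u that by (simp add: C_fun_def)
  have dV: "d t \<in> V L \<alpha>" if "t \<in> {0..\<mu>}" for t unfolding d_def by (intro V_diff L uV wV\<alpha> that) simp
  have cV: "c \<in> V L \<alpha>" unfolding c_def by (intro V_diff L u0 wV\<alpha>) simp
  obtain S where S: "0 \<le> S" "\<And>t. t \<in> {0..\<mu>} \<Longrightarrow> V_norm L \<alpha> (u t) \<le> S"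
    by (rule C_fun_bounded[OF L \<alpha>_nonneg(1) u(1)]) (rule that)
  have mu: "modes_measurable \<mu> u" by (rule C_fun_modes_measurable[OF L \<alpha>_nonneg(1) u(1)])
  have mw: "modes_measurable \<mu> (\<lambda>t. w)" by (simp add: modes_measurable_def)
  have md: "modes_measurable \<mu> d" using mu by (simp add: modes_measurable_def d_def borel_measurable_diff)
  have \<psi>w: "(\<lambda>t. \<psi> t - w) \<in> L2_fun L \<mu> (1 + \<alpha>)" by (rule L2_fun_diff[OF L \<alpha>_nonneg(2) \<psi> w_L2_fun])
  have "V_norm L \<alpha> (d t) \<le> S + 1" if t: "t \<in> {0..\<mu>}" for t
  proof -
    have "V_norm L \<alpha> (d t) \<le> V_norm L \<alpha> (u t) + V_norm L \<alpha> w"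
      unfolding d_def by (rule V_norm_triangle[OF L \<alpha>_nonneg(1) uV[OF t] wV\<alpha>]) (simp add: norm_triangle_ineq4)
    then show ?thesis using S(2)[OF t] w_1 by linarith
  qed
  then have bdd: "bdd_above ((\<lambda>t. V_norm L \<alpha> (d t)) ` {0..\<mu>})" by (auto intro!: bdd_aboveI2[where M = "S + 1"])
  define D where "D = (SUP t\<in>{0..\<mu>}. V_norm L \<alpha> (d t))"
  have dD: "V_norm L \<alpha> (d t) \<le> D" if "t \<in> {0..\<mu>}" for t unfolding D_def by (rule cSUP_upper[OF that bdd])
  have D0: "0 \<le> D" using dD[of 0] \<mu> V_norm_nonneg[OF L, of \<alpha> "d 0"] by (auto intro: order_trans)
  \<comment> \<open>\<open>h\<close> is the right-hand side of the equation for \<open>d\<close>, and \<open>\<Gamma>\<close> its majorant in terms of the supremum \<open>D\<close>.\<close>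
  define h where "h = (\<lambda>t k. - nl L (\<psi> t) (d t) k - nl L (\<psi> t - w) w k)"
  define \<Gamma> where "\<Gamma> = (\<lambda>t. 2 * ((K * D)\<^sup>2 * (V_norm L (1 + \<alpha>) (\<psi> t))\<^sup>2) + 2 * ((K * 1)\<^sup>2 * (V_norm L (1 + \<alpha>) (\<psi> t - w))\<^sup>2))"
  have f1: "forcing L \<mu> (\<alpha> - 1) (\<lambda>t. nl L (\<psi> t) (d t)) (\<lambda>t. (K * D)\<^sup>2 * (V_norm L (1 + \<alpha>) (\<psi> t))\<^sup>2)"
    using dV dD by (intro forcing_nl \<psi> md) auto
  have f2: "forcing L \<mu> (\<alpha> - 1) (\<lambda>t. nl L (\<psi> t - w) w) (\<lambda>t. (K * 1)\<^sup>2 * (V_norm L (1 + \<alpha>) (\<psi> t - w))\<^sup>2)"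
    using wV\<alpha> w_1 by (intro forcing_nl[OF \<psi>w mw]) auto
  have f1': "forcing L \<mu> (\<alpha> - 1) (\<lambda>t k. - nl L (\<psi> t) (d t) k) (\<lambda>t. (K * D)\<^sup>2 * (V_norm L (1 + \<alpha>) (\<psi> t))\<^sup>2)"
  proof -
    have "(V_norm L s (\<lambda>k. - x k)) = V_norm L s x" "(\<lambda>k. - x k) \<in> wl2 (sob L s) \<longleftrightarrow> x \<in> wl2 (sob L s)" for s x
      by (simp_all add: V_norm_eq wnorm_def wl2_def)
    then show ?thesis using f1 by (simp add: forcing_def modes_measurable_def)
  qed
  have fh: "forcing L \<mu> (\<alpha> - 1) h \<Gamma>"
    using forcing_diff[OF L f1' f2] by (simp add: h_def \<Gamma>_def fun_diff_def)
  have I\<Gamma>: "(LINT t|Leb \<mu>. \<Gamma> t) = 2 * (K * D)\<^sup>2 * P + 2 * K\<^sup>2 * A"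
    unfolding \<Gamma>_def P_def A(1)[symmetric]
    using L2_fun_integrable[OF \<psi>] L2_fun_integrable[OF \<psi>w]
    by (subst Bochner_Integration.integral_add) (simp_all add: mult.assoc)
  have dk: "d t k = exp (- rate k * t) *\<^sub>R c k + duh \<mu> (rate k) (\<lambda>s. h s k) t" if t: "t \<in> {0..\<mu>}" for k t
  proof -
    have fr: "forcing L \<mu> (\<alpha> - 1) (rhs \<psi> u) (\<lambda>t. 2 * (V_norm L (\<alpha> - 1) f)\<^sup>2 + 2 * ((K * S)\<^sup>2 * (V_norm L (1 + \<alpha>) (\<psi> t))\<^sup>2))"
      using uV S by (intro forcing_rhs \<psi> mu) auto
    interpret finite_measure "Leb \<mu>" by (rule finite_measure_Leb)
    have i: "integrable (Leb \<mu>) (\<lambda>s. rhs \<psi> u s k)" "integrable (Leb \<mu>) (\<lambda>s. rate k *\<^sub>R w k)" "integrable (Leb \<mu>) (\<lambda>s. h s k)"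
      using forcing_integrable[OF L fr] forcing_integrable[OF L fh] by auto
    have "w k = exp (- rate k * t) *\<^sub>R w k + duh \<mu> (rate k) (\<lambda>s. rate k *\<^sub>R w k) t"
      unfolding duh_const[OF t] by (simp add: scaleR_diff_left)
    moreover have "u t k = exp (- rate k * t) *\<^sub>R u0 k + duh \<mu> (rate k) (\<lambda>s. rhs \<psi> u s k) t"
      using u(2) t by (simp add: mild_def)
    ultimately have "d t k = exp (- rate k * t) *\<^sub>R c k + (duh \<mu> (rate k) (\<lambda>s. rhs \<psi> u s k) t - duh \<mu> (rate k) (\<lambda>s. rate k *\<^sub>R w k) t)"
      unfolding d_def c_def minus_apply scaleR_diff_right by (metis (no_types, lifting) add_diff_add)
    also have "duh \<mu> (rate k) (\<lambda>s. rhs \<psi> u s k) t - duh \<mu> (rate k) (\<lambda>s. rate k *\<^sub>R w k) t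
        = duh \<mu> (rate k) (\<lambda>s. rhs \<psi> u s k - rate k *\<^sub>R w k) t"
      by (rule duh_diff[symmetric]) (rule i)+
    also have "\<dots> = duh \<mu> (rate k) (\<lambda>s. h s k) t"
    proof (rule duh_cong_AE)
      show "AE s in Leb \<mu>. rhs \<psi> u s k - rate k *\<^sub>R w k = h s k"
        using L2_fun_AE[OF \<psi>] AE_Leb_mem
      proof eventually_elim
        case (elim s)
        show ?case
          using nl_difference[OF elim(1) wV uV[OF elim(2)] wV\<alpha>, of k]
          by (simp add: rhs_def stat h_def d_def algebra_simps)
      qed
    qed (use i in auto)
    finally show ?thesis .
  qed
  have c2: "(V_norm L \<alpha> c)\<^sup>2 = B" by (simp add: c_def B_def)
  have en: "(V_norm L \<alpha> (d t))\<^sup>2 \<le> 2 * exp (- 2 * lowest * t) * B + (LINT s|Leb \<mu>. \<Gamma> s) / \<nu>" if "t \<in> {0..\<mu>}" for t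
    using energy_sup[OF fh cV that dk[OF that]] by (simp add: c2)
  define G where "G = (LINT s|Leb \<mu>. \<Gamma> s)"
  have G: "G \<le> 2 * K\<^sup>2 * (34 * D\<^sup>2 + A)"
  proof -
    have "K\<^sup>2 * D\<^sup>2 * P \<le> K\<^sup>2 * D\<^sup>2 * 34" using P by (intro mult_left_mono) auto
    then show ?thesis unfolding G_def I\<Gamma> by (simp add: power_mult_distrib algebra_simps)
  qed
  \<comment> \<open>The supremum is finite beforehand, so its occurrence in the bound for \<open>G\<close> can be absorbed.\<close>
  have "D\<^sup>2 \<le> 2 * B + G / \<nu>"
  proof -
    have "V_norm L \<alpha> (d t) \<le> sqrt (2 * B + G / \<nu>)" if t: "t \<in> {0..\<mu>}" for t
    proof (rule real_le_rsqrt)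
      have "exp (- 2 * lowest * t) \<le> 1" using lowest_pos t by simp
      then have "2 * exp (- 2 * lowest * t) * B \<le> 2 * 1 * B" using A0 by (intro mult_right_mono) auto
      then show "(V_norm L \<alpha> (d t))\<^sup>2 \<le> 2 * B + G / \<nu>" using en[OF t] by (simp add: G_def)
    qed
    then have "D \<le> sqrt (2 * B + G / \<nu>)" unfolding D_def using \<mu> by (intro cSUP_least) auto
    then have "D\<^sup>2 \<le> (sqrt (2 * B + G / \<nu>))\<^sup>2" using D0 by (intro power_mono)
    moreover have "0 \<le> 2 * B + G / \<nu>"
      using en[of 0] \<mu> by (simp add: G_def) (meson order_trans zero_le_power2)
    ultimately show ?thesis by simp
  qed
  moreover have "G / \<nu> \<le> D\<^sup>2 / 2 + A / 64"
  proof -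
    have "2 * K\<^sup>2 * (34 * D\<^sup>2 + A) = 68 * K\<^sup>2 * D\<^sup>2 + 2 * K\<^sup>2 * A" by (simp add: algebra_simps)
    also have "\<dots> \<le> (\<nu> / 2) * D\<^sup>2 + (\<nu> / 64) * A"
      using K_bound A0 by (intro add_mono mult_right_mono) auto
    finally have "G \<le> \<nu> * (D\<^sup>2 / 2 + A / 64)" using G by (simp add: algebra_simps)
    then show ?thesis using \<nu> by (simp add: field_simps)
  qed
  ultimately have D2: "D\<^sup>2 \<le> 4 * B + A" using A0 by linarith
  \<comment> \<open>Since \<open>34 (4 B + A) + A \<le> 136 (A + B)\<close>, the constant needed here is \<open>2 * 136 * 16 = 4352\<close>.\<close>
  have Gs: "G \<le> \<nu> * ((A + B) / 16)"
  proof -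
    have "G \<le> 2 * K\<^sup>2 * (34 * (4 * B + A) + A)" using G D2 by (meson mult_left_mono add_mono order_refl order_trans zero_le_power2 mult_nonneg_nonneg zero_le_numeral)
    also have "\<dots> \<le> 2 * K\<^sup>2 * (136 * (A + B))" using A0 by (intro mult_left_mono) auto
    also have "\<dots> = 4352 * K\<^sup>2 * ((A + B) / 16)" by simp
    also have "\<dots> \<le> \<nu> * ((A + B) / 16)" using \<nu>_K A0 by (intro mult_right_mono) auto
    finally show ?thesis .
  qed
  have end_t: "(V_norm L \<alpha> (u \<mu> - w))\<^sup>2 \<le> B / 16 + (A + B) / 16"
  proof -
    have "exp (- (2 * lowest * \<mu>)) \<le> 1 / 32"
    proof -
      have "32 \<le> 2 * lowest * \<mu>" using \<nu>_low by (simp add: mult.commute)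
      also have "\<dots> \<le> exp (2 * lowest * \<mu>)" using exp_ge_add_one_self[of "2 * lowest * \<mu>"] by linarith
      finally show ?thesis by (simp add: exp_minus field_simps)
    qed
    then have "2 * exp (- 2 * lowest * \<mu>) * B \<le> 1 / 16 * B" using A0 by (intro mult_right_mono) auto
    moreover have "G / \<nu> \<le> (A + B) / 16" using Gs \<nu> by (simp add: field_simps)
    moreover have "(V_norm L \<alpha> (u \<mu> - w))\<^sup>2 \<le> 2 * exp (- 2 * lowest * \<mu>) * B + G / \<nu>"
      using en[of \<mu>] \<mu> by (simp add: d_def G_def)
    ultimately show ?thesis by linarith
  qed
  have "(LINT t|Leb \<mu>. (V_norm L (1 + \<alpha>) (u t - w))\<^sup>2) \<le> B / \<nu> + 2 * G / \<nu>\<^sup>2"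
    using energy_L2[where d = d, OF fh cV dk] by (simp add: c2 d_def G_def fun_diff_def)
  also have "\<dots> \<le> B / 16 + (A + B) / 16"
  proof (rule add_mono)
    show "B / \<nu> \<le> B / 16" using \<nu>_16 A0 by (intro divide_left_mono) auto
    have "2 * G / \<nu>\<^sup>2 \<le> 2 * (\<nu> * ((A + B) / 16)) / \<nu>\<^sup>2" using Gs by (intro divide_right_mono) auto
    also have "\<dots> = (2 / \<nu>) * ((A + B) / 16)" using \<nu> by (simp add: power2_eq_square field_simps)
    also have "\<dots> \<le> 1 * ((A + B) / 16)" using \<nu>_16 A0 by (intro mult_right_mono) auto
    finally show "2 * G / \<nu>\<^sup>2 \<le> (A + B) / 16" by simp
  qed
  finally show ?thesis using end_t A0 by (simp add: field_simps)
qed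

lemma phase_dist_power2:
  "(phase_dist L \<mu> \<alpha> X Y)\<^sup>2 = (L2_dist L \<mu> (1 + \<alpha>) (fst X) (fst Y))\<^sup>2 + (V_norm L \<alpha> (snd X - snd Y))\<^sup>2"
  by (simp add: phase_dist_def prod_dist_def case_prod_unfold V_dist_def)

lemma phase_dist_nonneg [simp]: "0 \<le> phase_dist L \<mu> \<alpha> X Y"
  by (simp add: phase_dist_def prod_dist_def case_prod_unfold)

text \<open>
  Radius 4 keeps the drift small in the sense of \<open>small\<close>, which makes \<open>U1\<close> the solution map
  there. Squared distances shrink by the factor 1/4 of the difference estimate.
\<close>

theorem U1_contracts:
  assumes X: "X \<in> phase_space L \<mu> \<alpha>" and near: "phase_dist L \<mu> \<alpha> X fixpoint \<le> 4"
  shows "U1 L \<mu> \<alpha> \<nu> f X \<in> phase_space L \<mu> \<alpha>"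
    and "phase_dist L \<mu> \<alpha> (U1 L \<mu> \<alpha> \<nu> f X) fixpoint \<le> phase_dist L \<mu> \<alpha> X fixpoint / 2"
proof -
  define \<psi> where "\<psi> = rep (fst X)"
  have XL: "fst X \<in> L2 L \<mu> (1 + \<alpha>)" and XV: "snd X \<in> V L \<alpha>" using X by (auto simp: phase_space_def)
  have \<psi>: "\<psi> \<in> L2_fun L \<mu> (1 + \<alpha>)" unfolding \<psi>_def by (rule rep_L2(1)[OF XL])
  define A where "A = (LINT t|Leb \<mu>. (V_norm L (1 + \<alpha>) (\<psi> t - w))\<^sup>2)"
  have A: "(L2_dist L \<mu> (1 + \<alpha>) (fst X) (fst fixpoint))\<^sup>2 = A"
    unfolding A_def by (rule L2_dist_fixpoint[OF \<psi>]) (simp add: \<psi>_def)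
  have dX: "(phase_dist L \<mu> \<alpha> X fixpoint)\<^sup>2 = A + (V_norm L \<alpha> (snd X - w))\<^sup>2"
    unfolding phase_dist_power2 A by (simp add: fixpoint_def)
  have "(phase_dist L \<mu> \<alpha> X fixpoint)\<^sup>2 \<le> 4\<^sup>2" using near by (intro power_mono) auto
  then have "A + (V_norm L \<alpha> (snd X - w))\<^sup>2 \<le> 16" using dX by simp
  then have A16: "A \<le> 16" using zero_le_power2[of "V_norm L \<alpha> (snd X - w)"] by linarith
  have small: "small \<psi>"
  proof -
    have "K\<^sup>2 * (LINT t|Leb \<mu>. (V_norm L (1 + \<alpha>) (\<psi> t))\<^sup>2) \<le> K\<^sup>2 * 34"
      using near_norm_le[OF \<psi>] A16 by (intro mult_left_mono) (auto simp: A_def)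
    then show ?thesis unfolding small_def using \<psi> K_bound(1) by simp
  qed
  define u where "u = solution L \<mu> \<alpha> \<nu> f X"
  have u: "u \<in> C_fun L \<mu> \<alpha>" "u \<in> L2_fun L \<mu> (1 + \<alpha>)" "mild \<psi> (snd X) u"
    using solution_mild[of X] small XV by (auto simp: u_def \<psi>_def)
  have U1: "U1 L \<mu> \<alpha> \<nu> f X = (L2_class_of L \<mu> (1 + \<alpha>) u, u \<mu>)" by (simp add: U1_def u_def Let_def)
  have "u \<mu> \<in> V L \<alpha>" using u(1) \<mu> by (simp add: C_fun_def)
  then show "U1 L \<mu> \<alpha> \<nu> f X \<in> phase_space L \<mu> \<alpha>"
    unfolding U1 using L2_class_of_mem[OF u(2)] by (simp add: phase_space_def)
  have "(phase_dist L \<mu> \<alpha> (U1 L \<mu> \<alpha> \<nu> f X) fixpoint)\<^sup>2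
      = (LINT t|Leb \<mu>. (V_norm L (1 + \<alpha>) (u t - w))\<^sup>2) + (V_norm L \<alpha> (u \<mu> - w))\<^sup>2"
    unfolding phase_dist_power2 U1 fst_conv snd_conv L2_dist_fixpoint[OF u(2) rep_class_AE[OF u(2)]]
    by (simp add: fixpoint_def)
  also have "\<dots> \<le> (A + (V_norm L \<alpha> (snd X - w))\<^sup>2) / 4"
    by (rule difference_estimate[OF \<psi> u(1,3) XV A_def[symmetric] A16])
  also have "\<dots> = (phase_dist L \<mu> \<alpha> X fixpoint / 2)\<^sup>2" by (simp add: dX power_divide)
  finally show "phase_dist L \<mu> \<alpha> (U1 L \<mu> \<alpha> \<nu> f X) fixpoint \<le> phase_dist L \<mu> \<alpha> X fixpoint / 2"
    by (rule power2_le_imp_le) simp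
qed

text \<open>
  A phase of the unit ball has squared distance at most 4 from the fixed point in each of the two
  components, hence distance at most \<open>sqrt 8 < 4\<close>. From there the contraction yields uniform
  geometric convergence.
\<close>

theorem local_attractor_fixpoint: "local_attractor L \<mu> \<alpha> \<nu> f 1 1 {fixpoint}"
proof -
  interpret Metric_space "phase_space L \<mu> \<alpha>" "phase_dist L \<mu> \<alpha>"
    by (rule Metric_space_phase[OF L \<alpha>_nonneg(1)])
  have iterate: "U L \<mu> \<alpha> \<nu> f n X \<in> phase_space L \<mu> \<alpha> \<and> phase_dist L \<mu> \<alpha> (U L \<mu> \<alpha> \<nu> f n X) fixpoint \<le> 4 * (1 / 2) ^ n"
    if "X \<in> phase_space L \<mu> \<alpha>" "phase_dist L \<mu> \<alpha> X fixpoint \<le> 4" for X n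
  proof (induction n)
    case 0
    then show ?case using that by (simp add: U_def)
  next
    case (Suc n)
    have "4 * (1 / 2 :: real) ^ n \<le> 4 * 1" by (intro mult_left_mono power_le_one) auto
    then have "phase_dist L \<mu> \<alpha> (U L \<mu> \<alpha> \<nu> f n X) fixpoint \<le> 4" using Suc by linarith
    from U1_contracts[OF _ this] Suc show ?case by (simp add: U_def)
  qed
  have near: "X \<in> phase_space L \<mu> \<alpha> \<and> phase_dist L \<mu> \<alpha> X fixpoint \<le> 4" if X: "X \<in> phase_ball L \<mu> \<alpha> 1 1" for X
  proof -
    have XL: "fst X \<in> L2 L \<mu> (1 + \<alpha>)" "L2_norm L \<mu> (1 + \<alpha>) (fst X) \<le> 1" and XV: "snd X \<in> V L \<alpha>" "V_norm L \<alpha> (snd X) \<le> 1"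
      using X by (auto simp: phase_ball_def)
    define \<psi> where "\<psi> = rep (fst X)"
    have \<psi>: "\<psi> \<in> L2_fun L \<mu> (1 + \<alpha>)" unfolding \<psi>_def by (rule rep_L2(1)[OF XL(1)])
    have n\<psi>: "(LINT t|Leb \<mu>. (V_norm L (1 + \<alpha>) (\<psi> t))\<^sup>2) \<le> 1"
      using XL(2) by (simp add: L2_norm_def \<psi>_def)
    have "(L2_dist L \<mu> (1 + \<alpha>) (fst X) (fst fixpoint))\<^sup>2 = (LINT t|Leb \<mu>. (V_norm L (1 + \<alpha>) (\<psi> t - w))\<^sup>2)"
      by (rule L2_dist_fixpoint[OF \<psi>]) (simp add: \<psi>_def)
    also have "\<dots> \<le> (LINT t|Leb \<mu>. 2 * (V_norm L (1 + \<alpha>) (\<psi> t))\<^sup>2 + 2 * (V_norm L (1 + \<alpha>) w)\<^sup>2)"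
    proof (rule integral_mono_AE)
      show "integrable (Leb \<mu>) (\<lambda>t. (V_norm L (1 + \<alpha>) (\<psi> t - w))\<^sup>2)"
        using L2_fun_V_dist(1)[OF L \<alpha>_nonneg(2) \<psi> w_L2_fun] by (simp add: V_dist_def)
      show "integrable (Leb \<mu>) (\<lambda>t. 2 * (V_norm L (1 + \<alpha>) (\<psi> t))\<^sup>2 + 2 * (V_norm L (1 + \<alpha>) w)\<^sup>2)"
        using L2_fun_integrable[OF \<psi>] L2_fun_integrable[OF w_L2_fun] by (intro Bochner_Integration.integrable_add integrable_mult_right)
      show "AE t in Leb \<mu>. (V_norm L (1 + \<alpha>) (\<psi> t - w))\<^sup>2 \<le> 2 * (V_norm L (1 + \<alpha>) (\<psi> t))\<^sup>2 + 2 * (V_norm L (1 + \<alpha>) w)\<^sup>2"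
        using L2_fun_AE[OF \<psi>]
      proof eventually_elim
        case (elim t)
        have "V_norm L (1 + \<alpha>) (\<psi> t - w) \<le> V_norm L (1 + \<alpha>) (\<psi> t) + V_norm L (1 + \<alpha>) w"
          by (rule V_norm_triangle[OF L \<alpha>_nonneg(2) elim wV]) (simp add: norm_triangle_ineq4)
        then show ?case using L by (intro square_sum_le) auto
      qed
    qed
    also have "\<dots> = 2 * (LINT t|Leb \<mu>. (V_norm L (1 + \<alpha>) (\<psi> t))\<^sup>2) + 2 * (LINT t|Leb \<mu>. (V_norm L (1 + \<alpha>) w)\<^sup>2)"
      using L2_fun_integrable[OF \<psi>] L2_fun_integrable[OF w_L2_fun]
      by (simp only: Bochner_Integration.integral_add integral_mult_right_zero integrable_mult_right)
    also have "\<dots> \<le> 4" using n\<psi> w_L2_norm by linarith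
    finally have a: "(L2_dist L \<mu> (1 + \<alpha>) (fst X) (fst fixpoint))\<^sup>2 \<le> 4" .
    have "V_norm L \<alpha> (snd X - w) \<le> V_norm L \<alpha> (snd X) + V_norm L \<alpha> w"
      by (rule V_norm_triangle[OF L \<alpha>_nonneg(1) XV(1) wV\<alpha>]) (simp add: norm_triangle_ineq4)
    then have "V_norm L \<alpha> (snd X - w) \<le> 2" using XV(2) w_1 by linarith
    then have "(V_norm L \<alpha> (snd X - w))\<^sup>2 \<le> 2\<^sup>2" using L by (intro power_mono) auto
    then have "(phase_dist L \<mu> \<alpha> X fixpoint)\<^sup>2 \<le> 4\<^sup>2"
      unfolding phase_dist_power2 using a by (simp add: fixpoint_def)
    then have "phase_dist L \<mu> \<alpha> X fixpoint \<le> 4" by (rule power2_le_imp_le) simp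
    then show ?thesis using XL XV by (cases X) (simp add: phase_space_def)
  qed
  have fx: "U L \<mu> \<alpha> \<nu> f 1 fixpoint = fixpoint"
  proof -
    have 0: "phase_dist L \<mu> \<alpha> fixpoint fixpoint = 0" using fixpoint_phase by simp
    have c: "U1 L \<mu> \<alpha> \<nu> f fixpoint \<in> phase_space L \<mu> \<alpha>"
      "phase_dist L \<mu> \<alpha> (U1 L \<mu> \<alpha> \<nu> f fixpoint) fixpoint \<le> phase_dist L \<mu> \<alpha> fixpoint fixpoint / 2"
      using U1_contracts[OF fixpoint_phase] 0 by auto
    then have "phase_dist L \<mu> \<alpha> (U1 L \<mu> \<alpha> \<nu> f fixpoint) fixpoint = 0"
      using 0 phase_dist_nonneg[of "U1 L \<mu> \<alpha> \<nu> f fixpoint" fixpoint] by linarith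
    then show ?thesis using c(1) fixpoint_phase by (simp add: U_def)
  qed
  have ball: "fixpoint \<in> phase_ball L \<mu> \<alpha> 1 1"
  proof -
    have "AE t in Leb \<mu>. (V_norm L (1 + \<alpha>) w)\<^sup>2 = (V_norm L (1 + \<alpha>) (rep (fst fixpoint) t))\<^sup>2"
      using rep_fixpoint_AE by eventually_elim simp
    from LINT_cong_AE_Leb[OF _ this] have "(LINT t|Leb \<mu>. (V_norm L (1 + \<alpha>) (rep (fst fixpoint) t))\<^sup>2) \<le> 1"
      using w_L2_norm by simp
    then have "L2_norm L \<mu> (1 + \<alpha>) (fst fixpoint) \<le> 1" by (simp add: L2_norm_def)
    then show ?thesis using L2_class_of_mem[OF w_L2_fun] wV\<alpha> w_1 by (simp add: phase_ball_def fixpoint_def)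
  qed
  have lim: "(\<lambda>n. SUP x\<in>phase_ball L \<mu> \<alpha> 1 1. INF a\<in>{fixpoint}. ennreal (phase_dist L \<mu> \<alpha> (U L \<mu> \<alpha> \<nu> f n x) a)) \<longlonglongrightarrow> 0"
  proof (rule tendsto_sandwich[OF _ _ tendsto_const])
    have "(\<lambda>n. 4 * (1 / 2 :: real) ^ n) \<longlonglongrightarrow> 4 * 0" by (intro tendsto_mult_left LIMSEQ_power_zero) simp
    from tendsto_ennrealI[OF this] show "(\<lambda>n. ennreal (4 * (1 / 2) ^ n)) \<longlonglongrightarrow> 0" by simp
    have "(SUP x\<in>phase_ball L \<mu> \<alpha> 1 1. INF a\<in>{fixpoint}. ennreal (phase_dist L \<mu> \<alpha> (U L \<mu> \<alpha> \<nu> f n x) a)) \<le> ennreal (4 * (1 / 2) ^ n)" for n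
      using iterate near by (intro SUP_least) (auto intro: ennreal_leI)
    then show "eventually (\<lambda>n. (SUP x\<in>phase_ball L \<mu> \<alpha> 1 1. INF a\<in>{fixpoint}. ennreal (phase_dist L \<mu> \<alpha> (U L \<mu> \<alpha> \<nu> f n x) a)) \<le> ennreal (4 * (1 / 2) ^ n)) sequentially"
      by (intro always_eventually allI)
  qed auto
  show ?thesis
    unfolding local_attractor_def using fixpoint_phase ball fx lim by (simp add: finite_imp_compactin)
qed

end

theorem theorem5p6:
  fixes L \<mu> \<alpha> :: real and f :: coeffs
  assumes "L > 0" and "\<mu> > 0" and "\<alpha> > 1 / 2" and "f \<in> V L \<alpha>"
  shows "\<exists>\<nu>\<^sub>1>0. \<forall>\<nu>\<ge>\<nu>\<^sub>1. \<exists>R>0. \<exists>\<rho>>0. \<exists>\<A>.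
           local_attractor L \<mu> \<alpha> \<nu> f R \<rho> \<A> \<and> is_singleton \<A>"
proof -
  obtain K where K: "0 < K" and nlb: "\<And>\<psi> u. \<psi> \<in> V L (1 + \<alpha>) \<Longrightarrow> u \<in> V L \<alpha> \<Longrightarrow> conv_summable \<psi> u \<and>
      nl L \<psi> u \<in> wl2 (sob L (\<alpha> - 1)) \<and>
      V_norm L (\<alpha> - 1) (nl L \<psi> u) \<le> K * (V_norm L (1 + \<alpha>) \<psi> * V_norm L \<alpha> u)"
    using nl_estimate[OF assms(1,3)] by blast
  define e where "e = L / (2 * pi)"
  \<comment> \<open>The first bound on \<open>r\<close> gives \<open>V_norm L \<alpha> w \<le> 1\<close>, the second gives the constant curve square
    integral norm at most 1.\<close>
  define r where "r = min (1 / e) (1 / sqrt \<mu>)"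
  have e: "0 < e" using assms by (simp add: e_def)
  have r: "0 < r" using e assms by (simp add: r_def)
  \<comment> \<open>A sum instead of a maximum of the five lower bounds that are imposed on \<open>\<nu>\<close>.\<close>
  define \<nu>1 where "\<nu>1 = 16 + 4352 * K\<^sup>2 + 16 / ((2 * pi / L)\<^sup>2 * \<mu>)
      + (V_norm L (\<alpha> - 1) f + K * e * r\<^sup>2) / r + 4 * (K * e * r)"
  have parts: "0 \<le> 4352 * K\<^sup>2" "0 \<le> 16 / ((2 * pi / L)\<^sup>2 * \<mu>)" "0 \<le> (V_norm L (\<alpha> - 1) f + K * e * r\<^sup>2) / r" "0 \<le> 4 * (K * e * r)"
    using K e r assms by auto
  have "\<exists>R>0. \<exists>\<rho>>0. \<exists>\<A>. local_attractor L \<mu> \<alpha> \<nu> f R \<rho> \<A> \<and> is_singleton \<A>" if \<nu>: "\<nu>1 \<le> \<nu>" for \<nu>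
  proof -
    have big: "16 \<le> \<nu>" "4352 * K\<^sup>2 \<le> \<nu>" "16 / ((2 * pi / L)\<^sup>2 * \<mu>) \<le> \<nu>" "(V_norm L (\<alpha> - 1) f + K * e * r\<^sup>2) / r \<le> \<nu>" "4 * (K * e * r) \<le> \<nu>"
      using \<nu> parts unfolding \<nu>1_def by linarith+
    interpret linearized L \<mu> \<alpha> \<nu> K f
      by unfold_locales (use assms big(1) K nlb in auto)
    have emb: "emb = e" by (simp add: emb_def e_def)
    obtain w where w: "w \<in> V L (1 + \<alpha>)" "V_norm L (1 + \<alpha>) w \<le> r" "\<And>k. rate k *\<^sub>R w k = f k - nl L w w k"
    proof (rule stationary_exists[OF r])
      show "V_norm L (\<alpha> - 1) f + K * emb * r\<^sup>2 \<le> \<nu> * r" using big(4) r unfolding emb by (simp add: field_simps)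
      show "4 * (K * emb * r) \<le> \<nu>" using big(5) unfolding emb .
    qed blast
    interpret stationary L \<mu> \<alpha> \<nu> K f w r
    proof unfold_locales
      have "V_norm L \<alpha> w \<le> emb * r" using V_norm_weaken[OF w(1)] mult_left_mono[OF w(2), of emb] emb_pos by linarith
      also have "\<dots> \<le> e * (1 / e)" unfolding emb using e by (intro mult_left_mono) (auto simp: r_def)
      finally show "V_norm L \<alpha> w \<le> 1" using e by simp
      have "\<mu> * r\<^sup>2 \<le> \<mu> * (1 / sqrt \<mu>)\<^sup>2" using assms r by (intro mult_left_mono power_mono) (auto simp: r_def)
      then show "\<mu> * r\<^sup>2 \<le> 1" using assms by (simp add: power_divide)
      have "16 \<le> \<nu> * ((2 * pi / L)\<^sup>2 * \<mu>)"
        using big(3) assms by (subst (asm) pos_divide_le_eq) auto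
      then show "16 \<le> lowest * \<mu>" by (simp add: lowest_def mult.assoc)
    qed (use w big r in auto)
    show ?thesis
      using local_attractor_fixpoint by (intro exI[of _ 1] conjI exI[of _ "{fixpoint}"]) auto
  qed
  moreover have "0 < \<nu>1" unfolding \<nu>1_def using parts by linarith
  ultimately show ?thesis by blast
qed

end
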